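(* In the setting of i.i.d. random compositions of intermittent maps described in the context, assume $\gamma_{max}<\frac13$ and let $\alpha\in(0,2)$. Then for $m$-a.e. $x_0\in[0,1]$ the following holds, with $\phi_{x_0}(x)=|x-x_0|^{-1/\alpha}$: for every $J\in\mathcal{J}$, setting $A_n:=\phi_{x_0}^{-1}(b_nJ)$, for $\mathbb{P}$-a.e. $\omega\in\Omega$ and all $0\le s<t$, $$\lim_{n\to\infty}\nu^{\sigma^{\lfloor ns\rfloor}\omega}\Big(R_{A_n}(\sigma^{\lfloor ns\rfloor}\omega)>\lfloor n(t-s)\rfloor\Big)=e^{-(t-s)\Pi_\alpha(J)}.$$
   Context: $m$ is Lebesgue measure on $[0,1]$. Random intermittent maps. For $\gamma\in(0,1)$ let $T_\gamma:[0,1]\to[0,1]$, $T_\gamma(x)=x(1+2^\gamma x^\gamma)$ for $0\le x<\frac12$ and $T_\gamma(x)=2x-1$ for $\frac12\le x\le1$. Fix $\gamma_1,\dots,\gamma_q\in(0,1)$, $T_i:=T_{\gamma_i}$, $\gamma_{max}:=\max_i\gamma_i$. $\Omega=\{1,\dots,q\}^{\mathbb{Z}}$, $\sigma$ is the left shift, $\mathbb{P}$ is the Bernoulli (product) measure of a probability vector $(p_1,\dots,p_q)$. $T_\omega:=T_{\omega_0}$, $T_\omega^n:=T_{\sigma^{n-1}\omega}\circ\cdots\circ T_\omega$, $T_\omega^0=\mathrm{id}$. $P_\omega$ is the transfer operator of $T_\omega$ with respect to $m$, $P_\omega^n:=P_{\sigma^{n-1}\omega}\circ\cdots\circ P_\omega$.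 The limit $h_\omega:=\lim_nP^n_{\sigma^{-n}\omega}\mathbf{1}$ exists in $L^1(m)$, and $P_\omega h_\omega=h_{\sigma\omega}$. The sample measures are $d\nu^\omega=h_\omega\,dm$ and the stationary measure on $[0,1]$ is $\nu(A)=\int_\Omega\nu^\omega(A)\,d\mathbb{P}(\omega)$. $(b_n)$ is a sequence of positive reals with $\lim_nn\,\nu(\phi_{x_0}>b_n)=1$. $\mathcal{J}$ is the family of all finite unions of intervals $(x,y]$ with $-\infty\le x<y\le\infty$ and $0\notin[x,y]$. $\Pi_\alpha(dx)=\alpha x^{-\alpha-1}dx$ on $(0,\infty)$ (and zero on $(-\infty,0)$). For measurable $U\subset[0,1]$, the hitting time is $R_U(\omega)(x):=\inf\{k\ge1:T_\omega^k(x)\in U\}$. *)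

theory Defs
  imports "HOL-Probability.Probability"
begin

definition unit_lebesgue :: "real measure" where
  "unit_lebesgue = restrict_space lborel {0..1}"

text \<open>The intermittent map with parameter \<open>\<gamma>\<close>; only its values on \<open>[0,1]\<close> matter.\<close>

definition intermittent_map :: "real \<Rightarrow> real \<Rightarrow> real" where
  "intermittent_map \<gamma> x =
     (if x < 1 / 2 then x * (1 + 2 powr \<gamma> * x powr \<gamma>) else 2 * x - 1)"

definition bernoulli_measure :: "nat \<Rightarrow> (nat \<Rightarrow> real) \<Rightarrow> (int \<Rightarrow> nat) measure" where
  "bernoulli_measure q p =
     PiM (UNIV :: int set) (\<lambda>_. point_measure {1..q} (\<lambda>i. ennreal (p i)))"

text \<open>\<open>shift_by k\<close> is the \<open>k\<close>-th iterate of the left shift, for an integer \<open>k\<close> of either sign.\<close>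

definition shift_by :: "int \<Rightarrow> (int \<Rightarrow> nat) \<Rightarrow> (int \<Rightarrow> nat)" where
  "shift_by k \<omega> = (\<lambda>j. \<omega> (j + k))"

definition random_map :: "(nat \<Rightarrow> real) \<Rightarrow> (int \<Rightarrow> nat) \<Rightarrow> real \<Rightarrow> real" where
  "random_map \<gamma> \<omega> = intermittent_map (\<gamma> (\<omega> 0))"

primrec random_iterate :: "(nat \<Rightarrow> real) \<Rightarrow> nat \<Rightarrow> (int \<Rightarrow> nat) \<Rightarrow> real \<Rightarrow> real" where
  "random_iterate \<gamma> 0 \<omega> = id"
| "random_iterate \<gamma> (Suc n) \<omega> =
     random_map \<gamma> (shift_by (int n) \<omega>) \<circ> random_iterate \<gamma> n \<omega>"

text \<open>
  The transfer operator with respect to \<open>M\<close> is characterised by duality against bounded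
  observables. This determines its value up to \<open>M\<close>-null sets; \<open>SOME\<close> picks a version. Which
  version is picked depends on \<open>f\<close> only through its class modulo \<open>M\<close>-null sets when \<open>T\<close> is
  nonsingular.
\<close>

definition transfer_operator ::
    "'a measure \<Rightarrow> ('a \<Rightarrow> 'a) \<Rightarrow> ('a \<Rightarrow> real) \<Rightarrow> ('a \<Rightarrow> real)" where
  "transfer_operator M T f =
     (SOME g. integrable M g \<and>
        (\<forall>\<psi> \<in> borel_measurable M. bounded (\<psi> ` space M) \<longrightarrow>
           (\<integral>x. g x * \<psi> x \<partial>M) = (\<integral>x. f x * \<psi> (T x) \<partial>M)))"

primrec transfer_iterate ::
    "(nat \<Rightarrow> real) \<Rightarrow> nat \<Rightarrow> (int \<Rightarrow> nat) \<Rightarrow> (real \<Rightarrow> real) \<Rightarrow> (real \<Rightarrow> real)" where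
  "transfer_iterate \<gamma> 0 \<omega> = id"
| "transfer_iterate \<gamma> (Suc n) \<omega> =
     transfer_operator unit_lebesgue (random_map \<gamma> (shift_by (int n) \<omega>))
       \<circ> transfer_iterate \<gamma> n \<omega>"

text \<open>
  A version of the \<open>L\<^sup>1\<close>-limit of the pullbacks of the constant function 1; it is unique up to
  null sets, so the measure \<open>sample_measure\<close> below does not depend on the version.
\<close>

definition sample_density :: "(nat \<Rightarrow> real) \<Rightarrow> (int \<Rightarrow> nat) \<Rightarrow> real \<Rightarrow> real" where
  "sample_density \<gamma> \<omega> =
     (SOME h. integrable unit_lebesgue h \<and>
        (\<lambda>n. \<integral>x. \<bar>transfer_iterate \<gamma> n (shift_by (- int n) \<omega>) (\<lambda>_. 1) x - h x\<bar> \<partial>unit_lebesgue)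
          \<longlonglongrightarrow> 0)"

definition sample_measure :: "(nat \<Rightarrow> real) \<Rightarrow> (int \<Rightarrow> nat) \<Rightarrow> real measure" where
  "sample_measure \<gamma> \<omega> = density unit_lebesgue (\<lambda>x. ennreal (sample_density \<gamma> \<omega> x))"

definition stationary_measure ::
    "nat \<Rightarrow> (nat \<Rightarrow> real) \<Rightarrow> (nat \<Rightarrow> real) \<Rightarrow> real set \<Rightarrow> real" where
  "stationary_measure q p \<gamma> A =
     (\<integral>\<omega>. measure (sample_measure \<gamma> \<omega>) A \<partial>bernoulli_measure q p)"

text \<open>
  The observable \<open>|x - x\<^sub>0|\<close> to the power \<open>-1/\<alpha>\<close>. At the singularity \<open>x = x\<^sub>0\<close> it takes the value
  0 (the value of \<open>powr\<close> at base 0); this single point, and its preimages under the maps, are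
  null for all measures considered.
\<close>

definition observable :: "real \<Rightarrow> real \<Rightarrow> real \<Rightarrow> real" where
  "observable \<alpha> x\<^sub>0 x = \<bar>x - x\<^sub>0\<bar> powr (- (1 / \<alpha>))"

text \<open>
  Half-open intervals of reals with extended-real endpoints, so that \<open>(x, \<infinity>]\<close> is the set of all
  reals above \<open>x\<close>.
\<close>

definition ereal_Ioc :: "ereal \<Rightarrow> ereal \<Rightarrow> real set" where
  "ereal_Ioc x y = {z. x < ereal z \<and> ereal z \<le> y}"

definition interval_unions :: "real set set" where
  "interval_unions =
     {\<Union> \<I> | \<I>. finite \<I> \<and> \<I> \<subseteq> {ereal_Ioc x y | x y. x < y \<and> 0 \<notin> {x..y}}}"

definition levy_measure :: "real \<Rightarrow> real measure" where
  "levy_measure \<alpha> =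
     density lborel (\<lambda>x. ennreal (if 0 < x then \<alpha> * x powr (- \<alpha> - 1) else 0))"

text \<open>Note that the infimum of the empty set is \<open>\<infinity>\<close> in \<open>enat\<close>.\<close>

definition hitting_time ::
    "(nat \<Rightarrow> real) \<Rightarrow> real set \<Rightarrow> (int \<Rightarrow> nat) \<Rightarrow> real \<Rightarrow> enat" where
  "hitting_time \<gamma> U \<omega> x = Inf {enat k | k. 1 \<le> k \<and> random_iterate \<gamma> k \<omega> x \<in> U}"

end

theory Submission
  imports Defs "HOL-Real_Asymp.Real_Asymp"
begin

text \<open>
  All transfer operators preserve the cone of decreasing functions \<open>f\<close> for which \<open>x\<close> to the power
  \<open>1+\<gamma>\<^sub>m\<^sub>a\<^sub>x\<close> times \<open>f\<close> is increasing. Densities in the cone are bounded below, so splitting off a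
  constant again and again couples any two of them, uniformly in the fibre; this gives the densities
  \<open>h\<close> of the sample measures and their continuity.

  For an interval \<open>I\<close>, the image of \<open>1\<^sub>I h\<close> after \<open>\<surd>n\<close> steps is a function of the cone up to a mass
  of the order of the integral of \<open>h\<close> over a neighbourhood of 0 of size \<open>n\<close> to the power
  \<open>-1/(2\<gamma>\<^sub>m\<^sub>a\<^sub>x)\<close>. For \<open>\<gamma>\<^sub>m\<^sub>a\<^sub>x < 1/3\<close> this mass is \<open>o(1/n)\<close>, so the targets \<open>A\<^sub>n\<close> decorrelate within
  \<open>O(\<surd>n)\<close> steps with total error \<open>o(1)\<close>. Decomposing according to the first visit turns the survival
  probability into the product of \<open>1 - \<nu>(A\<^sub>n)\<close> over the fibres along the orbit, up to the mass that
  returns to \<open>A\<^sub>n\<close> within \<open>O(\<surd>n)\<close> steps. Averaged over \<open>x\<^sub>0\<close>, this mass is small enough for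
  Borel-Cantelli along a subsequence. Finally a law of large numbers for \<open>h(x\<^sub>0)\<close> along the fibres,
  obtained by approximating \<open>h\<close> by functions of finitely many coordinates, identifies the limit of
  the product.
\<close>

subsection \<open>The branches and their inverses\<close>

text \<open>The law of large numbers evaluates the densities at the single point \<open>x0\<close>.
  Hence the proof works with an explicit operator on functions, \<open>Pop\<close>, and with
  densities obtained as pointwise limits; the versions picked by \<open>SOME\<close> in the
  definitions are identified with them almost everywhere. The exceptional centres must be fixed
  before \<open>b\<close>, \<open>J\<close> and the fibre, the exceptional fibres before
  \<open>s\<close> and \<open>t\<close>. Therefore short returns are counted for balls with integer
  constants \<open>M\<close>, which dominate every target. A target has mass of order 1/n, but the
  cone function made from its indicator inherits only the pole bound of the full density, which is
  useless relative to so small a mass. Removing the part that never left the left branch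
  (\<open>Pn\<close> minus \<open>Ln\<close>) restores a pole bound proportional to the mass; only
  then can two densities be coupled with uniform constants. The gap sqrt n enters twice: the mass
  near 0 is of order n to the power -(1 - G)/(2 G), which is o(1/n) for G < 1/3, and the averaged
  short returns have order n * sqrt n * (1/n)^2, summable along n = i^4.\<close>

definition left_map :: "real \<Rightarrow> real \<Rightarrow> real" where
  "left_map a y = y * (1 + (2 * y) powr a)"

text \<open>Continuing the inverse by its end values 0 and 1/2 makes it monotone on the whole line,
  so that measurability comes from monotonicity alone.\<close>

definition left_inv :: "real \<Rightarrow> real \<Rightarrow> real" where
  "left_inv a x = (if x \<le> 0 then 0 else if 1 \<le> x then 1/2
     else (SOME y. 0 \<le> y \<and> y \<le> 1/2 \<and> left_map a y = x))"

text \<open>The reciprocal of the derivative of \<open>left_map a\<close> at the preimage, that is,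
  the Jacobian of the inverse branch.\<close>

definition left_weight :: "real \<Rightarrow> real \<Rightarrow> real" where
  "left_weight a x = 1 / (1 + (1 + a) * (2 * left_inv a x) powr a)"

lemma left_map_0 [simp]: "left_map a 0 = 0"
  by (simp add: left_map_def)

lemma left_map_half [simp]: "left_map a (1/2) = 1"
  by (simp add: left_map_def)

lemma left_map_diff_ge:
  assumes "0 < a" "0 \<le> u" "u \<le> v"
  shows "(v - u) * (1 + (2 * u) powr a) \<le> left_map a v - left_map a u"
proof -
  have "(2 * u) powr a \<le> (2 * v) powr a"
    using assms by (intro powr_mono2) auto
  then have "v * (2 * u) powr a \<le> v * (2 * v) powr a"
    using assms by (intro mult_left_mono) auto
  then show ?thesis
    by (simp add: left_map_def algebra_simps)
qed

lemma left_map_strict_mono: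
  assumes "0 < a" "0 \<le> u" "u < v"
  shows "left_map a u < left_map a v"
proof -
  have "0 < (v - u) * (1 + (2 * u) powr a)"
    using assms by (intro mult_pos_pos) (auto intro: add_pos_nonneg)
  then show ?thesis
    using left_map_diff_ge[of a u v] assms by linarith
qed

lemma left_map_mono:
  assumes "0 < a" "0 \<le> u" "u \<le> v"
  shows "left_map a u \<le> left_map a v"
  using left_map_strict_mono[of a u v] assms by (cases "u = v") auto

lemma powr_abs: "\<bar>x\<bar> powr a = x powr a" for x a :: real
  by (auto simp: powr_def abs_if ln_minus)

text \<open>The substitution in \<open>distr_left_inv\<close> asks for a two-sided derivative even
  at the end point 0. It exists because \<open>powr\<close> sees its base only through the absolute
  value, so \<open>left_map a\<close> is odd.\<close>

lemma left_map_deriv: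
  assumes "0 < a"
  shows "(left_map a has_real_derivative 1 + (1 + a) * (2 * y) powr a) (at y)"
proof (cases "y = 0")
  case True
  have "((\<lambda>h. 1 + \<bar>2 * h\<bar> powr a) \<longlongrightarrow> 1 + \<bar>2 * 0\<bar> powr a) (at (0::real))"
    using assms by (intro tendsto_intros tendsto_powr2) auto
  moreover have "\<forall>\<^sub>F h in at 0. 1 + \<bar>2 * h\<bar> powr a = (left_map a (0 + h) - left_map a 0) / h"
    unfolding eventually_at_filter by (simp add: left_map_def powr_abs del: abs_mult)
  ultimately have "((\<lambda>h. (left_map a (0 + h) - left_map a 0) / h) \<longlongrightarrow> 1) (at 0)"
    by (simp add: filterlim_cong)
  then show ?thesis
    using True by (simp add: DERIV_def)
next
  case False
  have pos: "((\<lambda>y. y * (1 + (2 * y) powr a)) has_real_derivative 1 + (1 + a) * (2 * z) powr a) (at z)"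
    if "0 < z" for z
  proof -
    have "((\<lambda>y. y * (1 + (2 * y) powr a)) has_real_derivative
        1 * (1 + (2 * z) powr a) + (a * (2 * z) powr (a - of_nat 1) * 2) * z) (at z)"
      using that by (auto intro!: derivative_eq_intros DERIV_fun_powr[THEN DERIV_cong])
    moreover have "(2 * z) powr (a - 1) * (2 * z) = (2 * z) powr a"
      using that by (simp add: powr_diff)
    ultimately show ?thesis
      by (simp add: algebra_simps)
  qed
  have eq: "left_map a = (\<lambda>y. y * (1 + (2 * y) powr a))"
    by (auto simp: left_map_def)
  show ?thesis
  proof (cases "0 < y")
    case True
    then show ?thesis
      using pos[of y] by (simp add: eq)
  next
    case False
    have even: "(2 * - z) powr a = (2 * z) powr a" for z
      by (metis abs_minus_cancel mult_minus_right powr_abs)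
    have "(left_map a has_real_derivative 1 + (1 + a) * (2 * - y) powr a) (at (- y))"
      using False \<open>y \<noteq> 0\<close> pos[of "- y"] by (simp add: eq)
    then have "((\<lambda>x. - left_map a (- x)) has_real_derivative - (- (1 + (1 + a) * (2 * - y) powr a))) (at y)"
      unfolding DERIV_mirror by (rule DERIV_minus)
    moreover have "(\<lambda>x. - left_map a (- x)) = left_map a"
      unfolding left_map_def even by simp
    ultimately show ?thesis
      unfolding even by (simp add: add.commute)
  qed
qed

lemma left_map_cont: "0 < a \<Longrightarrow> continuous_on S (left_map a)"
  by (meson DERIV_isCont continuous_at_imp_continuous_on left_map_deriv)

lemma left_inv_ex:
  assumes "0 < a" "0 \<le> x" "x \<le> 1"
  shows "\<exists>y. 0 \<le> y \<and> y \<le> 1/2 \<and> left_map a y = x"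
  using IVT'[of "left_map a" 0 x "1/2"] assms left_map_cont[of a] by auto

lemma left_inv_spec:
  assumes "0 < a" "0 \<le> x" "x \<le> 1"
  shows "0 \<le> left_inv a x" "left_inv a x \<le> 1/2" "left_map a (left_inv a x) = x"
proof -
  have "0 \<le> left_inv a x \<and> left_inv a x \<le> 1/2 \<and> left_map a (left_inv a x) = x"
    using someI_ex[OF left_inv_ex[OF assms]] assms by (auto simp: left_inv_def)
  then show "0 \<le> left_inv a x" "left_inv a x \<le> 1/2" "left_map a (left_inv a x) = x" by auto
qed

lemma left_inv_range:
  assumes "0 < a"
  shows "0 \<le> left_inv a x" "left_inv a x \<le> 1/2"
  using left_inv_spec[OF assms, of x] by (auto simp: left_inv_def)

lemma left_inv_left_map:
  assumes "0 < a" "0 \<le> y" "y \<le> 1/2"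
  shows "left_inv a (left_map a y) = y"
proof -
  have "0 \<le> left_map a y" "left_map a y \<le> 1"
    using left_map_mono[of a 0 y] left_map_mono[of a y "1/2"] assms by auto
  note * = left_inv_spec[OF assms(1) this]
  show ?thesis
    using * left_map_strict_mono[of a y "left_inv a (left_map a y)"]
      left_map_strict_mono[of a "left_inv a (left_map a y)" y] assms
    by (cases y "left_inv a (left_map a y)" rule: linorder_cases) auto
qed

lemma left_inv_strict_mono:
  assumes "0 < a" "0 \<le> x" "x < y" "y \<le> 1"
  shows "left_inv a x < left_inv a y"
  using left_map_mono[of a "left_inv a y" "left_inv a x"] left_inv_spec[of a x] left_inv_spec[of a y] assms
  by (smt (verit))

lemma left_inv_mono:
  assumes "0 < a"
  shows "mono (left_inv a)"
proof
  fix x y :: real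
  assume "x \<le> y"
  show "left_inv a x \<le> left_inv a y"
  proof (cases "0 < x \<and> y < 1")
    case True
    then show ?thesis
      using left_inv_strict_mono[of a x y] assms \<open>x \<le> y\<close> by (cases "x = y") auto
  next
    case False
    then have "left_inv a x = 0 \<or> left_inv a y = 1/2"
      by (auto simp: left_inv_def)
    then show ?thesis
      using left_inv_range[OF assms, of x] left_inv_range[OF assms, of y] by auto
  qed
qed

lemma left_inv_bounds:
  assumes "0 < a" "0 \<le> x" "x \<le> 1"
  shows "x / 2 \<le> left_inv a x" "left_inv a x \<le> x"
proof -
  let ?y = "left_inv a x"
  have y: "0 \<le> ?y" "?y \<le> 1/2" "?y * (1 + (2 * ?y) powr a) = x"
    using left_inv_spec[OF assms] by (auto simp: left_map_def)
  have "(2 * ?y) powr a \<le> 1 powr a"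
    using y assms by (intro powr_mono2) auto
  then have "?y * (1 + (2 * ?y) powr a) \<le> ?y * 2"
    using y by (intro mult_left_mono) auto
  then show "x / 2 \<le> ?y" using y by auto
  have "?y * 1 \<le> ?y * (1 + (2 * ?y) powr a)"
    using y by (intro mult_left_mono) auto
  then show "?y \<le> x" using y by auto
qed

lemma left_inv_pos: "0 < a \<Longrightarrow> 0 < x \<Longrightarrow> 0 < left_inv a x"
  using left_inv_bounds(1)[of a x] by (cases "x \<le> 1") (auto simp: left_inv_def)

lemma left_inv_0 [simp]: "left_inv a 0 = 0"
  by (simp add: left_inv_def)

lemma left_inv_1 [simp]: "left_inv a 1 = 1/2"
  by (simp add: left_inv_def)

lemma left_inv_measurable [measurable]: "0 < a \<Longrightarrow> left_inv a \<in> borel_measurable borel"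
  by (intro borel_measurable_mono left_inv_mono)

lemma left_weight_measurable [measurable]: "0 < a \<Longrightarrow> left_weight a \<in> borel_measurable borel"
  unfolding left_weight_def[abs_def] by measurable

lemma left_weight_pos: "0 < a \<Longrightarrow> 0 < left_weight a x"
  by (auto simp: left_weight_def intro!: add_pos_nonneg)

lemma left_weight_anti:
  assumes "0 < a" "x \<le> y"
  shows "left_weight a y \<le> left_weight a x"
proof -
  have "(2 * left_inv a x) powr a \<le> (2 * left_inv a y) powr a"
    using assms left_inv_range[OF assms(1)] monoD[OF left_inv_mono[OF assms(1)] assms(2)]
    by (intro powr_mono2) auto
  then show ?thesis
    using assms by (auto simp: left_weight_def intro!: divide_left_mono mult_left_mono add_pos_nonneg mult_pos_pos)
qed

text \<open>Away from the neutral fixed point the branch contracts uniformly in the parameter: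
  difference quotients of \<open>left_map a\<close> to the right of \<open>u = left_inv a x\<close>
  are at least \<open>1 + (2 * u) powr a\<close>, and \<open>(2 * u) powr a\<close> is at least
  \<open>2 * u\<close> because \<open>2 * u\<close> and \<open>a\<close> are at most 1.\<close>

lemma left_inv_contract:
  assumes "0 < a" "a \<le> 1" "0 \<le> x" "x \<le> y" "y \<le> 1" "0 \<le> d" "d \<le> 1/2" "d \<le> left_inv a x"
  shows "(left_inv a y - left_inv a x) * (1 + 2 * d) \<le> y - x"
proof -
  let ?u = "left_inv a x" and ?v = "left_inv a y"
  have uv: "0 \<le> ?u" "?u \<le> ?v" "?u \<le> 1/2" "left_map a ?u = x" "left_map a ?v = y"
    using left_inv_spec[of a x] left_inv_spec[of a y] assms monoD[OF left_inv_mono[OF assms(1)], of x y] by auto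
  have "2 * d \<le> (2 * ?u) powr a"
  proof -
    have "2 * d \<le> 2 * ?u" using assms by simp
    also have "2 * ?u = (2 * ?u) powr 1" using uv by (simp)
    also have "\<dots> \<le> (2 * ?u) powr a" 
      using uv assms by (intro powr_mono') auto
    finally show ?thesis .
  qed
  then have "(?v - ?u) * (1 + 2 * d) \<le> (?v - ?u) * (1 + (2 * ?u) powr a)"
    using uv by (intro mult_left_mono) auto
  also have "\<dots> \<le> y - x"
    using left_map_diff_ge[of a ?u ?v] uv assms by simp
  finally show ?thesis .
qed

lemma left_inv_nonexpansive:
  assumes "0 < a" "a \<le> 1" "0 \<le> x" "x \<le> y" "y \<le> 1"
  shows "left_inv a y - left_inv a x \<le> y - x"
  using left_inv_contract[of a x y 0] left_inv_range[of a x] assms by simp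

section \<open>Lebesgue measure on the unit interval and the change of variables along the two
  branches\<close>

abbreviation (input) "U \<equiv> unit_lebesgue"

lemma space_U [simp]: "space U = {0..1}"
  by (simp add: unit_lebesgue_def space_restrict_space)

lemma sets_U: "sets U = sets (restrict_space borel {0..1})"
  by (simp add: unit_lebesgue_def sets_restrict_space)

lemma measurable_U [measurable (raw)]: "f \<in> borel_measurable borel \<Longrightarrow> f \<in> borel_measurable U"
  by (simp add: unit_lebesgue_def measurable_restrict_space1)

interpretation U: prob_space U
  by standard (simp add: unit_lebesgue_def emeasure_restrict_space space_restrict_space)

lemma integral_U: "(\<integral>x. f x \<partial>U) = (\<integral>x. indicator {0..1} x * f x \<partial>lborel)" for f :: "real \<Rightarrow> real"
  by (simp add: unit_lebesgue_def integral_restrict_space)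

lemma integrable_U: "integrable U f \<longleftrightarrow> integrable lborel (\<lambda>x. indicator {0..1} x * f x)"
  for f :: "real \<Rightarrow> real"
  by (simp add: unit_lebesgue_def integrable_restrict_space)

lemma AE_U: "(AE x in U. P x) \<longleftrightarrow> (AE x in lborel. x \<in> {0..1} \<longrightarrow> P x)"
  unfolding unit_lebesgue_def by (subst AE_restrict_space_iff) auto

lemma AE_U_I:
  assumes "\<And>x. 0 < x \<Longrightarrow> x < 1 \<Longrightarrow> P x"
  shows "AE x in U. P x"
proof -
  have "AE x in lborel. x \<notin> {0, 1 :: real}"
    by (intro AE_not_in countable_imp_null_set_lborel) auto
  then show ?thesis
    unfolding AE_U by eventually_elim (use assms in force)
qed

lemma integral_U_cong:
  fixes f g :: "real \<Rightarrow> real"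
  assumes "f \<in> borel_measurable borel" "g \<in> borel_measurable borel"
    and "\<And>x. 0 < x \<Longrightarrow> x < 1 \<Longrightarrow> f x = g x"
  shows "(\<integral>x. f x \<partial>U) = (\<integral>x. g x \<partial>U)"
  by (intro integral_cong_AE AE_U_I) (use assms in auto)

text \<open>An identity of measures delivers the integral formula and the equivalence of
  integrability from a single computation.\<close>

lemma distr_left_inv:
  assumes a: "0 < a"
  shows "distr (density U (\<lambda>x. ennreal (left_weight a x))) borel (left_inv a) = density lborel (indicator {0..1/2::real})"
proof (rule measure_eqI)
  note [measurable] = left_inv_measurable[OF a] left_weight_measurable[OF a]
  fix B assume "B \<in> sets (distr (density U (\<lambda>x. ennreal (left_weight a x))) borel (left_inv a))"
  then have [measurable]: "B \<in> sets borel" by simp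
  have "emeasure (distr (density U (\<lambda>x. ennreal (left_weight a x))) borel (left_inv a)) B
      = (\<integral>\<^sup>+x. ennreal (left_weight a x) * indicator (left_inv a -` B \<inter> space U) x \<partial>U)"
    by (subst emeasure_distr) (simp_all add: emeasure_density cong: measurable_cong_sets)
  also have "\<dots> = (\<integral>\<^sup>+x. ennreal (left_weight a x * indicator B (left_inv a x)) \<partial>U)"
    by (intro nn_integral_cong) (auto split: split_indicator)
  also have "\<dots> = (\<integral>\<^sup>+x. ennreal (left_weight a x * indicator B (left_inv a x)) * indicator {0..1} x \<partial>lborel)"
    by (simp add: unit_lebesgue_def nn_integral_restrict_space)
  also have "\<dots> = (\<integral>\<^sup>+x. ennreal (left_weight a x * indicator B (left_inv a x) * indicator {left_map a 0..left_map a (1/2)} x) \<partial>lborel)"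
    by (intro nn_integral_cong) (auto split: split_indicator)
  also have "\<dots> = (\<integral>\<^sup>+y. ennreal ((left_weight a (left_map a y) * indicator B (left_inv a (left_map a y))) * (1 + (1 + a) * (2 * y) powr a) * indicator {0..1/2} y) \<partial>lborel)"
    using a by (intro nn_integral_substitution left_map_deriv)
      (auto intro!: continuous_intros continuous_on_powr' simp: set_borel_measurable_def)
  also have "\<dots> = (\<integral>\<^sup>+y. indicator {0..1/2} y * indicator B y \<partial>lborel)"
  proof (intro nn_integral_cong)
    fix y :: real
    have "0 < 1 + (1 + a) * (2 * y) powr a"
      using a by (auto intro: add_pos_nonneg)
    then show "ennreal ((left_weight a (left_map a y) * indicator B (left_inv a (left_map a y))) * (1 + (1 + a) * (2 * y) powr a) * indicator {0..1/2} y)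
        = indicator {0..1/2} y * indicator B y"
      using a by (auto simp: left_weight_def left_inv_left_map split: split_indicator)
  qed
  also have "\<dots> = emeasure (density lborel (indicator {0..1/2::real})) B"
    by (simp add: emeasure_density)
  finally show "emeasure (distr (density U (\<lambda>x. ennreal (left_weight a x))) borel (left_inv a)) B
      = emeasure (density lborel (indicator {0..1/2::real})) B" .
qed simp

lemma distr_rbr:
  "distr (density U (\<lambda>x. ennreal (1/2))) borel (\<lambda>x. (x + 1) / 2) = density lborel (indicator {1/2..1::real})"
proof (rule measure_eqI)
  fix B assume "B \<in> sets (distr (density U (\<lambda>x. ennreal (1/2))) borel (\<lambda>x. (x + 1) / 2 :: real))"
  then have [measurable]: "B \<in> sets borel" by simp
  have "emeasure (distr (density U (\<lambda>x. ennreal (1/2))) borel (\<lambda>x. (x + 1) / 2)) B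
      = (\<integral>\<^sup>+x. ennreal (1/2) * indicator ((\<lambda>x. (x + 1) / 2) -` B \<inter> space U) x \<partial>U)"
    by (subst emeasure_distr) (simp_all add: emeasure_density cong: measurable_cong_sets)
  also have "\<dots> = (\<integral>\<^sup>+x. ennreal (1/2 * indicator B ((x + 1) / 2)) \<partial>U)"
    by (intro nn_integral_cong) (auto split: split_indicator)
  also have "\<dots> = (\<integral>\<^sup>+x. ennreal (1/2 * indicator B ((x + 1) / 2)) * indicator {0..1} x \<partial>lborel)"
    by (simp add: unit_lebesgue_def nn_integral_restrict_space)
  also have "\<dots> = (\<integral>\<^sup>+x. ennreal (1/2 * indicator B ((x + 1) / 2) * indicator {2 * (1/2) - 1..2 * 1 - 1} x) \<partial>lborel)"
    by (intro nn_integral_cong) (auto split: split_indicator)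
  also have "\<dots> = (\<integral>\<^sup>+y. ennreal ((1/2 * indicator B (((2 * y - 1) + 1) / 2)) * 2 * indicator {1/2..1} y) \<partial>lborel)"
    by (intro nn_integral_substitution[where g = "\<lambda>y. 2 * y - 1"])
      (auto intro!: continuous_intros derivative_eq_intros simp: set_borel_measurable_def)
  also have "\<dots> = (\<integral>\<^sup>+y. indicator {1/2..1} y * indicator B y \<partial>lborel)"
    by (intro nn_integral_cong) (auto split: split_indicator)
  also have "\<dots> = emeasure (density lborel (indicator {1/2..1::real})) B"
    by (simp add: emeasure_density)
  finally show "emeasure (distr (density U (\<lambda>x. ennreal (1/2))) borel (\<lambda>x. (x + 1) / 2)) B
      = emeasure (density lborel (indicator {1/2..1::real})) B" .
qed simp

lemma
  fixes F :: "real \<Rightarrow> real"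
  assumes a: "0 < a" and F [measurable]: "F \<in> borel_measurable borel"
  shows integral_lbr: "(\<integral>x. F (left_inv a x) * left_weight a x \<partial>U) = (\<integral>x. F x * indicator {..1/2} x \<partial>U)" (is ?A)
    and integrable_lbr: "integrable U (\<lambda>x. F (left_inv a x) * left_weight a x) \<longleftrightarrow> integrable U (\<lambda>x. F x * indicator {..1/2} x)" (is ?B)
proof -
  note [measurable] = left_inv_measurable[OF a] left_weight_measurable[OF a]
  have left_weight: "AE x in U. 0 \<le> left_weight a x"
    using left_weight_pos[OF a] by (auto intro: less_imp_le)
  have m: "left_inv a \<in> measurable (density U (\<lambda>x. ennreal (left_weight a x))) borel"
    by (simp cong: measurable_cong_sets)
  have e: "density lborel (indicator {0..1/2::real}) = density lborel (\<lambda>x. ennreal (indicator {0..1/2::real} x))"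
    by (intro density_cong) (auto simp: ennreal_indicator)
  have ind: "indicator {0..1} x * (F x * indicator {..1/2} x) = indicator {0..1/2} x * F x" for x
    by (auto split: split_indicator)
  have "(\<integral>x. F (left_inv a x) * left_weight a x \<partial>U) = (\<integral>x. F (left_inv a x) \<partial>density U (\<lambda>x. ennreal (left_weight a x)))"
    by (subst integral_real_density) (use left_weight in \<open>auto simp: mult.commute\<close>)
  also have "\<dots> = (\<integral>x. F x \<partial>density lborel (indicator {0..1/2::real}))"
    by (subst distr_left_inv[OF a, symmetric], subst integral_distr[OF m]) auto
  also have "\<dots> = (\<integral>x. indicator {0..1/2} x * F x \<partial>lborel)"
    unfolding e by (subst integral_real_density) auto
  also have "\<dots> = (\<integral>x. F x * indicator {..1/2} x \<partial>U)"
    unfolding integral_U ind ..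
  finally show ?A .
  have "integrable U (\<lambda>x. F (left_inv a x) * left_weight a x) \<longleftrightarrow> integrable (density U (\<lambda>x. ennreal (left_weight a x))) (\<lambda>x. F (left_inv a x))"
    by (subst integrable_real_density) (use left_weight in \<open>auto simp: mult.commute\<close>)
  also have "\<dots> \<longleftrightarrow> integrable (density lborel (indicator {0..1/2::real})) F"
    by (subst distr_left_inv[OF a, symmetric], subst integrable_distr_eq[OF m]) auto
  also have "\<dots> \<longleftrightarrow> integrable lborel (\<lambda>x. indicator {0..1/2} x * F x)"
    unfolding e by (subst integrable_real_density) auto
  also have "\<dots> \<longleftrightarrow> integrable U (\<lambda>x. F x * indicator {..1/2} x)"
    unfolding integrable_U ind ..
  finally show ?B .
qed

lemma
  fixes F :: "real \<Rightarrow> real"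
  assumes F [measurable]: "F \<in> borel_measurable borel"
  shows integral_rbr: "(\<integral>x. F ((x + 1) / 2) / 2 \<partial>U) = (\<integral>x. F x * indicator {1/2<..} x \<partial>U)" (is ?A)
    and integrable_rbr: "integrable U (\<lambda>x. F ((x + 1) / 2) / 2) \<longleftrightarrow> integrable U (\<lambda>x. F x * indicator {1/2<..} x)" (is ?B)
proof -
  have m: "(\<lambda>x. (x + 1) / 2) \<in> measurable (density U (\<lambda>x. ennreal (1/2))) borel"
    by (simp cong: measurable_cong_sets)
  have e: "density lborel (indicator {1/2..1::real}) = density lborel (\<lambda>x. ennreal (indicator {1/2<..1::real} x :: real))"
  proof (intro density_cong)
    have "AE x in lborel. x \<noteq> (1/2::real)" by (rule AE_lborel_singleton)
    then show "AE x in lborel. indicator {1/2..1::real} x = ennreal (indicator {1/2<..1} x :: real)"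
      by eventually_elim (auto simp: ennreal_indicator split: split_indicator)
  qed auto
  have ind: "indicator {0..1} x * (F x * indicator {1/2<..} x) = indicator {1/2<..1} x * F x" for x
    by (auto split: split_indicator)
  have "(\<integral>x. F ((x + 1) / 2) / 2 \<partial>U) = (\<integral>x. F ((x + 1) / 2) \<partial>density U (\<lambda>x. ennreal (1/2)))"
    by (subst integral_real_density) auto
  also have "\<dots> = (\<integral>x. F x \<partial>density lborel (indicator {1/2..1::real}))"
    by (subst distr_rbr[symmetric], subst integral_distr[OF m]) auto
  also have "\<dots> = (\<integral>x. indicator {1/2<..1} x * F x \<partial>lborel)"
    unfolding e by (subst integral_real_density) auto
  also have "\<dots> = (\<integral>x. F x * indicator {1/2<..} x \<partial>U)"
    unfolding integral_U ind ..
  finally show ?A .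
  have "integrable U (\<lambda>x. F ((x + 1) / 2) / 2) \<longleftrightarrow> integrable (density U (\<lambda>x. ennreal (1/2))) (\<lambda>x. F ((x + 1) / 2))"
    by (subst integrable_real_density) auto
  also have "\<dots> \<longleftrightarrow> integrable (density lborel (indicator {1/2..1::real})) F"
    by (subst distr_rbr[symmetric], subst integrable_distr_eq[OF m]) auto
  also have "\<dots> \<longleftrightarrow> integrable lborel (\<lambda>x. indicator {1/2<..1} x * F x)"
    unfolding e by (subst integrable_real_density) auto
  also have "\<dots> \<longleftrightarrow> integrable U (\<lambda>x. F x * indicator {1/2<..} x)"
    unfolding integrable_U ind ..
  finally show ?B .
qed

subsection \<open>The transfer operator\<close>

definition Lop :: "real \<Rightarrow> (real \<Rightarrow> real) \<Rightarrow> real \<Rightarrow> real" where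
  "Lop a f x = f (left_inv a x) * left_weight a x"

definition Rop :: "(real \<Rightarrow> real) \<Rightarrow> real \<Rightarrow> real" where
  "Rop f x = f ((x + 1) / 2) / 2"

text \<open>An everywhere defined version of the transfer operator, acting on functions and not on
  classes; \<open>transfer_operator_AE\<close> relates it to
  \<open>transfer_operator\<close>.\<close>

definition Pop :: "real \<Rightarrow> (real \<Rightarrow> real) \<Rightarrow> real \<Rightarrow> real" where
  "Pop a f x = Lop a f x + Rop f x"

lemma Lop_measurable [measurable (raw)]:
  assumes "0 < a" and [measurable]: "f \<in> borel_measurable borel"
  shows "Lop a f \<in> borel_measurable borel"
proof -
  note [measurable] = left_inv_measurable[OF assms(1)] left_weight_measurable[OF assms(1)]
  show ?thesis unfolding Lop_def[abs_def] by measurable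
qed

lemma Rop_measurable [measurable (raw)]:
  assumes [measurable]: "f \<in> borel_measurable borel"
  shows "Rop f \<in> borel_measurable borel"
  unfolding Rop_def[abs_def] by measurable

lemma Pop_measurable [measurable (raw)]:
  assumes "0 < a" and [measurable]: "f \<in> borel_measurable borel"
  shows "Pop a f \<in> borel_measurable borel"
proof -
  note [measurable] = Lop_measurable[OF assms] Rop_measurable[OF assms(2)]
  show ?thesis unfolding Pop_def[abs_def] by measurable
qed

lemma integrable_mult_ind:
  "integrable U f \<Longrightarrow> A \<in> sets borel \<Longrightarrow> integrable U (\<lambda>x. f x * indicator A x)"
  for f :: "real \<Rightarrow> real"
  by (rule Bochner_Integration.integrable_bound[of U f])
    (auto split: split_indicator intro!: borel_measurable_times measurable_U borel_measurable_integrable)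

lemma
  assumes a: "0 < a" and [measurable]: "f \<in> borel_measurable borel" and f: "integrable U f"
  shows integrable_Lop: "integrable U (Lop a f)"
    and integrable_Rop: "integrable U (Rop f)"
    and integrable_Pop: "integrable U (Pop a f)"
    and integral_Lop: "(\<integral>x. Lop a f x \<partial>U) = (\<integral>x. f x * indicator {..1/2} x \<partial>U)"
    and integral_Rop: "(\<integral>x. Rop f x \<partial>U) = (\<integral>x. f x * indicator {1/2<..} x \<partial>U)"
    and integral_Pop: "(\<integral>x. Pop a f x \<partial>U) = (\<integral>x. f x \<partial>U)"
    and integral_L_R: "(\<integral>x. Lop a f x \<partial>U) + (\<integral>x. Rop f x \<partial>U) = (\<integral>x. f x \<partial>U)"
proof -
  show L: "integrable U (Lop a f)" and R: "integrable U (Rop f)"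
    using integrable_lbr[OF a, of f] integrable_rbr[of f] integrable_mult_ind[OF f]
    by (auto simp: Lop_def[abs_def] Rop_def[abs_def])
  then show "integrable U (Pop a f)"
    by (auto simp: Pop_def[abs_def])
  show l: "(\<integral>x. Lop a f x \<partial>U) = (\<integral>x. f x * indicator {..1/2} x \<partial>U)"
    and r: "(\<integral>x. Rop f x \<partial>U) = (\<integral>x. f x * indicator {1/2<..} x \<partial>U)"
    using integral_lbr[OF a, of f] integral_rbr[of f] by (auto simp: Lop_def[abs_def] Rop_def[abs_def])
  have "(\<integral>x. f x * indicator {..1/2} x \<partial>U) + (\<integral>x. f x * indicator {1/2<..} x \<partial>U)
      = (\<integral>x. f x * indicator {..1/2} x + f x * indicator {1/2<..} x \<partial>U)"
    using integrable_mult_ind[OF f] by (subst Bochner_Integration.integral_add) auto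
  also have "\<dots> = (\<integral>x. f x \<partial>U)"
    by (intro Bochner_Integration.integral_cong) (auto split: split_indicator)
  finally show lr: "(\<integral>x. Lop a f x \<partial>U) + (\<integral>x. Rop f x \<partial>U) = (\<integral>x. f x \<partial>U)"
    unfolding l r .
  then show "(\<integral>x. Pop a f x \<partial>U) = (\<integral>x. f x \<partial>U)"
    unfolding Pop_def[abs_def] using L R by simp
qed

definition lsv_map :: "real \<Rightarrow> real \<Rightarrow> real" where
  "lsv_map a x = (if x < 1/2 then left_map a x else 2 * x - 1)"

lemma lsv_map_eq: "intermittent_map a = lsv_map a"
  by (auto simp: intermittent_map_def lsv_map_def left_map_def powr_mult)

lemma lsv_map_measurable [measurable]: "lsv_map a \<in> borel_measurable borel"
  unfolding lsv_map_def[abs_def] left_map_def[abs_def] by measurable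

lemma lsv_map_range: "0 < a \<Longrightarrow> x \<in> {0..1} \<Longrightarrow> lsv_map a x \<in> {0..1}"
  using left_map_mono[of a 0 x] left_map_mono[of a x "1/2"] by (auto simp: lsv_map_def)

lemma lsv_map_left_inv: "0 < a \<Longrightarrow> 0 < x \<Longrightarrow> x < 1 \<Longrightarrow> lsv_map a (left_inv a x) = x"
  using left_inv_strict_mono[of a x 1] left_inv_spec[of a x] by (simp add: lsv_map_def)

lemma lsv_map_rbr: "0 < x \<Longrightarrow> lsv_map a ((x + 1) / 2) = x"
  by (simp add: lsv_map_def field_simps)

text \<open>Duality is mass preservation applied to the function
  \<open>f x * \<psi> (lsv_map a x)\<close>: on either inverse branch the factor \<psi> is evaluated
  at \<open>x\<close> again.\<close>

lemma
  assumes a: "0 < a" and [measurable]: "f \<in> borel_measurable borel" "\<psi> \<in> borel_measurable borel"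
    and i: "integrable U (\<lambda>x. f x * \<psi> (lsv_map a x))"
  shows integral_Pop_mult: "(\<integral>x. Pop a f x * \<psi> x \<partial>U) = (\<integral>x. f x * \<psi> (lsv_map a x) \<partial>U)"
    and integrable_Pop_mult: "integrable U (\<lambda>x. Pop a f x * \<psi> x)"
proof -
  have *: "AE x in U. Pop a (\<lambda>x. f x * \<psi> (lsv_map a x)) x = Pop a f x * \<psi> x"
    by (intro AE_U_I) (auto simp: Pop_def Lop_def Rop_def lsv_map_left_inv[OF a] lsv_map_rbr algebra_simps)
  note [measurable] = Pop_measurable[OF a]
  have "(\<integral>x. f x * \<psi> (lsv_map a x) \<partial>U) = (\<integral>x. Pop a (\<lambda>x. f x * \<psi> (lsv_map a x)) x \<partial>U)"
    by (rule integral_Pop[OF a _ i, symmetric]) measurable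
  also have "\<dots> = (\<integral>x. Pop a f x * \<psi> x \<partial>U)"
    by (rule integral_cong_AE[OF _ _ *]) measurable
  finally show "(\<integral>x. Pop a f x * \<psi> x \<partial>U) = (\<integral>x. f x * \<psi> (lsv_map a x) \<partial>U)" ..
  have "integrable U (Pop a (\<lambda>x. f x * \<psi> (lsv_map a x)))"
    by (rule integrable_Pop[OF a _ i]) measurable
  then show "integrable U (\<lambda>x. Pop a f x * \<psi> x)"
    by (rule integrable_cong_AE_imp[OF _ _ *]) measurable
qed

subsection \<open>The invariant cone\<close>

text \<open>
  A fibre is represented by its sequence \<open>a\<close> of parameters in \<open>(0,G]\<close>, with \<open>G\<close> in the role of
  \<open>\<gamma>\<^sub>m\<^sub>a\<^sub>x\<close>; an integer index \<open>k\<close> stands for the fibre over the \<open>k\<close>-th shift.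
\<close>

locale lsv =
  fixes G :: real
  assumes G0: "0 < G" and G1: "G < 1/3"
begin

definition param :: "real \<Rightarrow> bool" where
  "param a \<longleftrightarrow> 0 < a \<and> a \<le> G"

text \<open>
  The cone of Liverani, Saussol and Vaienti for the largest exponent. It is invariant under the
  operators of all smaller exponents, and even under their two summands separately.
\<close>

definition cone :: "(real \<Rightarrow> real) \<Rightarrow> bool" where
  "cone f \<longleftrightarrow> f \<in> borel_measurable borel \<and> (\<forall>x. 0 < x \<and> x \<le> 1 \<longrightarrow> 0 \<le> f x) \<and>
    (\<forall>x y. 0 < x \<and> x \<le> y \<and> y \<le> 1 \<longrightarrow>
       f y \<le> f x \<and> x powr (1 + G) * f x \<le> y powr (1 + G) * f y)"

text \<open>The growth condition at the neutral fixed point. It is kept apart from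
  \<open>cone\<close> because its constant has to be tracked relative to the mass whenever a
  function is split.\<close>

definition pole_bound :: "real \<Rightarrow> (real \<Rightarrow> real) \<Rightarrow> bool" where
  "pole_bound K f \<longleftrightarrow> (\<forall>x. 0 < x \<and> x \<le> 1 \<longrightarrow> f x \<le> K * x powr (- G))"

lemma paramD: "param a \<Longrightarrow> 0 < a" "param a \<Longrightarrow> a \<le> G" "param a \<Longrightarrow> a \<le> 1"
  using G1 by (auto simp: param_def)

lemma
  assumes "cone f"
  shows reg_measurable: "f \<in> borel_measurable borel"
    and reg_nonneg: "0 < x \<Longrightarrow> x \<le> 1 \<Longrightarrow> 0 \<le> f x"
    and reg_anti: "0 < x \<Longrightarrow> x \<le> y \<Longrightarrow> y \<le> 1 \<Longrightarrow> f y \<le> f x"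
    and reg_incr: "0 < x \<Longrightarrow> x \<le> y \<Longrightarrow> y \<le> 1 \<Longrightarrow> x powr (1 + G) * f x \<le> y powr (1 + G) * f y"
  using assms by (auto simp: cone_def)

lemma pole_boundD: "pole_bound K f \<Longrightarrow> 0 < x \<Longrightarrow> x \<le> 1 \<Longrightarrow> f x \<le> K * x powr (- G)"
  by (auto simp: pole_bound_def)

lemma cone_const: "0 \<le> c \<Longrightarrow> cone (\<lambda>_. c)"
  using G0 by (auto simp: cone_def intro!: mult_right_mono powr_mono2)

lemma cone_add:
  assumes "cone f" "cone g"
  shows "cone (\<lambda>x. f x + g x)"
  using reg_measurable[OF assms(1)] reg_measurable[OF assms(2)] assms
  by (auto simp: cone_def distrib_left add_mono)

lemma cone_scale:
  assumes "cone f" "0 \<le> c"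
  shows "cone (\<lambda>x. c * f x)"
  using reg_measurable[OF assms(1)] assms
  by (auto simp: cone_def mult.left_commute[of _ c] mult_left_mono)

lemma pole_bound_scale: "pole_bound K f \<Longrightarrow> 0 \<le> c \<Longrightarrow> pole_bound (c * K) (\<lambda>x. c * f x)"
  by (auto simp: pole_bound_def mult.assoc mult_left_mono)

lemma pole_bound_mono: "pole_bound K f \<Longrightarrow> K \<le> K' \<Longrightarrow> pole_bound K' f"
  by (auto simp: pole_bound_def) (meson mult_right_mono order_trans powr_ge_zero)

lemma one_le_powr_neg: "0 < x \<Longrightarrow> x \<le> 1 \<Longrightarrow> 1 \<le> x powr (- G)"
  using powr_mono'[of "- G" 0 x] G0 by simp

text \<open>This is where the largest exponent is used: the numerator of the derivative is a
  positive multiple of \<open>(G - a) + (1 + a) * z * G\<close>, nonnegative for every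
  \<open>a\<close> up to \<open>G\<close>. With \<open>u = (2 * left_inv a x) powr a\<close> the
  quotient is the factor that \<open>Lop\<close> contributes to
  \<open>x powr (1 + G) * f x\<close>.\<close>

lemma incr_aux:
  fixes a u v :: real
  assumes "0 < a" "a \<le> G" "0 \<le> u" "u \<le> v"
  shows "(1 + u) powr (1 + G) / (1 + (1 + a) * u) \<le> (1 + v) powr (1 + G) / (1 + (1 + a) * v)"
proof (rule DERIV_nonneg_imp_nondecreasing[OF assms(4)])
  fix z assume z: "u \<le> z" "z \<le> v"
  let ?w = "1 + (1 + a) * z"
  have pos: "0 < ?w" "0 < 1 + z" using z assms by (auto intro!: add_pos_nonneg)
  have d: "((\<lambda>u. (1 + u) powr (1 + G) / (1 + (1 + a) * u)) has_real_derivative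
      (((1 + G) * (1 + z) powr (1 + G - of_nat 1) * 1) * ?w - (1 + z) powr (1 + G) * (1 + a)) / (?w * ?w)) (at z)"
    using pos by (auto intro!: derivative_eq_intros DERIV_fun_powr[THEN DERIV_cong])
  have "(1 + z) powr (1 + G) = (1 + z) * (1 + z) powr G"
    using pos by (simp add: powr_add)
  then have eq: "((1 + G) * (1 + z) powr (1 + G - of_nat 1) * 1) * ?w - (1 + z) powr (1 + G) * (1 + a)
      = (1 + z) powr G * ((G - a) + (1 + a) * z * G)"
    by (simp add: algebra_simps)
  have "0 \<le> (1 + z) powr G * ((G - a) + (1 + a) * z * G)"
    using assms z G0 by (intro mult_nonneg_nonneg add_nonneg_nonneg) auto
  then show "\<exists>y. ((\<lambda>u. (1 + u) powr (1 + G) / (1 + (1 + a) * u)) has_real_derivative y) (at z) \<and> 0 \<le> y"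
    using d[unfolded eq] pos by (intro exI[of _ "(1 + z) powr G * ((G - a) + (1 + a) * z * G) / (?w * ?w)"] conjI divide_nonneg_pos) auto
qed

lemma left_inv_eq:
  assumes "param a" "0 < x" "x \<le> 1"
  shows "x = left_inv a x * (1 + (2 * left_inv a x) powr a)"
  using left_inv_spec[of a x] assms paramD by (simp add: left_map_def)

lemma cone_Lop:
  assumes a: "param a" and f: "cone f"
  shows "cone (Lop a f)"
  unfolding cone_def
proof (intro conjI allI impI)
  note a' = paramD[OF a]
  note [measurable] = reg_measurable[OF f]
  show "Lop a f \<in> borel_measurable borel"
    using a' by measurable
  have rng: "0 < left_inv a x" "left_inv a x \<le> 1" if "0 < x" for x
    using left_inv_pos[of a x] left_inv_range[of a x] a' that by auto
  show "0 \<le> Lop a f x" if "0 < x \<and> x \<le> 1" for x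
    using reg_nonneg[OF f rng] left_weight_pos[of a x] a' that by (auto simp: Lop_def intro!: mult_nonneg_nonneg less_imp_le)
  fix x y :: real assume xy: "0 < x \<and> x \<le> y \<and> y \<le> 1"
  have le: "left_inv a x \<le> left_inv a y" using monoD[OF left_inv_mono[OF a'(1)]] xy by auto
  have xy0: "0 < x" "0 < y" using xy by auto
  have anti: "f (left_inv a y) \<le> f (left_inv a x)"
    using reg_anti[OF f rng(1)[OF xy0(1)] le rng(2)[OF xy0(2)]] .
  then show "Lop a f y \<le> Lop a f x"
    unfolding Lop_def using left_weight_anti[of a x y] left_weight_pos[of a y] reg_nonneg[OF f rng(1)[OF xy0(1)] rng(2)[OF xy0(1)]] xy a'
    by (intro mult_mono) (auto intro: less_imp_le)
  \<comment> \<open>Writing \<open>z = y * (1 + u)\<close> with \<open>y = left_inv a z\<close>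
    factors the quantity into its counterpart for \<open>f\<close> at \<open>y\<close> and the
    quotient of \<open>incr_aux\<close>; both factors increase with \<open>z\<close>.\<close>
  have form: "z powr (1 + G) * Lop a f z = (left_inv a z powr (1 + G) * f (left_inv a z)) *
     ((1 + (2 * left_inv a z) powr a) powr (1 + G) / (1 + (1 + a) * (2 * left_inv a z) powr a))" if "0 < z" "z \<le> 1" for z
  proof -
    have "z powr (1 + G) = left_inv a z powr (1 + G) * (1 + (2 * left_inv a z) powr a) powr (1 + G)"
      by (subst left_inv_eq[OF a that]) (simp add: powr_mult)
    then show ?thesis by (simp add: Lop_def left_weight_def)
  qed
  have "(2 * left_inv a x) powr a \<le> (2 * left_inv a y) powr a"
    using le rng[OF xy0(1)] a' by (intro powr_mono2) auto
  then have "(left_inv a x powr (1 + G) * f (left_inv a x)) *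
     ((1 + (2 * left_inv a x) powr a) powr (1 + G) / (1 + (1 + a) * (2 * left_inv a x) powr a))
     \<le> (left_inv a y powr (1 + G) * f (left_inv a y)) *
     ((1 + (2 * left_inv a y) powr a) powr (1 + G) / (1 + (1 + a) * (2 * left_inv a y) powr a))"
    using reg_nonneg[OF f rng(1)[OF xy0(2)] rng(2)[OF xy0(2)]] a'
    by (intro mult_mono[OF reg_incr[OF f rng(1)[OF xy0(1)] le rng(2)[OF xy0(2)]] incr_aux])
      (auto intro!: divide_nonneg_nonneg add_nonneg_nonneg)
  then show "x powr (1 + G) * Lop a f x \<le> y powr (1 + G) * Lop a f y"
    using form[of x] form[of y] xy by simp
qed

lemma cone_Rop_aux:
  assumes "0 < x" "x \<le> y" "y \<le> 1"
  shows "(x / ((x + 1) / 2)) \<le> (y / ((y + 1) / 2 :: real))"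
  using assms by (simp add: field_simps)

text \<open>The surplus on the left pays later for the constant subtracted in
  \<open>coupling\<close>; for \<open>cone_Rop\<close> only its sign matters.\<close>

lemma Rop_incr:
  assumes f: "cone f" and xy: "0 < x" "x \<le> y" "y \<le> 1"
  shows "((x + 1) / 2) powr (1 + G) * f ((x + 1) / 2) / 2 *
      ((y / ((y + 1) / 2)) powr (1 + G) - (x / ((x + 1) / 2)) powr (1 + G))
    \<le> y powr (1 + G) * Rop f y - x powr (1 + G) * Rop f x"
proof -
  have form: "z powr (1 + G) * Rop f z = (((z + 1) / 2) powr (1 + G) * f ((z + 1) / 2) / 2) * (z / ((z + 1) / 2)) powr (1 + G)"
    if "0 < z" for z
  proof -
    have "z powr (1 + G) = ((z + 1) / 2) powr (1 + G) * (z / ((z + 1) / 2)) powr (1 + G)"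
      using that by (subst powr_mult[symmetric]) simp
    then show ?thesis by (simp add: Rop_def)
  qed
  have "((x + 1) / 2) powr (1 + G) * f ((x + 1) / 2) / 2 * (y / ((y + 1) / 2)) powr (1 + G)
    \<le> ((y + 1) / 2) powr (1 + G) * f ((y + 1) / 2) / 2 * (y / ((y + 1) / 2)) powr (1 + G)"
    using reg_incr[OF f, of "(x + 1) / 2" "(y + 1) / 2"] xy by (intro mult_right_mono divide_right_mono) auto
  then show ?thesis
    unfolding form[OF xy(1)] form[OF less_le_trans[OF xy(1,2)]] right_diff_distrib by linarith
qed

lemma cone_Rop:
  assumes f: "cone f"
  shows "cone (Rop f)"
  unfolding cone_def
proof (intro conjI allI impI)
  note [measurable] = reg_measurable[OF f]
  show "Rop f \<in> borel_measurable borel"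
    by measurable
  show "0 \<le> Rop f x" if "0 < x \<and> x \<le> 1" for x
    using reg_nonneg[OF f, of "(x + 1) / 2"] that by (auto simp: Rop_def)
  fix x y :: real assume xy: "0 < x \<and> x \<le> y \<and> y \<le> 1"
  show "Rop f y \<le> Rop f x"
    using reg_anti[OF f, of "(x + 1) / 2" "(y + 1) / 2"] xy by (auto simp: Rop_def)
  have "(x / ((x + 1) / 2)) powr (1 + G) \<le> (y / ((y + 1) / 2)) powr (1 + G)"
    using cone_Rop_aux[of x y] xy G0 by (intro powr_mono2) auto
  then have "0 \<le> ((x + 1) / 2) powr (1 + G) * f ((x + 1) / 2) / 2 *
      ((y / ((y + 1) / 2)) powr (1 + G) - (x / ((x + 1) / 2)) powr (1 + G))"
    using reg_nonneg[OF f, of "(x + 1) / 2"] xy by (intro mult_nonneg_nonneg) auto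
  also have "\<dots> \<le> y powr (1 + G) * Rop f y - x powr (1 + G) * Rop f x"
    using Rop_incr[OF f] xy by auto
  finally show "x powr (1 + G) * Rop f x \<le> y powr (1 + G) * Rop f y" by simp
qed

lemma cone_Pop: "param a \<Longrightarrow> cone f \<Longrightarrow> cone (Pop a f)"
  using cone_add[OF cone_Lop cone_Rop] by (simp add: Pop_def[abs_def])

lemma powr_integral:
  assumes "0 \<le> t" "t \<le> 1"
  shows "integrable U (\<lambda>x. indicator {0..t} x * x powr (- G))"
    and "(\<integral>x. indicator {0..t} x * x powr (- G) \<partial>U) = t powr (1 - G) / (1 - G)"
proof -
  have "((\<lambda>x. x powr (- G)) has_integral (t powr (- G + 1) / (- G + 1))) {0..t}"
    using G1 assms by (intro has_integral_powr_from_0) auto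
  then have nn: "integral\<^sup>N lborel (\<lambda>x. ennreal (indicator {0..t} x * x powr (- G))) = ennreal (t powr (1 - G) / (1 - G))"
    using nn_integral_has_integral_lebesgue[of "{0..t}" "\<lambda>x. x powr (- G)" "t powr (1 - G) / (1 - G)"] by simp
  have eq: "indicator {0..1} x * (indicator {0..t} x * x powr (- G)) = indicator {0..t} x * x powr (- G)" for x
    using assms by (auto split: split_indicator)
  show int: "integrable U (\<lambda>x. indicator {0..t} x * x powr (- G))"
    unfolding integrable_U eq using nn
    by (intro integrableI_nonneg) auto
  show "(\<integral>x. indicator {0..t} x * x powr (- G) \<partial>U) = t powr (1 - G) / (1 - G)"
    unfolding integral_U eq using nn G1
    by (subst integral_eq_nn_integral) (auto intro!: divide_nonneg_pos)
qed

lemma cone_integrable: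
  assumes f: "cone f" and K: "pole_bound K f"
  shows "integrable U f"
proof (rule Bochner_Integration.integrable_bound)
  show "integrable U (\<lambda>x. K * (indicator {0..1} x * x powr (- G)))"
    using powr_integral(1)[of 1] by (intro integrable_mult_right) auto
  show "f \<in> borel_measurable U" using reg_measurable[OF f] by measurable
  show "AE x in U. norm (f x) \<le> norm (K * (indicator {0..1} x * x powr (- G)))"
  proof (rule AE_U_I)
    fix x :: real assume "0 < x" "x < 1"
    then show "norm (f x) \<le> norm (K * (indicator {0..1} x * x powr (- G)))"
      using reg_nonneg[OF f, of x] pole_boundD[OF K, of x] by auto
  qed
qed

lemma cone_integral_nonneg:
  assumes f: "cone f"
  shows "0 \<le> (\<integral>x. f x \<partial>U)"
  by (intro integral_nonneg_AE AE_U_I) (use reg_nonneg[OF f] in auto)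

lemma cone_integral_near_0:
  assumes f: "cone f" and K: "pole_bound K f" and t: "0 \<le> t" "t \<le> 1"
  shows "(\<integral>x. indicator {..t} x * f x \<partial>U) \<le> K * (t powr (1 - G) / (1 - G))"
proof -
  have "(\<integral>x. indicator {..t} x * f x \<partial>U) \<le> (\<integral>x. K * (indicator {0..t} x * x powr (- G)) \<partial>U)"
  proof (rule integral_mono_AE)
    show "integrable U (\<lambda>x. indicator {..t} x * f x)"
      using integrable_mult_ind[OF cone_integrable[OF f K], of "{..t}"] by (simp add: mult.commute)
    show "integrable U (\<lambda>x. K * (indicator {0..t} x * x powr (- G)))"
      using powr_integral(1)[OF t] by (intro integrable_mult_right) auto
    show "AE x in U. indicator {..t} x * f x \<le> K * (indicator {0..t} x * x powr (- G))"
      by (rule AE_U_I) (use pole_boundD[OF K] t in \<open>auto split: split_indicator\<close>)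
  qed
  then show ?thesis
    using powr_integral(2)[OF t] by simp
qed

text \<open>A decreasing function is at least \<open>f x\<close> on all of \<open>(0, x]\<close>, an
  interval of length \<open>x\<close>.\<close>

lemma cone_mult_le:
  assumes anti: "\<And>x y. 0 < x \<Longrightarrow> x \<le> y \<Longrightarrow> y \<le> 1 \<Longrightarrow> f y \<le> f x"
    and nn: "\<And>x. 0 < x \<Longrightarrow> x \<le> 1 \<Longrightarrow> 0 \<le> f x"
    and int: "integrable U f" and x: "0 < x" "x \<le> 1"
  shows "x * f x \<le> (\<integral>x. f x \<partial>U)"
proof -
  have i: "(\<integral>y. indicator {0..x} y * f x \<partial>U) = x * f x"
  proof -
    have eq: "indicator {0..1} y * (indicator {0..x} y * f x) = indicator {0..x} y * f x" for y :: real
      using x by (auto split: split_indicator)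
    show ?thesis
      unfolding integral_U eq using x by simp
  qed
  have "(\<integral>y. indicator {0..x} y * f x \<partial>U) \<le> (\<integral>y. f y \<partial>U)"
  proof (rule integral_mono_AE)
    show "integrable U (\<lambda>y. indicator {0..x} y * f x)"
      by (intro integrable_mult_left U.integrable_const_bound[where B = 1]) (auto split: split_indicator)
    show "AE y in U. indicator {0..x} y * f x \<le> f y"
      by (rule AE_U_I) (use anti[of _ x] nn x in \<open>auto split: split_indicator\<close>)
  qed (rule int)
  then show ?thesis unfolding i .
qed

text \<open>The right branch sees only points above 1/2; there the bound mass over distance costs a
  factor 2, which the weight 1/2 absorbs.\<close>

lemma Rop_le:
  assumes f: "cone f" and int: "integrable U f" and x: "0 < x" "x \<le> 1"
  shows "Rop f x \<le> (\<integral>x. f x \<partial>U)"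
proof -
  have "f ((x + 1) / 2) / 2 \<le> (x + 1) / 2 * f ((x + 1) / 2)"
    using reg_nonneg[OF f, of "(x + 1) / 2"] x by (simp add: field_simps)
  also have "\<dots> \<le> (\<integral>x. f x \<partial>U)"
    using x by (intro cone_mult_le reg_anti[OF f] reg_nonneg[OF f] int) auto
  finally show ?thesis by (simp add: Rop_def)
qed

text \<open>With \<open>y = left_inv a x\<close> and \<open>x = y * (1 + u)\<close>, the operator
  gains the relative amount \<open>(1 - G) * u / 2\<close> on the bound, and
  \<open>x powr (- G) * u\<close> is at least 1. So the gain is at least a constant, uniformly in
  \<open>x\<close> and \<open>a\<close>; it makes room for the right branch in
  \<open>pole_bound_Lop_add\<close>.\<close>

lemma Lop_pole_bound:
  assumes a: "param a" and K: "pole_bound K f" "0 \<le> K" and x: "0 < x" "x \<le> 1"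
  shows "Lop a f x \<le> K * x powr (- G) - K * (1 - G) / 2"
proof -
  note a' = paramD[OF a]
  let ?y = "left_inv a x"
  define u where "u = (2 * ?y) powr a"
  have y: "0 < ?y" "?y \<le> 1" "2 * ?y \<le> 1" "x \<le> 2 * ?y"
    using left_inv_pos[of a x] left_inv_range[of a x] left_inv_bounds[of a x] a' x by auto
  have u0: "0 \<le> u" by (simp add: u_def)
  have "u \<le> 1 powr a" unfolding u_def using y a' by (intro powr_mono2) auto
  then have u1: "u \<le> 1" by simp
  have xeq: "x = ?y * (1 + u)" using left_inv_eq[OF a x] by (simp add: u_def)
  have "x powr G \<le> (2 * ?y) powr G" using y x G0 by (intro powr_mono2) auto
  also have "\<dots> \<le> u" unfolding u_def using y a' by (intro powr_mono') auto
  finally have xu: "1 \<le> x powr (- G) * u"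
    using x by (simp add: powr_minus field_simps)
  have yG: "?y powr (- G) = x powr (- G) * (1 + u) powr G"
  proof -
    have "x powr (- G) = ?y powr (- G) * (1 + u) powr (- G)" by (subst xeq) (simp add: powr_mult)
    then show ?thesis using u0 by (simp add: powr_minus field_simps)
  qed
  \<comment> \<open>Bernoulli's inequality for an exponent below 1, read off from weighted AM-GM for
    \<open>1 + u\<close> and 1.\<close>
  have bern: "(1 + u) powr G \<le> 1 + G * u"
    using Youngs_inequality_0[of G "1 - G" "1 + u" 1] G0 G1 u0 by (simp add: algebra_simps)
  have frac: "(1 + G * u) / (1 + (1 + a) * u) \<le> 1 - (1 - G) * u / 2"
  proof -
    have "(1 - (1 - G) * u / 2) * (1 + (1 + a) * u) - (1 + G * u)
      = u * ((1 - G) * (1 - u) / 2 + a * (1 - (1 - G) * u / 2))"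
      by (simp add: field_simps)
    moreover have "(1 - G) * u \<le> 1 * 1" using G0 G1 u0 u1 by (intro mult_mono) auto
    ultimately have "0 \<le> (1 - (1 - G) * u / 2) * (1 + (1 + a) * u) - (1 + G * u)"
      using a' u0 u1 G0 G1 by (auto intro!: mult_nonneg_nonneg add_nonneg_nonneg)
    moreover have "0 < 1 + (1 + a) * u" using a' u0 by (auto intro: add_pos_nonneg)
    ultimately show ?thesis by (simp add: field_simps)
  qed
  have "Lop a f x = f ?y / (1 + (1 + a) * u)" by (simp add: Lop_def left_weight_def u_def)
  also have "\<dots> \<le> K * ?y powr (- G) / (1 + (1 + a) * u)"
    using pole_boundD[OF K(1) y(1,2)] a' u0 by (intro divide_right_mono) auto
  also have "\<dots> = K * x powr (- G) * ((1 + u) powr G / (1 + (1 + a) * u))" by (simp add: yG)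
  also have "\<dots> \<le> K * x powr (- G) * ((1 + G * u) / (1 + (1 + a) * u))"
    using bern a' u0 K by (intro mult_left_mono divide_right_mono) auto
  also have "\<dots> \<le> K * x powr (- G) * (1 - (1 - G) * u / 2)"
    using frac K by (intro mult_left_mono) auto
  also have "\<dots> = K * x powr (- G) - K * (1 - G) / 2 * (x powr (- G) * u)"
    by (simp add: algebra_simps)
  also have "\<dots> \<le> K * x powr (- G) - K * (1 - G) / 2 * 1"
    using xu K G1 by (intro diff_left_mono mult_left_mono) auto
  finally show ?thesis by simp
qed

text \<open>Chosen so that for \<open>K = a0 * M\<close> the constant gained in
  \<open>Lop_pole_bound\<close> is exactly \<open>M\<close>, the bound of the contribution of the
  right branch.\<close>

definition "a0 = 2 / (1 - G)"

lemma a0_gt: "2 < a0" "a0 * (1 - G) / 2 = 1"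
  using G0 G1 by (auto simp: a0_def field_simps)

lemma pole_bound_Lop:
  assumes "param a" "pole_bound K f" "0 \<le> K"
  shows "pole_bound K (Lop a f)"
  unfolding pole_bound_def
proof (intro allI impI)
  fix x :: real assume "0 < x \<and> x \<le> 1"
  then have "Lop a f x \<le> K * x powr (- G) - K * (1 - G) / 2"
    by (intro Lop_pole_bound assms) auto
  moreover have "0 \<le> K * (1 - G) / 2" using assms G1 by auto
  ultimately show "Lop a f x \<le> K * x powr (- G)" by linarith
qed

lemma pole_bound_Lop_add:
  assumes "param a" "pole_bound (a0 * M) f" "0 \<le> M" "\<And>x. 0 < x \<Longrightarrow> x \<le> 1 \<Longrightarrow> g x \<le> M"
  shows "pole_bound (a0 * M) (\<lambda>x. Lop a f x + g x)"
  unfolding pole_bound_def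
proof (intro allI impI)
  fix x :: real assume x: "0 < x \<and> x \<le> 1"
  then have "Lop a f x \<le> a0 * M * x powr (- G) - a0 * M * (1 - G) / 2"
    using assms a0_gt by (intro Lop_pole_bound assms) auto
  also have "a0 * M * (1 - G) / 2 = M" using a0_gt(2) by (metis mult.assoc mult.commute mult.right_neutral times_divide_eq_left)
  finally show "Lop a f x + g x \<le> a0 * M * x powr (- G)"
    using assms(4)[of x] x by auto
qed

lemma pole_bound_Pop:
  assumes "param a" "cone f" "pole_bound K f" "a0 * (\<integral>x. f x \<partial>U) \<le> K"
  shows "pole_bound K (Pop a f)"
proof -
  have K: "K = a0 * (K / a0)" using a0_gt by simp
  have "pole_bound (a0 * (K / a0)) (\<lambda>x. Lop a f x + Rop f x)"
  proof (rule pole_bound_Lop_add)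
    have *: "(\<integral>x. f x \<partial>U) \<le> K / a0" using assms(4) a0_gt by (simp add: field_simps)
    then show "0 \<le> K / a0" using cone_integral_nonneg[OF assms(2)] by linarith
    show "Rop f x \<le> K / a0" if "0 < x" "x \<le> 1" for x
      using Rop_le[OF assms(2) cone_integrable[OF assms(2,3)] that] * by linarith
  qed (use assms K in auto)
  then show ?thesis using K by (simp add: Pop_def[abs_def])
qed

end

section \<open>Iterated transfer operators and their action on integrals and L1 norms\<close>

lemma measure_U_unit [simp]: "measure U {0..1} = 1"
  using U.prob_space by simp

abbreviation nrm :: "(real \<Rightarrow> real) \<Rightarrow> real" where
  "nrm f \<equiv> \<integral>x. \<bar>f x\<bar> \<partial>U"

text \<open>
  \<open>Pn a n k\<close> is the composition of the operators with parameters \<open>a k, \<dots>, a (k + n - 1)\<close>, applied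
  in this order.
\<close>

primrec Pn :: "(int \<Rightarrow> real) \<Rightarrow> nat \<Rightarrow> int \<Rightarrow> (real \<Rightarrow> real) \<Rightarrow> real \<Rightarrow> real" where
  "Pn a 0 k f = f"
| "Pn a (Suc n) k f = Pn a n (k + 1) (Pop (a k) f)"

lemma Pn_add: "Pn a (n + m) k f = Pn a m (k + int n) (Pn a n k f)"
  by (induction n arbitrary: k f) (auto simp: add.assoc)

lemma Pn_back: "Pn a (Suc n) k f = Pop (a (k + int n)) (Pn a n k f)"
  using Pn_add[of a n 1 k f] by simp

lemma Pop_lin: "Pop a (\<lambda>x. c * f x + d * g x) = (\<lambda>x. c * Pop a f x + d * Pop a g x)"
  by (auto simp: Pop_def Lop_def Rop_def fun_eq_iff algebra_simps)

lemma Pn_lin: "Pn a n k (\<lambda>x. c * f x + d * g x) = (\<lambda>x. c * Pn a n k f x + d * Pn a n k g x)"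
  by (induction n arbitrary: k f g) (auto simp: Pop_lin)

lemma Pn_plus: "Pn a n k (\<lambda>x. f x + g x) = (\<lambda>x. Pn a n k f x + Pn a n k g x)"
  using Pn_lin[of a n k 1 f 1 g] by simp

lemma Pn_minus: "Pn a n k (\<lambda>x. f x - g x) = (\<lambda>x. Pn a n k f x - Pn a n k g x)"
  using Pn_lin[of a n k 1 f "-1" g] by simp

lemma Pn_scale: "Pn a n k (\<lambda>x. c * f x) = (\<lambda>x. c * Pn a n k f x)"
  using Pn_lin[of a n k c f 0 f] by simp

lemma Pop_mono:
  assumes "0 < a" "\<And>x. 0 < x \<Longrightarrow> x \<le> 1 \<Longrightarrow> f x \<le> g x" "0 < x" "x \<le> 1"
  shows "Pop a f x \<le> Pop a g x"
  using assms left_inv_pos[of a x] left_inv_range[of a x] left_weight_pos[of a x]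
  by (auto simp: Pop_def Lop_def Rop_def intro!: add_mono mult_right_mono divide_right_mono)

lemma Pn_mono:
  assumes "\<And>j. 0 < a j" "\<And>x. 0 < x \<Longrightarrow> x \<le> 1 \<Longrightarrow> f x \<le> g x" "0 < x" "x \<le> 1"
  shows "Pn a n k f x \<le> Pn a n k g x"
  using assms(2)
proof (induction n arbitrary: k f g)
  case (Suc n)
  show ?case
    unfolding Pn.simps using Pop_mono[OF assms(1) Suc.prems] by (intro Suc.IH)
qed (use assms in auto)

lemma Pn_cong:
  assumes "\<And>j. 0 < a j" "\<And>x. 0 < x \<Longrightarrow> x \<le> 1 \<Longrightarrow> f x = g x" "0 < x" "x \<le> 1"
  shows "Pn a n k f x = Pn a n k g x"
  by (intro antisym Pn_mono) (use assms in auto)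

lemma Pn_0: "Pn a n k (\<lambda>_. 0) = (\<lambda>_. 0)"
  using Pn_scale[of a n k 0 "\<lambda>_. 0"] by simp

lemma Pn_measurable [measurable (raw)]:
  assumes "\<And>j. 0 < a j" "f \<in> borel_measurable borel"
  shows "Pn a n k f \<in> borel_measurable borel"
  using assms(2) by (induction n arbitrary: k f) (auto simp: assms(1) Pop_measurable)

lemma
  assumes "\<And>j. 0 < a j" "f \<in> borel_measurable borel" "integrable U f"
  shows Pn_integrable: "integrable U (Pn a n k f)"
    and Pn_integral: "(\<integral>x. Pn a n k f x \<partial>U) = (\<integral>x. f x \<partial>U)"
  using assms(2,3)
  by (induction n arbitrary: k f) (auto simp: Pop_measurable[OF assms(1)] integrable_Pop[OF assms(1)] integral_Pop[OF assms(1)])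

lemma nrm_triangle:
  assumes "integrable U f" "integrable U g"
  shows "nrm (\<lambda>x. f x + g x) \<le> nrm f + nrm g"
proof -
  have "nrm (\<lambda>x. f x + g x) \<le> (\<integral>x. \<bar>f x\<bar> + \<bar>g x\<bar> \<partial>U)"
    using assms by (intro integral_mono) auto
  then show ?thesis using assms by simp
qed

lemma nrm_minus_triangle:
  assumes "integrable U f" "integrable U g"
  shows "nrm (\<lambda>x. f x - g x) \<le> nrm f + nrm g"
  using nrm_triangle[of f "\<lambda>x. - g x"] assms by simp

lemma nrm_scale: "nrm (\<lambda>x. c * f x) = \<bar>c\<bar> * nrm f"
  by (simp add: abs_mult)

lemma nrm_Pn:
  assumes a: "\<And>j. 0 < a j" and f: "f \<in> borel_measurable borel" "integrable U f"
  shows "nrm (Pn a n k f) \<le> nrm f"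
proof -
  have "nrm (Pn a n k f) \<le> (\<integral>x. Pn a n k (\<lambda>x. \<bar>f x\<bar>) x \<partial>U)"
  proof (rule integral_mono_AE)
    show "integrable U (\<lambda>x. \<bar>Pn a n k f x\<bar>)" using Pn_integrable[OF a f] by auto
    show "integrable U (Pn a n k (\<lambda>x. \<bar>f x\<bar>))" using f by (intro Pn_integrable[OF a]) auto
    show "AE x in U. \<bar>Pn a n k f x\<bar> \<le> Pn a n k (\<lambda>x. \<bar>f x\<bar>) x"
    proof (rule AE_U_I)
      fix x :: real assume "0 < x" "x < 1"
      then have "Pn a n k f x \<le> Pn a n k (\<lambda>x. \<bar>f x\<bar>) x" "Pn a n k (\<lambda>x. - \<bar>f x\<bar>) x \<le> Pn a n k f x"
        by (auto intro!: Pn_mono a)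
      then show "\<bar>Pn a n k f x\<bar> \<le> Pn a n k (\<lambda>x. \<bar>f x\<bar>) x"
        using Pn_scale[of a n k "-1" "\<lambda>x. \<bar>f x\<bar>"] by simp
    qed
  qed
  also have "\<dots> = nrm f"
    using f by (intro Pn_integral[OF a]) auto
  finally show ?thesis .
qed

section \<open>Iterates on the cone, and the mass that stays near the neutral fixed point\<close>

context lsv
begin

definition admissible :: "(int \<Rightarrow> real) \<Rightarrow> bool" where
  "admissible a \<longleftrightarrow> (\<forall>j. param (a j))"

lemma admissibleD: "admissible a \<Longrightarrow> param (a j)" "admissible a \<Longrightarrow> 0 < a j"
  by (auto simp: admissible_def param_def)

lemma cone_Pn: "admissible a \<Longrightarrow> cone f \<Longrightarrow> cone (Pn a n k f)"
  by (induction n arbitrary: k f) (auto simp: cone_Pop admissibleD)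

lemma pole_bound_Pn:
  assumes "admissible a" "cone f" "pole_bound K f" "a0 * (\<integral>x. f x \<partial>U) \<le> K"
  shows "pole_bound K (Pn a n k f)"
  using assms(2-)
proof (induction n arbitrary: k f)
  case (Suc n)
  have "(\<integral>x. Pop (a k) f x \<partial>U) = (\<integral>x. f x \<partial>U)"
    using Suc.prems assms(1) by (intro integral_Pop admissibleD reg_measurable cone_integrable)
  then show ?case
    using Suc.prems assms(1) by (auto intro!: Suc.IH cone_Pop pole_bound_Pop admissibleD)
qed auto

text \<open>
  An explicit supersolution, of order \<open>n\<close> to the power \<open>-1/G\<close>, for the backward orbit of 1 under the
  left inverse branches.
\<close>

definition cusp_bound :: "nat \<Rightarrow> real" where
  "cusp_bound n = (1 + G * n / 4) powr (- 1 / G)"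

lemma cusp_bound_0 [simp]: "cusp_bound 0 = 1"
  by (simp add: cusp_bound_def)

lemma cusp_bound_base: "0 < 1 + G * real n / 4"
  using G0 by (intro add_pos_nonneg) auto

lemma cusp_bound_pos: "0 < cusp_bound n"
  using cusp_bound_base[of n] by (simp add: cusp_bound_def)

lemma cusp_bound_le_1: "cusp_bound n \<le> 1"
proof -
  have "cusp_bound n \<le> (1 + G * n / 4) powr 0"
    unfolding cusp_bound_def using G0 by (intro powr_mono) auto
  also have "\<dots> = 1"
    using cusp_bound_base[of n] by simp
  finally show ?thesis .
qed

text \<open>In the variable \<open>t powr (- G)\<close> one backward step adds at least
  \<open>G / 4\<close>, which is exactly how \<open>cusp_bound\<close> advances. All parameters up
  to \<open>G\<close> are covered at once by bounding \<open>(2 * y) powr a\<close> from below by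
  \<open>y powr G\<close>.\<close>

lemma cusp_bound_step:
  assumes a: "param a" and t: "0 \<le> t" "t \<le> cusp_bound n"
  shows "left_inv a t \<le> cusp_bound (Suc n)"
proof (cases "t = 0")
  case True then show ?thesis using cusp_bound_pos[of "Suc n"] by simp
next
  case False
  note a' = paramD[OF a]
  let ?y = "left_inv a t" and ?A = "1 + G * n / 4"
  have t1: "0 < t" "t \<le> 1" using False t cusp_bound_le_1[of n] by auto
  have y: "0 < ?y" "2 * ?y \<le> 1" using left_inv_pos[of a t] left_inv_range[of a t] a' t1 by auto
  define v where "v = ?y powr G"
  have v0: "0 < v" using y by (simp add: v_def)
  have "v \<le> 1 powr G" unfolding v_def using y G0 by (intro powr_mono2) auto
  then have v1: "v \<le> 1" by simp
  have "?y powr G \<le> (2 * ?y) powr G" using y G0 by (intro powr_mono2) auto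
  also have "\<dots> \<le> (2 * ?y) powr a" using y a' by (intro powr_mono') auto
  finally have "v \<le> (2 * ?y) powr a" by (simp add: v_def)
  then have "?y * (1 + v) \<le> t"
    using left_inv_eq[OF a t1] y by (metis add_left_mono less_imp_le mult_left_mono)
  then have "t powr (- G) \<le> (?y * (1 + v)) powr (- G)"
    using y v0 G0 by (intro powr_mono2') auto
  also have "\<dots> = (1 + v) powr (- G) / v"
    by (simp only: powr_mult) (simp add: v_def powr_minus divide_inverse mult.commute)
  also have "\<dots> \<le> (1 - G * v / 4) / v"
  proof (intro divide_right_mono)
    have "v / 2 \<le> ln (1 + v)"
    proof -
      have "v / 2 \<le> v / (1 + v)" by (rule divide_left_mono) (use v0 v1 in auto)
      moreover have "v / (1 + v) \<le> ln (1 + v)"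
        using ln_add_one_self_le_self2[of "- v / (1 + v)"] v0
        by (simp add: ln_div field_simps)
      ultimately show ?thesis by linarith
    qed
    then have "G * (v / 2) \<le> G * ln (1 + v)" using G0 by (intro mult_left_mono) auto
    then have "(1 + v) powr (- G) \<le> exp (- (G * v / 2))" using v0 by (simp add: powr_def)
    also have "\<dots> \<le> 1 / (1 + G * v / 2)"
      using exp_ge_add_one_self[of "G * v / 2"] G0 v0
      by (simp add: exp_minus inverse_eq_divide frac_le add_pos_nonneg)
    also have "\<dots> \<le> 1 - G * v / 4"
    proof -
      have "G * v \<le> 1 * 1" using G0 G1 v0 v1 by (intro mult_mono) auto
      then have "0 \<le> (G * v) * (1 - G * v / 2) / 4" using G0 v0 by (intro divide_nonneg_pos mult_nonneg_nonneg) auto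
      moreover have "(1 - G * v / 4) * (1 + G * v / 2) - 1 = (G * v) * (1 - G * v / 2) / 4" by (simp add: field_simps)
      ultimately have "1 \<le> (1 - G * v / 4) * (1 + G * v / 2)" by linarith
      moreover have "0 < 1 + G * v / 2" using G0 v0 by (intro add_pos_nonneg) auto
      ultimately show ?thesis by (simp add: divide_le_eq)
    qed
    finally show "(1 + v) powr (- G) \<le> 1 - G * v / 4" .
  qed (use v0 in auto)
  also have "\<dots> = ?y powr (- G) - G / 4"
    using v0 y by (simp add: v_def powr_minus field_simps)
  finally have 1: "t powr (- G) + G / 4 \<le> ?y powr (- G)" by simp
  have A: "0 < ?A" "0 < 1 + G * Suc n / 4" using G0 by (auto intro!: add_pos_nonneg)
  have "?A = cusp_bound n powr (- G)" using A G0 by (simp add: cusp_bound_def powr_powr)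
  also have "\<dots> \<le> t powr (- G)" using t1 t G0 by (intro powr_mono2') auto
  finally have "1 + G * Suc n / 4 \<le> ?y powr (- G)" using 1 by (simp add: field_simps)
  then have "(?y powr (- G)) powr (- 1 / G) \<le> (1 + G * Suc n / 4) powr (- 1 / G)"
    using A G0 by (intro powr_mono2') auto
  then show ?thesis using y G0 by (simp add: powr_powr cusp_bound_def)
qed

lemma cusp_bound_tendsto: "(\<lambda>n. cusp_bound n powr (1 - G)) \<longlonglongrightarrow> 0"
  unfolding cusp_bound_def using G0 G1 by real_asymp

lemma integral_Lop_ind:
  assumes a: "0 < a" and [measurable]: "f \<in> borel_measurable borel" and t: "0 \<le> t" "t \<le> 1"
  shows "(\<integral>x. indicator {..t} x * Lop a f x \<partial>U) = (\<integral>x. indicator {..left_inv a t} x * f x \<partial>U)"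
proof -
  note [measurable] = left_inv_measurable[OF a] left_weight_measurable[OF a] Lop_measurable[OF a]
  let ?F = "\<lambda>y. indicator {..left_inv a t} y * f y"
  have "(\<integral>x. indicator {..t} x * Lop a f x \<partial>U) = (\<integral>x. ?F (left_inv a x) * left_weight a x \<partial>U)"
  proof (rule integral_U_cong)
    fix x :: real assume x: "0 < x" "x < 1"
    have "left_inv a x \<le> left_inv a t \<longleftrightarrow> x \<le> t"
      using left_inv_strict_mono[OF a, of t x] monoD[OF left_inv_mono[OF a], of x t] t x by (auto simp: not_le[symmetric])
    then show "indicator {..t} x * Lop a f x = ?F (left_inv a x) * left_weight a x"
      by (auto simp: Lop_def split: split_indicator)
  qed measurable
  also have "\<dots> = (\<integral>x. ?F x * indicator {..1/2} x \<partial>U)"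
    by (rule integral_lbr[OF a]) measurable
  also have "\<dots> = (\<integral>x. ?F x \<partial>U)"
    using left_inv_range[OF a, of t] by (intro Bochner_Integration.integral_cong) (auto split: split_indicator)
  finally show ?thesis .
qed

lemma cone_ind_integrable:
  "cone f \<Longrightarrow> pole_bound K f \<Longrightarrow> A \<in> sets borel \<Longrightarrow> integrable U (\<lambda>x. indicator A x * f x)"
  using integrable_mult_ind[of f A] cone_integrable[of f K] by (simp add: mult.commute)

lemma cone_ind_mono:
  assumes "cone f" "pole_bound K f" "s \<le> t"
  shows "(\<integral>x. indicator {..s} x * f x \<partial>U) \<le> (\<integral>x. indicator {..t} x * f x \<partial>U)"
  using assms reg_nonneg[OF assms(1)]
  by (intro integral_mono_AE cone_ind_integrable AE_U_I) (auto split: split_indicator)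

text \<open>The part of \<open>Pn\<close> that uses the left branch at every step, coming from
  points that never left the neighbourhood of the neutral fixed point.\<close>

primrec Ln :: "(int \<Rightarrow> real) \<Rightarrow> nat \<Rightarrow> int \<Rightarrow> (real \<Rightarrow> real) \<Rightarrow> real \<Rightarrow> real" where
  "Ln a 0 k f = f"
| "Ln a (Suc n) k f = Lop (a (k + int n)) (Ln a n k f)"

lemma cone_Ln: "admissible a \<Longrightarrow> cone f \<Longrightarrow> cone (Ln a n k f)"
  by (induction n) (auto simp: cone_Lop admissibleD)

lemma pole_bound_Ln: "admissible a \<Longrightarrow> pole_bound K f \<Longrightarrow> 0 \<le> K \<Longrightarrow> pole_bound K (Ln a n k f)"
  by (induction n) (auto simp: pole_bound_Lop admissibleD)

lemma Ln_integral_le: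
  assumes a: "admissible a" and f: "cone f" "pole_bound K f" "0 \<le> K"
  shows "(\<integral>x. indicator {..cusp_bound m} x * Ln a n k f x \<partial>U) \<le> (\<integral>x. indicator {..cusp_bound (m + n)} x * f x \<partial>U)"
proof (induction n arbitrary: m)
  case (Suc n)
  let ?b = "a (k + int n)"
  have "(\<integral>x. indicator {..cusp_bound m} x * Ln a (Suc n) k f x \<partial>U) = (\<integral>x. indicator {..left_inv ?b (cusp_bound m)} x * Ln a n k f x \<partial>U)"
    unfolding Ln.simps using cusp_bound_pos[of m] cusp_bound_le_1[of m] a f
    by (intro integral_Lop_ind admissibleD reg_measurable[OF cone_Ln]) auto
  also have "\<dots> \<le> (\<integral>x. indicator {..cusp_bound (Suc m)} x * Ln a n k f x \<partial>U)"
    using cusp_bound_pos[of m] a f by (intro cone_ind_mono[of _ K] cone_Ln pole_bound_Ln cusp_bound_step admissibleD) auto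
  also have "\<dots> \<le> (\<integral>x. indicator {..cusp_bound (Suc m + n)} x * f x \<partial>U)" by (rule Suc.IH)
  finally show ?case by simp
qed auto

lemma integral_ind_X0: "(\<integral>x. indicator {..cusp_bound 0} x * f x \<partial>U) = (\<integral>x. f x \<partial>U)"
  for f :: "real \<Rightarrow> real"
  by (intro Bochner_Integration.integral_cong) auto

text \<open>Mass that follows the left branch for \<open>n\<close> steps started below the
  \<open>n\<close>-th backward iterate of 1, and \<open>cusp_bound n\<close> dominates that
  iterate.\<close>

lemma Ln_mass:
  assumes "admissible a" "cone f" "pole_bound K f" "0 \<le> K"
  shows "(\<integral>x. Ln a n k f x \<partial>U) \<le> (\<integral>x. indicator {..cusp_bound n} x * f x \<partial>U)"
  using Ln_integral_le[OF assms, of 0 n k] unfolding integral_ind_X0 by simp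

text \<open>The difference starts at zero and receives at each step only the bounded function
  \<open>Rop (Pn a n k f)\<close>. Hence its pole constant stays below \<open>a0\<close> times the
  mass, whatever the constant \<open>K\<close> of \<open>f\<close> was. Forgetting \<open>K\<close>
  is what allows the coupling to be repeated with uniform constants.\<close>

lemma Pn_minus_Ln_cone:
  assumes a: "admissible a" and f: "cone f" "pole_bound K f"
  shows "cone (\<lambda>x. Pn a n k f x - Ln a n k f x) \<and> pole_bound (a0 * (\<integral>x. f x \<partial>U)) (\<lambda>x. Pn a n k f x - Ln a n k f x)"
proof (induction n)
  case 0
  then show ?case
    using cone_const[of 0] cone_integral_nonneg[OF f(1)] a0_gt by (auto simp: pole_bound_def)
next
  case (Suc n)
  let ?b = "a (k + int n)" and ?M = "\<integral>x. f x \<partial>U"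
  have K: "pole_bound (max K (a0 * ?M)) f" using f by (auto intro: pole_bound_mono)
  have r: "cone (Pn a n k f)" "pole_bound (max K (a0 * ?M)) (Pn a n k f)"
    using cone_Pn[OF a f(1)] pole_bound_Pn[OF a f(1) K] by auto
  have i: "(\<integral>x. Pn a n k f x \<partial>U) = ?M"
    by (intro Pn_integral admissibleD[OF a] reg_measurable[OF f(1)] cone_integrable[OF f])
  have eq: "(\<lambda>x. Pn a (Suc n) k f x - Ln a (Suc n) k f x)
      = (\<lambda>x. Lop ?b (\<lambda>x. Pn a n k f x - Ln a n k f x) x + Rop (Pn a n k f) x)"
    unfolding Pn_back by (auto simp: Pop_def Lop_def fun_eq_iff algebra_simps)
  show ?case
    unfolding eq
    using Suc r cone_integral_nonneg[OF f(1)] Rop_le[OF r(1) cone_integrable[OF r]] i a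
    by (auto intro!: cone_add cone_Lop cone_Rop pole_bound_Lop_add admissibleD)
qed

subsection \<open>Coupling and loss of memory\<close>

text \<open>The length for which \<open>cone_integral_near_0\<close> leaves at most half of the mass
  to the left, for a pole constant of \<kappa> times the mass.\<close>

definition couple_scale :: "real \<Rightarrow> real" where
  "couple_scale \<kappa> = ((1 - G) / (2 * \<kappa>)) powr (1 / (1 - G))"

text \<open>The denominator 32 is 2 * 16: the 2 belongs to half the mass in
  \<open>cone_lower\<close>, the 16 is the reserve spent in \<open>coupling\<close>.\<close>

definition couple_const :: "real \<Rightarrow> real" where
  "couple_const \<kappa> = couple_scale \<kappa> powr (1 + G) / 32"

lemma couple_scale: "1 \<le> \<kappa> \<Longrightarrow> 0 < couple_scale \<kappa>" "1 \<le> \<kappa> \<Longrightarrow> couple_scale \<kappa> \<le> 1"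
  using G0 G1 by (auto simp: couple_scale_def intro!: powr_le1)

lemma couple_const: "1 \<le> \<kappa> \<Longrightarrow> 0 < couple_const \<kappa>" "1 \<le> \<kappa> \<Longrightarrow> couple_const \<kappa> \<le> 1/32"
  using couple_scale[of \<kappa>] G0 by (auto simp: couple_const_def intro!: powr_le1)

text \<open>At least half of the mass lies to the right of \<open>couple_scale \<kappa>\<close>,
  where \<open>f\<close> is at most its value at that point; so this value is at least
  \<open>m / 2\<close>. The second monotonicity carries the bound to the point 1, the first one from
  there to all \<open>x\<close>.\<close>

lemma cone_lower:
  assumes f: "cone f" "pole_bound (\<kappa> * m) f" and m: "m = (\<integral>x. f x \<partial>U)" "0 < m" and \<kappa>: "1 \<le> \<kappa>"
    and x: "0 < x" "x \<le> 1"
  shows "16 * couple_const \<kappa> * m \<le> f x"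
proof -
  let ?e = "couple_scale \<kappa>"
  note e = couple_scale[OF \<kappa>]
  have "?e powr (1 - G) = (1 - G) / (2 * \<kappa>)"
    using \<kappa> G1 by (simp add: couple_scale_def powr_powr)
  then have "\<kappa> * m * (?e powr (1 - G) / (1 - G)) = m / 2" using \<kappa> G1 by simp
  then have "(\<integral>x. indicator {..?e} x * f x \<partial>U) \<le> m / 2"
    using cone_integral_near_0[OF f less_imp_le[OF e(1)] e(2)] by linarith
  moreover have "m \<le> (\<integral>x. indicator {..?e} x * f x + f ?e \<partial>U)"
    unfolding m
  proof (rule integral_mono_AE)
    show "AE x in U. f x \<le> indicator {..?e} x * f x + f ?e"
      by (rule AE_U_I) (use reg_anti[OF f(1), of ?e] reg_nonneg[OF f(1), of ?e] e in \<open>auto split: split_indicator\<close>)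
  next
    show "integrable U f" using f by (rule cone_integrable)
    show "integrable U (\<lambda>x. indicator {..?e} x * f x + f ?e)"
      using f by (intro Bochner_Integration.integrable_add cone_ind_integrable) auto
  qed
  moreover have "(\<integral>x. indicator {..?e} x * f x + f ?e \<partial>U) = (\<integral>x. indicator {..?e} x * f x \<partial>U) + f ?e"
    using f by (subst Bochner_Integration.integral_add) (auto intro!: cone_ind_integrable simp: U.prob_space)
  ultimately have "m / 2 \<le> f ?e" by linarith
  then have "?e powr (1 + G) * (m / 2) \<le> ?e powr (1 + G) * f ?e" by (intro mult_left_mono) auto
  also have "\<dots> \<le> f 1" using reg_incr[OF f(1), of ?e 1] e by simp
  also have "\<dots> \<le> f x" using reg_anti[OF f(1), of x 1] x by simp
  finally show ?thesis by (simp add: couple_const_def)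
qed

text \<open>The map \<open>z / ((z + 1) / 2)\<close> dominates \<open>z\<close> and has slope at
  least 1/2 on the unit interval, so its power has at least half the derivative of
  \<open>z powr (1 + G)\<close>.\<close>

lemma right_powr_incr:
  assumes "0 < x" "x \<le> y" "y \<le> (1::real)"
  shows "(y powr (1 + G) - x powr (1 + G)) / 2 \<le> (y / ((y + 1) / 2)) powr (1 + G) - (x / ((x + 1) / 2)) powr (1 + G)"
proof -
  let ?q = "\<lambda>z. (z / ((z + 1) / 2)) powr (1 + G) - z powr (1 + G) / 2"
  have "?q x \<le> ?q y"
  proof (rule DERIV_nonneg_imp_nondecreasing[OF assms(2)])
    fix z assume "x \<le> z" "z \<le> y"
    then have z: "0 < z" "z \<le> 1" using assms by auto
    let ?s = "z / ((z + 1) / 2)"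
    let ?d = "(1 + G) * ?s powr (1 + G - of_nat 1) * (2 / (z + 1)\<^sup>2) - (1 + G) * z powr (1 + G - of_nat 1) * 1 / 2"
    have s: "0 < ?s" "z \<le> ?s" using z by (auto simp: field_simps)
    have ds: "((\<lambda>z. z / ((z + 1) / 2)) has_real_derivative 2 / (z + 1)\<^sup>2) (at z)"
      using z by (auto intro!: derivative_eq_intros simp: field_simps power2_eq_square)
    have d: "(?q has_real_derivative ?d) (at z)"
      using z s by (intro DERIV_diff DERIV_cdivide DERIV_fun_powr ds DERIV_ident) auto
    have "z powr G * (1/2) \<le> ?s powr G * (2 / (z + 1)\<^sup>2)"
    proof (rule mult_mono)
      show "z powr G \<le> ?s powr G" using z s G0 by (intro powr_mono2) auto
      have "(z + 1)\<^sup>2 \<le> 2\<^sup>2" using z by (intro power_mono) auto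
      then show "1/2 \<le> 2 / (z + 1)\<^sup>2" using z by (simp add: field_simps)
    qed auto
    then have "(1 + G) * (z powr G * (1/2)) \<le> (1 + G) * (?s powr G * (2 / (z + 1)\<^sup>2))"
      using G0 by (intro mult_left_mono) auto
    moreover have "1 + G - of_nat 1 = G" by simp
    ultimately have "0 \<le> ?d" unfolding mult.assoc by simp
    with d show "\<exists>y. (?q has_real_derivative y) (at z) \<and> 0 \<le> y" by blast
  qed
  then show ?thesis by (simp add: field_simps)
qed

text \<open>Subtracting a constant \<open>c\<close> leaves the function decreasing but costs
  \<open>c * (y powr (1 + G) - x powr (1 + G))\<close> in the second monotonicity. The right branch
  alone earns this amount: it evaluates \<open>f\<close> where \<open>cone_lower\<close> applies,
  and \<open>Rop_incr\<close> is quantitative.\<close>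

lemma coupling:
  assumes a: "param a" and f: "cone f" "pole_bound (\<kappa> * m) f" and m: "m = (\<integral>x. f x \<partial>U)" "0 < m" and \<kappa>: "1 \<le> \<kappa>"
  shows "cone (\<lambda>x. Pop a f x - couple_const \<kappa> * m)"
  unfolding cone_def
proof (intro conjI allI impI)
  let ?c = "couple_const \<kappa> * m"
  have c0: "0 < ?c" using couple_const[OF \<kappa>] m by auto
  have low: "16 * ?c \<le> f x" if "0 < x" "x \<le> 1" for x
    using cone_lower[OF f m \<kappa> that] by simp
  note L = cone_Lop[OF a f(1)]
  have [measurable]: "Pop a f \<in> borel_measurable borel"
    using paramD[OF a] reg_measurable[OF f(1)] by measurable
  show "(\<lambda>x. Pop a f x - ?c) \<in> borel_measurable borel" by measurable
  show "0 \<le> Pop a f x - ?c" if "0 < x \<and> x \<le> 1" for x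
    using low[of "(x + 1) / 2"] reg_nonneg[OF L, of x] that c0 by (auto simp: Pop_def Rop_def)
  fix x y :: real assume xy: "0 < x \<and> x \<le> y \<and> y \<le> 1"
  show "Pop a f y - ?c \<le> Pop a f x - ?c"
    using reg_anti[OF cone_Pop[OF a f(1)], of x y] xy by simp
  have 1: "0 \<le> (y powr (1 + G) - x powr (1 + G)) / 2"
    using powr_mono2[of "1 + G" x y] xy G0 by simp
  have "?c * (y powr (1 + G) - x powr (1 + G)) = 2 * ?c * ((y powr (1 + G) - x powr (1 + G)) / 2)" by simp
  also have "\<dots> \<le> ((x + 1) / 2) powr (1 + G) * f ((x + 1) / 2) / 2 *
      ((y / ((y + 1) / 2)) powr (1 + G) - (x / ((x + 1) / 2)) powr (1 + G))"
  proof (rule mult_mono)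
    \<comment> \<open>The reserve 16 is used up as 4 * 2 * 2: this power is at least 1/4, the right
      branch has weight 1/2, and \<open>right_powr_incr\<close> loses another half.\<close>
    have "(1/2) powr 2 \<le> (1/2::real) powr (1 + G)" using G1 by (intro powr_mono') auto
    also have "\<dots> \<le> ((x + 1) / 2) powr (1 + G)" using xy G0 by (intro powr_mono2) auto
    finally have "1/4 \<le> ((x + 1) / 2) powr (1 + G)" by (simp add: power2_eq_square)
    then have "1/4 * (16 * ?c) \<le> ((x + 1) / 2) powr (1 + G) * f ((x + 1) / 2)"
      using low[of "(x + 1) / 2"] xy c0 by (intro mult_mono) auto
    then show "2 * ?c \<le> ((x + 1) / 2) powr (1 + G) * f ((x + 1) / 2) / 2" by (simp add: ac_simps)
    show "0 \<le> ((x + 1) / 2) powr (1 + G) * f ((x + 1) / 2) / 2"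
      using reg_nonneg[OF f(1), of "(x + 1) / 2"] xy by auto
  qed (use 1 right_powr_incr[of x y] xy in auto)
  also have "\<dots> \<le> y powr (1 + G) * Rop f y - x powr (1 + G) * Rop f x"
    using Rop_incr[OF f(1)] xy by auto
  finally have "?c * (y powr (1 + G) - x powr (1 + G)) \<le> y powr (1 + G) * Rop f y - x powr (1 + G) * Rop f x" .
  moreover have "x powr (1 + G) * Lop a f x \<le> y powr (1 + G) * Lop a f y"
    using reg_incr[OF L] xy by auto
  ultimately show "x powr (1 + G) * (Pop a f x - ?c) \<le> y powr (1 + G) * (Pop a f y - ?c)"
    by (simp add: Pop_def algebra_simps)
qed

definition cone_dens :: "real \<Rightarrow> (real \<Rightarrow> real) \<Rightarrow> bool" where
  "cone_dens \<kappa> f \<longleftrightarrow> cone f \<and> pole_bound \<kappa> f \<and> (\<integral>x. f x \<partial>U) = 1"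

lemma cone_densD:
  assumes "cone_dens \<kappa> f"
  shows "cone f" "pole_bound \<kappa> f" "(\<integral>x. f x \<partial>U) = 1" "integrable U f" "f \<in> borel_measurable borel"
  using assms cone_integrable reg_measurable by (auto simp: cone_dens_def)

lemma nrm_cone_dens: "cone_dens \<kappa> f \<Longrightarrow> nrm f = 1"
proof -
  assume f: "cone_dens \<kappa> f"
  have "nrm f = (\<integral>x. f x \<partial>U)"
    using cone_densD[OF f] reg_nonneg by (intro integral_U_cong) auto
  then show ?thesis using cone_densD[OF f] by simp
qed

lemma nrm_cone_dens_diff_le: "cone_dens \<kappa> f \<Longrightarrow> cone_dens \<kappa> g \<Longrightarrow> nrm (\<lambda>x. f x - g x) \<le> 2"
  using nrm_minus_triangle[of f g] nrm_cone_dens cone_densD by (metis one_add_one)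

lemma cone_dens_mono: "cone_dens \<kappa> f \<Longrightarrow> \<kappa> \<le> \<kappa>' \<Longrightarrow> cone_dens \<kappa>' f"
  by (auto simp: cone_dens_def intro: pole_bound_mono)

lemma cone_dens_Pn:
  assumes "admissible a" "cone_dens \<kappa> f" "a0 \<le> \<kappa>"
  shows "cone_dens \<kappa> (Pn a n k f)"
  using assms cone_densD[OF assms(2)] unfolding cone_dens_def
  by (auto intro!: cone_Pn pole_bound_Pn simp: Pn_integral admissibleD)

lemma cone_dens_1: "cone_dens a0 (\<lambda>_. 1)"
proof -
  have "1 \<le> a0 * x powr (- G)" if "0 < x" "x \<le> 1" for x
    using mult_mono[of 1 a0 1 "x powr (- G)"] one_le_powr_neg[OF that] a0_gt by simp
  then show ?thesis
    using cone_const[of 1] by (auto simp: cone_dens_def pole_bound_def)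
qed

text \<open>
  Coupling removes a constant from a density and renormalises the remainder; the value of \<open>\<kappa>0\<close> allows
  for a remainder of mass as small as \<open>(1 - c0) / 2\<close>.
\<close>

definition "c0 = couple_const (2 * a0)"
definition "\<kappa>0 = 2 * a0 / (1 - c0)"

lemma c0: "0 < c0" "c0 \<le> 1/32"
  using couple_const[of "2 * a0"] a0_gt by (auto simp: c0_def)

lemma \<kappa>0: "2 * a0 \<le> \<kappa>0" "a0 \<le> \<kappa>0" "0 < \<kappa>0"
proof -
  have "2 * a0 * (1 - c0) \<le> 2 * a0 * 1" using a0_gt c0 by (intro mult_left_mono) auto
  then show "2 * a0 \<le> \<kappa>0" unfolding \<kappa>0_def using c0 by (simp add: pos_le_divide_eq)
  then show "a0 \<le> \<kappa>0" "0 < \<kappa>0" using a0_gt by auto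
qed

text \<open>Here \<open>l\<close> comes from the part that stayed on the left branch for
  \<open>k\<close> steps, \<open>c0 * m\<close> is the constant split off, and \<open>F\<close> is
  the renormalised rest. The rest has again the pole constant \<kappa>0, so the stage can be
  repeated on it.\<close>

lemma coupling_stage:
  assumes a: "admissible a" and f: "cone_dens \<kappa>0 f" and \<epsilon>: "\<epsilon> \<le> 1/2"
    and k: "\<kappa>0 * (cusp_bound k powr (1 - G) / (1 - G)) \<le> \<epsilon>"
  shows "\<exists>l m F. l \<in> borel_measurable borel \<and> integrable U l \<and> nrm l \<le> \<epsilon> \<and> 1 - \<epsilon> \<le> m \<and> m \<le> 1
    \<and> cone_dens \<kappa>0 F \<and> Pn a (Suc k) j f = (\<lambda>x. l x + (c0 * m + (1 - c0) * m * F x))"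
proof -
  note fD = cone_densD[OF f]
  have pos: "\<And>j. 0 < a j" using admissibleD(2)[OF a] .
  define L where "L = Ln a k j f"
  define r where "r = (\<lambda>x. Pn a k j f x - Ln a k j f x)"
  define b where "b = a (j + int k)"
  have b: "param b" "0 < b" using admissibleD[OF a] by (auto simp: b_def)
  have L: "cone L" "pole_bound \<kappa>0 L" using cone_Ln[OF a fD(1)] pole_bound_Ln[OF a fD(2)] \<kappa>0 by (auto simp: L_def)
  have r: "cone r" "pole_bound a0 r" using Pn_minus_Ln_cone[OF a fD(1,2), of k j] fD(3) by (auto simp: r_def)
  have int: "integrable U L" "integrable U r" using cone_integrable L r by blast+
  have Lm: "(\<integral>x. L x \<partial>U) \<le> \<epsilon>"
  proof -
    have "(\<integral>x. L x \<partial>U) \<le> (\<integral>x. indicator {..cusp_bound k} x * f x \<partial>U)"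
      unfolding L_def using Ln_mass[OF a fD(1,2)] \<kappa>0 by auto
    also have "\<dots> \<le> \<kappa>0 * (cusp_bound k powr (1 - G) / (1 - G))"
      using cone_integral_near_0[OF fD(1,2)] cusp_bound_pos[of k] cusp_bound_le_1[of k] by auto
    finally show ?thesis using k by simp
  qed
  define m where "m = (\<integral>x. r x \<partial>U)"
  have "(\<integral>x. Pn a k j f x \<partial>U) = 1" using Pn_integral[of a f k j] pos fD by simp
  moreover have "(\<integral>x. L x + r x \<partial>U) = (\<integral>x. L x \<partial>U) + m" using int by (simp add: m_def)
  moreover have Lr: "(\<lambda>x. L x + r x) = Pn a k j f" by (simp add: L_def r_def)
  ultimately have sum: "(\<integral>x. L x \<partial>U) + m = 1" by simp
  have m: "1 - \<epsilon> \<le> m" "m \<le> 1" "1/2 \<le> m"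
    using sum Lm \<epsilon> cone_integral_nonneg[OF L(1)] by linarith+
  have rb: "pole_bound (2 * a0 * m) r"
  proof (rule pole_bound_mono[OF r(2)])
    have "a0 * (2 * (1/2)) \<le> a0 * (2 * m)" using m a0_gt by (intro mult_left_mono) auto
    then show "a0 \<le> 2 * a0 * m" by simp
  qed
  define l where "l = Pop b L"
  define F where "F = (\<lambda>x. (1 / ((1 - c0) * m)) * (Pop b r x - c0 * m))"
  have mm: "0 < (1 - c0) * m" using m c0 by (intro mult_pos_pos) auto
  have regF: "cone F"
    unfolding F_def using coupling[OF b(1) r(1) rb m_def] m mm a0_gt
    by (intro cone_scale) (auto simp: c0_def)
  have "pole_bound (2 * a0 * m) (Pop b r)"
    using pole_bound_Pop[OF b(1) r(1) rb] m a0_gt by (simp add: m_def[symmetric])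
  then have "pole_bound (2 * a0 * m) (\<lambda>x. Pop b r x - c0 * m)"
    unfolding pole_bound_def using c0 m by (auto intro: order_trans[rotated] simp: mult_nonneg_nonneg)
  then have "pole_bound (1 / ((1 - c0) * m) * (2 * a0 * m)) F"
    unfolding F_def using mm by (intro pole_bound_scale) auto
  then have bndF: "pole_bound \<kappa>0 F" using m by (simp add: \<kappa>0_def)
  have rm: "r \<in> borel_measurable borel" "L \<in> borel_measurable borel" using r L reg_measurable by auto
  have "(\<integral>x. F x \<partial>U) = (1 / ((1 - c0) * m)) * (m - c0 * m)"
    unfolding F_def using integrable_Pop[OF b(2) rm(1) int(2)] integral_Pop[OF b(2) rm(1) int(2)]
    by (simp add: m_def)
  also have "\<dots> = 1" using m c0 by (simp add: field_simps)
  finally have F: "cone_dens \<kappa>0 F" using regF bndF by (simp add: cone_dens_def)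
  have l: "l \<in> borel_measurable borel" "integrable U l"
    unfolding l_def using b rm int by (auto intro: Pop_measurable integrable_Pop)
  have "cone l" unfolding l_def by (rule cone_Pop[OF b(1) L(1)])
  then have "nrm l = (\<integral>x. l x \<partial>U)"
    using l reg_nonneg by (intro integral_U_cong) auto
  also have "\<dots> \<le> \<epsilon>" unfolding l_def using integral_Pop[OF b(2) rm(2) int(1)] Lm by simp
  finally have nl: "nrm l \<le> \<epsilon>" .
  have "Pn a (Suc k) j f = Pop b (\<lambda>x. L x + r x)" unfolding Pn_back Lr b_def ..
  also have "\<dots> = (\<lambda>x. l x + Pop b r x)" using Pop_lin[of b 1 L 1 r] by (simp add: l_def)
  also have "\<dots> = (\<lambda>x. l x + (c0 * m + (1 - c0) * m * F x))"
  proof -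
    have "q * ((1 / q) * z) = z" if "q \<noteq> 0" for q z :: real using that by simp
    then have "(1 - c0) * m * F x = Pop b r x - c0 * m" for x
      unfolding F_def using mm by (metis less_numeral_extra(3))
    then show ?thesis by simp
  qed
  finally show ?thesis using l nl m F by blast
qed

text \<open>In the difference of the two images the constants cancel up to \<open>m - m'\<close>,
  and the rests \<open>F\<close>, \<open>F'\<close> enter with weight at most \<open>1 - c0\<close>.
  The errors from \<open>l\<close>, \<open>l'\<close> and \<open>m - m'\<close> together stay below
  \<open>4 * \<epsilon>\<close>.\<close>

lemma contraction:
  assumes \<epsilon>: "0 < \<epsilon>" "\<epsilon> \<le> 1/2" and k: "\<kappa>0 * (cusp_bound k powr (1 - G) / (1 - G)) \<le> \<epsilon>"
    and D: "\<And>a j f g. admissible a \<Longrightarrow> cone_dens \<kappa>0 f \<Longrightarrow> cone_dens \<kappa>0 g \<Longrightarrow> nrm (\<lambda>x. Pn a n j f x - Pn a n j g x) \<le> D"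
    and a: "admissible a" and f: "cone_dens \<kappa>0 f" and g: "cone_dens \<kappa>0 g"
  shows "nrm (\<lambda>x. Pn a (Suc k + n) j f x - Pn a (Suc k + n) j g x) \<le> 4 * \<epsilon> + (1 - c0) * D"
proof -
  obtain l m F where 1: "l \<in> borel_measurable borel" "integrable U l" "nrm l \<le> \<epsilon>" "1 - \<epsilon> \<le> m" "m \<le> 1"
    "cone_dens \<kappa>0 F" "Pn a (Suc k) j f = (\<lambda>x. l x + (c0 * m + (1 - c0) * m * F x))"
    using coupling_stage[OF a f \<epsilon>(2) k] by blast
  obtain l' m' F' where 2: "l' \<in> borel_measurable borel" "integrable U l'" "nrm l' \<le> \<epsilon>" "1 - \<epsilon> \<le> m'" "m' \<le> 1"
    "cone_dens \<kappa>0 F'" "Pn a (Suc k) j g = (\<lambda>x. l' x + (c0 * m' + (1 - c0) * m' * F' x))"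
    using coupling_stage[OF a g \<epsilon>(2) k] by blast
  have pos: "\<And>j. 0 < a j" using admissibleD(2)[OF a] .
  note FD = cone_densD[OF 1(6)] and FD' = cone_densD[OF 2(6)]
  let ?j = "j + int (Suc k)"
  define e where "e = (\<lambda>x. (l x - l' x) + (c0 * (m - m') + (1 - c0) * (m - m') * F x))"
  note [measurable] = 1(1) 2(1) FD(5)
  have em: "e \<in> borel_measurable borel" unfolding e_def by measurable
  have ei: "integrable U e" unfolding e_def using 1 2 FD by auto
  have md: "\<bar>m - m'\<bar> \<le> \<epsilon>" using 1 2 by linarith
  have en: "nrm e \<le> 4 * \<epsilon>"
  proof -
    let ?h = "\<lambda>x. c0 * (m - m') + (1 - c0) * (m - m') * F x"
    have t1: "nrm e \<le> nrm (\<lambda>x. l x - l' x) + nrm ?h"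
      unfolding e_def using 1 2 FD by (intro nrm_triangle) auto
    have t2: "nrm (\<lambda>x. l x - l' x) \<le> nrm l + nrm l'" using 1 2 by (intro nrm_minus_triangle)
    have t3: "nrm ?h \<le> nrm (\<lambda>x. c0 * (m - m')) + nrm (\<lambda>x. ((1 - c0) * (m - m')) * F x)"
      using FD by (intro nrm_triangle) auto
    have t4: "nrm (\<lambda>x. c0 * (m - m')) = c0 * \<bar>m - m'\<bar>" using c0 by (simp add: abs_mult)
    have t5: "nrm (\<lambda>x. ((1 - c0) * (m - m')) * F x) = (1 - c0) * \<bar>m - m'\<bar>"
      unfolding nrm_scale nrm_cone_dens[OF 1(6)] using c0 by (simp add: abs_mult)
    have t6: "c0 * \<bar>m - m'\<bar> + (1 - c0) * \<bar>m - m'\<bar> = \<bar>m - m'\<bar>" by (simp add: algebra_simps)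
    show ?thesis using t1 t2 t3 t4 t5 t6 1(3) 2(3) md by linarith
  qed
  define d where "d = (\<lambda>x. Pn a n ?j F x - Pn a n ?j F' x)"
  have di: "integrable U d"
    unfolding d_def using Pn_integrable[of a F n ?j] Pn_integrable[of a F' n ?j] pos FD FD' by auto
  have eq: "(\<lambda>x. Pn a (Suc k) j f x - Pn a (Suc k) j g x) = (\<lambda>x. e x + (1 - c0) * m' * (F x - F' x))"
    unfolding 1(7) 2(7) e_def by (auto simp: algebra_simps)
  have "(\<lambda>x. Pn a (Suc k + n) j f x - Pn a (Suc k + n) j g x)
      = Pn a n ?j (\<lambda>x. e x + (1 - c0) * m' * (F x - F' x))"
    unfolding Pn_add using Pn_minus[of a n ?j "Pn a (Suc k) j f" "Pn a (Suc k) j g"] eq by metis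
  also have "\<dots> = (\<lambda>x. Pn a n ?j e x + (1 - c0) * m' * d x)"
    unfolding Pn_plus Pn_scale Pn_minus d_def ..
  finally have "nrm (\<lambda>x. Pn a (Suc k + n) j f x - Pn a (Suc k + n) j g x)
      = nrm (\<lambda>x. Pn a n ?j e x + (1 - c0) * m' * d x)" by (simp add: fun_eq_iff)
  also have "\<dots> \<le> nrm (Pn a n ?j e) + nrm (\<lambda>x. (1 - c0) * m' * d x)"
    using Pn_integrable[of a e n ?j] pos em ei di by (intro nrm_triangle) auto
  also have "\<dots> \<le> 4 * \<epsilon> + (1 - c0) * D"
  proof -
    have nd: "nrm d \<le> D" unfolding d_def using D[OF a 1(6) 2(6)] .
    have "0 \<le> nrm d" by simp
    then have D0: "0 \<le> D" using nd by linarith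
    have m'0: "0 \<le> (1 - c0) * m'" using c0 2(4) \<epsilon> by (intro mult_nonneg_nonneg) auto
    have "(1 - c0) * m' \<le> (1 - c0) * 1" using c0 2(5) by (intro mult_left_mono) auto
    then have "(1 - c0) * m' * nrm d \<le> ((1 - c0) * 1) * D"
      by (rule mult_mono[OF _ nd]) (use c0 in auto)
    then have "nrm (\<lambda>x. (1 - c0) * m' * d x) \<le> (1 - c0) * D"
      unfolding nrm_scale using m'0 by simp
    moreover have "nrm (Pn a n ?j e) \<le> nrm e" by (rule nrm_Pn[OF pos em ei])
    ultimately show ?thesis using en by linarith
  qed
  finally show ?thesis by simp
qed

text \<open>Repeating \<open>contraction\<close> leads to the fixed point
  \<open>4 * \<epsilon> / c0\<close> plus a geometric term that starts from the trivial bound 2. The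
  choices are made in the order \<epsilon>, block length \<open>k\<close>, number \<open>s\<close>
  of blocks, and none of them looks at the fibre.\<close>

lemma memory_loss:
  assumes \<eta>: "0 < \<eta>"
  shows "\<exists>N. \<forall>n\<ge>N. \<forall>a j f g. admissible a \<longrightarrow> cone_dens \<kappa>0 f \<longrightarrow> cone_dens \<kappa>0 g \<longrightarrow>
      nrm (\<lambda>x. Pn a n j f x - Pn a n j g x) \<le> \<eta>"
proof -
  define \<epsilon> where "\<epsilon> = min (1/2) (c0 * \<eta> / 8)"
  have \<epsilon>: "0 < \<epsilon>" "\<epsilon> \<le> 1/2" "4 * \<epsilon> / c0 \<le> \<eta> / 2"
    using c0 \<eta> by (auto simp: \<epsilon>_def field_simps)
  have "(\<lambda>k. \<kappa>0 * (cusp_bound k powr (1 - G) / (1 - G))) \<longlonglongrightarrow> \<kappa>0 * (0 / (1 - G))"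
    using G1 by (intro tendsto_intros cusp_bound_tendsto) auto
  then have "\<forall>\<^sub>F k in sequentially. \<kappa>0 * (cusp_bound k powr (1 - G) / (1 - G)) < \<epsilon>"
    by (rule order_tendstoD(2)) (simp add: \<epsilon>(1))
  then have "\<exists>k. \<kappa>0 * (cusp_bound k powr (1 - G) / (1 - G)) < \<epsilon>"
    by (rule eventually_happens'[OF sequentially_bot])
  then obtain k where k: "\<kappa>0 * (cusp_bound k powr (1 - G) / (1 - G)) \<le> \<epsilon>"
    by (auto intro: less_imp_le)
  have step: "nrm (\<lambda>x. Pn a (s * Suc k) j f x - Pn a (s * Suc k) j g x) \<le> 4 * \<epsilon> / c0 + 2 * (1 - c0) ^ s"
    if "admissible a" "cone_dens \<kappa>0 f" "cone_dens \<kappa>0 g" for a j f g s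
    using that
  proof (induction s arbitrary: a j f g)
    case 0
    have "0 \<le> 4 * \<epsilon> / c0" using \<epsilon> c0 by auto
    then show ?case using nrm_cone_dens_diff_le[OF 0(2,3)] by simp
  next
    case (Suc s)
    have "nrm (\<lambda>x. Pn a (Suc k + s * Suc k) j f x - Pn a (Suc k + s * Suc k) j g x)
      \<le> 4 * \<epsilon> + (1 - c0) * (4 * \<epsilon> / c0 + 2 * (1 - c0) ^ s)"
      by (rule contraction[OF \<epsilon>(1,2) k Suc.IH Suc.prems]) auto
    also have "\<dots> = 4 * \<epsilon> / c0 + 2 * (1 - c0) ^ Suc s" using c0 by (simp add: field_simps)
    finally show ?case unfolding mult_Suc .
  qed
  have "(\<lambda>s. 2 * (1 - c0) ^ s) \<longlonglongrightarrow> 2 * 0"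
    using c0 by (intro tendsto_intros LIMSEQ_realpow_zero) auto
  then have "\<forall>\<^sub>F s in sequentially. 2 * (1 - c0) ^ s < \<eta> / 2"
    by (rule order_tendstoD(2)) (simp add: \<eta>)
  then have "\<exists>s. 2 * (1 - c0) ^ s < \<eta> / 2"
    by (rule eventually_happens'[OF sequentially_bot])
  then obtain s where s: "2 * (1 - c0) ^ s \<le> \<eta> / 2"
    by (auto intro: less_imp_le)
  show ?thesis
  proof (intro exI allI impI)
    fix n a j f g assume n: "s * Suc k \<le> n" and a: "admissible a" and f: "cone_dens \<kappa>0 f" and g: "cone_dens \<kappa>0 g"
    define N where "N = s * Suc k"
    obtain r where r: "n = N + r" using n by (auto simp: le_iff_add N_def)
    have pos: "\<And>j. 0 < a j" using admissibleD(2)[OF a] .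
    let ?d = "\<lambda>x. Pn a N j f x - Pn a N j g x"
    have i: "integrable U (Pn a N j f)" "integrable U (Pn a N j g)"
      using cone_densD[OF f] cone_densD[OF g] by (auto intro!: Pn_integrable pos)
    have "(\<lambda>x. Pn a n j f x - Pn a n j g x) = Pn a r (j + int N) ?d"
        unfolding r Pn_add using Pn_minus[of a r "j + int N" "Pn a N j f" "Pn a N j g"] by simp
    then have "nrm (\<lambda>x. Pn a n j f x - Pn a n j g x) = nrm (Pn a r (j + int N) ?d)" by (simp add: fun_eq_iff)
    also have "\<dots> \<le> nrm ?d"
      using i cone_densD[OF f] cone_densD[OF g] by (intro nrm_Pn pos borel_measurable_diff Pn_measurable) auto
    also have "\<dots> \<le> 4 * \<epsilon> / c0 + 2 * (1 - c0) ^ s" unfolding N_def by (rule step[OF a f g])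
    finally show "nrm (\<lambda>x. Pn a n j f x - Pn a n j g x) \<le> \<eta>" using \<epsilon> s by linarith
  qed
qed

lemma cone_pole_bound_le:
  assumes "pole_bound K f" "0 \<le> K" "0 < \<delta>" "\<delta> \<le> x" "x \<le> 1"
  shows "f x \<le> K / \<delta>"
proof -
  have "x powr (- G) \<le> x powr (- 1)" using assms G1 by (intro powr_mono') auto
  also have "\<dots> \<le> \<delta> powr (- 1)" using assms by (intro powr_mono2') auto
  also have "\<dots> = 1 / \<delta>" using assms by (simp add: powr_minus divide_inverse)
  finally have "K * x powr (- G) \<le> K * (1 / \<delta>)" using assms by (intro mult_left_mono)
  then show ?thesis using pole_boundD[OF assms(1), of x] assms by simp
qed

text \<open>The second monotonicity bounds \<open>f y\<close> below by
  \<open>(x / y) powr (1 + G) * f x\<close>; rounding the exponent up to 2 gives an explicit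
  constant.\<close>

lemma cone_lip:
  assumes f: "cone f" and K: "pole_bound K f" "0 \<le> K" and x: "0 < \<delta>" "\<delta> \<le> x" "x \<le> y" "y \<le> 1"
  shows "f x - f y \<le> 2 * K / \<delta>\<^sup>2 * (y - x)"
proof -
  have y: "0 < x" "0 < y" using x by auto
  have fx: "0 \<le> f x" "f x \<le> K / \<delta>" using reg_nonneg[OF f] cone_pole_bound_le[OF K x(1,2)] x by auto
  have "(x / y)\<^sup>2 = (x / y) powr 2" using y by simp
  also have "\<dots> \<le> (x / y) powr (1 + G)" using y x G1 by (intro powr_mono') auto
  also have "\<dots> = x powr (1 + G) / y powr (1 + G)" using y by (simp add: powr_divide)
  finally have "(x / y)\<^sup>2 * f x \<le> x powr (1 + G) / y powr (1 + G) * f x" using fx by (intro mult_right_mono)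
  also have "\<dots> \<le> f y" using reg_incr[OF f, of x y] y x by (simp add: field_simps)
  finally have 1: "(x / y)\<^sup>2 * f x \<le> f y" .
  have "0 \<le> (1 - x / y)\<^sup>2" by simp
  moreover have "(y - x) / y = 1 - x / y" using y by (simp add: diff_divide_distrib)
  ultimately have "1 - 2 * ((y - x) / y) \<le> (x / y)\<^sup>2" by (simp add: power2_diff)
  then have "(1 - 2 * ((y - x) / y)) * f x \<le> (x / y)\<^sup>2 * f x" using fx by (intro mult_right_mono)
  then have "f x - f y \<le> 2 * ((y - x) / y) * f x" using 1 by (simp add: algebra_simps)
  also have "\<dots> \<le> 2 * ((y - x) / \<delta>) * (K / \<delta>)"
    using fx x y by (intro mult_mono divide_left_mono) auto
  also have "\<dots> = 2 * K / \<delta>\<^sup>2 * (y - x)" by (simp add: power2_eq_square)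
  finally show ?thesis .
qed

subsection \<open>Fibre densities\<close>

text \<open>
  Functions of the cone are Lipschitz on \<open>[\<delta>,1]\<close>, so a difference of \<open>\<eta>\<close> at one point there forces
  an \<open>L\<^sup>1\<close>-distance of at least this size.
\<close>

definition unif_thr :: "real \<Rightarrow> real \<Rightarrow> real \<Rightarrow> real" where
  "unif_thr K \<delta> \<eta> = (\<eta> / 2) * min (\<delta> / 2) (\<eta> * \<delta>\<^sup>2 / (16 * K))"

lemma unif_thr_pos: "0 < K \<Longrightarrow> 0 < \<delta> \<Longrightarrow> 0 < \<eta> \<Longrightarrow> 0 < unif_thr K \<delta> \<eta>"
  by (auto simp: unif_thr_def)

lemma pointwise_from_nrm:
  assumes f: "cone f" "pole_bound K f" and g: "cone g" "pole_bound K g" and K: "0 < K" and \<delta>: "0 < \<delta>" "\<delta> \<le> x" "x \<le> 1"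
    and \<eta>: "0 < \<eta>" and n: "nrm (\<lambda>x. f x - g x) < unif_thr K \<delta> \<eta>"
  shows "\<bar>f x - g x\<bar> < \<eta>"
proof (rule ccontr)
  assume "\<not> \<bar>f x - g x\<bar> < \<eta>"
  then have d: "\<eta> \<le> \<bar>f x - g x\<bar>" by simp
  \<comment> \<open>A window to the left of \<open>x\<close>, short enough to stay above
    \<open>\<delta> / 2\<close> and to let each function vary by at most \<open>\<eta> / 2\<close>,
    the Lipschitz constant there being \<open>8 * K / \<delta>\<^sup>2\<close>.\<close>
  define l where "l = min (\<delta> / 2) (\<eta> * \<delta>\<^sup>2 / (16 * K))"
  have l: "0 < l" "l \<le> \<delta> / 2" "8 * K / \<delta>\<^sup>2 * l \<le> \<eta> / 2"
  proof -
    show "0 < l" "l \<le> \<delta> / 2" using \<delta> K \<eta> by (auto simp: l_def)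
    have "8 * K / \<delta>\<^sup>2 * l \<le> 8 * K / \<delta>\<^sup>2 * (\<eta> * \<delta>\<^sup>2 / (16 * K))"
      using K by (intro mult_left_mono) (auto simp: l_def)
    then show "8 * K / \<delta>\<^sup>2 * l \<le> \<eta> / 2" using K \<delta> by simp
  qed
  have near: "\<eta> / 2 \<le> \<bar>f z - g z\<bar>" if z: "x - l \<le> z" "z \<le> x" for z
  proof -
    have z': "\<delta> / 2 \<le> z" "0 < \<delta> / 2" "0 < z" using z l \<delta> by auto
    have "2 * K / (\<delta> / 2)\<^sup>2 * (x - z) \<le> 8 * K / \<delta>\<^sup>2 * l"
    proof -
      have "2 * K / (\<delta> / 2)\<^sup>2 = 8 * K / \<delta>\<^sup>2" by (simp add: power2_eq_square)
      moreover have "8 * K / \<delta>\<^sup>2 * (x - z) \<le> 8 * K / \<delta>\<^sup>2 * l" using z K by (intro mult_left_mono) auto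
      ultimately show ?thesis by simp
    qed
    then have "f z - f x \<le> \<eta> / 2" "g z - g x \<le> \<eta> / 2"
      using cone_lip[OF f less_imp_le[OF K] z'(2,1) z(2) \<delta>(3)] cone_lip[OF g less_imp_le[OF K] z'(2,1) z(2) \<delta>(3)] l(3)
      by linarith+
    \<comment> \<open>Towards the left both functions only grow, so their variations do not add up:
      the difference changes by at most \<open>\<eta> / 2\<close>.\<close>
    moreover have "f x \<le> f z" "g x \<le> g z"
      using reg_anti[OF f(1) z'(3) z(2) \<delta>(3)] reg_anti[OF g(1) z'(3) z(2) \<delta>(3)] by auto
    ultimately show ?thesis using d by linarith
  qed
  have sub: "{x - l..x} \<subseteq> {0..1}" using l \<delta> by auto
  have eq: "indicator {0..1} y * (indicator {x - l..x} y * (\<eta> / 2)) = indicator {x - l..x} y * (\<eta> / 2)" for y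
    using sub by (auto split: split_indicator)
  have "(\<integral>z. indicator {x - l..x} z * (\<eta> / 2) \<partial>U) = l * (\<eta> / 2)"
    unfolding integral_U eq using l by simp
  moreover have "(\<integral>z. indicator {x - l..x} z * (\<eta> / 2) \<partial>U) \<le> nrm (\<lambda>x. f x - g x)"
  proof (rule integral_mono_AE)
    show "integrable U (\<lambda>z. indicator {x - l..x} z * (\<eta> / 2))"
      by (intro integrable_mult_left U.integrable_const_bound[where B = 1]) (auto split: split_indicator)
    show "integrable U (\<lambda>x. \<bar>f x - g x\<bar>)" using cone_integrable f g by auto
    show "AE z in U. indicator {x - l..x} z * (\<eta> / 2) \<le> \<bar>f z - g z\<bar>"
      using near by (auto split: split_indicator)
  qed
  moreover have "unif_thr K \<delta> \<eta> = l * (\<eta> / 2)" by (simp add: unif_thr_def l_def)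
  ultimately show False using n by linarith
qed

definition pull_dens :: "(int \<Rightarrow> real) \<Rightarrow> int \<Rightarrow> nat \<Rightarrow> real \<Rightarrow> real" where
  "pull_dens a k n = Pn a n (k - int n) (\<lambda>_. 1)"

text \<open>A pointwise limit, which exists at every point of \<open>(0, 1]\<close>; an L1 limit
  would have no value at the centre.\<close>

definition fibre_dens :: "(int \<Rightarrow> real) \<Rightarrow> int \<Rightarrow> real \<Rightarrow> real" where
  "fibre_dens a k x = lim (\<lambda>n. pull_dens a k n x)"

lemma cone_dens_pull_dens: "admissible a \<Longrightarrow> cone_dens a0 (pull_dens a k n)"
  unfolding pull_dens_def by (intro cone_dens_Pn cone_dens_1) auto

text \<open>Starting further in the past means applying the last \<open>n\<close> operators to
  another density of the cone, so \<open>memory_loss\<close> compares the two uniformly in the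
  fibre.\<close>

lemma pull_dens_cauchy:
  assumes \<eta>: "0 < \<eta>"
  shows "\<exists>N. \<forall>n\<ge>N. \<forall>m\<ge>n. \<forall>a k. admissible a \<longrightarrow> nrm (\<lambda>x. pull_dens a k n x - pull_dens a k m x) \<le> \<eta>"
proof -
  obtain N where N: "\<And>n a j f g. N \<le> n \<Longrightarrow> admissible a \<Longrightarrow> cone_dens \<kappa>0 f \<Longrightarrow> cone_dens \<kappa>0 g \<Longrightarrow>
      nrm (\<lambda>x. Pn a n j f x - Pn a n j g x) \<le> \<eta>"
    using memory_loss[OF \<eta>] by blast
  show ?thesis
  proof (intro exI allI impI)
    fix n m a k assume n: "N \<le> n" "n \<le> m" and a: "admissible a"
    have "pull_dens a k m = Pn a n (k - int n) (Pn a (m - n) (k - int m) (\<lambda>_. 1))"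
      unfolding pull_dens_def using Pn_add[of a "m - n" n "k - int m" "\<lambda>_. 1"] n by (simp add: of_nat_diff)
    moreover have "cone_dens \<kappa>0 (Pn a (m - n) (k - int m) (\<lambda>_. 1))" "cone_dens \<kappa>0 (\<lambda>_. 1)"
      using \<kappa>0 by (auto intro!: cone_dens_Pn cone_dens_mono[OF cone_dens_1] a)
    ultimately show "nrm (\<lambda>x. pull_dens a k n x - pull_dens a k m x) \<le> \<eta>"
      using N[OF n(1) a] by (simp add: pull_dens_def)
  qed
qed

lemma pull_dens_unif:
  assumes \<eta>: "0 < \<eta>" and \<delta>: "0 < \<delta>"
  shows "\<exists>N. \<forall>n\<ge>N. \<forall>m\<ge>n. \<forall>a k x. admissible a \<longrightarrow> \<delta> \<le> x \<longrightarrow> x \<le> 1 \<longrightarrow> \<bar>pull_dens a k n x - pull_dens a k m x\<bar> < \<eta>"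
proof -
  have t: "0 < unif_thr a0 \<delta> \<eta> / 2" using unif_thr_pos[of a0 \<delta> \<eta>] a0_gt \<eta> \<delta> by auto
  obtain N where N: "\<And>n m a k. N \<le> n \<Longrightarrow> n \<le> m \<Longrightarrow> admissible a \<Longrightarrow> nrm (\<lambda>x. pull_dens a k n x - pull_dens a k m x) \<le> unif_thr a0 \<delta> \<eta> / 2"
    using pull_dens_cauchy[OF t] by blast
  show ?thesis
  proof (intro exI allI impI)
    fix n m a k x assume n: "N \<le> n" "n \<le> m" and a: "admissible a" and x: "\<delta> \<le> x" "x \<le> 1"
    show "\<bar>pull_dens a k n x - pull_dens a k m x\<bar> < \<eta>"
      using cone_densD[OF cone_dens_pull_dens[OF a]] a0_gt N[OF n a, of k] t
      by (intro pointwise_from_nrm[where K = a0 and \<delta> = \<delta>] \<delta> x \<eta>) (auto simp: \<delta>)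
  qed
qed

lemma pull_dens_tendsto:
  assumes a: "admissible a" and x: "0 < x" "x \<le> 1"
  shows "(\<lambda>n. pull_dens a k n x) \<longlonglongrightarrow> fibre_dens a k x"
proof -
  have "Cauchy (\<lambda>n. pull_dens a k n x)"
  proof (rule CauchyI')
    fix e :: real assume "0 < e"
    from pull_dens_unif[OF this x(1)] obtain N where
      "\<And>n m. N \<le> n \<Longrightarrow> n \<le> m \<Longrightarrow> \<bar>pull_dens a k n x - pull_dens a k m x\<bar> < e" using a x by blast
    then show "\<exists>M. \<forall>m\<ge>M. \<forall>n>m. dist (pull_dens a k m x) (pull_dens a k n x) < e"
      by (auto simp: dist_real_def intro!: exI[of _ N])
  qed
  then show ?thesis
    unfolding fibre_dens_def by (simp add: Cauchy_convergent_iff convergent_LIMSEQ_iff)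
qed

lemma fibre_dens_unif:
  assumes \<eta>: "0 < \<eta>" and \<delta>: "0 < \<delta>"
  shows "\<exists>N. \<forall>n\<ge>N. \<forall>a k x. admissible a \<longrightarrow> \<delta> \<le> x \<longrightarrow> x \<le> 1 \<longrightarrow> \<bar>pull_dens a k n x - fibre_dens a k x\<bar> \<le> \<eta>"
proof -
  obtain N where N: "\<And>n m a k x. N \<le> n \<Longrightarrow> n \<le> m \<Longrightarrow> admissible a \<Longrightarrow> \<delta> \<le> x \<Longrightarrow> x \<le> 1 \<Longrightarrow> \<bar>pull_dens a k n x - pull_dens a k m x\<bar> < \<eta>"
    using pull_dens_unif[OF assms] by blast
  show ?thesis
  proof (intro exI allI impI)
    fix n a k x assume n: "N \<le> n" and a: "admissible a" and x: "\<delta> \<le> x" "x \<le> 1"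
    have "(\<lambda>m. \<bar>pull_dens a k n x - pull_dens a k m x\<bar>) \<longlonglongrightarrow> \<bar>pull_dens a k n x - fibre_dens a k x\<bar>"
      using \<delta> x by (intro tendsto_intros pull_dens_tendsto a) auto
    then show "\<bar>pull_dens a k n x - fibre_dens a k x\<bar> \<le> \<eta>"
      by (rule LIMSEQ_le_const2) (use N[OF n _ a x] in \<open>auto intro!: exI[of _ n] less_imp_le\<close>)
  qed
qed

lemma fibre_dens_measurable: 
  assumes "admissible a"
  shows "fibre_dens a k \<in> borel_measurable borel"
  unfolding fibre_dens_def[abs_def]
  using cone_densD(5)[OF cone_dens_pull_dens[OF assms]] by (intro borel_measurable_lim_metric) auto

lemma cone_fibre_dens:
  assumes a: "admissible a"
  shows "cone (fibre_dens a k)" "pole_bound a0 (fibre_dens a k)"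
proof -
  note u = cone_densD[OF cone_dens_pull_dens[OF a]]
  show "cone (fibre_dens a k)"
    unfolding cone_def
  proof (intro conjI allI impI)
    show "fibre_dens a k \<in> borel_measurable borel" by (rule fibre_dens_measurable[OF a])
    show "0 \<le> fibre_dens a k x" if "0 < x \<and> x \<le> 1" for x
      by (rule LIMSEQ_le_const[OF pull_dens_tendsto[OF a]]) (use that reg_nonneg[OF u(1)] in auto)
    fix x y :: real assume xy: "0 < x \<and> x \<le> y \<and> y \<le> 1"
    then have lx: "(\<lambda>n. pull_dens a k n x) \<longlonglongrightarrow> fibre_dens a k x" and ly: "(\<lambda>n. pull_dens a k n y) \<longlonglongrightarrow> fibre_dens a k y"
      by (auto intro!: pull_dens_tendsto a)
    show "fibre_dens a k y \<le> fibre_dens a k x"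
      by (rule LIMSEQ_le[OF ly lx]) (use reg_anti[OF u(1)] xy in auto)
    show "x powr (1 + G) * fibre_dens a k x \<le> y powr (1 + G) * fibre_dens a k y"
      by (rule LIMSEQ_le[OF tendsto_mult_left[OF lx] tendsto_mult_left[OF ly]]) (use reg_incr[OF u(1)] xy in auto)
  qed
  show "pole_bound a0 (fibre_dens a k)"
    unfolding pole_bound_def
  proof (intro allI impI)
    fix x :: real assume x: "0 < x \<and> x \<le> 1"
    show "fibre_dens a k x \<le> a0 * x powr (- G)"
      by (rule LIMSEQ_le_const2[OF pull_dens_tendsto[OF a]]) (use pole_boundD[OF u(2)] x in auto)
  qed
qed

lemma fibre_dens_nrm_tendsto:
  assumes a: "admissible a"
  shows "(\<lambda>n. nrm (\<lambda>x. pull_dens a k n x - fibre_dens a k x)) \<longlonglongrightarrow> 0"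
proof -
  note u = cone_densD[OF cone_dens_pull_dens[OF a]]
  have "(\<lambda>n. nrm (\<lambda>x. pull_dens a k n x - fibre_dens a k x)) \<longlonglongrightarrow> (\<integral>x. (\<lambda>_. 0) x \<partial>U)"
  proof (rule integral_dominated_convergence)
    show "(\<lambda>x. \<bar>pull_dens a k n x - fibre_dens a k x\<bar>) \<in> borel_measurable U" for n
      using u(5) fibre_dens_measurable[OF a] by measurable
    show "integrable U (\<lambda>x. 2 * a0 * (indicator {0..1} x * x powr (- G)))"
      using powr_integral(1)[of 1] by (intro integrable_mult_right) auto
    show "AE x in U. (\<lambda>n. \<bar>pull_dens a k n x - fibre_dens a k x\<bar>) \<longlonglongrightarrow> 0"
    proof (rule AE_U_I)
      fix x :: real assume x: "0 < x" "x < 1"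
      have "(\<lambda>n. \<bar>pull_dens a k n x - fibre_dens a k x\<bar>) \<longlonglongrightarrow> \<bar>fibre_dens a k x - fibre_dens a k x\<bar>"
        using x by (intro tendsto_intros pull_dens_tendsto a) auto
      then show "(\<lambda>n. \<bar>pull_dens a k n x - fibre_dens a k x\<bar>) \<longlonglongrightarrow> 0" by simp
    qed
    show "AE x in U. norm \<bar>pull_dens a k n x - fibre_dens a k x\<bar> \<le> 2 * a0 * (indicator {0..1} x * x powr (- G))" for n
    proof (rule AE_U_I)
      fix x :: real assume x: "0 < x" "x < 1"
      then have "pull_dens a k n x \<le> a0 * x powr (- G)" "fibre_dens a k x \<le> a0 * x powr (- G)" "0 \<le> pull_dens a k n x" "0 \<le> fibre_dens a k x"
        using pole_boundD[OF u(2), of x] pole_boundD[OF cone_fibre_dens(2)[OF a], of x] reg_nonneg[OF u(1), of x] reg_nonneg[OF cone_fibre_dens(1)[OF a], of x]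
        by auto
      then have "\<bar>pull_dens a k n x - fibre_dens a k x\<bar> \<le> 2 * (a0 * x powr (- G))" by linarith
      then show "norm \<bar>pull_dens a k n x - fibre_dens a k x\<bar> \<le> 2 * a0 * (indicator {0..1} x * x powr (- G))"
        using x by simp
    qed
  qed auto
  then show ?thesis by simp
qed

lemma cone_dens_fibre_dens:
  assumes a: "admissible a"
  shows "cone_dens a0 (fibre_dens a k)"
proof -
  note u = cone_densD[OF cone_dens_pull_dens[OF a]]
  have i: "integrable U (fibre_dens a k)" using cone_fibre_dens[OF a] by (rule cone_integrable)
  have "\<bar>1 - (\<integral>x. fibre_dens a k x \<partial>U)\<bar> \<le> nrm (\<lambda>x. pull_dens a k n x - fibre_dens a k x)" for n
  proof -
    have "1 - (\<integral>x. fibre_dens a k x \<partial>U) = (\<integral>x. pull_dens a k n x - fibre_dens a k x \<partial>U)" using u i by simp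
    then show ?thesis by (simp add: integral_abs_bound)
  qed
  then have "\<bar>1 - (\<integral>x. fibre_dens a k x \<partial>U)\<bar> \<le> 0"
    by (intro LIMSEQ_le_const[OF fibre_dens_nrm_tendsto[OF a]]) auto
  then show ?thesis using cone_fibre_dens[OF a] by (simp add: cone_dens_def)
qed

lemma Pop_fibre_dens:
  assumes a: "admissible a" and x: "0 < x" "x \<le> 1"
  shows "Pop (a k) (fibre_dens a k) x = fibre_dens a (k + 1) x"
proof -
  have l: "0 < left_inv (a k) x" "left_inv (a k) x \<le> 1"
    using left_inv_pos[OF admissibleD(2)[OF a], of x] left_inv_range[OF admissibleD(2)[OF a], of k x] x by auto
  have "(\<lambda>n. Pop (a k) (pull_dens a k n) x) \<longlonglongrightarrow> Pop (a k) (fibre_dens a k) x"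
    unfolding Pop_def Lop_def Rop_def using l x by (intro tendsto_intros pull_dens_tendsto a) auto
  moreover have "Pop (a k) (pull_dens a k n) = pull_dens a (k + 1) (Suc n)" for n
    unfolding pull_dens_def Pn_back by (simp add: algebra_simps)
  ultimately have "(\<lambda>n. pull_dens a (k + 1) (Suc n) x) \<longlonglongrightarrow> Pop (a k) (fibre_dens a k) x" by simp
  then show ?thesis
    using LIMSEQ_unique LIMSEQ_Suc[OF pull_dens_tendsto[OF a x, of "k + 1"]] by blast
qed

lemma Pn_fibre_dens:
  assumes a: "admissible a" and x: "0 < x" "x \<le> 1"
  shows "Pn a n k (fibre_dens a k) x = fibre_dens a (k + int n) x"
proof (induction n arbitrary: k)
  case (Suc n)
  have "Pn a (Suc n) k (fibre_dens a k) x = Pn a n (k + 1) (fibre_dens a (k + 1)) x"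
    unfolding Pn.simps using Pop_fibre_dens[OF a] by (intro Pn_cong admissibleD(2)[OF a] x) auto
  then show ?case using Suc.IH[of "k + 1"] by (simp add: algebra_simps)
qed simp

subsection \<open>Decay of correlations for intervals\<close>

definition cone_bdd :: "(real \<Rightarrow> real) \<Rightarrow> bool" where
  "cone_bdd f \<longleftrightarrow> cone f \<and> (\<exists>K\<ge>0. pole_bound K f)"

lemma cone_bdd_integrable: "cone_bdd f \<Longrightarrow> integrable U f"
  by (auto simp: cone_bdd_def intro: cone_integrable)

lemma cone_bdd_measurable: "cone_bdd f \<Longrightarrow> f \<in> borel_measurable borel"
  by (auto simp: cone_bdd_def intro: reg_measurable)

lemma cone_bdd_Lop: "param a \<Longrightarrow> cone_bdd f \<Longrightarrow> cone_bdd (Lop a f)"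
  by (auto simp: cone_bdd_def intro: cone_Lop pole_bound_Lop)

lemma cone_bdd_Rop:
  assumes "cone_bdd f"
  shows "cone_bdd (Rop f)"
proof -
  have r: "cone f" using assms by (simp add: cone_bdd_def)
  have "pole_bound (\<integral>x. f x \<partial>U) (Rop f)"
    unfolding pole_bound_def
  proof (intro allI impI)
    fix x :: real assume x: "0 < x \<and> x \<le> 1"
    have "Rop f x \<le> (\<integral>x. f x \<partial>U) * 1"
      using Rop_le[OF r cone_bdd_integrable[OF assms]] x by simp
    also have "\<dots> \<le> (\<integral>x. f x \<partial>U) * x powr (- G)"
      using cone_integral_nonneg[OF r] one_le_powr_neg x by (intro mult_left_mono) auto
    finally show "Rop f x \<le> (\<integral>x. f x \<partial>U) * x powr (- G)" .
  qed
  then show ?thesis using cone_Rop[OF r] cone_integral_nonneg[OF r] by (auto simp: cone_bdd_def)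
qed

lemma cone_bdd_ind_integrable: "cone_bdd f \<Longrightarrow> A \<in> sets borel \<Longrightarrow> integrable U (\<lambda>x. indicator A x * f x)"
  by (auto simp: cone_bdd_def intro: cone_ind_integrable)

lemma Lop_cusp_bound_le:
  assumes "param a" "cone_bdd f"
  shows "(\<integral>x. indicator {..cusp_bound n} x * Lop a f x \<partial>U) \<le> (\<integral>x. indicator {..cusp_bound (Suc n)} x * f x \<partial>U)"
proof -
  obtain K where K: "cone f" "0 \<le> K" "pole_bound K f" using assms by (auto simp: cone_bdd_def)
  have "(\<integral>x. indicator {..cusp_bound n} x * Lop a f x \<partial>U) = (\<integral>x. indicator {..left_inv a (cusp_bound n)} x * f x \<partial>U)"
    using cusp_bound_pos[of n] cusp_bound_le_1[of n] paramD[OF assms(1)] K by (intro integral_Lop_ind reg_measurable) auto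
  also have "\<dots> \<le> (\<integral>x. indicator {..cusp_bound (Suc n)} x * f x \<partial>U)"
    using cusp_bound_pos[of n] K assms by (intro cone_ind_mono[of _ K] cusp_bound_step) auto
  finally show ?thesis .
qed

lemma integral_ind_const:
  fixes c :: real
  assumes "0 \<le> t" "t \<le> 1"
  shows "(\<integral>x. indicator {..t} x * c \<partial>U) = t * c" "integrable U (\<lambda>x. indicator {..t} x * c)"
proof -
  have eq: "indicator {0..1} y * (indicator {..t} y * c) = indicator {0..t} y * c" for y :: real
    using assms by (auto split: split_indicator)
  show "(\<integral>x. indicator {..t} x * c \<partial>U) = t * c"
    unfolding integral_U eq using assms by simp
  show "integrable U (\<lambda>x. indicator {..t} x * c)"
    by (intro integrable_mult_left U.integrable_const_bound[where B = 1]) (auto split: split_indicator)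
qed

text \<open>What the right branch puts on \<open>[0, t]\<close> comes from an interval of length
  \<open>t / 2\<close> above 1/2. The left preimage of \<open>[0, t]\<close> is at least as long and
  lies below 1/2, where \<open>f\<close> is larger.\<close>

lemma Rop_cusp_bound_le:
  assumes "param a" "cone_bdd f"
  shows "(\<integral>x. indicator {..cusp_bound n} x * Rop f x \<partial>U) \<le> (\<integral>x. indicator {..cusp_bound (Suc n)} x * f x \<partial>U)"
proof -
  obtain K where K: "cone f" "0 \<le> K" "pole_bound K f" using assms by (auto simp: cone_bdd_def)
  let ?t = "cusp_bound n" and ?s = "left_inv a (cusp_bound n)"
  have t: "0 < ?t" "?t \<le> 1" using cusp_bound_pos cusp_bound_le_1 by auto
  have s: "?t / 2 \<le> ?s" "?s \<le> 1/2" "0 \<le> ?s"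
    using left_inv_bounds[of a ?t] left_inv_range[of a ?t] paramD[OF assms(1)] t by auto
  have f0: "0 \<le> f (1/2)" using reg_nonneg[OF K(1)] by simp
  have "(\<integral>x. indicator {..?t} x * Rop f x \<partial>U) \<le> (\<integral>x. indicator {..?t} x * (f (1/2) / 2) \<partial>U)"
  proof (rule integral_mono_AE)
    show "integrable U (\<lambda>x. indicator {..?t} x * Rop f x)"
      using cone_bdd_Rop[OF assms(2)] by (rule cone_bdd_ind_integrable) auto
    show "AE x in U. indicator {..?t} x * Rop f x \<le> indicator {..?t} x * (f (1/2) / 2)"
      by (rule AE_U_I) (use reg_anti[OF K(1), of "1/2"] in \<open>auto simp: Rop_def split: split_indicator\<close>)
  qed (use integral_ind_const t in auto)
  also have "\<dots> = (?t / 2) * f (1/2)" using integral_ind_const(1)[of ?t] t by simp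
  also have "\<dots> \<le> ?s * f (1/2)" using s f0 by (intro mult_right_mono) auto
  also have "\<dots> = (\<integral>x. indicator {..?s} x * f (1/2) \<partial>U)"
    by (rule integral_ind_const(1)[symmetric]) (use s in auto)
  also have "\<dots> \<le> (\<integral>x. indicator {..?s} x * f x \<partial>U)"
  proof (rule integral_mono_AE)
    show "integrable U (\<lambda>x. indicator {..?s} x * f x)" using assms(2) by (rule cone_bdd_ind_integrable) auto
    show "AE x in U. indicator {..?s} x * f (1/2) \<le> indicator {..?s} x * f x"
      by (rule AE_U_I) (use reg_anti[OF K(1), of _ "1/2"] s in \<open>auto split: split_indicator\<close>)
  qed (use integral_ind_const s in auto)
  also have "\<dots> \<le> (\<integral>x. indicator {..cusp_bound (Suc n)} x * f x \<partial>U)"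
    using cusp_bound_pos[of n] K assms by (intro cone_ind_mono[of _ K] cusp_bound_step) auto
  finally show ?thesis .
qed

section \<open>Intervals under the two inverse branches\<close>

definition down :: "real set \<Rightarrow> bool" where
  "down I \<longleftrightarrow> I \<in> sets borel \<and> (\<forall>x y. 0 < x \<and> x \<le> y \<and> y \<le> 1 \<and> y \<in> I \<longrightarrow> x \<in> I)"

definition up :: "real set \<Rightarrow> bool" where
  "up I \<longleftrightarrow> I \<in> sets borel \<and> (\<forall>x y. 0 < x \<and> x \<le> y \<and> y \<le> 1 \<and> x \<in> I \<longrightarrow> y \<in> I)"

text \<open>Intervals are described by order convexity instead of end points; preimages under the
  monotone branches are then immediate, and empty or full ones are no special case.\<close>

definition conv :: "real set \<Rightarrow> bool" where
  "conv I \<longleftrightarrow> I \<in> sets borel \<and> (\<forall>x y z. 0 < x \<and> x \<le> y \<and> y \<le> z \<and> z \<le> 1 \<and> x \<in> I \<and> z \<in> I \<longrightarrow> y \<in> I)"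

definition left_preimage :: "real \<Rightarrow> real set \<Rightarrow> real set" where "left_preimage a I = left_inv a -` I"
definition right_preimage :: "real set \<Rightarrow> real set" where "right_preimage I = (\<lambda>x. (x + 1) / 2) -` I"

lemma left_preimage_borel: "0 < a \<Longrightarrow> I \<in> sets borel \<Longrightarrow> left_preimage a I \<in> sets borel"
  unfolding left_preimage_def using measurable_sets[OF left_inv_measurable] by fastforce

lemma right_preimage_borel: "I \<in> sets borel \<Longrightarrow> right_preimage I \<in> sets borel"
  unfolding right_preimage_def using measurable_sets[of "\<lambda>x. (x + 1) / 2 :: real" borel borel I] by simp

lemma Pop_ind:
  "Pop a (\<lambda>x. indicator I x * f x) x = indicator (left_preimage a I) x * Lop a f x + indicator (right_preimage I) x * Rop f x"
  by (auto simp: Pop_def Lop_def Rop_def left_preimage_def right_preimage_def split: split_indicator)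

lemma lr_rng:
  assumes "0 < a" "0 < x" "x \<le> 1"
  shows "0 < left_inv a x" "left_inv a x \<le> 1/2" "1/2 < (x + 1) / 2" "(x + 1) / 2 \<le> 1"
  using left_inv_pos left_inv_range assms by auto

lemma left_preimage_conv: "0 < a \<Longrightarrow> conv I \<Longrightarrow> conv (left_preimage a I)"
  unfolding conv_def left_preimage_def
proof (intro conjI allI impI)
  assume a: "0 < a" and I: "I \<in> sets borel \<and> (\<forall>x y z. 0 < x \<and> x \<le> y \<and> y \<le> z \<and> z \<le> 1 \<and> x \<in> I \<and> z \<in> I \<longrightarrow> y \<in> I)"
  then show "left_inv a -` I \<in> sets borel" using left_preimage_borel by (auto simp: left_preimage_def)
  fix x y z :: real assume h: "0 < x \<and> x \<le> y \<and> y \<le> z \<and> z \<le> 1 \<and> x \<in> left_inv a -` I \<and> z \<in> left_inv a -` I"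
  have "left_inv a x \<le> left_inv a y" "left_inv a y \<le> left_inv a z" using h monoD[OF left_inv_mono[OF a]] by auto
  moreover have "0 < left_inv a x" "left_inv a z \<le> 1" using lr_rng[OF a, of x] lr_rng[OF a, of z] h by auto
  ultimately have "left_inv a y \<in> I" using I h by (metis vimageE)
  then show "y \<in> left_inv a -` I" by simp
qed

lemma right_preimage_conv: "conv I \<Longrightarrow> conv (right_preimage I)"
  unfolding conv_def
proof (intro conjI allI impI)
  assume I: "I \<in> sets borel \<and> (\<forall>x y z. 0 < x \<and> x \<le> y \<and> y \<le> z \<and> z \<le> 1 \<and> x \<in> I \<and> z \<in> I \<longrightarrow> y \<in> I)"
  then show "right_preimage I \<in> sets borel" using right_preimage_borel by auto
  fix x y z :: real assume h: "0 < x \<and> x \<le> y \<and> y \<le> z \<and> z \<le> 1 \<and> x \<in> right_preimage I \<and> z \<in> right_preimage I"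
  then show "y \<in> right_preimage I"
    using I[THEN conjunct2, rule_format, of "(x + 1) / 2" "(y + 1) / 2" "(z + 1) / 2"] by (auto simp: right_preimage_def)
qed

lemma left_preimage_down:
  assumes a: "0 < a" and I: "down I"
  shows "down (left_preimage a I)"
  unfolding down_def
proof (intro conjI allI impI)
  show "left_preimage a I \<in> sets borel" using left_preimage_borel[OF a] I by (auto simp: down_def)
  fix x y :: real assume h: "0 < x \<and> x \<le> y \<and> y \<le> 1 \<and> y \<in> left_preimage a I"
  then have "0 < left_inv a x" "left_inv a x \<le> left_inv a y" "left_inv a y \<le> 1" "left_inv a y \<in> I"
    using lr_rng[OF a, of x] lr_rng[OF a, of y] monoD[OF left_inv_mono[OF a], of x y] by (auto simp: left_preimage_def)
  then have "left_inv a x \<in> I" using I unfolding down_def by blast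
  then show "x \<in> left_preimage a I" by (simp add: left_preimage_def)
qed

lemma left_preimage_up:
  assumes a: "0 < a" and I: "up I"
  shows "up (left_preimage a I)"
  unfolding up_def
proof (intro conjI allI impI)
  show "left_preimage a I \<in> sets borel" using left_preimage_borel[OF a] I by (auto simp: up_def)
  fix x y :: real assume h: "0 < x \<and> x \<le> y \<and> y \<le> 1 \<and> x \<in> left_preimage a I"
  then have "0 < left_inv a x" "left_inv a x \<le> left_inv a y" "left_inv a y \<le> 1" "left_inv a x \<in> I"
    using lr_rng[OF a, of x] lr_rng[OF a, of y] monoD[OF left_inv_mono[OF a], of x y] by (auto simp: left_preimage_def)
  then have "left_inv a y \<in> I" using I unfolding up_def by blast
  then show "y \<in> left_preimage a I" by (simp add: left_preimage_def)
qed

lemma right_preimage_down: "down (right_preimage I)" if "down I"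
  unfolding down_def
proof (intro conjI allI impI)
  show "right_preimage I \<in> sets borel" using right_preimage_borel that by (auto simp: down_def)
  fix x y :: real assume "0 < x \<and> x \<le> y \<and> y \<le> 1 \<and> y \<in> right_preimage I"
  then show "x \<in> right_preimage I"
    using that[unfolded down_def, THEN conjunct2, rule_format, of "(x + 1) / 2" "(y + 1) / 2"] by (auto simp: right_preimage_def)
qed

lemma right_preimage_up: "up (right_preimage I)" if "up I"
  unfolding up_def
proof (intro conjI allI impI)
  show "right_preimage I \<in> sets borel" using right_preimage_borel that by (auto simp: up_def)
  fix x y :: real assume "0 < x \<and> x \<le> y \<and> y \<le> 1 \<and> x \<in> right_preimage I"
  then show "y \<in> right_preimage I"
    using that[unfolded up_def, THEN conjunct2, rule_format, of "(x + 1) / 2" "(y + 1) / 2"] by (auto simp: right_preimage_def)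
qed

text \<open>A down set that reaches the right half contains the whole left half; one that does not
  reach it meets only the left branch. Up sets behave symmetrically. So at most one branch, the one
  carrying \<open>g\<close>, keeps an indicator.\<close>

lemma mon_step:
  assumes a: "param a" and f: "cone_bdd f" and I: "down I \<or> up I"
  shows "\<exists>h g I'. (h = (\<lambda>_. 0) \<or> cone_bdd h) \<and> cone_bdd g \<and> (down I' \<or> up I') \<and>
     (\<forall>x. 0 < x \<longrightarrow> x \<le> 1 \<longrightarrow> Pop a (\<lambda>x. indicator I x * f x) x = h x + indicator I' x * g x) \<and>
     (\<forall>n. (\<integral>x. indicator {..cusp_bound n} x * g x \<partial>U) \<le> (\<integral>x. indicator {..cusp_bound (Suc n)} x * f x \<partial>U))"
proof -
  note a' = paramD[OF a]
  note L = cone_bdd_Lop[OF a f] and R = cone_bdd_Rop[OF f]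
  have LX: "\<forall>n. (\<integral>x. indicator {..cusp_bound n} x * Lop a f x \<partial>U) \<le> (\<integral>x. indicator {..cusp_bound (Suc n)} x * f x \<partial>U)"
    and RX: "\<forall>n. (\<integral>x. indicator {..cusp_bound n} x * Rop f x \<partial>U) \<le> (\<integral>x. indicator {..cusp_bound (Suc n)} x * f x \<partial>U)"
    using Lop_cusp_bound_le[OF a f] Rop_cusp_bound_le[OF a f] by auto
  show ?thesis
  proof (cases "\<exists>y. 0 < y \<and> y \<le> 1 \<and> (if down I then y \<in> right_preimage I else y \<in> left_preimage a I)")
    case ex: True
    show ?thesis
    proof (cases "down I")
      case True
      with ex obtain y where y: "0 < y" "y \<le> 1" "(y + 1) / 2 \<in> I" by (auto simp: right_preimage_def)
      have "x \<in> left_preimage a I" if "0 < x" "x \<le> 1" for x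
        using True[unfolded down_def] y lr_rng[OF a'(1) that] lr_rng[OF a'(1) y(1,2)] unfolding left_preimage_def
        by (meson less_imp_le order_trans vimageI2)
      then have "Pop a (\<lambda>x. indicator I x * f x) x = Lop a f x + indicator (right_preimage I) x * Rop f x" if "0 < x" "x \<le> 1" for x
        using that by (simp add: Pop_ind)
      then show ?thesis
        using L R RX right_preimage_down[OF True] by (intro exI[of _ "Lop a f"] exI[of _ "Rop f"] exI[of _ "right_preimage I"]) auto
    next
      case False
      then have up: "up I" using I by auto
      from False ex obtain y where y: "0 < y" "y \<le> 1" "left_inv a y \<in> I" by (auto simp: left_preimage_def)
      have "x \<in> right_preimage I" if "0 < x" "x \<le> 1" for x
        using up[unfolded up_def] y lr_rng[OF a'(1) that] lr_rng[OF a'(1) y(1,2)] unfolding right_preimage_def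
        by (meson less_imp_le order_trans vimageI2)
      then have "Pop a (\<lambda>x. indicator I x * f x) x = Rop f x + indicator (left_preimage a I) x * Lop a f x" if "0 < x" "x \<le> 1" for x
        using that by (simp add: Pop_ind)
      then show ?thesis
        using L R LX left_preimage_up[OF a'(1) up] by (intro exI[of _ "Rop f"] exI[of _ "Lop a f"] exI[of _ "left_preimage a I"]) auto
    qed
  next
    case none: False
    show ?thesis
    proof (cases "down I")
      case True
      have "Pop a (\<lambda>x. indicator I x * f x) x = 0 + indicator (left_preimage a I) x * Lop a f x" if "0 < x" "x \<le> 1" for x
        using that none True by (auto simp: Pop_ind)
      then show ?thesis
        using L LX left_preimage_down[OF a'(1) True] by (intro exI[of _ "\<lambda>_. 0"] exI[of _ "Lop a f"] exI[of _ "left_preimage a I"]) auto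
    next
      case False
      then have up: "up I" using I by auto
      have "Pop a (\<lambda>x. indicator I x * f x) x = 0 + indicator (right_preimage I) x * Rop f x" if "0 < x" "x \<le> 1" for x
        using that none False by (auto simp: Pop_ind)
      then show ?thesis
        using R RX right_preimage_up[OF up] by (intro exI[of _ "\<lambda>_. 0"] exI[of _ "Rop f"] exI[of _ "right_preimage I"]) auto
    qed
  qed
qed

lemma cone_Pn_0: "admissible a \<Longrightarrow> h = (\<lambda>_. 0) \<or> cone_bdd h \<Longrightarrow> cone (Pn a n k h)"
  using cone_const[of 0] by (auto simp: Pn_0 cone_bdd_def intro: cone_Pn)

text \<open>
  The boundary point of a monotone set cuts only one of the two branches; the other one contributes a
  function of the cone. So \<open>H\<close> is carried by a single branch of the \<open>n\<close>-th iterate, and since \<open>f\<close> is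
  decreasing, no cylinder has more mass than the leftmost one.
\<close>

lemma mon_decomp:
  assumes a: "admissible a" and "cone_bdd f" "down I \<or> up I"
  shows "\<exists>F H. cone F \<and> H \<in> borel_measurable borel \<and> integrable U H \<and>
     (\<forall>x. 0 < x \<longrightarrow> x \<le> 1 \<longrightarrow> 0 \<le> H x \<and> Pn a n k (\<lambda>x. indicator I x * f x) x = F x + H x) \<and>
     (\<integral>x. H x \<partial>U) \<le> (\<integral>x. indicator {..cusp_bound n} x * f x \<partial>U)"
  using assms(2,3)
proof (induction n arbitrary: k f I)
  case 0
  have I: "I \<in> sets borel" using 0 by (auto simp: down_def up_def)
  note [measurable] = cone_bdd_measurable[OF 0(1)] I
  have nn: "0 \<le> f x" if "0 < x" "x \<le> 1" for x using 0 reg_nonneg that by (auto simp: cone_bdd_def)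
  have i: "integrable U (\<lambda>x. indicator I x * f x)" by (rule cone_bdd_ind_integrable[OF 0(1) I])
  have "(\<integral>x. indicator I x * f x \<partial>U) \<le> (\<integral>x. f x \<partial>U)"
    by (intro integral_mono_AE AE_U_I i cone_bdd_integrable[OF 0(1)]) (use nn in \<open>auto split: split_indicator\<close>)
  then show ?case
    using i cone_const[of 0] nn
    by (intro exI[of _ "\<lambda>_. 0"] exI[of _ "\<lambda>x. indicator I x * f x"]) (auto simp: integral_ind_X0 simp del: cusp_bound_0)
next
  case (Suc n)
  from mon_step[OF admissibleD(1)[OF a] Suc.prems, of k] obtain h g I' where
    h: "h = (\<lambda>_. 0) \<or> cone_bdd h" and g: "cone_bdd g" and I': "down I' \<or> up I'" and
    eq: "\<And>x. 0 < x \<Longrightarrow> x \<le> 1 \<Longrightarrow> Pop (a k) (\<lambda>x. indicator I x * f x) x = h x + indicator I' x * g x" and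
    le: "\<And>n. (\<integral>x. indicator {..cusp_bound n} x * g x \<partial>U) \<le> (\<integral>x. indicator {..cusp_bound (Suc n)} x * f x \<partial>U)"
    by blast
  from Suc.IH[OF g I', of "k + 1"] obtain F H where FH: "cone F" "H \<in> borel_measurable borel" "integrable U H"
    "\<And>x. 0 < x \<Longrightarrow> x \<le> 1 \<Longrightarrow> 0 \<le> H x \<and> Pn a n (k + 1) (\<lambda>x. indicator I' x * g x) x = F x + H x"
    "(\<integral>x. H x \<partial>U) \<le> (\<integral>x. indicator {..cusp_bound n} x * g x \<partial>U)" by blast
  have "Pn a (Suc n) k (\<lambda>x. indicator I x * f x) x = (Pn a n (k + 1) h x + F x) + H x" if "0 < x" "x \<le> 1" for x
  proof -
    have "Pn a (Suc n) k (\<lambda>x. indicator I x * f x) x = Pn a n (k + 1) (\<lambda>x. h x + indicator I' x * g x) x"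
      unfolding Pn.simps by (intro Pn_cong admissibleD(2)[OF a] eq that)
    also have "\<dots> = Pn a n (k + 1) h x + Pn a n (k + 1) (\<lambda>x. indicator I' x * g x) x" unfolding Pn_plus ..
    finally show ?thesis using FH(4)[OF that] by simp
  qed
  moreover have "cone (\<lambda>x. Pn a n (k + 1) h x + F x)" by (intro cone_add cone_Pn_0 a h FH)
  ultimately show ?case
    using FH le[of n] by (intro exI[of _ "\<lambda>x. Pn a n (k + 1) h x + F x"] exI[of _ H]) auto
qed

text \<open>As long as the interval lies on one side of the branch point, a single branch carries
  it. When it first meets both sides, it becomes an up set for the left branch and a down set for
  the right one, and \<open>mon_decomp\<close> takes over for each; hence the factor 2.\<close>

lemma conv_decomp:
  assumes a: "admissible a" and "cone_bdd f" "conv I"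
  shows "\<exists>F H. cone F \<and> H \<in> borel_measurable borel \<and> integrable U H \<and>
     (\<forall>x. 0 < x \<longrightarrow> x \<le> 1 \<longrightarrow> 0 \<le> H x \<and> Pn a n k (\<lambda>x. indicator I x * f x) x = F x + H x) \<and>
     (\<integral>x. H x \<partial>U) \<le> 2 * (\<integral>x. indicator {..cusp_bound n} x * f x \<partial>U)"
  using assms(2,3)
proof (induction n arbitrary: k f I)
  case 0
  have I: "I \<in> sets borel" using 0 by (auto simp: conv_def)
  note [measurable] = cone_bdd_measurable[OF 0(1)] I
  have nn: "0 \<le> f x" if "0 < x" "x \<le> 1" for x using 0 reg_nonneg that by (auto simp: cone_bdd_def)
  have i: "integrable U (\<lambda>x. indicator I x * f x)" by (rule cone_bdd_ind_integrable[OF 0(1) I])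
  have "(\<integral>x. indicator I x * f x \<partial>U) \<le> (\<integral>x. f x \<partial>U)"
    by (intro integral_mono_AE AE_U_I i cone_bdd_integrable[OF 0(1)]) (use nn in \<open>auto split: split_indicator\<close>)
  also have "\<dots> \<le> 2 * (\<integral>x. f x \<partial>U)" using cone_integral_nonneg 0 by (auto simp: cone_bdd_def)
  finally show ?case
    using i cone_const[of 0] nn
    by (intro exI[of _ "\<lambda>_. 0"] exI[of _ "\<lambda>x. indicator I x * f x"]) (auto simp: integral_ind_X0 simp del: cusp_bound_0)
next
  case (Suc n)
  let ?L = "Lop (a k) f" and ?R = "Rop f"
  note ak = admissibleD[OF a, of k]
  note L = cone_bdd_Lop[OF ak(1) Suc.prems(1)] and R = cone_bdd_Rop[OF Suc.prems(1)]
  note LX = Lop_cusp_bound_le[OF ak(1) Suc.prems(1), of n] and RX = Rop_cusp_bound_le[OF ak(1) Suc.prems(1), of n]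
  have red: "Pn a (Suc n) k (\<lambda>x. indicator I x * f x) x
      = Pn a n (k + 1) (\<lambda>x. indicator (left_preimage (a k) I) x * ?L x) x + Pn a n (k + 1) (\<lambda>x. indicator (right_preimage I) x * ?R x) x" for x
    unfolding Pn.simps Pop_ind Pn_plus ..
  have Pz: "Pn a n (k + 1) g x = 0" if "\<And>x. 0 < x \<Longrightarrow> x \<le> 1 \<Longrightarrow> g x = 0" "0 < x" "x \<le> 1" for g x
    using Pn_cong[of a g "\<lambda>_. 0" x n "k + 1"] admissibleD(2)[OF a] that by (simp add: Pn_0)
  consider (l) "\<And>x. 0 < x \<Longrightarrow> x \<le> 1 \<Longrightarrow> x \<notin> right_preimage I" | (r) "\<And>x. 0 < x \<Longrightarrow> x \<le> 1 \<Longrightarrow> x \<notin> left_preimage (a k) I"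
    | (b) y z where "0 < y" "y \<le> 1" "y \<in> left_preimage (a k) I" "0 < z" "z \<le> 1" "z \<in> right_preimage I" by blast
  then show ?case
  proof cases
    case l
    from Suc.IH[OF L left_preimage_conv[OF ak(2) Suc.prems(2)], of "k + 1"] obtain F H where FH: "cone F" "H \<in> borel_measurable borel" "integrable U H"
      "\<And>x. 0 < x \<Longrightarrow> x \<le> 1 \<Longrightarrow> 0 \<le> H x \<and> Pn a n (k + 1) (\<lambda>x. indicator (left_preimage (a k) I) x * ?L x) x = F x + H x"
      "(\<integral>x. H x \<partial>U) \<le> 2 * (\<integral>x. indicator {..cusp_bound n} x * ?L x \<partial>U)" by blast
    have "Pn a (Suc n) k (\<lambda>x. indicator I x * f x) x = F x + H x" if "0 < x" "x \<le> 1" for x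
      unfolding red using FH(4)[OF that] Pz[of "\<lambda>x. indicator (right_preimage I) x * ?R x" x] l that by auto
    then show ?thesis using FH LX by (intro exI[of _ F] exI[of _ H]) auto
  next
    case r
    from Suc.IH[OF R right_preimage_conv[OF Suc.prems(2)], of "k + 1"] obtain F H where FH: "cone F" "H \<in> borel_measurable borel" "integrable U H"
      "\<And>x. 0 < x \<Longrightarrow> x \<le> 1 \<Longrightarrow> 0 \<le> H x \<and> Pn a n (k + 1) (\<lambda>x. indicator (right_preimage I) x * ?R x) x = F x + H x"
      "(\<integral>x. H x \<partial>U) \<le> 2 * (\<integral>x. indicator {..cusp_bound n} x * ?R x \<partial>U)" by blast
    have "Pn a (Suc n) k (\<lambda>x. indicator I x * f x) x = F x + H x" if "0 < x" "x \<le> 1" for x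
      unfolding red using FH(4)[OF that] Pz[of "\<lambda>x. indicator (left_preimage (a k) I) x * ?L x" x] r that by auto
    then show ?thesis using FH RX by (intro exI[of _ F] exI[of _ H]) auto
  next
    case b
    have bor: "left_preimage (a k) I \<in> sets borel" "right_preimage I \<in> sets borel"
      using left_preimage_borel[OF ak(2)] right_preimage_borel Suc.prems(2) by (auto simp: conv_def)
    have cI: "v \<in> I" if "0 < u" "u \<le> v" "v \<le> w" "w \<le> 1" "u \<in> I" "w \<in> I" for u v w
      using Suc.prems(2) that unfolding conv_def by blast
    have yz: "left_inv (a k) y \<in> I" "(z + 1) / 2 \<in> I" using b by (auto simp: left_preimage_def right_preimage_def)
    have up: "up (left_preimage (a k) I)"
      unfolding up_def
    proof (intro conjI allI impI bor)
      fix u v :: real assume h: "0 < u \<and> u \<le> v \<and> v \<le> 1 \<and> u \<in> left_preimage (a k) I"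
      then have "left_inv (a k) v \<in> I"
        using lr_rng[OF ak(2), of u] lr_rng[OF ak(2), of v] lr_rng[OF ak(2) b(4,5)] monoD[OF left_inv_mono[OF ak(2)], of u v] yz
        by (intro cI[of "left_inv (a k) u" "left_inv (a k) v" "(z + 1) / 2"]) (simp_all add: left_preimage_def)
      then show "v \<in> left_preimage (a k) I" by (simp add: left_preimage_def)
    qed
    from mon_decomp[OF a L disjI2[OF up], of n "k + 1"] obtain F H where FH: "cone F" "H \<in> borel_measurable borel" "integrable U H"
      "\<And>x. 0 < x \<Longrightarrow> x \<le> 1 \<Longrightarrow> 0 \<le> H x \<and> Pn a n (k + 1) (\<lambda>x. indicator (left_preimage (a k) I) x * ?L x) x = F x + H x"
      "(\<integral>x. H x \<partial>U) \<le> (\<integral>x. indicator {..cusp_bound n} x * ?L x \<partial>U)" by blast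
    have down: "down (right_preimage I)"
      unfolding down_def
    proof (intro conjI allI impI bor)
      fix u v :: real assume h: "0 < u \<and> u \<le> v \<and> v \<le> 1 \<and> v \<in> right_preimage I"
      then have "(u + 1) / 2 \<in> I"
        using lr_rng[OF ak(2) b(1,2)] yz
        by (intro cI[of "left_inv (a k) y" "(u + 1) / 2" "(v + 1) / 2"]) (simp_all add: right_preimage_def)
      then show "u \<in> right_preimage I" by (simp add: right_preimage_def)
    qed
    from mon_decomp[OF a R disjI1[OF down], of n "k + 1"] obtain F' H' where FH': "cone F'" "H' \<in> borel_measurable borel" "integrable U H'"
      "\<And>x. 0 < x \<Longrightarrow> x \<le> 1 \<Longrightarrow> 0 \<le> H' x \<and> Pn a n (k + 1) (\<lambda>x. indicator (right_preimage I) x * ?R x) x = F' x + H' x"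
      "(\<integral>x. H' x \<partial>U) \<le> (\<integral>x. indicator {..cusp_bound n} x * ?R x \<partial>U)" by blast
    have "Pn a (Suc n) k (\<lambda>x. indicator I x * f x) x = (F x + F' x) + (H x + H' x)" if "0 < x" "x \<le> 1" for x
      unfolding red using FH(4)[OF that] FH'(4)[OF that] by simp
    moreover have "(\<integral>x. H x + H' x \<partial>U) \<le> 2 * (\<integral>x. indicator {..cusp_bound (Suc n)} x * f x \<partial>U)"
      using FH FH' LX RX by simp
    ultimately show ?thesis
      using FH FH' by (intro exI[of _ "\<lambda>x. F x + F' x"] exI[of _ "\<lambda>x. H x + H' x"]) (auto intro: cone_add)
  qed
qed

section \<open>The gap of order sqrt n and the resulting mixing estimate\<close>

definition root_up :: "nat \<Rightarrow> nat" where
  "root_up n = nat \<lceil>sqrt (real n)\<rceil>"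

lemma root_up_ge: "sqrt (real n) \<le> real (root_up n)"
  unfolding root_up_def by (simp add: real_nat_ceiling_ge)

lemma root_up_le: "real (root_up n) \<le> sqrt (real n) + 1"
  unfolding root_up_def using ceiling_correct[of "sqrt (real n)"] by (simp add: less_imp_le)

definition cusp_mass :: "nat \<Rightarrow> real" where
  "cusp_mass n = a0 * (cusp_bound (root_up n) powr (1 - G) / (1 - G))"

lemma cusp_mass_nonneg: "0 \<le> cusp_mass n"
  using a0_gt G1 by (auto simp: cusp_mass_def intro!: mult_nonneg_nonneg divide_nonneg_pos)

text \<open>With \<open>e = (1 - G) / G\<close> the product has order n to the power 1 - e/2, and
  \<open>2 < e\<close> is equivalent to \<open>G < 1/3\<close>.\<close>

lemma cusp_mass_small: "(\<lambda>n. real n * cusp_mass n) \<longlonglongrightarrow> 0"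
proof (rule tendsto_sandwich[of "\<lambda>_. 0"])
  show "\<forall>\<^sub>F n in sequentially. real n * cusp_mass n \<le> real n * (a0 * (((1 + G * sqrt (real n) / 4) powr (- 1 / G)) powr (1 - G) / (1 - G)))"
  proof (intro always_eventually allI)
    fix n
    have "cusp_bound (root_up n) \<le> (1 + G * sqrt (real n) / 4) powr (- 1 / G)"
      unfolding cusp_bound_def using root_up_ge[of n] G0
      by (intro powr_mono2') (auto intro!: add_pos_nonneg mult_left_mono divide_right_mono)
    then have "cusp_bound (root_up n) powr (1 - G) \<le> ((1 + G * sqrt (real n) / 4) powr (- 1 / G)) powr (1 - G)"
      using cusp_bound_pos[of "root_up n"] G1 by (intro powr_mono2) auto
    then show "real n * cusp_mass n \<le> real n * (a0 * (((1 + G * sqrt (real n) / 4) powr (- 1 / G)) powr (1 - G) / (1 - G)))"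
      unfolding cusp_mass_def using a0_gt G1 by (intro mult_left_mono divide_right_mono) auto
  qed
  show "\<forall>\<^sub>F n in sequentially. 0 \<le> real n * cusp_mass n"
    using cusp_mass_nonneg by (intro always_eventually allI mult_nonneg_nonneg) auto
  show "(\<lambda>n. real n * (a0 * (((1 + G * sqrt (real n) / 4) powr (- 1 / G)) powr (1 - G) / (1 - G)))) \<longlonglongrightarrow> 0"
  proof -
    define e where "e = (1 - G) / G"
    have e: "2 < e" using G0 G1 by (simp add: e_def field_simps)
    have "(\<lambda>n. real n * (a0 * ((1 + G * sqrt (real n) / 4) powr (- e) / (1 - G)))) \<longlonglongrightarrow> 0"
      using G0 G1 a0_gt e by real_asymp
    moreover have "- 1 / G * (1 - G) = - e" using G0 by (simp add: e_def field_simps)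
    ultimately show ?thesis unfolding powr_powr by simp
  qed
qed auto

lemma cusp_mass_cusp_bound: "cone f \<Longrightarrow> pole_bound a0 f \<Longrightarrow> (\<integral>x. indicator {..cusp_bound (root_up n)} x * f x \<partial>U) \<le> cusp_mass n"
  unfolding cusp_mass_def using cusp_bound_pos[of "root_up n"] cusp_bound_le_1[of "root_up n"] by (intro cone_integral_near_0) auto

lemma nrm_nonneg_eq:
  assumes "f \<in> borel_measurable borel" "\<And>x. 0 < x \<Longrightarrow> x \<le> 1 \<Longrightarrow> 0 \<le> f x"
  shows "nrm f = (\<integral>x. f x \<partial>U)"
  using assms by (intro integral_U_cong) auto

text \<open>The gap consists of three stretches of \<open>root_up n\<close> steps. The first turns
  the indicator into a function \<open>F\<close> of the cone, with pole constant \<open>a0\<close>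
  although its mass may be as small as \<open>M\<close>. The second discards what stays on the left
  branch and leaves a remainder \<open>r\<close> whose constant is \<open>a0\<close> times the mass
  of \<open>F\<close>. Normalised, \<open>r\<close> is a density as required by
  \<open>memory_loss\<close>, which over the third stretch compares it with the fibre
  density.\<close>

lemma mixing_aux:
  fixes k :: int
  assumes \<eta>: "0 \<le> \<eta>"
    and N: "\<And>a j f g. admissible a \<Longrightarrow> cone_dens \<kappa>0 f \<Longrightarrow> cone_dens \<kappa>0 g \<Longrightarrow>
      nrm (\<lambda>x. Pn a (root_up n) j f x - Pn a (root_up n) j g x) \<le> \<eta>"
    and a: "admissible a" and I: "conv I"
  defines "M \<equiv> (\<integral>x. indicator I x * fibre_dens a k x \<partial>U)"
  shows "nrm (\<lambda>x. Pn a (3 * root_up n) k (\<lambda>x. indicator I x * fibre_dens a k x) x - M * fibre_dens a (k + int (3 * root_up n)) x)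
    \<le> 10 * cusp_mass n + M * \<eta>"
proof -
  define j where "j = root_up n"
  have pos: "\<And>j. 0 < a j" using admissibleD(2)[OF a] .
  note h = cone_fibre_dens[OF a] and hD = cone_densD[OF cone_dens_fibre_dens[OF a]]
  have Ib: "I \<in> sets borel" using I by (simp add: conv_def)
  note [measurable] = Ib hD(5)
  have rb: "cone_bdd (fibre_dens a k)" using h a0_gt by (auto simp: cone_bdd_def intro!: exI[of _ a0])
  define f where "f = (\<lambda>x. indicator I x * fibre_dens a k x)"
  have fm: "f \<in> borel_measurable borel" unfolding f_def by measurable
  have fi: "integrable U f" unfolding f_def by (rule cone_bdd_ind_integrable[OF rb Ib])
  obtain F H where FH: "cone F" "H \<in> borel_measurable borel" "integrable U H"
    "\<And>x. 0 < x \<Longrightarrow> x \<le> 1 \<Longrightarrow> 0 \<le> H x \<and> Pn a j k f x = F x + H x"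
    "(\<integral>x. H x \<partial>U) \<le> 2 * (\<integral>x. indicator {..cusp_bound j} x * fibre_dens a k x \<partial>U)"
    using conv_decomp[OF a rb I, of j k] unfolding f_def by blast
  have Ht: "(\<integral>x. H x \<partial>U) \<le> 2 * cusp_mass n" using FH(5) cusp_mass_cusp_bound[OF h, of n k] by (simp add: j_def)
  let ?k1 = "k + int j" let ?k2 = "k + int j + int j" let ?k3 = "k + int j + int j + int j"
  have Fh: "F x \<le> fibre_dens a ?k1 x" if "0 < x" "x \<le> 1" for x
  proof -
    have "F x \<le> Pn a j k f x" using FH(4)[OF that] by linarith
    also have "\<dots> \<le> Pn a j k (fibre_dens a k) x"
      by (rule Pn_mono[of a, OF pos _ that]) (use reg_nonneg[OF h(1)] in \<open>auto simp: f_def split: split_indicator\<close>)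
    finally show ?thesis using Pn_fibre_dens[OF a that] by simp
  qed
  have Fb: "pole_bound a0 F"
    unfolding pole_bound_def using Fh pole_boundD[OF h(2)] by (meson order_trans)
  have Fi: "integrable U F" using FH(1) Fb by (rule cone_integrable)
  define L where "L = Ln a j ?k1 F"
  define r where "r = (\<lambda>x. Pn a j ?k1 F x - Ln a j ?k1 F x)"
  have L: "cone L" "pole_bound a0 L" using cone_Ln[OF a FH(1)] pole_bound_Ln[OF a Fb] a0_gt by (auto simp: L_def)
  have Li: "integrable U L" using L by (rule cone_integrable)
  have r: "cone r" "pole_bound (a0 * (\<integral>x. F x \<partial>U)) r" using Pn_minus_Ln_cone[OF a FH(1) Fb] by (auto simp: r_def)
  have ri: "integrable U r" using r by (rule cone_integrable)
  have Lt: "(\<integral>x. L x \<partial>U) \<le> cusp_mass n"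
    unfolding L_def using Ln_mass[OF a FH(1) Fb, of j ?k1] cusp_mass_cusp_bound[OF FH(1) Fb, of n] a0_gt by (simp add: j_def)
  define m where "m = (\<integral>x. r x \<partial>U)"
  have m0: "0 \<le> m" unfolding m_def using cone_integral_nonneg[OF r(1)] .
  have H0: "0 \<le> (\<integral>x. H x \<partial>U)" using FH(4) by (intro integral_nonneg_AE AE_U_I) auto
  have L0: "0 \<le> (\<integral>x. L x \<partial>U)" using cone_integral_nonneg[OF L(1)] .
  have FM: "(\<integral>x. F x \<partial>U) + (\<integral>x. H x \<partial>U) = M"
  proof -
    have "M = (\<integral>x. Pn a j k f x \<partial>U)" unfolding M_def using Pn_integral[of a, OF pos fm fi, of j k] by (simp add: f_def)
    also have "\<dots> = (\<integral>x. F x + H x \<partial>U)"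
      using FH fm reg_measurable[OF FH(1)] by (intro integral_U_cong Pn_measurable pos borel_measurable_add) auto
    finally show ?thesis using Fi FH(3) by simp
  qed
  have Fm: "(\<integral>x. F x \<partial>U) = (\<integral>x. L x \<partial>U) + m"
  proof -
    have "(\<integral>x. F x \<partial>U) = (\<integral>x. Pn a j ?k1 F x \<partial>U)" using Pn_integral[of a, OF pos reg_measurable[OF FH(1)] Fi] by simp
    also have "\<dots> = (\<integral>x. L x + r x \<partial>U)" by (simp add: L_def r_def)
    finally show ?thesis using Li ri by (simp add: m_def)
  qed
  define A where "A = (\<lambda>x. Pn a j ?k2 r x - m * fibre_dens a ?k3 x)"
  have Pri: "integrable U (Pn a j ?k2 r)" "Pn a j ?k2 r \<in> borel_measurable borel"
    using Pn_integrable[of a, OF pos reg_measurable[OF r(1)] ri] Pn_measurable[of a, OF pos reg_measurable[OF r(1)]] by auto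
  have Ai: "integrable U A" unfolding A_def using Pri hD by auto
  \<comment> \<open>If \<open>r\<close> keeps at least half of the mass of \<open>F\<close>,
    normalising it at most doubles the pole constant, which \<kappa>0 tolerates. Otherwise
    \<open>m\<close> is at most the mass of \<open>L\<close>, and the trivial bound
    \<open>2 * m\<close> for the norm suffices.\<close>
  have main: "nrm A \<le> M * \<eta> + 4 * cusp_mass n"
  proof (cases "0 < m \<and> (\<integral>x. F x \<partial>U) / 2 \<le> m")
    case True
    define g where "g = (\<lambda>x. (1 / m) * r x)"
    have "cone g" unfolding g_def using r True by (intro cone_scale) auto
    moreover have "pole_bound (2 * a0) g"
    proof -
      have "pole_bound (1 / m * (a0 * (\<integral>x. F x \<partial>U))) g" unfolding g_def using True r by (intro pole_bound_scale) auto
      moreover have "1 / m * (a0 * (\<integral>x. F x \<partial>U)) \<le> 2 * a0"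
        using True a0_gt by (simp add: pos_divide_le_eq)
      ultimately show ?thesis by (rule pole_bound_mono)
    qed
    moreover have "(\<integral>x. g x \<partial>U) = 1" using True by (simp add: g_def m_def)
    ultimately have g: "cone_dens \<kappa>0 g" using \<kappa>0 by (auto intro: cone_dens_mono simp: cone_dens_def intro: pole_bound_mono)
    have hk: "cone_dens \<kappa>0 (fibre_dens a ?k2)" by (rule cone_dens_mono[OF cone_dens_fibre_dens[OF a] \<kappa>0(2)])
    have mg: "Pn a j ?k2 r = (\<lambda>x. m * Pn a j ?k2 g x)" unfolding g_def Pn_scale using True by auto
    have "nrm A = nrm (\<lambda>x. m * (Pn a j ?k2 g x - Pn a j ?k2 (fibre_dens a ?k2) x))"
      unfolding A_def mg
      using Pn_fibre_dens[OF a, of _ j ?k2] Pn_measurable[of a, OF pos cone_densD(5)[OF g]] Pn_measurable[of a, OF pos hD(5)]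
      by (intro integral_U_cong) (auto simp: right_diff_distrib)
    also have "\<dots> = m * nrm (\<lambda>x. Pn a j ?k2 g x - Pn a j ?k2 (fibre_dens a ?k2) x)" unfolding nrm_scale using True by simp
    also have "\<dots> \<le> m * \<eta>" using N[OF a g hk] True unfolding j_def by (intro mult_left_mono) auto
    also have "\<dots> \<le> M * \<eta>" using FM Fm H0 L0 \<eta> by (intro mult_right_mono) auto
    finally show ?thesis using cusp_mass_nonneg[of n] by linarith
  next
    case False
    have m2: "m \<le> 2 * cusp_mass n"
    proof (cases "m = 0")
      case False
      then show ?thesis using \<open>\<not> (0 < m \<and> _)\<close> m0 Fm Lt cusp_mass_nonneg[of n] by (auto simp: not_le)
    qed (use cusp_mass_nonneg in auto)
    have "nrm A \<le> nrm (Pn a j ?k2 r) + nrm (\<lambda>x. m * fibre_dens a ?k3 x)"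
      unfolding A_def using Pri hD by (intro nrm_minus_triangle) auto
    moreover have "nrm (Pn a j ?k2 r) \<le> m"
      using nrm_Pn[of a, OF pos reg_measurable[OF r(1)] ri, of j ?k2] nrm_nonneg_eq[OF reg_measurable[OF r(1)]] reg_nonneg[OF r(1)]
      by (simp add: m_def)
    moreover have "nrm (\<lambda>x. m * fibre_dens a ?k3 x) = m" unfolding nrm_scale nrm_cone_dens[OF cone_dens_fibre_dens[OF a]] using m0 by simp
    moreover have "0 \<le> M * \<eta>" using FM Fm H0 L0 m0 \<eta> by (intro mult_nonneg_nonneg) auto
    ultimately show ?thesis using m2 by linarith
  qed
  define B where "B = Pn a (j + j) ?k1 H"
  define C where "C = Pn a j ?k2 L"
  have Bi: "integrable U B" "B \<in> borel_measurable borel" "nrm B \<le> 2 * cusp_mass n"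
  proof -
    show "integrable U B" "B \<in> borel_measurable borel" unfolding B_def
      using Pn_integrable[of a, OF pos FH(2,3)] Pn_measurable[of a, OF pos FH(2)] by auto
    have "nrm B \<le> nrm H" unfolding B_def by (rule nrm_Pn[of a, OF pos FH(2,3)])
    also have "\<dots> = (\<integral>x. H x \<partial>U)" using FH by (intro nrm_nonneg_eq) auto
    finally show "nrm B \<le> 2 * cusp_mass n" using Ht by simp
  qed
  have Ci: "integrable U C" "C \<in> borel_measurable borel" "nrm C \<le> cusp_mass n"
  proof -
    have Lm: "L \<in> borel_measurable borel" using L reg_measurable by auto
    show "integrable U C" "C \<in> borel_measurable borel" unfolding C_def
      using Pn_integrable[of a, OF pos Lm Li] Pn_measurable[of a, OF pos Lm] by auto
    have "nrm C \<le> nrm L" unfolding C_def by (rule nrm_Pn[of a, OF pos Lm Li])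
    also have "\<dots> = (\<integral>x. L x \<partial>U)" using Lm reg_nonneg[OF L(1)] by (intro nrm_nonneg_eq) auto
    finally show "nrm C \<le> cusp_mass n" using Lt by simp
  qed
  define D where "D = (\<lambda>x. (m - M) * fibre_dens a ?k3 x)"
  have Di: "integrable U D" unfolding D_def using hD by auto
  have Dn: "nrm D \<le> 3 * cusp_mass n"
  proof -
    have "\<bar>m - M\<bar> \<le> 3 * cusp_mass n" using FM Fm H0 L0 Ht Lt by linarith
    then show ?thesis unfolding D_def nrm_scale nrm_cone_dens[OF cone_dens_fibre_dens[OF a]] by simp
  qed
  have eq: "Pn a (3 * j) k f x - M * fibre_dens a ?k3 x = (A x + B x) + (C x + D x)" if x: "0 < x" "x \<le> 1" for x
  proof -
    have "Pn a (3 * j) k f x = Pn a (j + j) ?k1 (Pn a j k f) x"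
      using Pn_add[of a j "j + j" k f] by (simp add: numeral_3_eq_3)
    also have "\<dots> = Pn a (j + j) ?k1 (\<lambda>x. F x + H x) x"
      using FH(4) by (intro Pn_cong pos x) auto
    also have "\<dots> = Pn a (j + j) ?k1 F x + B x" unfolding Pn_plus B_def ..
    also have "Pn a (j + j) ?k1 F = Pn a j ?k2 (\<lambda>x. L x + r x)" unfolding Pn_add by (simp add: L_def r_def)
    also have "\<dots> = (\<lambda>x. C x + Pn a j ?k2 r x)" unfolding Pn_plus C_def ..
    finally show ?thesis by (simp add: A_def D_def algebra_simps)
  qed
  have k3: "k + int (3 * j) = ?k3" by simp
  have "nrm (\<lambda>x. Pn a (3 * j) k f x - M * fibre_dens a ?k3 x) = nrm (\<lambda>x. (A x + B x) + (C x + D x))"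
  proof (rule integral_U_cong)
    have [measurable]: "Pn a (3 * j) k f \<in> borel_measurable borel" by (rule Pn_measurable[of a, OF pos fm])
    note [measurable] = Pri(2) Bi(2) Ci(2)
    show "(\<lambda>x. \<bar>Pn a (3 * j) k f x - M * fibre_dens a ?k3 x\<bar>) \<in> borel_measurable borel" by measurable
    show "(\<lambda>x. \<bar>(A x + B x) + (C x + D x)\<bar>) \<in> borel_measurable borel" unfolding A_def D_def by measurable
  qed (simp only: eq less_imp_le)
  moreover have "\<dots> \<le> nrm (\<lambda>x. A x + B x) + nrm (\<lambda>x. C x + D x)"
    using Ai Bi Ci Di by (intro nrm_triangle) auto
  moreover have "nrm (\<lambda>x. A x + B x) \<le> nrm A + nrm B" using Ai Bi by (intro nrm_triangle)
  moreover have "nrm (\<lambda>x. C x + D x) \<le> nrm C + nrm D" using Ci Di by (intro nrm_triangle)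
  \<comment> \<open>The 10 collects 4 from \<open>A\<close>, 2 from \<open>B\<close>, 1 from
    \<open>C\<close> and 3 from \<open>D\<close>.\<close>
  ultimately have "nrm (\<lambda>x. Pn a (3 * j) k f x - M * fibre_dens a ?k3 x) \<le> 10 * cusp_mass n + M * \<eta>"
    using main Bi(3) Ci(3) Dn by linarith
  then show ?thesis unfolding f_def j_def[symmetric] k3 .
qed

lemma root_up_unbounded: "\<exists>N. \<forall>n\<ge>N. m \<le> root_up n"
proof (intro exI allI impI)
  fix n assume "m\<^sup>2 \<le> n"
  then have "real m ^ 2 \<le> real n" by (metis of_nat_le_iff of_nat_power)
  then have "real m \<le> sqrt (real n)" by (simp add: real_le_rsqrt)
  then show "m \<le> root_up n" using root_up_ge[of n] by linarith
qed

text \<open>The factor \<open>n\<close> anticipates that about \<open>n\<close> such errors are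
  added up along an orbit; for targets of mass of order 1/n the right side is a constant times
  \<epsilon>.\<close>

lemma mixing:
  assumes \<epsilon>: "0 < \<epsilon>"
  shows "\<exists>N. \<forall>n\<ge>N. \<forall>a k I. admissible a \<longrightarrow> conv I \<longrightarrow>
    real n * nrm (\<lambda>x. Pn a (3 * root_up n) k (\<lambda>x. indicator I x * fibre_dens a k x) x
        - (\<integral>x. indicator I x * fibre_dens a k x \<partial>U) * fibre_dens a (k + int (3 * root_up n)) x)
    \<le> \<epsilon> * (1 + real n * (\<integral>x. indicator I x * fibre_dens a k x \<partial>U))"
proof -
  obtain N1 where N1: "\<And>n a j f g. N1 \<le> n \<Longrightarrow> admissible a \<Longrightarrow> cone_dens \<kappa>0 f \<Longrightarrow> cone_dens \<kappa>0 g \<Longrightarrow>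
      nrm (\<lambda>x. Pn a n j f x - Pn a n j g x) \<le> \<epsilon>"
    using memory_loss[OF \<epsilon>] by blast
  obtain N2 where N2: "\<And>n. N2 \<le> n \<Longrightarrow> N1 \<le> root_up n" using root_up_unbounded by blast
  have "\<forall>\<^sub>F n in sequentially. real n * cusp_mass n < \<epsilon> / 10"
    by (rule order_tendstoD(2)[OF cusp_mass_small]) (simp add: \<epsilon>)
  then obtain N3 where N3: "\<And>n. N3 \<le> n \<Longrightarrow> real n * cusp_mass n < \<epsilon> / 10"
    unfolding eventually_sequentially by blast
  show ?thesis
  proof (rule exI[of _ "max N2 N3"], intro allI impI)
    fix n a k I assume n: "max N2 N3 \<le> n" and a: "admissible a" and I: "conv I"
    let ?M = "\<integral>x. indicator I x * fibre_dens a k x \<partial>U"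
    have "real n * nrm (\<lambda>x. Pn a (3 * root_up n) k (\<lambda>x. indicator I x * fibre_dens a k x) x - ?M * fibre_dens a (k + int (3 * root_up n)) x)
      \<le> real n * (10 * cusp_mass n + ?M * \<epsilon>)"
      using N1[OF N2] n by (intro mult_left_mono mixing_aux a I less_imp_le[OF \<epsilon>]) auto
    also have "\<dots> = 10 * (real n * cusp_mass n) + \<epsilon> * (real n * ?M)" by (simp add: algebra_simps)
    also have "\<dots> \<le> \<epsilon> * (1 + real n * ?M)" using N3[of n] n by (simp add: algebra_simps)
    finally show "real n * nrm (\<lambda>x. Pn a (3 * root_up n) k (\<lambda>x. indicator I x * fibre_dens a k x) x - ?M * fibre_dens a (k + int (3 * root_up n)) x)
      \<le> \<epsilon> * (1 + real n * ?M)" .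
  qed
qed

end

subsection \<open>Survival probabilities\<close>

primrec Tn :: "(int \<Rightarrow> real) \<Rightarrow> nat \<Rightarrow> int \<Rightarrow> real \<Rightarrow> real" where
  "Tn a 0 k x = x"
| "Tn a (Suc n) k x = Tn a n (k + 1) (lsv_map (a k) x)"

lemma Tn_add: "Tn a (n + m) k x = Tn a m (k + int n) (Tn a n k x)"
  by (induction n arbitrary: k x) (auto simp: add.assoc)

lemma Tn_measurable [measurable]: "Tn a n k \<in> borel_measurable borel"
proof (induction n arbitrary: k)
  case (Suc n)
  have "Tn a (Suc n) k = Tn a n (k + 1) \<circ> lsv_map (a k)" by (auto simp: fun_eq_iff)
  then show ?case by (simp only: measurable_comp[OF lsv_map_measurable Suc.IH])
next
  case 0
  have "Tn a 0 k = (\<lambda>x. x)" by auto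
  then show ?case by simp
qed

lemma integrable_mult_bounded:
  fixes f \<psi> :: "real \<Rightarrow> real"
  assumes f: "integrable U f" "f \<in> borel_measurable borel" and \<psi>: "\<psi> \<in> borel_measurable borel" "\<And>x. \<bar>\<psi> x\<bar> \<le> B"
  shows "integrable U (\<lambda>x. f x * \<psi> x)"
proof (rule Bochner_Integration.integrable_bound)
  show "integrable U (\<lambda>x. B * f x)" using f by auto
  show "(\<lambda>x. f x * \<psi> x) \<in> borel_measurable U" using f \<psi> by measurable
  have "0 \<le> B" using \<psi>(2)[of 0] by linarith
  then show "AE x in U. norm (f x * \<psi> x) \<le> norm (B * f x)"
    using \<psi>(2) by (auto simp: abs_mult mult.commute intro!: mult_right_mono)
qed

lemma Pn_dual:
  fixes f \<psi> :: "real \<Rightarrow> real"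
  assumes a: "\<And>j. 0 < a j" and f: "integrable U f" "f \<in> borel_measurable borel"
    and \<psi>: "\<psi> \<in> borel_measurable borel" "\<And>x. \<bar>\<psi> x\<bar> \<le> B"
  shows "(\<integral>x. Pn a n k f x * \<psi> x \<partial>U) = (\<integral>x. f x * \<psi> (Tn a n k x) \<partial>U)"
  using f
proof (induction n arbitrary: k f)
  case (Suc n)
  have m: "(\<lambda>x. \<psi> (Tn a n (k + 1) x)) \<in> borel_measurable borel"
    using measurable_compose[OF Tn_measurable \<psi>(1)] .
  have m': "(\<lambda>x. \<psi> (Tn a n (k + 1) (lsv_map (a k) x))) \<in> borel_measurable borel"
    using measurable_compose[OF lsv_map_measurable m] .
  have "(\<integral>x. Pn a (Suc n) k f x * \<psi> x \<partial>U) = (\<integral>x. Pop (a k) f x * \<psi> (Tn a n (k + 1) x) \<partial>U)"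
    unfolding Pn.simps using Suc.prems by (intro Suc.IH integrable_Pop Pop_measurable a)
  also have "\<dots> = (\<integral>x. f x * \<psi> (Tn a n (k + 1) (lsv_map (a k) x)) \<partial>U)"
    by (rule integral_Pop_mult[OF a Suc.prems(2) m integrable_mult_bounded[OF Suc.prems m' \<psi>(2)]])
  finally show ?case by simp
qed simp

definition survivors :: "(int \<Rightarrow> real) \<Rightarrow> nat \<Rightarrow> int \<Rightarrow> real set \<Rightarrow> real set" where
  "survivors a N k A = {x. \<forall>j\<in>{1..N}. Tn a j k x \<notin> A}"

lemma ball_atLeast1_Suc: "(\<forall>j\<in>{1..Suc N}. Q j) \<longleftrightarrow> Q 1 \<and> (\<forall>j\<in>{1..N}. Q (Suc j))"
proof (intro iffI ballI)
  fix j assume h: "Q 1 \<and> (\<forall>j\<in>{1..N}. Q (Suc j))" and j: "j \<in> {1..Suc N}"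
  then obtain i where "j = Suc i" by (cases j) auto
  then show "Q j" using h j by (cases "i = 0") auto
qed auto

lemma ball_atLeast1_add:
  fixes g N :: nat
  assumes "g \<le> N"
  shows "(\<forall>j\<in>{1..N}. Q j) \<longleftrightarrow> (\<forall>j\<in>{1..g}. Q j) \<and> (\<forall>j\<in>{1..N - g}. Q (g + j))"
proof (intro iffI ballI)
  fix j assume h: "(\<forall>j\<in>{1..g}. Q j) \<and> (\<forall>j\<in>{1..N - g}. Q (g + j))" and j: "j \<in> {1..N}"
  show "Q j"
  proof (cases "j \<le> g")
    case False
    then have "j - g \<in> {1..N - g}" using j by auto
    then have "Q (g + (j - g))" by (rule h[THEN conjunct2, rule_format])
    then show ?thesis using False by simp
  qed (use h j in auto)
qed (use assms in auto)

lemma survivors_Suc: "x \<in> survivors a (Suc N) k A \<longleftrightarrow> lsv_map (a k) x \<notin> A \<and> lsv_map (a k) x \<in> survivors a N (k + 1) A"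
  unfolding survivors_def mem_Collect_eq ball_atLeast1_Suc by simp

lemma survivors_add:
  assumes "g \<le> N"
  shows "x \<in> survivors a N k A \<longleftrightarrow> (\<forall>j\<in>{1..g}. Tn a j k x \<notin> A) \<and> Tn a g k x \<in> survivors a (N - g) (k + int g) A"
  unfolding survivors_def mem_Collect_eq ball_atLeast1_add[OF assms] Tn_add ..

lemma survivors_borel: "A \<in> sets borel \<Longrightarrow> survivors a N k A \<in> sets borel"
proof -
  assume A: "A \<in> sets borel"
  have "survivors a N k A = (\<Inter>j\<in>{1..N}. Tn a j k -` (- A))" by (auto simp: survivors_def)
  moreover have "Tn a j k -` (- A) \<in> sets borel" for j
    using measurable_sets[OF Tn_measurable, of "- A" a j k] A by auto
  ultimately show ?thesis by (cases "N = 0") (auto simp: survivors_def)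
qed

context lsv
begin

definition fibre_mass :: "(int \<Rightarrow> real) \<Rightarrow> int \<Rightarrow> real set \<Rightarrow> real" where
  "fibre_mass a k A = (\<integral>x. indicator A x * fibre_dens a k x \<partial>U)"

definition surv_mass :: "(int \<Rightarrow> real) \<Rightarrow> nat \<Rightarrow> int \<Rightarrow> real set \<Rightarrow> real" where
  "surv_mass a N k A = (\<integral>x. fibre_dens a k x * indicator (survivors a N k A) x \<partial>U)"

lemma fibre_dens_dual:
  assumes a: "admissible a" and \<psi>: "\<psi> \<in> borel_measurable borel" "\<And>x. \<bar>\<psi> x\<bar> \<le> B"
  shows "(\<integral>x. fibre_dens a k x * \<psi> (Tn a n k x) \<partial>U) = (\<integral>x. fibre_dens a (k + int n) x * \<psi> x \<partial>U)"
proof -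
  note D = cone_densD[OF cone_dens_fibre_dens[OF a]]
  note pos = admissibleD(2)[OF a]
  have "(\<integral>x. fibre_dens a k x * \<psi> (Tn a n k x) \<partial>U) = (\<integral>x. Pn a n k (fibre_dens a k) x * \<psi> x \<partial>U)"
    by (rule Pn_dual[of a, OF pos D(4,5) \<psi>, symmetric])
  also have "\<dots> = (\<integral>x. fibre_dens a (k + int n) x * \<psi> x \<partial>U)"
    using Pn_measurable[of a, OF pos D(5)] D(5) \<psi>(1) by (intro integral_U_cong) (auto simp: Pn_fibre_dens[OF a])
  finally show ?thesis .
qed

lemma ind_le_1: "\<bar>indicator A x :: real\<bar> \<le> 1"
  by (auto split: split_indicator)

lemma fibre_dens_ind_integrable: "admissible a \<Longrightarrow> A \<in> sets borel \<Longrightarrow> integrable U (\<lambda>x. fibre_dens a k x * indicator A x)"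
  using cone_densD[OF cone_dens_fibre_dens] by (intro integrable_mult_ind) auto

lemma fibre_dens_ind_integrable2:
  assumes "admissible a" "A \<in> sets borel" "B \<in> sets borel"
  shows "integrable U (\<lambda>x. fibre_dens a k x * indicator A x * indicator B x)"
  using fibre_dens_ind_integrable[OF assms(1,2)] assms(3) by (rule integrable_mult_ind)

lemma fibre_dens_ind_mono:
  assumes a: "admissible a" and "f \<in> borel_measurable borel" "g \<in> borel_measurable borel"
    "integrable U (\<lambda>x. fibre_dens a k x * f x)" "integrable U (\<lambda>x. fibre_dens a k x * g x)"
    "\<And>x. f x \<le> g x"
  shows "(\<integral>x. fibre_dens a k x * f x \<partial>U) \<le> (\<integral>x. fibre_dens a k x * g x \<partial>U)"
  by (intro integral_mono_AE AE_U_I mult_left_mono) (use assms reg_nonneg[OF cone_fibre_dens(1)[OF a]] in auto)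

lemma fibre_mass_bounds:
  assumes "admissible a" "A \<in> sets borel"
  shows "0 \<le> fibre_mass a k A" "fibre_mass a k A \<le> 1"
proof -
  note D = cone_densD[OF cone_dens_fibre_dens[OF assms(1)], of k]
  show "0 \<le> fibre_mass a k A"
    unfolding fibre_mass_def using reg_nonneg[OF D(1)] by (intro integral_nonneg_AE AE_U_I) auto
  have "fibre_mass a k A \<le> (\<integral>x. fibre_dens a k x * 1 \<partial>U)"
    unfolding fibre_mass_def mult.commute[of "indicator A _"]
    using fibre_dens_ind_integrable[OF assms] D assms(2) by (intro fibre_dens_ind_mono assms(1)) (auto split: split_indicator)
  then show "fibre_mass a k A \<le> 1" using D by simp
qed

lemma surv_mass_0: "admissible a \<Longrightarrow> surv_mass a 0 k A = 1"
  using cone_densD(3)[OF cone_dens_fibre_dens] by (simp add: surv_mass_def survivors_def)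

text \<open>Equivariance of the densities moves the first step to the next fibre; the mass lost is
  that of the points of \<open>A\<close> surviving from there. Once this term factorises
  approximately, the recursion becomes a product.\<close>

lemma surv_mass_Suc:
  assumes a: "admissible a" and A [measurable]: "A \<in> sets borel"
  shows "surv_mass a (Suc N) k A = surv_mass a N (k + 1) A - (\<integral>x. fibre_dens a (k + 1) x * indicator A x * indicator (survivors a N (k + 1) A) x \<partial>U)"
proof -
  let ?S = "survivors a N (k + 1) A"
  have S [measurable]: "?S \<in> sets borel" by (rule survivors_borel[OF A])
  let ?\<psi> = "\<lambda>x. indicator (- A) x * indicator ?S x :: real"
  have "surv_mass a (Suc N) k A = (\<integral>x. fibre_dens a k x * ?\<psi> (Tn a 1 k x) \<partial>U)"
    unfolding surv_mass_def by (intro Bochner_Integration.integral_cong) (auto simp: survivors_Suc split: split_indicator)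
  also have "\<dots> = (\<integral>x. fibre_dens a (k + int 1) x * ?\<psi> x \<partial>U)"
    by (intro fibre_dens_dual[OF a, where B = 1]) (auto split: split_indicator)
  also have "\<dots> = (\<integral>x. fibre_dens a (k + 1) x * indicator ?S x - fibre_dens a (k + 1) x * indicator A x * indicator ?S x \<partial>U)"
    by (intro Bochner_Integration.integral_cong) (auto split: split_indicator)
  also have "\<dots> = surv_mass a N (k + 1) A - (\<integral>x. fibre_dens a (k + 1) x * indicator A x * indicator ?S x \<partial>U)"
    unfolding surv_mass_def using fibre_dens_ind_integrable[OF a S] fibre_dens_ind_integrable2[OF a A S]
    by (intro Bochner_Integration.integral_diff) auto
  finally show ?thesis .
qed

definition return_mass :: "(int \<Rightarrow> real) \<Rightarrow> nat \<Rightarrow> int \<Rightarrow> real set \<Rightarrow> real" where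
  "return_mass a j k A = (\<integral>x. fibre_dens a k x * indicator A x * indicator A (Tn a j k x) \<partial>U)"

definition mix_error :: "(int \<Rightarrow> real) \<Rightarrow> nat \<Rightarrow> int \<Rightarrow> real set \<Rightarrow> real" where
  "mix_error a g k A = nrm (\<lambda>x. Pn a g k (\<lambda>x. indicator A x * fibre_dens a k x) x - fibre_mass a k A * fibre_dens a (k + int g) x)"

lemma mixing_ind:
  assumes a: "admissible a" and A [measurable]: "A \<in> sets borel" and S [measurable]: "S \<in> sets borel"
  shows "\<bar>(\<integral>x. fibre_dens a k x * indicator A x * indicator S (Tn a g k x) \<partial>U)
      - fibre_mass a k A * (\<integral>x. fibre_dens a k x * indicator S (Tn a g k x) \<partial>U)\<bar> \<le> mix_error a g k A"
proof -
  note pos = admissibleD(2)[OF a]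
  note D = cone_densD[OF cone_dens_fibre_dens[OF a]]
  let ?f = "\<lambda>x. indicator A x * fibre_dens a k x"
  let ?h = "fibre_dens a (k + int g)"
  note [measurable] = D(5)
  have fm: "?f \<in> borel_measurable borel" by measurable
  have fi: "integrable U ?f" using fibre_dens_ind_integrable[OF a A] by (simp add: mult.commute)
  let ?P = "Pn a g k ?f"
  have Pi: "integrable U ?P" and Pm [measurable]: "?P \<in> borel_measurable borel"
    using Pn_integrable[of a, OF pos fm fi] Pn_measurable[of a, OF pos fm] by auto
  have "(\<integral>x. fibre_dens a k x * indicator A x * indicator S (Tn a g k x) \<partial>U) = (\<integral>x. ?f x * indicator S (Tn a g k x) \<partial>U)"
    by (simp add: mult.commute mult.left_commute)
  also have "\<dots> = (\<integral>x. ?P x * indicator S x \<partial>U)"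
    by (rule Pn_dual[of a, OF pos fi fm _ ind_le_1, symmetric]) measurable
  finally have 1: "(\<integral>x. fibre_dens a k x * indicator A x * indicator S (Tn a g k x) \<partial>U) = (\<integral>x. ?P x * indicator S x \<partial>U)" .
  have 2: "(\<integral>x. fibre_dens a k x * indicator S (Tn a g k x) \<partial>U) = (\<integral>x. ?h x * indicator S x \<partial>U)"
    by (rule fibre_dens_dual[OF a _ ind_le_1]) measurable
  have i1: "integrable U (\<lambda>x. ?P x * indicator S x)" using Pi S by (rule integrable_mult_ind)
  have i2: "integrable U (\<lambda>x. ?h x * indicator S x)" by (rule fibre_dens_ind_integrable[OF a S])
  have 3: "(\<integral>x. ?P x * indicator S x \<partial>U) - fibre_mass a k A * (\<integral>x. ?h x * indicator S x \<partial>U)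
     = (\<integral>x. ?P x * indicator S x - fibre_mass a k A * (?h x * indicator S x) \<partial>U)"
    using i1 i2 by simp
  have 4: "\<bar>\<integral>x. ?P x * indicator S x - fibre_mass a k A * (?h x * indicator S x) \<partial>U\<bar>
     \<le> (\<integral>x. \<bar>?P x * indicator S x - fibre_mass a k A * (?h x * indicator S x)\<bar> \<partial>U)"
    by (rule integral_abs_bound)
  have 5: "(\<integral>x. \<bar>?P x * indicator S x - fibre_mass a k A * (?h x * indicator S x)\<bar> \<partial>U) \<le> mix_error a g k A"
    unfolding mix_error_def
  proof (rule integral_mono)
    show "integrable U (\<lambda>x. \<bar>?P x * indicator S x - fibre_mass a k A * (?h x * indicator S x)\<bar>)" using i1 i2 by auto
    show "integrable U (\<lambda>x. \<bar>?P x - fibre_mass a k A * ?h x\<bar>)" using Pi D(4) by auto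
  qed (auto split: split_indicator)
  show ?thesis unfolding 1 2 3 by (rule order_trans[OF 4 5])
qed

text \<open>Mixing needs an event observed after the gap, so the first \<open>g\<close> conditions
  of survival are dropped, which gives \<open>W\<close>. The two indicators differ by at most
  \<open>s\<close>, the number of visits up to time \<open>g\<close>. On \<open>A\<close> this costs
  the short returns, on the whole space the sum of the target masses.\<close>

lemma hit_error:
  assumes a: "admissible a" and A [measurable]: "A \<in> sets borel"
  shows "\<bar>(\<integral>x. fibre_dens a k x * indicator A x * indicator (survivors a N k A) x \<partial>U) - fibre_mass a k A * surv_mass a N k A\<bar>
    \<le> mix_error a g k A + (\<Sum>j\<in>{1..g}. return_mass a j k A) + fibre_mass a k A * (\<Sum>j\<in>{1..g}. fibre_mass a (k + int j) A)"
proof -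
  have Sv [measurable]: "survivors a N k A \<in> sets borel" by (rule survivors_borel[OF A])
  note D = cone_densD[OF cone_dens_fibre_dens[OF a]]
  note [measurable] = D(5)
  have nn: "0 \<le> fibre_dens a k x" if "0 < x" "x \<le> 1" for x using reg_nonneg[OF D(1)] that .
  define s where "s = (\<lambda>x. \<Sum>j\<in>{1..g}. indicator A (Tn a j k x) :: real)"
  have sm [measurable]: "s \<in> borel_measurable borel" unfolding s_def by measurable
  have s0: "0 \<le> s x" for x by (auto simp: s_def intro: sum_nonneg)
  have s1: "1 \<le> s x" if "j \<in> {1..g}" "Tn a j k x \<in> A" for x j
    using member_le_sum[of j "{1..g}" "\<lambda>j. indicator A (Tn a j k x) :: real"] that by (auto simp: s_def)
  have "\<exists>W. W \<in> sets borel \<and> (\<forall>x. indicator (survivors a N k A) x \<le> (indicator W x :: real)) \<and>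
    (\<forall>x. indicator W x - s x \<le> indicator (survivors a N k A) x) \<and>
    \<bar>(\<integral>x. fibre_dens a k x * indicator A x * indicator W x \<partial>U) - fibre_mass a k A * (\<integral>x. fibre_dens a k x * indicator W x \<partial>U)\<bar> \<le> mix_error a g k A"
  proof (cases "g \<le> N")
    case True
    let ?S = "survivors a (N - g) (k + int g) A"
    have S [measurable]: "?S \<in> sets borel" by (rule survivors_borel[OF A])
    have "Tn a g k -` ?S \<in> sets borel" using measurable_sets[OF Tn_measurable S, of a g k] by simp
    moreover have "indicator (survivors a N k A) x \<le> (indicator (Tn a g k -` ?S) x :: real)" for x
      using survivors_add[OF True, of x a k A] by (auto split: split_indicator)
    moreover have "indicator (Tn a g k -` ?S) x - s x \<le> indicator (survivors a N k A) x" for x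
    proof (cases "\<exists>j\<in>{1..g}. Tn a j k x \<in> A")
      case True
      then have "1 \<le> s x" using s1 by blast
      then show ?thesis by (auto split: split_indicator)
    next
      case False
      then have "indicator (Tn a g k -` ?S) x = (indicator (survivors a N k A) x :: real)"
        using survivors_add[OF \<open>g \<le> N\<close>, of x a k A] by (auto split: split_indicator)
      then show ?thesis using s0[of x] by simp
    qed
    moreover have "indicator (Tn a g k -` ?S) x = (indicator ?S (Tn a g k x) :: real)" for x
      by (auto split: split_indicator)
    ultimately show ?thesis
      using mixing_ind[OF a A S, of k g] by (intro exI[of _ "Tn a g k -` ?S"]) auto
  next
    \<comment> \<open>With a horizon shorter than the gap nothing remains to be decoupled:
      \<open>W\<close> is the whole space and the visits counted by \<open>s\<close> cover all
      conditions.\<close>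
    case False
    have "1 - s x \<le> indicator (survivors a N k A) x" for x
    proof (cases "x \<in> survivors a N k A")
      case True
      then show ?thesis using s0[of x] by simp
    next
      case nin: False
      then obtain j where "j \<in> {1..N}" "Tn a j k x \<in> A" by (auto simp: survivors_def)
      then show ?thesis using s1[of j x] False nin by auto
    qed
    moreover have "0 \<le> mix_error a g k A" by (simp add: mix_error_def)
    ultimately show ?thesis
      using D(3) by (intro exI[of _ UNIV]) (auto simp: fibre_mass_def mult.commute split: split_indicator)
  qed
  then obtain W where W [measurable]: "W \<in> sets borel" and up: "\<And>x. indicator (survivors a N k A) x \<le> (indicator W x :: real)"
    and lo: "\<And>x. indicator W x - s x \<le> indicator (survivors a N k A) x"
    and mW: "\<bar>(\<integral>x. fibre_dens a k x * indicator A x * indicator W x \<partial>U) - fibre_mass a k A * (\<integral>x. fibre_dens a k x * indicator W x \<partial>U)\<bar> \<le> mix_error a g k A"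
    by blast
  let ?I = "\<lambda>S. (\<integral>x. fibre_dens a k x * indicator A x * indicator S x \<partial>U)"
  let ?J = "\<lambda>S. (\<integral>x. fibre_dens a k x * indicator S x \<partial>U)"
  let ?SRs = "\<Sum>j\<in>{1..g}. return_mass a j k A" and ?ws = "\<Sum>j\<in>{1..g}. fibre_mass a (k + int j) A"
  note I1 = fibre_dens_ind_integrable[OF a A, of k]
  note J1 = fibre_dens_ind_integrable[OF a, of _ k]
  have TA: "integrable U (\<lambda>x. fibre_dens a k x * indicator A (Tn a j k x))" for j
    by (rule integrable_mult_bounded[OF D(4,5) _ ind_le_1]) measurable
  have TA': "integrable U (\<lambda>x. (fibre_dens a k x * indicator A x) * indicator A (Tn a j k x))" for j
    by (rule integrable_mult_bounded[OF I1 _ _ ind_le_1]) measurable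
  have si: "integrable U (\<lambda>x. fibre_dens a k x * s x)" "integrable U (\<lambda>x. fibre_dens a k x * indicator A x * s x)"
    unfolding s_def sum_distrib_left by (intro Bochner_Integration.integrable_sum TA TA')+
  have ss: "(\<integral>x. fibre_dens a k x * s x \<partial>U) = ?ws"
  proof -
    have "(\<integral>x. fibre_dens a k x * indicator A (Tn a j k x) \<partial>U) = (\<integral>x. fibre_dens a (k + int j) x * indicator A x \<partial>U)" for j
      by (rule fibre_dens_dual[OF a _ ind_le_1]) measurable
    then have "(\<integral>x. fibre_dens a k x * indicator A (Tn a j k x) \<partial>U) = fibre_mass a (k + int j) A" for j
      by (simp add: fibre_mass_def mult.commute)
    then show ?thesis unfolding s_def sum_distrib_left by (subst Bochner_Integration.integral_sum[OF TA]) simp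
  qed
  have ss': "(\<integral>x. fibre_dens a k x * indicator A x * s x \<partial>U) = ?SRs"
    unfolding s_def sum_distrib_left return_mass_def by (rule Bochner_Integration.integral_sum[OF TA'])
  have mono: "(\<integral>x. f x * fibre_dens a k x \<partial>U) \<le> (\<integral>x. g x * fibre_dens a k x \<partial>U)"
    if "integrable U (\<lambda>x. f x * fibre_dens a k x)" "integrable U (\<lambda>x. g x * fibre_dens a k x)" "\<And>x. f x \<le> g x" for f g
    using that nn by (intro integral_mono_AE AE_U_I mult_right_mono) auto
  note W2 = fibre_dens_ind_integrable2[OF a A W, of k] and S2 = fibre_dens_ind_integrable2[OF a A Sv, of k]
  have b1: "?I (survivors a N k A) \<le> ?I W"
    using mono[of "\<lambda>x. indicator A x * indicator (survivors a N k A) x" "\<lambda>x. indicator A x * indicator W x"] W2 S2 up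
    by (simp add: ac_simps mult_left_mono)
  have b2: "?I W - ?SRs \<le> ?I (survivors a N k A)"
  proof -
    have "?I W - ?SRs = (\<integral>x. (indicator A x * (indicator W x - s x)) * fibre_dens a k x \<partial>U)"
      unfolding ss'[symmetric] using W2 si by (subst Bochner_Integration.integral_diff[symmetric]) (auto simp: algebra_simps)
    also have "\<dots> \<le> (\<integral>x. (indicator A x * indicator (survivors a N k A) x) * fibre_dens a k x \<partial>U)"
      using Bochner_Integration.integrable_diff[OF W2 si(2)] S2 lo
      by (intro mono mult_left_mono) (auto simp: algebra_simps)
    finally show ?thesis by (simp add: ac_simps)
  qed
  have b3: "?J (survivors a N k A) \<le> ?J W"
    using mono[of "indicator (survivors a N k A)" "indicator W"] J1[OF W] J1[OF Sv] up by (simp add: ac_simps)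
  have b4: "?J W - ?ws \<le> ?J (survivors a N k A)"
  proof -
    have "?J W - ?ws = (\<integral>x. (indicator W x - s x) * fibre_dens a k x \<partial>U)"
      unfolding ss[symmetric] using J1[OF W] si by (subst Bochner_Integration.integral_diff[symmetric]) (auto simp: algebra_simps)
    also have "\<dots> \<le> (\<integral>x. indicator (survivors a N k A) x * fibre_dens a k x \<partial>U)"
      using Bochner_Integration.integrable_diff[OF J1[OF W] si(1)] J1[OF Sv] lo
      by (intro mono) (auto simp: algebra_simps)
    finally show ?thesis by (simp add: ac_simps)
  qed
  let ?w = "fibre_mass a k A"
  have w0: "0 \<le> ?w" using fibre_mass_bounds[OF a A] by simp
  have "?w * ?J (survivors a N k A) \<le> ?w * ?J W" "?w * (?J W - ?ws) \<le> ?w * ?J (survivors a N k A)"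
    using b3 b4 w0 by (auto intro: mult_left_mono)
  moreover have "?w * (?J W - ?ws) = ?w * ?J W - ?w * ?ws" by (simp add: right_diff_distrib)
  moreover have "0 \<le> ?SRs" using b1 b2 by linarith
  moreover have "0 \<le> ?w * ?ws" using w0 fibre_mass_bounds[OF a A] by (intro mult_nonneg_nonneg sum_nonneg) auto
  ultimately show ?thesis
    using b1 b2 mW unfolding surv_mass_def[of a N k A] by (simp only: abs_le_iff) linarith
qed

text \<open>The factors \<open>1 - fibre_mass\<close> lie between 0 and 1, so errors are never
  amplified by the recursion and simply add up.\<close>

lemma surv_mass_prod:
  assumes a: "admissible a" and A: "A \<in> sets borel"
    and E: "\<And>k N. \<bar>(\<integral>x. fibre_dens a k x * indicator A x * indicator (survivors a N k A) x \<partial>U) - fibre_mass a k A * surv_mass a N k A\<bar> \<le> E k"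
  shows "\<bar>surv_mass a N k A - (\<Prod>i<N. 1 - fibre_mass a (k + 1 + int i) A)\<bar> \<le> (\<Sum>i<N. E (k + 1 + int i))"
proof (induction N arbitrary: k)
  case 0
  then show ?case by (simp add: surv_mass_0[OF a])
next
  case (Suc N)
  let ?w = "fibre_mass a (k + 1) A" and ?V = "surv_mass a N (k + 1) A"
  let ?I = "\<integral>x. fibre_dens a (k + 1) x * indicator A x * indicator (survivors a N (k + 1) A) x \<partial>U"
  let ?P = "\<Prod>i<N. 1 - fibre_mass a (k + 1 + 1 + int i) A"
  let ?S = "\<Sum>i<N. E (k + 1 + 1 + int i)"
  have w: "0 \<le> ?w" "?w \<le> 1" using fibre_mass_bounds[OF a A] by auto
  have s: "k + 1 + int (Suc i) = k + 1 + 1 + int i" for i by simp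
  have e1: "surv_mass a (Suc N) k A - (1 - ?w) * ?P = (1 - ?w) * (?V - ?P) - (?I - ?w * ?V)"
    unfolding surv_mass_Suc[OF a A] by (simp add: algebra_simps)
  have e2: "\<bar>(1 - ?w) * (?V - ?P)\<bar> \<le> 1 * ?S"
    unfolding abs_mult using w Suc.IH[of "k + 1"] by (intro mult_mono) auto
  have e3: "\<bar>?I - ?w * ?V\<bar> \<le> E (k + 1)" by (rule E)
  have "\<bar>surv_mass a (Suc N) k A - (1 - ?w) * ?P\<bar> \<le> E (k + 1) + ?S"
    unfolding e1 using e2 e3 by linarith
  then have "\<bar>surv_mass a (Suc N) k A - (1 - fibre_mass a (k + 1 + int 0) A) * (\<Prod>i<N. 1 - fibre_mass a (k + 1 + int (Suc i)) A)\<bar>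
      \<le> E (k + 1 + int 0) + (\<Sum>i<N. E (k + 1 + int (Suc i)))"
    unfolding s by (simp only: of_nat_0 add_0_right)
  then show ?case
    unfolding prod.lessThan_Suc_shift sum.lessThan_Suc_shift .
qed

subsection \<open>Short returns\<close>

text \<open>
  \<open>\<phi>\<close> stands for an inverse branch of an iterate and \<open>w\<close> for its weight. The Lipschitz constant
  \<open>\<theta> < 1\<close> is only available where \<open>\<phi> \<ge> d\<close>, away from the neutral fixed point.
\<close>

definition branch_pair :: "real \<Rightarrow> real \<Rightarrow> (real \<Rightarrow> real) \<Rightarrow> (real \<Rightarrow> real) \<Rightarrow> bool" where
  "branch_pair d \<theta> \<phi> w \<longleftrightarrow> w \<in> borel_measurable borel \<and> integrable U w \<and> mono \<phi> \<and>
    (\<forall>x. 0 < x \<and> x \<le> 1 \<longrightarrow> 0 \<le> w x) \<and>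
    (\<forall>x y. 0 < x \<and> x \<le> y \<and> y \<le> 1 \<longrightarrow> w y \<le> w x) \<and>
    (\<forall>x y. 0 < x \<and> x \<le> y \<and> y \<le> 1 \<and> d \<le> \<phi> x \<longrightarrow> \<phi> y - \<phi> x \<le> \<theta> * (y - x))"

lemma branch_pairD:
  assumes "branch_pair d \<theta> \<phi> w"
  shows "w \<in> borel_measurable borel" "integrable U w" "mono \<phi>" "\<phi> \<in> borel_measurable borel"
    "\<And>x. 0 < x \<Longrightarrow> x \<le> 1 \<Longrightarrow> 0 \<le> w x"
    "\<And>x y. 0 < x \<Longrightarrow> x \<le> y \<Longrightarrow> y \<le> 1 \<Longrightarrow> w y \<le> w x"
    "\<And>x y. 0 < x \<Longrightarrow> x \<le> y \<Longrightarrow> y \<le> 1 \<Longrightarrow> d \<le> \<phi> x \<Longrightarrow> \<phi> y - \<phi> x \<le> \<theta> * (y - x)"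
  using assms by (auto simp: branch_pair_def intro: borel_measurable_mono)

lemma Lop_fibre_mass:
  assumes b: "0 < b" and w: "\<And>x. 0 < x \<Longrightarrow> x \<le> 1 \<Longrightarrow> 0 \<le> w x" "\<And>x y. 0 < x \<Longrightarrow> x \<le> y \<Longrightarrow> y \<le> 1 \<Longrightarrow> w y \<le> w x"
  shows "0 < x \<Longrightarrow> x \<le> 1 \<Longrightarrow> 0 \<le> Lop b w x"
    and "0 < x \<Longrightarrow> x \<le> y \<Longrightarrow> y \<le> 1 \<Longrightarrow> Lop b w y \<le> Lop b w x"
proof -
  show "0 \<le> Lop b w x" if "0 < x" "x \<le> 1"
    using lr_rng[OF b that] w(1)[of "left_inv b x"] left_weight_pos[OF b, of x] by (auto simp: Lop_def)
  show "Lop b w y \<le> Lop b w x" if "0 < x" "x \<le> y" "y \<le> 1"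
  proof -
    have "x \<le> 1" "0 < y" using that by auto
    note rx = lr_rng[OF b that(1) this(1)] and ry = lr_rng[OF b this(2) that(3)]
    have "left_inv b x \<le> left_inv b y" using monoD[OF left_inv_mono[OF b] that(2)] .
    then have "w (left_inv b y) \<le> w (left_inv b x)" using w(2)[of "left_inv b x" "left_inv b y"] rx ry by auto
    moreover have "left_weight b y \<le> left_weight b x" by (rule left_weight_anti[OF b that(2)])
    moreover have "0 \<le> w (left_inv b x)" "0 \<le> left_weight b y" using w(1)[of "left_inv b x"] rx left_weight_pos[OF b, of y] by auto
    ultimately show ?thesis unfolding Lop_def by (intro mult_mono)
  qed
qed

lemma mono_left_inv_comp: "0 < b \<Longrightarrow> mono \<phi> \<Longrightarrow> mono (\<lambda>x. \<phi> (left_inv b x))"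
  using left_inv_mono by (auto simp: mono_def)

lemma mono_rbr_comp: "mono \<phi> \<Longrightarrow> mono (\<lambda>x :: real. \<phi> ((x + 1) / 2))"
  by (auto simp: mono_def)

lemma Rop_fibre_mass:
  assumes w: "\<And>x. 0 < x \<Longrightarrow> x \<le> 1 \<Longrightarrow> 0 \<le> w x" "\<And>x y. 0 < x \<Longrightarrow> x \<le> y \<Longrightarrow> y \<le> 1 \<Longrightarrow> w y \<le> w x"
  shows "0 < x \<Longrightarrow> x \<le> 1 \<Longrightarrow> 0 \<le> Rop w x"
    and "0 < x \<Longrightarrow> x \<le> y \<Longrightarrow> y \<le> 1 \<Longrightarrow> Rop w y \<le> Rop w x"
  using w(1)[of "(x + 1) / 2"] w(2)[of "(x + 1) / 2" "(y + 1) / 2"] by (auto simp: Rop_def)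

lemma branch_pair_L:
  assumes b: "param b" and P: "branch_pair d \<theta> \<phi> w" and \<theta>: "0 \<le> \<theta>"
  shows "branch_pair d \<theta> (\<lambda>x. \<phi> (left_inv b x)) (Lop b w)"
proof -
  note b' = paramD[OF b] and D = branch_pairD[OF P]
  have "\<phi> (left_inv b y) - \<phi> (left_inv b x) \<le> \<theta> * (y - x)" if h: "0 < x" "x \<le> y" "y \<le> 1" "d \<le> \<phi> (left_inv b x)" for x y
  proof -
    have "x \<le> 1" "0 < y" using h by auto
    note rx = lr_rng[OF b'(1) h(1) this(1)] and ry = lr_rng[OF b'(1) this(2) h(3)]
    have "left_inv b x \<le> left_inv b y" using monoD[OF left_inv_mono[OF b'(1)] h(2)] .
    then have "\<phi> (left_inv b y) - \<phi> (left_inv b x) \<le> \<theta> * (left_inv b y - left_inv b x)" using rx ry h(4) by (intro D(7)) auto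
    also have "\<dots> \<le> \<theta> * (y - x)" using left_inv_nonexpansive[of b x y] b' h \<theta> by (intro mult_left_mono) auto
    finally show ?thesis .
  qed
  then show ?thesis
    using Lop_fibre_mass[OF b'(1) D(5,6)] D b'(1) unfolding branch_pair_def
    by (auto intro: Lop_measurable integrable_Lop mono_left_inv_comp)
qed

lemma branch_pair_R:
  assumes P: "branch_pair d \<theta> \<phi> w" and \<theta>: "0 \<le> \<theta>"
  shows "branch_pair d \<theta> (\<lambda>x. \<phi> ((x + 1) / 2)) (Rop w)"
proof -
  note D = branch_pairD[OF P]
  have "\<phi> ((y + 1) / 2) - \<phi> ((x + 1) / 2) \<le> \<theta> * (y - x)" if h: "0 < x" "x \<le> y" "y \<le> 1" "d \<le> \<phi> ((x + 1) / 2)" for x y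
  proof -
    have "\<phi> ((y + 1) / 2) - \<phi> ((x + 1) / 2) \<le> \<theta> * ((y + 1) / 2 - (x + 1) / 2)" using h by (intro D(7)) auto
    also have "\<dots> \<le> \<theta> * (y - x)" using h \<theta> by (intro mult_left_mono) (auto simp: field_simps)
    finally show ?thesis .
  qed
  then show ?thesis
    using Rop_fibre_mass[OF D(5,6)] D integrable_Rop[of 1 w] unfolding branch_pair_def
    by (auto intro: Rop_measurable mono_rbr_comp)
qed

text \<open>For the identity in place of \<phi> these are the points above \<open>d\<close> that
  come back close to themselves after \<open>n\<close> steps; the distance \<open>2 * r\<close>
  arises from two points in a ball of radius \<open>r\<close>. The induction moves one step at a
  time from the iterate into \<phi>.\<close>

definition nearset :: "(int \<Rightarrow> real) \<Rightarrow> nat \<Rightarrow> int \<Rightarrow> real \<Rightarrow> real \<Rightarrow> (real \<Rightarrow> real) \<Rightarrow> real set" where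
  "nearset a n k d r \<phi> = {z. d \<le> \<phi> z \<and> \<bar>Tn a n k z - \<phi> z\<bar> < 2 * r}"

lemma nearset_borel:
  assumes [measurable]: "\<phi> \<in> borel_measurable borel"
  shows "nearset a n k d r \<phi> \<in> sets borel"
  unfolding nearset_def by measurable

lemma near_step:
  assumes b: "0 < a k" and w [measurable]: "w \<in> borel_measurable borel" and i: "integrable U w"
    and p [measurable]: "\<phi> \<in> borel_measurable borel"
  shows "(\<integral>z. w z * indicator (nearset a (Suc n) k d r \<phi>) z \<partial>U)
    = (\<integral>z. Lop (a k) w z * indicator (nearset a n (k + 1) d r (\<lambda>x. \<phi> (left_inv (a k) x))) z \<partial>U)
    + (\<integral>z. Rop w z * indicator (nearset a n (k + 1) d r (\<lambda>x. \<phi> ((x + 1) / 2))) z \<partial>U)"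
proof -
  note [measurable] = left_inv_measurable[OF b] Lop_measurable[OF b w] Rop_measurable[OF w]
    nearset_borel[OF p, of a "Suc n" k d r]
  have pl: "(\<lambda>x. \<phi> (left_inv (a k) x)) \<in> borel_measurable borel" and pr: "(\<lambda>x. \<phi> ((x + 1) / 2)) \<in> borel_measurable borel"
    by measurable
  note [measurable] = nearset_borel[OF pl, of a n "k + 1" d r] nearset_borel[OF pr, of a n "k + 1" d r]
  let ?F = "\<lambda>z. w z * indicator (nearset a (Suc n) k d r \<phi>) z"
  have Fi: "integrable U ?F" using i by (rule integrable_mult_ind) measurable
  have Fm: "?F \<in> borel_measurable borel" by measurable
  let ?A = "\<lambda>z. Lop (a k) w z * indicator (nearset a n (k + 1) d r (\<lambda>x. \<phi> (left_inv (a k) x))) z"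
  let ?B = "\<lambda>z. Rop w z * indicator (nearset a n (k + 1) d r (\<lambda>x. \<phi> ((x + 1) / 2))) z"
  have "(\<integral>z. ?F z \<partial>U) = (\<integral>z. Pop (a k) ?F z \<partial>U)" by (rule integral_Pop[OF b Fm Fi, symmetric])
  also have "\<dots> = (\<integral>z. ?A z + ?B z \<partial>U)"
  proof (rule integral_U_cong)
    show "Pop (a k) ?F \<in> borel_measurable borel" by (rule Pop_measurable[OF b Fm])
    fix x :: real assume x: "0 < x" "x < 1"
    show "Pop (a k) ?F x = ?A x + ?B x"
      using lsv_map_left_inv[OF b x] lsv_map_rbr[OF x(1), of "a k"]
      by (auto simp: Pop_def Lop_def Rop_def nearset_def split: split_indicator)
  qed measurable
  also have "\<dots> = (\<integral>z. ?A z \<partial>U) + (\<integral>z. ?B z \<partial>U)"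
    by (intro Bochner_Integration.integral_add integrable_mult_ind integrable_Lop[OF b w i] integrable_Rop[OF b w i]) measurable
  finally show ?thesis .
qed

lemma integral_ind_interval:
  assumes "u \<le> v"
  shows "(\<integral>z. indicator {u..v} z \<partial>U) \<le> v - u"
proof -
  have "(\<integral>z. indicator {u..v} z \<partial>U) = measure lborel ({0..1} \<inter> {u..v})"
    unfolding integral_U indicator_inter_arith[symmetric] by simp
  also have "\<dots> \<le> measure lborel {u..v}" by (intro measure_mono_fmeasurable) (auto simp: fmeasurable_def emeasure_lborel_Icc_eq)
  finally show ?thesis using assms by simp
qed

text \<open>The factor \<open>2 / d\<close> bounds a decreasing weight of mass 1 at points above
  \<open>d / 2\<close>; \<open>8 / (1 - \<theta>)\<close> times the radius is the length of the
  interval containing the near fixed points.\<close>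

definition return_const :: "real \<Rightarrow> real \<Rightarrow> real" where
  "return_const d \<theta> = (2 / d) * (8 / (1 - \<theta>))"

text \<open>Once all steps are absorbed into \<phi>, the set consists of near fixed points of a
  contraction; these lie within \<open>4 * r / (1 - \<theta>)\<close> of one another. The masses of
  the weights of all branches add up to that of \<open>w\<close>, so the bound does not depend on
  \<open>n\<close>.\<close>

lemma near_bound:
  assumes a: "admissible a" and d: "0 < d" and \<theta>: "0 \<le> \<theta>" "\<theta> < 1" and r: "0 < r" "r \<le> d / 4"
    and P: "branch_pair d \<theta> \<phi> w"
  shows "(\<integral>z. w z * indicator (nearset a n k d r \<phi>) z \<partial>U) \<le> return_const d \<theta> * r * (\<integral>z. w z \<partial>U)"
  using P
proof (induction n arbitrary: k \<phi> w)
  case 0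
  note D = branch_pairD[OF 0]
  let ?Z = "nearset a 0 k d r \<phi>" and ?m = "\<integral>z. w z \<partial>U"
  define l where "l = 4 * r / (1 - \<theta>)"
  have l: "0 < l" using r \<theta> by (simp add: l_def)
  have m: "0 \<le> ?m" using D(5) by (intro integral_nonneg_AE AE_U_I) auto
  have Z: "d / 2 \<le> z" if "z \<in> ?Z" for z using that r by (auto simp: nearset_def)
  have wz: "w z \<le> (2 / d) * ?m" if "z \<in> ?Z" "z \<le> 1" for z
  proof -
    have z: "0 < z" using Z[OF that(1)] d by auto
    have "z * w z \<le> ?m" by (rule cone_mult_le[OF D(6,5,2) z that(2)])
    moreover have "(d / 2) * w z \<le> z * w z" using Z[OF that(1)] D(5)[OF z that(2)] by (intro mult_right_mono)
    ultimately show ?thesis using d by (simp add: field_simps)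
  qed
  have close: "z' - z \<le> l" if "z \<in> ?Z" "z' \<in> ?Z" "z \<le> z'" "z' \<le> 1" for z z'
  proof -
    have "\<phi> z' - \<phi> z \<le> \<theta> * (z' - z)"
      using that Z[OF that(1)] d by (intro D(7)) (auto simp: nearset_def)
    moreover have "z' - \<phi> z' < 2 * r" "- (2 * r) < z - \<phi> z" using that by (auto simp: nearset_def abs_less_iff)
    ultimately have "(1 - \<theta>) * (z' - z) \<le> 4 * r" by (simp add: algebra_simps)
    then show ?thesis using \<theta> by (simp add: l_def field_simps)
  qed
  show ?case
  proof (cases "\<exists>z0. z0 \<in> ?Z \<and> z0 \<le> 1")
    case True
    then obtain z0 where z0: "z0 \<in> ?Z" "z0 \<le> 1" by blast
    have "(\<integral>z. w z * indicator ?Z z \<partial>U) \<le> (\<integral>z. (2 / d) * ?m * indicator {z0 - l..z0 + l} z \<partial>U)"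
    proof (rule integral_mono_AE)
      show "integrable U (\<lambda>z. w z * indicator ?Z z)" using D(2) by (rule integrable_mult_ind) (rule nearset_borel[OF D(4)])
      show "integrable U (\<lambda>z. (2 / d) * ?m * indicator {z0 - l..z0 + l} z)"
        by (intro integrable_mult_right U.integrable_const_bound[where B = 1]) (auto split: split_indicator)
      show "AE z in U. w z * indicator ?Z z \<le> (2 / d) * ?m * indicator {z0 - l..z0 + l} z"
      proof (rule AE_U_I)
        fix z :: real assume z: "0 < z" "z < 1"
        show "w z * indicator ?Z z \<le> (2 / d) * ?m * indicator {z0 - l..z0 + l} z"
        proof (cases "z \<in> ?Z")
          case True
          then have "z \<in> {z0 - l..z0 + l}"
            using close[of z z0] close[of z0 z] z0 z l by (cases "z \<le> z0") auto
          then show ?thesis using True wz[OF True] z by simp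
        qed (use m d in auto)
      qed
    qed
    also have "\<dots> = (2 / d) * ?m * (\<integral>z. indicator {z0 - l..z0 + l} z \<partial>U)" by simp
    also have "\<dots> \<le> (2 / d) * ?m * (z0 + l - (z0 - l))"
      using integral_ind_interval[of "z0 - l" "z0 + l"] l m d by (intro mult_left_mono) auto
    also have "\<dots> = return_const d \<theta> * r * ?m" by (simp add: return_const_def l_def)
    finally show ?thesis .
  next
    case False
    have "(\<integral>z. w z * indicator ?Z z \<partial>U) = (\<integral>z. 0 \<partial>U)"
      using False by (intro Bochner_Integration.integral_cong) (auto split: split_indicator)
    then show ?thesis using m r \<theta> d by (auto simp: return_const_def)
  qed
next
  case (Suc n)
  note D = branch_pairD[OF Suc.prems] and ak = admissibleD[OF a, of k]
  show ?case
    unfolding near_step[of a k, OF ak(2) D(1,2,4)] integral_L_R[OF ak(2) D(1,2), symmetric] distrib_left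
    by (intro add_mono Suc.IH branch_pair_L[OF ak(1) Suc.prems \<theta>(1)] branch_pair_R[OF Suc.prems \<theta>(1)])
qed

text \<open>The identity is no strict contraction, so the first step is made by hand: above
  \<open>d\<close> the left inverse contracts by \<open>1 / (1 + 2 * d)\<close>, and the factor 1/2
  of the right one is smaller since \<open>d\<close> is at most 1/2.\<close>

lemma near_id:
  assumes a: "admissible a" and d: "0 < d" "d \<le> 1/2" and r: "0 < r" "r \<le> d / 4"
  shows "(\<integral>z. indicator (nearset a (Suc n) k d r (\<lambda>x. x)) z \<partial>U) \<le> return_const d (1 / (1 + 2 * d)) * r"
proof -
  let ?l = "1 / (1 + 2 * d)"
  note ak = admissibleD[OF a, of k] and b = paramD[OF admissibleD(1)[OF a, of k]]
  have l: "0 \<le> ?l" "?l < 1" "1/2 \<le> ?l" using d by (auto simp: field_simps)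
  have one: "(\<lambda>_. 1 :: real) \<in> borel_measurable borel" "integrable U (\<lambda>_. 1 :: real)" by auto
  have L: "branch_pair d ?l (left_inv (a k)) (Lop (a k) (\<lambda>_. 1))"
  proof -
    have "left_inv (a k) y - left_inv (a k) x \<le> ?l * (y - x)" if h: "0 < x" "x \<le> y" "y \<le> 1" "d \<le> left_inv (a k) x" for x y
      using left_inv_contract[of "a k" x y d] b d h by (simp add: field_simps)
    then show ?thesis
      using Lop_fibre_mass[OF b(1), of "\<lambda>_. 1"] left_inv_mono[OF b(1)] Lop_measurable[OF b(1) one(1)] integrable_Lop[OF b(1) one]
      unfolding branch_pair_def by auto
  qed
  have R: "branch_pair d ?l (\<lambda>x. (x + 1) / 2) (Rop (\<lambda>_. 1))"
  proof -
    have "(y + 1) / 2 - (x + 1) / 2 \<le> ?l * (y - x)" if h: "x \<le> y" for x y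
    proof -
      have e: "(y + 1) / 2 - (x + 1) / 2 = 1/2 * (y - x)" by (simp add: field_simps)
      show ?thesis unfolding e by (rule mult_right_mono[OF l(3)]) (use h in simp)
    qed
    then show ?thesis
      using Rop_fibre_mass[of "\<lambda>_. 1"] Rop_measurable[OF one(1)] integrable_Rop[OF b(1) one]
      unfolding branch_pair_def by (auto simp: mono_def)
  qed
  have i: "(\<integral>z. Lop (a k) (\<lambda>_. 1) z \<partial>U) + (\<integral>z. Rop (\<lambda>_. 1) z \<partial>U) = 1"
    using integral_L_R[OF b(1) one] by simp
  have "(\<integral>z. (indicator (nearset a (Suc n) k d r (\<lambda>x. x)) z :: real) \<partial>U)
      = (\<integral>z. 1 * indicator (nearset a (Suc n) k d r (\<lambda>x. x)) z \<partial>U)" by simp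
  also have "\<dots> = (\<integral>z. Lop (a k) (\<lambda>_. 1) z * indicator (nearset a n (k + 1) d r (left_inv (a k))) z \<partial>U)
    + (\<integral>z. Rop (\<lambda>_. 1) z * indicator (nearset a n (k + 1) d r (\<lambda>x. (x + 1) / 2)) z \<partial>U)"
    using near_step[of a k, OF b(1) one, of "\<lambda>x. x" n d r] by simp
  also have "\<dots> \<le> return_const d ?l * r * (\<integral>z. Lop (a k) (\<lambda>_. 1) z \<partial>U) + return_const d ?l * r * (\<integral>z. Rop (\<lambda>_. 1) z \<partial>U)"
    by (intro add_mono near_bound[OF a d(1) l(1,2) r] L R)
  also have "\<dots> = return_const d ?l * r" unfolding distrib_left[symmetric] i by simp
  finally show ?thesis .
qed

text \<open>Returns to a ball instead of a target, under Lebesgue measure: the quantity involves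
  neither the normalising sequence nor the densities. Values in \<open>ennreal\<close> suit Fubini
  and infinite series.\<close>

definition ball_return :: "(int \<Rightarrow> real) \<Rightarrow> nat \<Rightarrow> int \<Rightarrow> real \<Rightarrow> real \<Rightarrow> ennreal" where
  "ball_return a j k r x0 = (\<integral>\<^sup>+x. indicator {x. \<bar>x - x0\<bar> < r \<and> \<bar>Tn a j k x - x0\<bar> < r} x \<partial>U)"

interpretation UU: pair_sigma_finite U U ..

text \<open>If \<open>x\<close> and its image both lie within \<open>r\<close> of the centre, then
  \<open>x\<close> is within \<open>2 * r\<close> of its image, a condition free of the centre and
  of measure of order \<open>r\<close> by \<open>near_id\<close>. For each such \<open>x\<close> the
  admissible centres have measure at most \<open>2 * r\<close>. Centres above \<open>2 * d\<close>
  keep \<open>x\<close> above \<open>d\<close>.\<close>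

lemma ball_return_average:
  assumes a: "admissible a" and d: "0 < d" "d \<le> 1/2" and r: "0 < r" "r \<le> d / 4" and j: "1 \<le> j"
  shows "(\<integral>\<^sup>+x0. indicator {2 * d..} x0 * ball_return a j k r x0 \<partial>U) \<le> ennreal (2 * r * (return_const d (1 / (1 + 2 * d)) * r))"
proof -
  let ?N = "nearset a j k d r (\<lambda>x. x)" and ?C = "return_const d (1 / (1 + 2 * d))"
  have Nb [measurable]: "?N \<in> sets borel" by (rule nearset_borel) auto
  define F :: "real \<Rightarrow> real \<Rightarrow> ennreal" where "F = (\<lambda>x0 x. indicator {p. \<bar>snd p - fst p\<bar> < r} (x0, x) * indicator ?N x)"
  have U_id: "(\<lambda>x. x) \<in> borel_measurable U" by (rule measurable_U) simp
  have [measurable]: "fst \<in> borel_measurable (U \<Otimes>\<^sub>M U)" "snd \<in> borel_measurable (U \<Otimes>\<^sub>M U)"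
    by (rule measurable_compose[OF measurable_fst U_id], rule measurable_compose[OF measurable_snd U_id])
  have Fm: "case_prod F \<in> borel_measurable (U \<Otimes>\<^sub>M U)"
  proof -
    have "(\<lambda>p. if \<bar>snd p - fst p\<bar> < r then (if snd p \<in> ?N then 1 else 0) else 0 :: ennreal) \<in> borel_measurable (U \<Otimes>\<^sub>M U)"
      by measurable
    also have "(\<lambda>p. if \<bar>snd p - fst p\<bar> < r then (if snd p \<in> ?N then 1 else 0) else 0 :: ennreal) = case_prod F"
      by (auto simp: F_def fun_eq_iff split: split_indicator)
    finally show ?thesis .
  qed
  have le: "indicator {2 * d..} x0 * ball_return a j k r x0 \<le> (\<integral>\<^sup>+x. F x0 x \<partial>U)" for x0
  proof (cases "2 * d \<le> x0")
    case True
    have "indicator {x. \<bar>x - x0\<bar> < r \<and> \<bar>Tn a j k x - x0\<bar> < r} x \<le> F x0 x" for x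
      using True r d by (auto simp: F_def nearset_def abs_less_iff split: split_indicator)
    then show ?thesis unfolding ball_return_def using True by (auto intro: nn_integral_mono)
  qed simp
  have inner: "(\<integral>\<^sup>+x0. F x0 x \<partial>U) \<le> ennreal (2 * r) * indicator ?N x" for x
  proof -
    have "(\<integral>\<^sup>+x0. F x0 x \<partial>U) \<le> (\<integral>\<^sup>+x0. indicator {x - r..x + r} x0 * indicator ?N x \<partial>U)"
      by (intro nn_integral_mono) (auto simp: F_def split: split_indicator)
    also have "\<dots> = (\<integral>\<^sup>+x0. indicator {x - r..x + r} x0 \<partial>U) * indicator ?N x"
      by (rule nn_integral_multc) (auto intro: measurable_U)
    finally have 1: "(\<integral>\<^sup>+x0. F x0 x \<partial>U) \<le> (\<integral>\<^sup>+x0. indicator {x - r..x + r} x0 \<partial>U) * indicator ?N x" .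
    have "(\<integral>\<^sup>+x0. indicator {x - r..x + r} x0 \<partial>U) \<le> ennreal (2 * r)"
    proof -
      have "(\<integral>\<^sup>+x0. indicator {x - r..x + r} x0 \<partial>U) = (\<integral>\<^sup>+x0. indicator {x - r..x + r} x0 * indicator {0..1} x0 \<partial>lborel)"
        by (simp add: unit_lebesgue_def nn_integral_restrict_space)
      also have "\<dots> \<le> (\<integral>\<^sup>+x0. indicator {x - r..x + r} x0 \<partial>lborel)"
        by (intro nn_integral_mono) (auto split: split_indicator)
      also have "\<dots> = ennreal (2 * r)" using r by simp
      finally show ?thesis .
    qed
    then show ?thesis using 1 mult_right_mono[of _ "ennreal (2 * r)" "indicator ?N x"] by (meson order_trans zero_le)
  qed
  have "(\<integral>\<^sup>+x0. indicator {2 * d..} x0 * ball_return a j k r x0 \<partial>U) \<le> (\<integral>\<^sup>+x0. (\<integral>\<^sup>+x. F x0 x \<partial>U) \<partial>U)"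
    by (intro nn_integral_mono le)
  also have "\<dots> = (\<integral>\<^sup>+x. (\<integral>\<^sup>+x0. F x0 x \<partial>U) \<partial>U)" by (rule UU.Fubini'[OF Fm, symmetric])
  also have "\<dots> \<le> (\<integral>\<^sup>+x. ennreal (2 * r) * indicator ?N x \<partial>U)" by (intro nn_integral_mono inner)
  also have "\<dots> = ennreal (2 * r) * (\<integral>\<^sup>+x. indicator ?N x \<partial>U)"
    by (rule nn_integral_cmult) (auto intro: measurable_U)
  also have "(\<integral>\<^sup>+x. indicator ?N x \<partial>U) = ennreal (\<integral>x. indicator ?N x \<partial>U)"
  proof -
    have "(\<integral>\<^sup>+x. indicator ?N x \<partial>U) = (\<integral>\<^sup>+x. ennreal (indicator ?N x) \<partial>U)" by (simp add: ennreal_indicator)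
    also have "\<dots> = ennreal (\<integral>x. indicator ?N x \<partial>U)"
      by (rule nn_integral_eq_integral) (auto intro!: U.integrable_const_bound[where B = 1] measurable_U split: split_indicator)
    finally show ?thesis .
  qed
  also have "ennreal (2 * r) * ennreal (\<integral>x. indicator ?N x \<partial>U) = ennreal (2 * r * (\<integral>x. indicator ?N x \<partial>U))"
    using r by (simp add: ennreal_mult')
  also have "\<dots> \<le> ennreal (2 * r * (?C * r))"
  proof -
    obtain n where n: "j = Suc n" using j by (cases j) auto
    show ?thesis using near_id[OF a d r, of n k] r unfolding n by (intro ennreal_leI mult_left_mono) auto
  qed
  finally show ?thesis .
qed

end

subsection \<open>The sample measures\<close>

lemma Tn_back: "Tn a (Suc n) k x = lsv_map (a (k + int n)) (Tn a n k x)"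
  using Tn_add[of a n 1 k x] by simp

lemma random_map_shift: "random_map \<gamma> (shift_by k \<omega>) = lsv_map (\<gamma> (\<omega> k))"
  by (simp add: random_map_def shift_by_def lsv_map_eq)

lemma shift_by_shift_by: "shift_by j (shift_by k \<omega>) = shift_by (k + j) \<omega>"
  by (auto simp: shift_by_def algebra_simps)

lemma random_iterate_eq: "random_iterate \<gamma> n (shift_by k \<omega>) x = Tn (\<lambda>j. \<gamma> (\<omega> j)) n k x"
proof (induction n)
  case (Suc n)
  then show ?case unfolding Tn_back by (simp add: shift_by_shift_by random_map_shift)
qed simp

lemma nrm_diff_0_AE:
  fixes f g :: "real \<Rightarrow> real"
  assumes "integrable U f" "integrable U g" "nrm (\<lambda>x. f x - g x) \<le> 0"
  shows "AE x in U. f x = g x"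
proof -
  have "nrm (\<lambda>x. f x - g x) = 0" using assms(3) by (intro antisym) auto
  then have "AE x in U. \<bar>f x - g x\<bar> = 0"
    using assms by (subst (asm) integral_nonneg_eq_0_iff_AE) auto
  then show ?thesis by eventually_elim simp
qed

text \<open>The duality determines the function up to null sets, by testing with the sign
  \<open>s\<close> of the difference of two candidates; and \<open>Pop b f\<close> satisfies
  it.\<close>

lemma transfer_operator_AE:
  assumes b: "0 < b" and f: "f \<in> borel_measurable borel" "integrable U f"
    and g: "integrable U g" "AE x in U. g x = f x"
  shows "integrable U (transfer_operator U (lsv_map b) g)"
    and "AE x in U. transfer_operator U (lsv_map b) g x = Pop b f x"
proof -
  let ?Q = "\<lambda>h. integrable U h \<and> (\<forall>\<psi> \<in> borel_measurable U. bounded (\<psi> ` space U) \<longrightarrow>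
     (\<integral>x. h x * \<psi> x \<partial>U) = (\<integral>x. g x * \<psi> (lsv_map b x) \<partial>U))"
  note Pm [measurable] = Pop_measurable[OF b f(1)] and Pi = integrable_Pop[OF b f]
  note [measurable] = f(1)
  have dual: "(\<integral>x. Pop b f x * \<psi> x \<partial>U) = (\<integral>x. g x * \<psi> (lsv_map b x) \<partial>U)"
    if \<psi>: "\<psi> \<in> borel_measurable U" and bd: "bounded (\<psi> ` space U)" for \<psi>
  proof -
    \<comment> \<open>The observable is measurable and bounded only on the unit interval; extended
      by 0 it fits the duality for Borel functions on the line.\<close>
    define \<psi>' where "\<psi>' = (\<lambda>x. indicator {0..1} x * \<psi> x)"
    have m: "\<psi>' \<in> borel_measurable borel"
      using \<psi> unfolding \<psi>'_def unit_lebesgue_def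
      by (subst (asm) borel_measurable_restrict_space_iff) (auto simp: mult.commute)
    obtain B where "\<forall>y\<in>\<psi> ` space U. norm y \<le> B"
      using bd unfolding bounded_iff by blast
    then have B: "\<bar>\<psi> x\<bar> \<le> B" if "x \<in> {0..1}" for x using that by simp
    have B': "\<bar>\<psi>' x\<bar> \<le> max B 0" for x
      using B[of x] by (auto simp: \<psi>'_def split: split_indicator)
    have mt: "(\<lambda>x. \<psi>' (lsv_map b x)) \<in> borel_measurable borel" using measurable_compose[OF lsv_map_measurable m] .
    have fi: "integrable U (\<lambda>x. f x * \<psi>' (lsv_map b x))"
      by (rule integrable_mult_bounded[OF f(2,1) mt B'])
    have "(\<integral>x. Pop b f x * \<psi> x \<partial>U) = (\<integral>x. Pop b f x * \<psi>' x \<partial>U)"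
      by (intro Bochner_Integration.integral_cong) (auto simp: \<psi>'_def)
    also have "\<dots> = (\<integral>x. f x * \<psi>' (lsv_map b x) \<partial>U)" by (rule integral_Pop_mult[OF b f(1) m fi])
    also have "\<dots> = (\<integral>x. g x * \<psi>' (lsv_map b x) \<partial>U)"
    proof (rule integral_cong_AE)
      show "(\<lambda>x. f x * \<psi>' (lsv_map b x)) \<in> borel_measurable U" using fi by auto
      show "(\<lambda>x. g x * \<psi>' (lsv_map b x)) \<in> borel_measurable U" using g(1) mt by (auto intro: measurable_U)
      show "AE x in U. f x * \<psi>' (lsv_map b x) = g x * \<psi>' (lsv_map b x)" using g(2) by eventually_elim simp
    qed
    also have "\<dots> = (\<integral>x. g x * \<psi> (lsv_map b x) \<partial>U)"
      using lsv_map_range[OF b] by (intro Bochner_Integration.integral_cong) (auto simp: \<psi>'_def)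
    finally show ?thesis .
  qed
  have "?Q (Pop b f)" using Pi dual by blast
  then have Q: "?Q (transfer_operator U (lsv_map b) g)"
    unfolding transfer_operator_def by (rule someI[where P = ?Q])
  let ?T = "transfer_operator U (lsv_map b) g"
  show Ti: "integrable U ?T" using Q by blast
  have [measurable]: "?T \<in> borel_measurable U" "Pop b f \<in> borel_measurable U" using Ti Pi by auto
  define s :: "real \<Rightarrow> real" where "s = (\<lambda>x. if Pop b f x < ?T x then 1 else if ?T x < Pop b f x then - 1 else 0)"
  have sm: "s \<in> borel_measurable U"
    unfolding s_def by measurable
  have sb: "bounded (s ` space U)" unfolding bounded_iff s_def by (auto intro!: exI[of _ 1])
  have s1: "\<bar>s x\<bar> \<le> 1" for x by (simp add: s_def)
  have "(\<integral>x. ?T x * s x \<partial>U) = (\<integral>x. Pop b f x * s x \<partial>U)"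
    using Q dual sm sb by metis
  moreover have "integrable U (\<lambda>x. u x * s x)" if u: "integrable U u" for u
  proof (rule Bochner_Integration.integrable_bound[OF u])
    show "(\<lambda>x. u x * s x) \<in> borel_measurable U" using u sm by auto
    show "AE x in U. norm (u x * s x) \<le> norm (u x)" by (rule AE_I2) (simp add: abs_mult mult_left_le s1)
  qed
  ultimately have "(\<integral>x. ?T x * s x - Pop b f x * s x \<partial>U) = 0" using Ti Pi by simp
  moreover have "?T x * s x - Pop b f x * s x = \<bar>?T x - Pop b f x\<bar>" for x
    by (auto simp: s_def)
  ultimately have "nrm (\<lambda>x. ?T x - Pop b f x) \<le> 0" by simp
  then show "AE x in U. ?T x = Pop b f x" by (rule nrm_diff_0_AE[OF Ti Pi])
qed

lemma measure_density_U:
  assumes f: "integrable U f" and h: "h \<in> borel_measurable borel" "integrable U h" "AE x in U. f x = h x"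
    and nn: "AE x in U. 0 \<le> h x" and B: "B \<in> sets U"
  shows "measure (density U (\<lambda>x. ennreal (f x))) B = (\<integral>x. h x * indicator B x \<partial>U)"
proof -
  have [measurable]: "f \<in> borel_measurable U" using f by auto
  have hi: "integrable U (\<lambda>x. h x * indicator B x)"
    using h(2) B by (rule integrable_real_mult_indicator[rotated])
  have "emeasure (density U (\<lambda>x. ennreal (f x))) B = (\<integral>\<^sup>+x. ennreal (f x) * indicator B x \<partial>U)"
    using B by (subst emeasure_density) auto
  also have "\<dots> = (\<integral>\<^sup>+x. ennreal (h x * indicator B x) \<partial>U)"
  proof (rule nn_integral_cong_AE)
    show "AE x in U. ennreal (f x) * indicator B x = ennreal (h x * indicator B x)"
      using h(3) by eventually_elim (auto split: split_indicator)
  qed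
  also have "\<dots> = ennreal (\<integral>x. h x * indicator B x \<partial>U)"
  proof (rule nn_integral_eq_integral[OF hi])
    show "AE x in U. 0 \<le> h x * indicator B x"
      using nn by eventually_elim (auto split: split_indicator)
  qed
  finally show ?thesis
    using nn unfolding measure_def by (auto intro!: enn2real_ennreal integral_nonneg_AE split: split_indicator)
qed

context lsv
begin

lemma transfer_iterate_AE:
  assumes a: "admissible (\<lambda>j. \<gamma> (\<omega> j))"
  shows "integrable U (transfer_iterate \<gamma> n (shift_by k \<omega>) (\<lambda>_. 1)) \<and>
    (AE x in U. transfer_iterate \<gamma> n (shift_by k \<omega>) (\<lambda>_. 1) x = Pn (\<lambda>j. \<gamma> (\<omega> j)) n k (\<lambda>_. 1) x)"
proof (induction n)
  case 0
  show ?case by simp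
next
  case (Suc n)
  let ?a = "\<lambda>j. \<gamma> (\<omega> j)"
  have P: "Pn ?a n k (\<lambda>_. 1) \<in> borel_measurable borel" "integrable U (Pn ?a n k (\<lambda>_. 1))"
    by (rule Pn_measurable[of ?a, OF admissibleD(2)[OF a]], simp) (rule Pn_integrable[of ?a, OF admissibleD(2)[OF a]], auto)
  have e: "transfer_iterate \<gamma> (Suc n) (shift_by k \<omega>) (\<lambda>_. 1)
      = transfer_operator U (lsv_map (?a (k + int n))) (transfer_iterate \<gamma> n (shift_by k \<omega>) (\<lambda>_. 1))"
    by (simp add: shift_by_shift_by random_map_shift)
  show ?case
    unfolding e Pn_back using transfer_operator_AE[OF admissibleD(2)[OF a] P] Suc.IH by blast
qed

lemma sample_density_AE:
  assumes a: "admissible (\<lambda>j. \<gamma> (\<omega> j))"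
  shows "integrable U (sample_density \<gamma> (shift_by k \<omega>))"
    and "AE x in U. sample_density \<gamma> (shift_by k \<omega>) x = fibre_dens (\<lambda>j. \<gamma> (\<omega> j)) k x"
proof -
  let ?a = "\<lambda>j. \<gamma> (\<omega> j)"
  let ?t = "\<lambda>n. transfer_iterate \<gamma> n (shift_by (- int n) (shift_by k \<omega>)) (\<lambda>_. 1)"
  let ?Q = "\<lambda>h. integrable U h \<and> (\<lambda>n. nrm (\<lambda>x. ?t n x - h x)) \<longlonglongrightarrow> 0"
  have t: "integrable U (?t n)" "AE x in U. ?t n x = pull_dens ?a k n x" for n
    using transfer_iterate_AE[OF a, of n "k - int n"] by (auto simp: shift_by_shift_by pull_dens_def)
  note ui = cone_densD(4)[OF cone_dens_pull_dens[OF a]] and hi = cone_densD(4)[OF cone_dens_fibre_dens[OF a]]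
  have eq: "nrm (\<lambda>x. ?t n x - h x) = nrm (\<lambda>x. pull_dens ?a k n x - h x)" if "integrable U h" for n h
    using t(1)[of n] ui[of k n] that
    by (intro integral_cong_AE borel_measurable_abs borel_measurable_diff) (use t(2)[of n] in \<open>auto elim!: eventually_mono\<close>)
  have "?Q (fibre_dens ?a k)" using fibre_dens_nrm_tendsto[OF a, of k] hi eq[OF hi] by simp
  then have Q: "?Q (sample_density \<gamma> (shift_by k \<omega>))"
    unfolding sample_density_def by (rule someI[where P = ?Q])
  let ?s = "sample_density \<gamma> (shift_by k \<omega>)"
  show si: "integrable U ?s" using Q by blast
  have "(\<lambda>n. nrm (\<lambda>x. pull_dens ?a k n x - ?s x) + nrm (\<lambda>x. pull_dens ?a k n x - fibre_dens ?a k x)) \<longlonglongrightarrow> 0 + 0"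
    using Q eq[OF si] fibre_dens_nrm_tendsto[OF a, of k] by (intro tendsto_add) auto
  moreover have "nrm (\<lambda>x. ?s x - fibre_dens ?a k x) \<le> nrm (\<lambda>x. pull_dens ?a k n x - ?s x) + nrm (\<lambda>x. pull_dens ?a k n x - fibre_dens ?a k x)" for n
    using nrm_minus_triangle[of "\<lambda>x. pull_dens ?a k n x - fibre_dens ?a k x" "\<lambda>x. pull_dens ?a k n x - ?s x"] ui[of k n] si hi[of k]
    by simp
  ultimately have "nrm (\<lambda>x. ?s x - fibre_dens ?a k x) \<le> 0 + 0"
    by (intro LIMSEQ_le_const) auto
  then show "AE x in U. ?s x = fibre_dens ?a k x" using nrm_diff_0_AE[OF si hi] by simp
qed

lemma sample_measure_eq:
  assumes a: "admissible (\<lambda>j. \<gamma> (\<omega> j))" and B: "B \<in> sets borel" "B \<subseteq> {0..1}"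
  shows "measure (sample_measure \<gamma> (shift_by k \<omega>)) B = fibre_mass (\<lambda>j. \<gamma> (\<omega> j)) k B"
proof -
  note D = cone_densD[OF cone_dens_fibre_dens[OF a], of k]
  have BU: "B \<in> sets U" using B by (auto simp: sets_U sets_restrict_space image_iff)
  have nn: "AE x in U. 0 \<le> fibre_dens (\<lambda>j. \<gamma> (\<omega> j)) k x" using reg_nonneg[OF D(1)] by (intro AE_U_I) auto
  show ?thesis
    unfolding sample_measure_def
    using measure_density_U[OF sample_density_AE(1)[OF a] D(5,4) sample_density_AE(2)[OF a] nn BU]
    by (simp add: fibre_mass_def mult.commute)
qed

lemma hitting_set_eq:
  "{x \<in> {0..1}. hitting_time \<gamma> A (shift_by k \<omega>) x > enat N} = survivors (\<lambda>j. \<gamma> (\<omega> j)) N k A \<inter> {0..1}"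
proof -
  let ?H = "\<lambda>x. {enat i | i. 1 \<le> i \<and> random_iterate \<gamma> i (shift_by k \<omega>) x \<in> A}"
  have "Inf (?H x) > enat N \<longleftrightarrow> (\<forall>i. 1 \<le> i \<and> i \<le> N \<longrightarrow> random_iterate \<gamma> i (shift_by k \<omega>) x \<notin> A)" for x
  proof
    assume h: "Inf (?H x) > enat N"
    show "\<forall>i. 1 \<le> i \<and> i \<le> N \<longrightarrow> random_iterate \<gamma> i (shift_by k \<omega>) x \<notin> A"
    proof (intro allI impI notI)
      fix i assume i: "1 \<le> i \<and> i \<le> N" "random_iterate \<gamma> i (shift_by k \<omega>) x \<in> A"
      then have "Inf (?H x) \<le> enat i" by (intro Inf_lower) auto
      with h have "enat N < enat i" by (rule less_le_trans)
      then show False using i by simp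
    qed
  next
    assume h: "\<forall>i. 1 \<le> i \<and> i \<le> N \<longrightarrow> random_iterate \<gamma> i (shift_by k \<omega>) x \<notin> A"
    have "enat (Suc N) \<le> Inf (?H x)"
      using h by (intro Inf_greatest) (auto simp: not_less_eq_eq[symmetric])
    moreover have "enat N < enat (Suc N)" by simp
    ultimately show "Inf (?H x) > enat N" by (rule less_le_trans[rotated])
  qed
  then show ?thesis
    by (auto simp: hitting_time_def survivors_def random_iterate_eq)
qed

end

text \<open>Finite range of dependence; it makes \<open>pull_dens\<close> in distant fibres depend
  on disjoint sets of coordinates.\<close>

lemma Pn_depend:
  "(\<And>j. k \<le> j \<Longrightarrow> j < k + int n \<Longrightarrow> a j = a' j) \<Longrightarrow> Pn a n k f = Pn a' n k f"
proof (induction n arbitrary: k f)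
  case (Suc n)
  have "Pn a n (k + 1) (Pop (a k) f) = Pn a' n (k + 1) (Pop (a k) f)"
    by (rule Suc.IH) (auto intro!: Suc.prems)
  moreover have "a k = a' k" by (rule Suc.prems) auto
  ultimately show ?case by simp
qed simp

subsection \<open>Random parameters\<close>

locale rand_lsv = lsv G for G +
  fixes q :: nat and p \<gamma> :: "nat \<Rightarrow> real"
  assumes q1: "1 \<le> q" and par_\<gamma>: "\<And>i. i \<in> {1..q} \<Longrightarrow> param (\<gamma> i)"
    and p0: "\<And>i. i \<in> {1..q} \<Longrightarrow> 0 \<le> p i" and p1: "(\<Sum>i\<in>{1..q}. p i) = 1"
begin

abbreviation "M0 \<equiv> point_measure {1..q} (\<lambda>i. ennreal (p i))"
abbreviation "PP \<equiv> bernoulli_measure q p"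

definition params :: "(int \<Rightarrow> nat) \<Rightarrow> int \<Rightarrow> real" where
  "params \<omega> = (\<lambda>j. \<gamma> (\<omega> j))"

lemma prob_M0: "prob_space M0"
proof (rule prob_space_point_measure)
  have "(\<Sum>i\<in>{1..q}. ennreal (p i)) = ennreal (\<Sum>i\<in>{1..q}. p i)" by (rule sum_ennreal) (rule p0)
  then show "(\<Sum>i\<in>{1..q}. ennreal (p i)) = 1" unfolding p1 by simp
qed auto

sublocale M0: prob_space M0 by (rule prob_M0)

sublocale PP: prob_space PP
  unfolding bernoulli_measure_def by (intro prob_space_PiM prob_M0)

lemma space_PP: "space PP = {\<omega>. \<forall>j. \<omega> j \<in> {1..q}}"
  by (auto simp: bernoulli_measure_def space_PiM space_point_measure PiE_def Pi_def)

lemma admissible_params: "\<omega> \<in> space PP \<Longrightarrow> admissible (params \<omega>)"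
  using par_\<gamma> unfolding space_PP admissible_def params_def by blast

lemma coord_measurable: "(\<lambda>\<omega>. \<omega> k) \<in> measurable PP M0"
  unfolding bernoulli_measure_def by (rule measurable_component_singleton) simp

lemma coord_set: "{\<omega> \<in> space PP. \<omega> k = i} \<in> sets PP"
proof (cases "i \<in> {1..q}")
  case True
  have "(\<lambda>\<omega>. \<omega> k) -` {i} \<inter> space PP \<in> sets PP"
    using True by (intro measurable_sets[OF coord_measurable]) (auto simp: sets_point_measure)
  moreover have "(\<lambda>\<omega>. \<omega> k) -` {i} \<inter> space PP = {\<omega> \<in> space PP. \<omega> k = i}" by auto
  ultimately show ?thesis by simp
next
  case False
  then have "{\<omega> \<in> space PP. \<omega> k = i} = {}" by (auto simp: space_PP)
  then show ?thesis by (rule ssubst) (rule sets.empty_sets)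
qed

lemma split_coord:
  fixes F :: "nat \<Rightarrow> 'b :: comm_monoid_add"
  assumes "\<omega> \<in> space PP"
  shows "F (\<omega> k) = (\<Sum>i\<in>{1..q}. if \<omega> k = i then F i else 0)"
  using assms by (subst sum.delta') (auto simp: space_PP)

lemma Phi_Pn_measurable:
  fixes \<Phi> :: "(real \<Rightarrow> real) \<Rightarrow> real"
  shows "(\<lambda>\<omega>. \<Phi> (Pn (params \<omega>) n k f)) \<in> borel_measurable PP"
proof (induction n arbitrary: k f)
  case (Suc n)
  have "(\<lambda>\<omega>. \<Sum>i\<in>{1..q}. if \<omega> k = i then \<Phi> (Pn (params \<omega>) n (k + 1) (Pop (\<gamma> i) f)) else 0) \<in> borel_measurable PP"
    by (intro borel_measurable_sum measurable_If Suc.IH) (auto simp: coord_set)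
  moreover have "\<Phi> (Pn (params \<omega>) (Suc n) k f)
      = (\<Sum>i\<in>{1..q}. if \<omega> k = i then \<Phi> (Pn (params \<omega>) n (k + 1) (Pop (\<gamma> i) f)) else 0)" if "\<omega> \<in> space PP" for \<omega>
    using split_coord[OF that, of "\<lambda>i. \<Phi> (Pn (params \<omega>) n (k + 1) (Pop (\<gamma> i) f))" k] by (simp add: params_def)
  ultimately show ?case by (subst measurable_cong) auto
qed simp

text \<open>Independence by resampling: replacing coordinate \<open>k\<close> by a fresh draw
  preserves the product measure (\<open>eq\<close>) and does not change \<open>Z\<close>, so the
  integral becomes one over a product of two spaces.\<close>

lemma coord_independent:
  assumes Z: "Z \<in> borel_measurable PP" "\<And>\<omega>. \<omega> \<in> space PP \<Longrightarrow> \<bar>Z \<omega>\<bar> \<le> (B :: real)"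
    and inv: "\<And>\<omega> c. \<omega> \<in> space PP \<Longrightarrow> c \<in> {1..q} \<Longrightarrow> Z (fun_upd \<omega> k c) = Z \<omega>" and i: "i \<in> {1..q}"
  shows "(\<integral>\<omega>. (if \<omega> k = i then Z \<omega> else 0) \<partial>PP) = p i * (\<integral>\<omega>. Z \<omega> \<partial>PP)"
proof -
  interpret P2: pair_prob_space M0 PP ..
  have eq: "distr (M0 \<Otimes>\<^sub>M PP) PP (\<lambda>(x, V). V(k := x)) = PP"
    using distr_pair_PiM_eq_PiM[of UNIV "\<lambda>_. M0" k] prob_M0 by (simp add: bernoulli_measure_def)
  have m: "(\<lambda>(x, V). V(k := x)) \<in> measurable (M0 \<Otimes>\<^sub>M PP) PP"
    unfolding bernoulli_measure_def split_beta' by (rule measurable_fun_upd[of _ UNIV]) auto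
  let ?F = "\<lambda>\<omega>. if \<omega> k = i then Z \<omega> else 0"
  have Fm: "?F \<in> borel_measurable PP" using Z(1) by (intro measurable_If) (auto simp: coord_set)
  have Zi: "integrable PP Z" using Z by (intro PP.integrable_const_bound[where B = B]) auto
  have "(\<integral>\<omega>. ?F \<omega> \<partial>PP) = (\<integral>y. ?F (case y of (x, V) \<Rightarrow> V(k := x)) \<partial>(M0 \<Otimes>\<^sub>M PP))"
    by (subst (1) eq[symmetric], rule integral_distr[OF m Fm])
  also have "\<dots> = (\<integral>y. (case y of (x, V) \<Rightarrow> (if x = i then 1 else 0) * Z V) \<partial>(M0 \<Otimes>\<^sub>M PP))"
  proof (rule Bochner_Integration.integral_cong)
    fix y assume "y \<in> space (M0 \<Otimes>\<^sub>M PP)"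
    then show "?F (case y of (x, V) \<Rightarrow> V(k := x)) = (case y of (x, V) \<Rightarrow> (if x = i then 1 else 0) * Z V)"
      using inv by (auto simp: space_pair_measure space_point_measure split: prod.split)
  qed simp
  also have "\<dots> = (\<integral>x. (\<integral>V. (if x = i then 1 else 0) * Z V \<partial>PP) \<partial>M0)"
  proof (rule P2.integral_fst[symmetric])
    have [measurable]: "(\<lambda>x. if x = i then 1 else 0 :: real) \<in> borel_measurable M0" by simp
    note [measurable] = Z(1)
    show "integrable (M0 \<Otimes>\<^sub>M PP) (\<lambda>(x, V). (if x = i then 1 else 0) * Z V)"
    proof (rule P2.P.integrable_const_bound[where B = B])
      show "AE x in M0 \<Otimes>\<^sub>M PP. norm (case x of (x, V) \<Rightarrow> (if x = i then 1 else 0) * Z V) \<le> B"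
      proof (rule AE_I2)
        fix y assume "y \<in> space (M0 \<Otimes>\<^sub>M PP)"
        then obtain u v where y: "y = (u, v)" "v \<in> space PP" by (auto simp: space_pair_measure)
        have "\<bar>(if u = i then 1 else 0) * Z v\<bar> \<le> \<bar>Z v\<bar>" by simp
        then show "norm (case y of (x, V) \<Rightarrow> (if x = i then 1 else 0) * Z V) \<le> B"
          using Z(2)[OF y(2)] by (simp add: y)
      qed
    qed measurable
  qed
  also have "\<dots> = (\<integral>x. (if x = i then 1 else 0) \<partial>M0) * (\<integral>\<omega>. Z \<omega> \<partial>PP)"
    by simp
  also have "(\<integral>x. (if x = i then 1 else 0) \<partial>M0) = p i"
    using i p0 by (subst lebesgue_integral_point_measure_finite) (auto simp: if_distrib cong: if_cong)
  finally show ?thesis .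
qed

text \<open>The expectation of \<Phi> after \<open>n\<close> random operators, computed symbol by
  symbol. That no starting index appears expresses stationarity.\<close>

primrec Qn :: "((real \<Rightarrow> real) \<Rightarrow> real) \<Rightarrow> nat \<Rightarrow> (real \<Rightarrow> real) \<Rightarrow> real" where
  "Qn \<Phi> 0 f = \<Phi> f"
| "Qn \<Phi> (Suc n) f = (\<Sum>i\<in>{1..q}. p i * Qn \<Phi> n (Pop (\<gamma> i) f))"

lemma Phi_Pn_bounded:
  fixes \<Phi> :: "(real \<Rightarrow> real) \<Rightarrow> real"
  shows "\<exists>C. \<forall>\<omega>\<in>space PP. \<forall>k. \<bar>\<Phi> (Pn (params \<omega>) n k f)\<bar> \<le> C"
proof (induction n arbitrary: f)
  case (Suc n)
  have "\<forall>i. \<exists>C. \<forall>\<omega>\<in>space PP. \<forall>k. \<bar>\<Phi> (Pn (params \<omega>) n k (Pop (\<gamma> i) f))\<bar> \<le> C" using Suc by blast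
  from choice[OF this] obtain C where C: "\<And>i \<omega> k. \<omega> \<in> space PP \<Longrightarrow> \<bar>\<Phi> (Pn (params \<omega>) n k (Pop (\<gamma> i) f))\<bar> \<le> C i" by blast
  have "\<bar>\<Phi> (Pn (params \<omega>) (Suc n) k f)\<bar> \<le> (\<Sum>i\<in>{1..q}. \<bar>C i\<bar>)" if "\<omega> \<in> space PP" for \<omega> k
  proof -
    have "\<bar>\<Phi> (Pn (params \<omega>) (Suc n) k f)\<bar> \<le> \<bar>C (\<omega> k)\<bar>"
      using C[OF that, of "k + 1" "\<omega> k"] by (simp add: params_def)
    also have "\<dots> \<le> (\<Sum>i\<in>{1..q}. \<bar>C i\<bar>)"
      using that by (intro member_le_sum) (auto simp: space_PP)
    finally show ?thesis .
  qed
  then show ?case by blast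
qed auto

text \<open>Invariance of \<open>Z\<close> under changes of the coordinates from \<open>k\<close> on
  says that \<open>Z\<close> depends on the past only. Each induction step puts the indicator of one
  symbol at \<open>k\<close> into \<open>Z\<close>, which then belongs to the past of
  \<open>k + 1\<close>.\<close>

lemma expectation_Pn:
  fixes \<Phi> :: "(real \<Rightarrow> real) \<Rightarrow> real"
  assumes Z: "Z \<in> borel_measurable PP" "\<And>\<omega>. \<omega> \<in> space PP \<Longrightarrow> \<bar>Z \<omega>\<bar> \<le> (B :: real)"
    and inv: "\<And>\<omega> c j. \<omega> \<in> space PP \<Longrightarrow> c \<in> {1..q} \<Longrightarrow> k \<le> j \<Longrightarrow> Z (fun_upd \<omega> j c) = Z \<omega>"
  shows "(\<integral>\<omega>. Z \<omega> * \<Phi> (Pn (params \<omega>) n k f) \<partial>PP) = (\<integral>\<omega>. Z \<omega> \<partial>PP) * Qn \<Phi> n f"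
  using assms
proof (induction n arbitrary: k f Z)
  case (Suc n)
  let ?Zi = "\<lambda>i \<omega>. if \<omega> k = i then Z \<omega> else 0"
  have Zm: "?Zi i \<in> borel_measurable PP" for i using Suc.prems(1) by (intro measurable_If) (auto simp: coord_set)
  have Zb: "\<bar>?Zi i \<omega>\<bar> \<le> B" if "\<omega> \<in> space PP" for i \<omega>
    using Suc.prems(2)[OF that] by auto
  have Zinv: "?Zi i (fun_upd \<omega> j c) = ?Zi i \<omega>" if "\<omega> \<in> space PP" "c \<in> {1..q}" "k + 1 \<le> j" for i \<omega> c j
  proof -
    have "Z (fun_upd \<omega> j c) = Z \<omega>" using that by (intro Suc.prems(3)) auto
    moreover have "fun_upd \<omega> j c k = \<omega> k" using that by simp
    ultimately show ?thesis by (simp only:)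
  qed
  have int: "integrable PP (\<lambda>\<omega>. ?Zi i \<omega> * \<Phi> (Pn (params \<omega>) n (k + 1) g))" for i g
  proof -
    obtain C where C: "\<And>\<omega>. \<omega> \<in> space PP \<Longrightarrow> \<bar>\<Phi> (Pn (params \<omega>) n (k + 1) g)\<bar> \<le> C"
      using Phi_Pn_bounded[of \<Phi> n g] by blast
    show ?thesis
    proof (rule PP.integrable_const_bound[where B = "B * C"])
      show "AE \<omega> in PP. norm (?Zi i \<omega> * \<Phi> (Pn (params \<omega>) n (k + 1) g)) \<le> B * C"
      proof (rule AE_I2)
        fix \<omega> assume w: "\<omega> \<in> space PP"
        show "norm (?Zi i \<omega> * \<Phi> (Pn (params \<omega>) n (k + 1) g)) \<le> B * C"
          unfolding real_norm_def abs_mult using Zb[OF w, of i] C[OF w]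
          by (intro mult_mono) (auto intro: order_trans[OF abs_ge_zero])
      qed
    qed (intro borel_measurable_times Zm Phi_Pn_measurable)
  qed
  have "(\<integral>\<omega>. Z \<omega> * \<Phi> (Pn (params \<omega>) (Suc n) k f) \<partial>PP)
      = (\<integral>\<omega>. (\<Sum>i\<in>{1..q}. ?Zi i \<omega> * \<Phi> (Pn (params \<omega>) n (k + 1) (Pop (\<gamma> i) f))) \<partial>PP)"
  proof (rule Bochner_Integration.integral_cong)
    fix \<omega> assume w: "\<omega> \<in> space PP"
    show "Z \<omega> * \<Phi> (Pn (params \<omega>) (Suc n) k f) = (\<Sum>i\<in>{1..q}. ?Zi i \<omega> * \<Phi> (Pn (params \<omega>) n (k + 1) (Pop (\<gamma> i) f)))"
      using split_coord[OF w, of "\<lambda>i. Z \<omega> * \<Phi> (Pn (params \<omega>) n (k + 1) (Pop (\<gamma> i) f))" k]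
      by (simp add: params_def if_distrib[of "\<lambda>x. x * _"] cong: if_cong)
  qed simp
  also have "\<dots> = (\<Sum>i\<in>{1..q}. (\<integral>\<omega>. ?Zi i \<omega> * \<Phi> (Pn (params \<omega>) n (k + 1) (Pop (\<gamma> i) f)) \<partial>PP))"
    by (rule Bochner_Integration.integral_sum[OF int])
  also have "\<dots> = (\<Sum>i\<in>{1..q}. (\<integral>\<omega>. ?Zi i \<omega> \<partial>PP) * Qn \<Phi> n (Pop (\<gamma> i) f))"
    by (intro sum.cong refl Suc.IH[OF Zm Zb Zinv])
  also have "\<dots> = (\<Sum>i\<in>{1..q}. (p i * (\<integral>\<omega>. Z \<omega> \<partial>PP)) * Qn \<Phi> n (Pop (\<gamma> i) f))"
  proof (intro sum.cong refl arg_cong2[where f = "(*)"])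
    fix i assume i: "i \<in> {1..q}"
    show "(\<integral>\<omega>. ?Zi i \<omega> \<partial>PP) = p i * (\<integral>\<omega>. Z \<omega> \<partial>PP)"
      by (rule coord_independent[OF Suc.prems(1,2) _ i], assumption, rule Suc.prems(3)) auto
  qed
  also have "\<dots> = (\<integral>\<omega>. Z \<omega> \<partial>PP) * Qn \<Phi> (Suc n) f"
    by (simp add: sum_distrib_left ac_simps)
  finally show ?case .
qed simp

end

subsection \<open>A law of large numbers for the fibre densities\<close>

text \<open>Vanishing correlations at distance \<open>l\<close> make the second moment of the
  partial sums linear in \<open>n\<close>. Along squares the second moments of the averages are
  therefore summable; between consecutive squares boundedness controls the partial sums.\<close>

lemma (in prob_space) slln_bounded_dependent:
  fixes D :: "nat \<Rightarrow> 'a \<Rightarrow> real"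
  assumes m [measurable]: "\<And>k. D k \<in> borel_measurable M" and b: "\<And>k x. x \<in> space M \<Longrightarrow> \<bar>D k x\<bar> \<le> B"
    and uncorr: "\<And>j k. j + l \<le> k \<Longrightarrow> (\<integral>x. D j x * D k x \<partial>M) = 0"
  shows "AE x in M. (\<lambda>n. (\<Sum>k<n. D k x) / real n) \<longlonglongrightarrow> 0"
proof -
  have B0: "0 \<le> B" using b not_empty by (meson abs_ge_zero ex_in_conv order_trans)
  define S where "S = (\<lambda>n x. \<Sum>k<n. D k x)"
  have Sm [measurable]: "S n \<in> borel_measurable M" for n unfolding S_def by measurable
  have int: "integrable M (\<lambda>x. D j x * D k x)" for j k
  proof (rule integrable_const_bound[where B = "B * B"])
    show "AE x in M. norm (D j x * D k x) \<le> B * B"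
      using b B0 by (intro AE_I2) (simp add: abs_mult mult_mono)
  qed measurable
  have DD: "(\<integral>x. D j x * D k x \<partial>M) \<le> (if j < k + l \<and> k < j + l then B * B else 0)" for j k
  proof (cases "j < k + l \<and> k < j + l")
    case True
    have "(\<integral>x. D j x * D k x \<partial>M) \<le> (\<integral>x. B * B \<partial>M)"
    proof (rule integral_mono[OF int])
      fix x assume x: "x \<in> space M"
      have "D j x * D k x \<le> \<bar>D j x\<bar> * \<bar>D k x\<bar>" by (metis abs_ge_self abs_mult)
      also have "\<dots> \<le> B * B" using b[OF x] B0 by (intro mult_mono) auto
      finally show "D j x * D k x \<le> B * B" .
    qed auto
    then show ?thesis using True by (simp add: prob_space)
  next
    case False
    then show ?thesis using uncorr[of j k] uncorr[of k j] by (auto simp: mult.commute not_less)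
  qed
  have S2: "(\<integral>x. (S n x)\<^sup>2 \<partial>M) \<le> real n * (2 * real l * (B * B))" for n
  proof -
    have "(\<integral>x. (S n x)\<^sup>2 \<partial>M) = (\<integral>x. (\<Sum>j<n. \<Sum>k<n. D j x * D k x) \<partial>M)"
      by (simp add: S_def power2_eq_square sum_product)
    also have "\<dots> = (\<Sum>j<n. \<Sum>k<n. (\<integral>x. D j x * D k x \<partial>M))"
      using int by (simp add: Bochner_Integration.integral_sum Bochner_Integration.integrable_sum)
    also have "\<dots> \<le> (\<Sum>j<n. \<Sum>k<n. if j < k + l \<and> k < j + l then B * B else 0)"
      by (intro sum_mono DD)
    also have "\<dots> \<le> (\<Sum>j<n. 2 * real l * (B * B))"
    proof (rule sum_mono)
      fix j assume "j \<in> {..<n}"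
      have "(\<Sum>k<n. if j < k + l \<and> k < j + l then B * B else 0) = (\<Sum>k\<in>{k\<in>{..<n}. j < k + l \<and> k < j + l}. B * B)"
        by (rule sum.inter_filter[symmetric]) simp
      also have "\<dots> = real (card {k\<in>{..<n}. j < k + l \<and> k < j + l}) * (B * B)" by simp
      also have "\<dots> \<le> real (2 * l) * (B * B)"
      proof (rule mult_right_mono)
        have "card {k\<in>{..<n}. j < k + l \<and> k < j + l} \<le> card {j - l..<j + l}"
          by (intro card_mono) auto
        also have "\<dots> \<le> 2 * l" by simp
        finally show "real (card {k\<in>{..<n}. j < k + l \<and> k < j + l}) \<le> real (2 * l)" by simp
      qed (use B0 in auto)
      finally show "(\<Sum>k<n. if j < k + l \<and> k < j + l then B * B else 0) \<le> 2 * real l * (B * B)" by simp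
    qed
    finally show ?thesis by simp
  qed
  have Sb: "\<bar>S n x\<bar> \<le> real n * B" if "x \<in> space M" for n x
  proof -
    have "\<bar>S n x\<bar> \<le> (\<Sum>k<n. \<bar>D k x\<bar>)" unfolding S_def by (rule sum_abs)
    also have "\<dots> \<le> (\<Sum>k<n. B)" by (intro sum_mono b that)
    finally show ?thesis by simp
  qed
  define T where "T = (\<lambda>i x. (S (Suc i ^ 2) x / real (Suc i ^ 2))\<^sup>2)"
  have Tm [measurable]: "T i \<in> borel_measurable M" for i unfolding T_def by measurable
  have S2i: "integrable M (\<lambda>x. (S n x)\<^sup>2)" for n
  proof (rule integrable_const_bound[where B = "(real n * B)\<^sup>2"])
    show "AE x in M. norm ((S n x)\<^sup>2) \<le> (real n * B)\<^sup>2"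
      using Sb B0 by (intro AE_I2) (simp add: abs_le_square_iff[symmetric])
  qed measurable
  have ET: "(\<integral>\<^sup>+x. ennreal (T i x) \<partial>M) \<le> ennreal (2 * real l * (B * B) * inverse (real (Suc i) ^ 2))" for i
  proof -
    have "(\<integral>\<^sup>+x. ennreal (T i x) \<partial>M) = ennreal (\<integral>x. T i x \<partial>M)"
      unfolding T_def power_divide using S2i by (intro nn_integral_eq_integral) auto
    also have "(\<integral>x. T i x \<partial>M) = (\<integral>x. (S (Suc i ^ 2) x)\<^sup>2 \<partial>M) / (real (Suc i ^ 2))\<^sup>2"
      unfolding T_def power_divide by simp
    also have "ennreal \<dots> \<le> ennreal (real (Suc i ^ 2) * (2 * real l * (B * B)) / (real (Suc i ^ 2))\<^sup>2)"
      by (intro ennreal_leI divide_right_mono S2) auto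
    also have "real (Suc i ^ 2) * (2 * real l * (B * B)) / (real (Suc i ^ 2))\<^sup>2 = 2 * real l * (B * B) * inverse (real (Suc i) ^ 2)"
    proof -
      have "y * c / y\<^sup>2 = c * inverse y" if "y \<noteq> 0" for y c :: real
        using that by (simp add: power2_eq_square field_simps)
      then show ?thesis by (metis of_nat_power of_nat_0_neq power_not_zero)
    qed
    finally show ?thesis .
  qed
  have summ: "summable (\<lambda>i. 2 * real l * (B * B) * inverse (real (Suc i) ^ 2))"
  proof (rule summable_mult)
    have "summable (\<lambda>i. inverse (real i ^ 2))" by (rule inverse_power_summable) simp
    then show "summable (\<lambda>i. inverse (real (Suc i) ^ 2))"
      using summable_Suc_iff[of "\<lambda>i. inverse (real i ^ 2)"] by (simp only:)
  qed
  have "(\<integral>\<^sup>+x. (\<Sum>i. ennreal (T i x)) \<partial>M) = (\<Sum>i. \<integral>\<^sup>+x. ennreal (T i x) \<partial>M)"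
    by (rule nn_integral_suminf) measurable
  also have "\<dots> \<le> (\<Sum>i. ennreal (2 * real l * (B * B) * inverse (real (Suc i) ^ 2)))"
    by (intro suminf_le ET) auto
  also have "\<dots> < \<infinity>"
    using summ B0 by (subst suminf_ennreal2) auto
  finally have "AE x in M. (\<Sum>i. ennreal (T i x)) \<noteq> \<infinity>"
    by (intro nn_integral_PInf_AE) auto
  then show ?thesis
  proof (rule AE_mp, intro AE_I2 impI)
    fix x assume x: "x \<in> space M" and fin: "(\<Sum>i. ennreal (T i x)) \<noteq> \<infinity>"
    have "summable (\<lambda>i. T i x)"
      using fin by (intro summable_suminf_not_top) (auto simp: T_def)
    then have "(\<lambda>i. T i x) \<longlonglongrightarrow> 0" by (rule summable_LIMSEQ_zero)
    then have "(\<lambda>i. sqrt (T i x)) \<longlonglongrightarrow> sqrt 0" by (intro tendsto_real_sqrt)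
    then have "(\<lambda>i. \<bar>S (Suc i ^ 2) x\<bar> / real (Suc i ^ 2)) \<longlonglongrightarrow> 0"
      by (simp add: T_def abs_divide)
    then have lim0: "(\<lambda>i. \<bar>S (i ^ 2) x\<bar> / real (i ^ 2)) \<longlonglongrightarrow> 0"
      by (subst filterlim_sequentially_Suc[symmetric])
    define m where "m = (\<lambda>n. nat \<lfloor>sqrt (real n)\<rfloor>)"
    have mlim: "filterlim m at_top sequentially"
      unfolding m_def
      by (intro filterlim_compose[OF filterlim_nat_sequentially] filterlim_compose[OF filterlim_floor_sequentially]
          filterlim_compose[OF sqrt_at_top filterlim_real_sequentially])
    have "(\<lambda>n. \<bar>S (m n ^ 2) x\<bar> / real (m n ^ 2) + (2 * real (m n) + 1) * B / (real (m n))\<^sup>2) \<longlonglongrightarrow> 0 + 0"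
    proof (rule tendsto_add)
      show "(\<lambda>n. \<bar>S (m n ^ 2) x\<bar> / real (m n ^ 2)) \<longlonglongrightarrow> 0"
        using filterlim_compose[OF lim0 mlim] .
      have "(\<lambda>i. (2 * real i + 1) * B / (real i)\<^sup>2) \<longlonglongrightarrow> 0" by real_asymp
      from filterlim_compose[OF this mlim] show "(\<lambda>n. (2 * real (m n) + 1) * B / (real (m n))\<^sup>2) \<longlonglongrightarrow> 0" .
    qed
    then have up: "(\<lambda>n. \<bar>S (m n ^ 2) x\<bar> / real (m n ^ 2) + (2 * real (m n) + 1) * B / (real (m n))\<^sup>2) \<longlonglongrightarrow> 0" by simp
    have le: "\<bar>S n x / real n\<bar> \<le> \<bar>S (m n ^ 2) x\<bar> / real (m n ^ 2) + (2 * real (m n) + 1) * B / (real (m n))\<^sup>2"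
      if n: "1 \<le> n" for n
    proof -
      have s: "0 \<le> sqrt (real n)" "1 \<le> sqrt (real n)" using n by auto
      have mr: "real (m n) \<le> sqrt (real n)" "sqrt (real n) < real (m n) + 1"
      proof -
        have "real (m n) = real_of_int \<lfloor>sqrt (real n)\<rfloor>" using s by (simp add: m_def)
        then show "real (m n) \<le> sqrt (real n)" "sqrt (real n) < real (m n) + 1" by linarith+
      qed
      then have m1: "1 \<le> m n" using s unfolding m_def by (auto simp: le_nat_iff le_floor_iff)
      have "(real (m n))\<^sup>2 \<le> real n" using mr(1) s by (metis of_nat_0_le_iff power2_le_iff_abs_le power_mono real_sqrt_pow2)
      then have mn: "m n ^ 2 \<le> n" by (metis of_nat_le_iff of_nat_power)
      have "real n = (sqrt (real n))\<^sup>2" by simp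
      also have "\<dots> \<le> (real (m n) + 1)\<^sup>2" using mr s by (intro power_mono) auto
      finally have nm: "real n - (real (m n))\<^sup>2 \<le> 2 * real (m n) + 1" by (simp add: power2_eq_square algebra_simps)
      have "S n x = S (m n ^ 2) x + (\<Sum>k\<in>{m n ^ 2..<n}. D k x)"
        unfolding S_def using mn by (metis atLeast0LessThan sum.atLeastLessThan_concat zero_le)
      moreover have "\<bar>\<Sum>k\<in>{m n ^ 2..<n}. D k x\<bar> \<le> (\<Sum>k\<in>{m n ^ 2..<n}. B)"
        by (rule order_trans[OF sum_abs]) (intro sum_mono b x)
      moreover have "(\<Sum>k\<in>{m n ^ 2..<n}. B) \<le> (2 * real (m n) + 1) * B"
        using nm mn B0 by (simp add: of_nat_diff mult_right_mono)
      ultimately have "\<bar>S n x\<bar> \<le> \<bar>S (m n ^ 2) x\<bar> + (2 * real (m n) + 1) * B" by linarith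
      then have "\<bar>S n x\<bar> / real n \<le> (\<bar>S (m n ^ 2) x\<bar> + (2 * real (m n) + 1) * B) / real n"
        by (intro divide_right_mono) auto
      also have "\<dots> \<le> (\<bar>S (m n ^ 2) x\<bar> + (2 * real (m n) + 1) * B) / real (m n ^ 2)"
      proof (rule divide_left_mono)
        show "real (m n ^ 2) \<le> real n" using mn by (simp only: of_nat_le_iff)
        have "0 < real n" "0 < real (m n ^ 2)" using n m1 by auto
        then show "0 < real n * real (m n ^ 2)" by (rule mult_pos_pos)
      qed (use B0 in \<open>auto intro!: add_nonneg_nonneg mult_nonneg_nonneg\<close>)
      finally show ?thesis by (simp add: add_divide_distrib)
    qed
    have "(\<lambda>n. S n x / real n) \<longlonglongrightarrow> 0"
      by (rule Lim_null_comparison[OF _ up]) (use le in \<open>auto simp: eventually_sequentially intro!: exI[of _ 1]\<close>)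
    then show "(\<lambda>n. (\<Sum>k<n. D k x) / real n) \<longlonglongrightarrow> 0" by (simp add: S_def)
  qed
qed

lemma integral_U_ind:
  assumes "B \<in> sets borel" "B \<subseteq> {0..1}"
  shows "(\<integral>x. indicator B x \<partial>U) = measure lborel B"
proof -
  have eq: "indicator {0..1} x * indicator B x = (indicator B x :: real)" for x :: real
    using assms(2) by (auto split: split_indicator)
  show ?thesis unfolding integral_U eq using assms by simp
qed

context lsv
begin

lemma fibre_mass_approx:
  assumes a: "admissible a" and B: "B \<in> sets borel" "B \<subseteq> {x0 - r..x0 + r}" and \<delta>: "0 < \<delta>" "\<delta> \<le> x0 - r" "x0 + r \<le> 1" and r: "0 \<le> r"
  shows "\<bar>fibre_mass a k B - measure lborel B * fibre_dens a k x0\<bar> \<le> (2 * a0 / \<delta>\<^sup>2 * r) * measure lborel B"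
proof -
  note D = cone_densD[OF cone_dens_fibre_dens[OF a], of k]
  let ?h = "fibre_dens a k" and ?L = "2 * a0 / \<delta>\<^sup>2 * r"
  have BU: "B \<subseteq> {0..1}" using B \<delta> by auto
  have lip: "\<bar>?h x - ?h x0\<bar> \<le> ?L" if "x \<in> B" for x
  proof -
    have x: "x0 - r \<le> x" "x \<le> x0 + r" using that B by auto
    have c: "2 * a0 / \<delta>\<^sup>2 * \<bar>x - x0\<bar> \<le> ?L" using x a0_gt by (intro mult_left_mono) auto
    show ?thesis
    proof (cases "x \<le> x0")
      case True
      have "0 \<le> ?h x - ?h x0" using reg_anti[OF D(1), of x x0] True x \<delta> r by auto
      moreover have "?h x - ?h x0 \<le> 2 * a0 / \<delta>\<^sup>2 * (x0 - x)"
        by (rule cone_lip[OF D(1,2) _ \<delta>(1)]) (use True x \<delta> r a0_gt in auto)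
      ultimately show ?thesis using c True by simp
    next
      case False
      have "0 \<le> ?h x0 - ?h x" using reg_anti[OF D(1), of x0 x] False x \<delta> r by auto
      moreover have "?h x0 - ?h x \<le> 2 * a0 / \<delta>\<^sup>2 * (x - x0)"
        by (rule cone_lip[OF D(1,2) _ \<delta>(1)]) (use False x \<delta> r a0_gt in auto)
      ultimately show ?thesis using c False by simp
    qed
  qed
  have iB: "integrable U (\<lambda>x. indicator B x * c)" for c :: real
    by (intro integrable_mult_left U.integrable_const_bound[where B = 1]) (use B in \<open>auto intro: measurable_U split: split_indicator\<close>)
  have ih: "integrable U (\<lambda>x. indicator B x * ?h x)" using fibre_dens_ind_integrable[OF a B(1)] by (simp add: mult.commute)
  have c: "(\<integral>x. indicator B x * c \<partial>U) = measure lborel B * c" for c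
    using integral_U_ind[OF B(1) BU] by simp
  have "fibre_mass a k B - measure lborel B * ?h x0 = (\<integral>x. indicator B x * ?h x - indicator B x * ?h x0 \<partial>U)"
    unfolding fibre_mass_def c[symmetric] by (rule Bochner_Integration.integral_diff[OF ih iB, symmetric])
  then have "\<bar>fibre_mass a k B - measure lborel B * ?h x0\<bar> \<le> (\<integral>x. \<bar>indicator B x * ?h x - indicator B x * ?h x0\<bar> \<partial>U)"
    by (simp add: integral_abs_bound)
  moreover have "(\<integral>x. \<bar>indicator B x * ?h x - indicator B x * ?h x0\<bar> \<partial>U) \<le> (\<integral>x. indicator B x * ?L \<partial>U)"
    using ih iB lip by (intro integral_mono) (auto split: split_indicator)
  ultimately have "\<bar>fibre_mass a k B - measure lborel B * ?h x0\<bar> \<le> (\<integral>x. indicator B x * ?L \<partial>U)" by (rule order_trans)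
  then show ?thesis unfolding c by (simp only: mult.commute[of "measure lborel B" ?L])
qed

lemma ball_return_le_1: "ball_return a j k r x0 \<le> 1"
proof -
  have "ball_return a j k r x0 \<le> (\<integral>\<^sup>+x. 1 \<partial>U)" unfolding ball_return_def by (intro nn_integral_mono) (auto split: split_indicator)
  then show ?thesis using U.emeasure_space_1 by simp
qed

text \<open>
  Along \<open>n = i^4\<close> the averages of these sums over the centre are summable; monotonicity in the
  radius and in the ranges of summation covers the remaining \<open>n\<close>.
\<close>

definition return_sum :: "nat \<Rightarrow> nat \<Rightarrow> (int \<Rightarrow> real) \<Rightarrow> real \<Rightarrow> ennreal" where
  "return_sum M i a x0 = (\<Sum>k\<le>M * i ^ 4. \<Sum>j\<in>{1..M * i ^ 2}. ball_return a j (int k) (real M / real (i ^ 4)) x0)"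

lemma return_sum_finite: "return_sum M i a x0 < \<infinity>"
proof -
  have "ball_return a j k r x0 < \<infinity>" for j k r using ball_return_le_1[of a j k r x0] by (auto simp: le_less_trans)
  then show ?thesis unfolding return_sum_def by (auto simp: less_top[symmetric])
qed

lemma fibre_dens_lower:
  assumes "admissible a" "0 < x" "x \<le> 1"
  shows "16 * couple_const a0 \<le> fibre_dens a k x"
  using cone_lower[of "fibre_dens a k" a0 1 x] cone_densD[OF cone_dens_fibre_dens[OF assms(1)], of k] a0_gt assms by auto

lemma fibre_dens_upper:
  assumes "admissible a" "0 < x" "x \<le> 1"
  shows "fibre_dens a k x \<le> a0 * x powr (- G)"
  using pole_boundD[OF cone_fibre_dens(2)[OF assms(1)] assms(2,3)] .

end

context rand_lsv
begin

lemma fibre_dens_omega_measurable: "(\<lambda>\<omega>. fibre_dens (params \<omega>) k x) \<in> borel_measurable PP"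
  unfolding fibre_dens_def pull_dens_def by (intro borel_measurable_lim_metric Phi_Pn_measurable)

text \<open>A limit of the same functional of \<open>pull_dens\<close>, which depends on finitely
  many coordinates.\<close>

lemma fibre_mass_omega_measurable:
  assumes B: "B \<in> sets borel"
  shows "(\<lambda>\<omega>. fibre_mass (params \<omega>) k B) \<in> borel_measurable PP"
proof (rule borel_measurable_LIMSEQ_metric)
  let ?\<Phi> = "\<lambda>f. \<integral>x. indicator B x * f x \<partial>U"
  show "(\<lambda>\<omega>. ?\<Phi> (pull_dens (params \<omega>) k n)) \<in> borel_measurable PP" for n
    unfolding pull_dens_def by (rule Phi_Pn_measurable)
  fix \<omega> assume "\<omega> \<in> space PP"
  then have a: "admissible (params \<omega>)" by (rule admissible_params)
  note u = cone_densD[OF cone_dens_pull_dens[OF a]] and h = cone_densD[OF cone_dens_fibre_dens[OF a]]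
  have "norm (?\<Phi> (pull_dens (params \<omega>) k n) - fibre_mass (params \<omega>) k B) \<le> nrm (\<lambda>x. pull_dens (params \<omega>) k n x - fibre_dens (params \<omega>) k x)" for n
  proof -
    have iu: "integrable U (\<lambda>x. indicator B x * pull_dens (params \<omega>) k n x)" "integrable U (\<lambda>x. indicator B x * fibre_dens (params \<omega>) k x)"
      using integrable_mult_ind[OF u(4) B] integrable_mult_ind[OF h(4) B] by (auto simp: mult.commute)
    have "?\<Phi> (pull_dens (params \<omega>) k n) - fibre_mass (params \<omega>) k B = (\<integral>x. indicator B x * pull_dens (params \<omega>) k n x - indicator B x * fibre_dens (params \<omega>) k x \<partial>U)"
      unfolding fibre_mass_def using iu by simp
    then have "norm (?\<Phi> (pull_dens (params \<omega>) k n) - fibre_mass (params \<omega>) k B) \<le> (\<integral>x. \<bar>indicator B x * pull_dens (params \<omega>) k n x - indicator B x * fibre_dens (params \<omega>) k x\<bar> \<partial>U)"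
      by (simp add: integral_abs_bound)
    moreover have "(\<integral>x. \<bar>indicator B x * pull_dens (params \<omega>) k n x - indicator B x * fibre_dens (params \<omega>) k x\<bar> \<partial>U) \<le> nrm (\<lambda>x. pull_dens (params \<omega>) k n x - fibre_dens (params \<omega>) k x)"
      using iu u(4) h(4) by (intro integral_mono) (auto split: split_indicator)
    ultimately show ?thesis by linarith
  qed
  then have "(\<lambda>n. ?\<Phi> (pull_dens (params \<omega>) k n) - fibre_mass (params \<omega>) k B) \<longlonglongrightarrow> 0"
    by (intro Lim_null_comparison[OF _ fibre_dens_nrm_tendsto[OF a, of k]] always_eventually allI)
  then show "(\<lambda>n. ?\<Phi> (pull_dens (params \<omega>) k n)) \<longlonglongrightarrow> fibre_mass (params \<omega>) k B" by (simp add: LIM_zero_iff)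
qed

definition mean_dens :: "real \<Rightarrow> real" where
  "mean_dens x = (\<integral>\<omega>. fibre_dens (params \<omega>) 0 x \<partial>PP)"

lemma fibre_dens_omega_integrable:
  assumes "0 < x" "x \<le> 1"
  shows "integrable PP (\<lambda>\<omega>. fibre_dens (params \<omega>) k x)"
proof (rule PP.integrable_const_bound[where B = "a0 * x powr (- G)"])
  show "AE \<omega> in PP. norm (fibre_dens (params \<omega>) k x) \<le> a0 * x powr (- G)"
    using fibre_dens_upper[OF admissible_params assms] reg_nonneg[OF cone_fibre_dens(1)[OF admissible_params] assms] by (intro AE_I2) simp
qed (rule fibre_dens_omega_measurable)

lemma mean_dens_pos:
  assumes "0 < x" "x \<le> 1"
  shows "0 < mean_dens x"
proof -
  have "16 * couple_const a0 = (\<integral>\<omega>. 16 * couple_const a0 \<partial>PP)" using PP.prob_space by simp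
  also have "\<dots> \<le> mean_dens x"
    unfolding mean_dens_def using fibre_dens_omega_integrable[OF assms] fibre_dens_lower[OF admissible_params assms] by (intro integral_mono) auto
  finally show ?thesis using couple_const(1)[of a0] a0_gt by simp
qed

lemma shift_by_0: "shift_by 0 \<omega> = \<omega>"
  by (simp add: shift_by_def)

lemma stationary_eq:
  assumes "B \<in> sets borel" "B \<subseteq> {0..1}"
  shows "stationary_measure q p \<gamma> B = (\<integral>\<omega>. fibre_mass (params \<omega>) 0 B \<partial>PP)"
  unfolding stationary_measure_def
proof (rule Bochner_Integration.integral_cong)
  fix \<omega> assume "\<omega> \<in> space PP"
  then show "measure (sample_measure \<gamma> \<omega>) B = fibre_mass (params \<omega>) 0 B"
    using sample_measure_eq[of \<gamma> \<omega> B 0] admissible_params[of \<omega>] assms by (simp add: params_def shift_by_0)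
qed simp

lemma stationary_approx:
  assumes B: "B \<in> sets borel" "B \<subseteq> {x0 - r..x0 + r}" and \<delta>: "0 < \<delta>" "\<delta> \<le> x0 - r" "x0 + r \<le> 1" and r: "0 \<le> r"
  shows "\<bar>stationary_measure q p \<gamma> B - measure lborel B * mean_dens x0\<bar> \<le> (2 * a0 / \<delta>\<^sup>2 * r) * measure lborel B"
proof -
  have BU: "B \<subseteq> {0..1}" using B \<delta> by auto
  have x0: "0 < x0" "x0 \<le> 1" using \<delta> r by auto
  have wi: "integrable PP (\<lambda>\<omega>. fibre_mass (params \<omega>) 0 B)"
  proof (rule PP.integrable_const_bound[where B = 1])
    show "AE \<omega> in PP. norm (fibre_mass (params \<omega>) 0 B) \<le> 1"
      using fibre_mass_bounds[OF admissible_params B(1)] by (intro AE_I2) auto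
  qed (rule fibre_mass_omega_measurable[OF B(1)])
  note hi = fibre_dens_omega_integrable[OF x0, of 0]
  have "stationary_measure q p \<gamma> B - measure lborel B * mean_dens x0 = (\<integral>\<omega>. fibre_mass (params \<omega>) 0 B - measure lborel B * fibre_dens (params \<omega>) 0 x0 \<partial>PP)"
    unfolding stationary_eq[OF B(1) BU] mean_dens_def using wi hi by simp
  then have "\<bar>stationary_measure q p \<gamma> B - measure lborel B * mean_dens x0\<bar> \<le> (\<integral>\<omega>. \<bar>fibre_mass (params \<omega>) 0 B - measure lborel B * fibre_dens (params \<omega>) 0 x0\<bar> \<partial>PP)"
    by (simp add: integral_abs_bound)
  moreover have "(\<integral>\<omega>. \<bar>fibre_mass (params \<omega>) 0 B - measure lborel B * fibre_dens (params \<omega>) 0 x0\<bar> \<partial>PP) \<le> (\<integral>\<omega>. (2 * a0 / \<delta>\<^sup>2 * r) * measure lborel B \<partial>PP)"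
    using wi hi fibre_mass_approx[OF admissible_params B \<delta> r] by (intro integral_mono) auto
  ultimately show ?thesis using PP.prob_space by simp
qed

text \<open>The density pulled back over \<open>l\<close> steps to fibre \<open>k\<close> depends on
  the coordinates from \<open>k - l\<close> to \<open>k - 1\<close>, so terms at distance at least
  \<open>l\<close> are uncorrelated after centring.\<close>

lemma pull_dens_slln:
  assumes x: "0 < x" "x \<le> 1"
  shows "AE \<omega> in PP. (\<lambda>n. (\<Sum>k<n. pull_dens (params \<omega>) (int k) l x) / real n) \<longlonglongrightarrow> Qn (\<lambda>f. f x) l (\<lambda>_. 1)"
proof -
  define \<mu> where "\<mu> = Qn (\<lambda>f. f x) l (\<lambda>_. 1)"
  define Y where "Y = (\<lambda>k \<omega>. pull_dens (params \<omega>) (int k) l x)"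
  define D where "D = (\<lambda>k \<omega>. Y k \<omega> - \<mu>)"
  let ?K = "a0 * x powr (- G)"
  have Ym: "Y k \<in> borel_measurable PP" for k
    unfolding Y_def pull_dens_def by (rule Phi_Pn_measurable[of "\<lambda>f. f x"])
  have Yb: "\<bar>Y k \<omega>\<bar> \<le> ?K" if "\<omega> \<in> space PP" for k \<omega>
    using cone_densD[OF cone_dens_pull_dens[OF admissible_params[OF that]], of "int k" l] reg_nonneg[of _ x] pole_boundD[of a0 _ x] x by (auto simp: Y_def)
  have Dm: "D k \<in> borel_measurable PP" for k unfolding D_def using Ym by auto
  have Db: "\<bar>D k \<omega>\<bar> \<le> ?K + \<bar>\<mu>\<bar>" if "\<omega> \<in> space PP" for k \<omega>
    using Yb[OF that, of k] by (simp add: D_def)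
  have Yi: "integrable PP (Y k)" for k
    by (rule PP.integrable_const_bound[where B = ?K]) (use Yb Ym in auto)
  have EY: "(\<integral>\<omega>. Z \<omega> * Y k \<omega> \<partial>PP) = (\<integral>\<omega>. Z \<omega> \<partial>PP) * \<mu>"
    if "Z \<in> borel_measurable PP" "\<And>\<omega>. \<omega> \<in> space PP \<Longrightarrow> \<bar>Z \<omega>\<bar> \<le> C"
      "\<And>\<omega> c j. \<omega> \<in> space PP \<Longrightarrow> c \<in> {1..q} \<Longrightarrow> int k - int l \<le> j \<Longrightarrow> Z (fun_upd \<omega> j c) = Z \<omega>" for Z k C
    unfolding Y_def pull_dens_def \<mu>_def by (rule expectation_Pn[where \<Phi> = "\<lambda>f. f x", OF that])
  have ED: "(\<integral>\<omega>. D k \<omega> \<partial>PP) = 0" for k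
    using EY[of "\<lambda>_. 1" 1 k] Yi[of k] PP.prob_space by (simp add: D_def)
  have uncorr: "(\<integral>\<omega>. D j \<omega> * D k \<omega> \<partial>PP) = 0" if jk: "j + l \<le> k" for j k
  proof -
    have inv: "D j (fun_upd \<omega> i c) = D j \<omega>" if i: "int k - int l \<le> i" for \<omega> i c
    proof -
      have "Pn (params (fun_upd \<omega> i c)) l (int j - int l) (\<lambda>_. 1) = Pn (params \<omega>) l (int j - int l) (\<lambda>_. 1)"
        by (rule Pn_depend) (use i jk in \<open>auto simp: params_def\<close>)
      then show ?thesis by (simp add: D_def Y_def pull_dens_def)
    qed
    have 1: "(\<integral>\<omega>. D j \<omega> * Y k \<omega> \<partial>PP) = 0"
      using EY[of "D j" "?K + \<bar>\<mu>\<bar>" k] Dm Db inv ED by simp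
    have Di: "integrable PP (D j)" unfolding D_def using Yi by auto
    have DYi: "integrable PP (\<lambda>\<omega>. D j \<omega> * Y k \<omega>)"
    proof (rule PP.integrable_const_bound[where B = "(?K + \<bar>\<mu>\<bar>) * ?K"])
      show "AE \<omega> in PP. norm (D j \<omega> * Y k \<omega>) \<le> (?K + \<bar>\<mu>\<bar>) * ?K"
        unfolding real_norm_def abs_mult
        by (intro AE_I2 mult_mono Db Yb) (use a0_gt in \<open>auto intro!: add_nonneg_nonneg mult_nonneg_nonneg\<close>)
    qed (use Dm Ym in auto)
    have "(\<integral>\<omega>. D j \<omega> * D k \<omega> \<partial>PP) = (\<integral>\<omega>. D j \<omega> * Y k \<omega> - D j \<omega> * \<mu> \<partial>PP)"
      by (simp add: D_def[of ] right_diff_distrib)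
    also have "\<dots> = 0" using DYi Di 1 ED by simp
    finally show ?thesis .
  qed
  have "AE \<omega> in PP. (\<lambda>n. (\<Sum>k<n. D k \<omega>) / real n) \<longlonglongrightarrow> 0"
    by (rule PP.slln_bounded_dependent[OF Dm Db uncorr])
  then show ?thesis
  proof eventually_elim
    fix \<omega> assume "(\<lambda>n. (\<Sum>k<n. D k \<omega>) / real n) \<longlonglongrightarrow> 0"
    then have "(\<lambda>n. (\<Sum>k<n. D k \<omega>) / real n + \<mu>) \<longlonglongrightarrow> 0 + \<mu>" by (intro tendsto_intros)
    moreover have "\<forall>\<^sub>F n in sequentially. (\<Sum>k<n. D k \<omega>) / real n + \<mu> = (\<Sum>k<n. Y k \<omega>) / real n"
      unfolding eventually_sequentially
      by (intro exI[of _ 1]) (auto simp: D_def sum_subtractf diff_divide_distrib)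
    ultimately have "(\<lambda>n. (\<Sum>k<n. Y k \<omega>) / real n) \<longlonglongrightarrow> 0 + \<mu>" by (rule Lim_transform_eventually)
    then show "(\<lambda>n. (\<Sum>k<n. pull_dens (params \<omega>) (int k) l x) / real n) \<longlonglongrightarrow> Qn (\<lambda>f. f x) l (\<lambda>_. 1)"
      by (simp add: Y_def \<mu>_def)
  qed
qed

lemma fibre_dens_slln:
  assumes x: "0 < x" "x \<le> 1"
  shows "AE \<omega> in PP. (\<lambda>n. (\<Sum>k<n. fibre_dens (params \<omega>) (int k) x) / real n) \<longlonglongrightarrow> mean_dens x"
proof -
  \<comment> \<open>One null set has to serve all depths \<open>l\<close>, because the depth is
    chosen according to the accuracy \<open>e\<close>. The approximation error is uniform in the
    fibre and so affects averages and expectation alike.\<close>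
  have "AE \<omega> in PP. \<forall>l. (\<lambda>n. (\<Sum>k<n. pull_dens (params \<omega>) (int k) l x) / real n) \<longlonglongrightarrow> Qn (\<lambda>f. f x) l (\<lambda>_. 1)"
    unfolding AE_all_countable using pull_dens_slln[OF x] by blast
  then show ?thesis
  proof (rule AE_mp, intro AE_I2 impI)
    fix \<omega> assume w: "\<omega> \<in> space PP"
      and L: "\<forall>l. (\<lambda>n. (\<Sum>k<n. pull_dens (params \<omega>) (int k) l x) / real n) \<longlonglongrightarrow> Qn (\<lambda>f. f x) l (\<lambda>_. 1)"
    show "(\<lambda>n. (\<Sum>k<n. fibre_dens (params \<omega>) (int k) x) / real n) \<longlonglongrightarrow> mean_dens x"
    proof (rule LIMSEQ_I)
      fix e :: real assume e: "0 < e"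
      then have "0 < e / 4" by simp
      from fibre_dens_unif[OF this x(1)] obtain l where l: "\<And>a k. admissible a \<Longrightarrow> \<bar>pull_dens a k l x - fibre_dens a k x\<bar> \<le> e / 4"
        using x by blast
      let ?\<mu> = "Qn (\<lambda>f. f x) l (\<lambda>_. 1)"
      have \<mu>: "\<bar>?\<mu> - mean_dens x\<bar> \<le> e / 4"
      proof -
        have ui: "integrable PP (\<lambda>\<omega>. pull_dens (params \<omega>) 0 l x)"
        proof (rule PP.integrable_const_bound[where B = "a0 * x powr (- G)"])
          show "AE \<omega> in PP. norm (pull_dens (params \<omega>) 0 l x) \<le> a0 * x powr (- G)"
          proof (rule AE_I2)
            fix \<omega> assume "\<omega> \<in> space PP"
            note d = cone_densD[OF cone_dens_pull_dens[OF admissible_params[OF this]], of 0 l]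
            show "norm (pull_dens (params \<omega>) 0 l x) \<le> a0 * x powr (- G)"
              using reg_nonneg[OF d(1) x] pole_boundD[OF d(2) x] by simp
          qed
        qed (unfold pull_dens_def, rule Phi_Pn_measurable[of "\<lambda>f. f x"])
        have "?\<mu> = (\<integral>\<omega>. pull_dens (params \<omega>) 0 l x \<partial>PP)"
          using expectation_Pn[of "\<lambda>_. 1" 1 "0 - int l" "\<lambda>f. f x" l "\<lambda>_. 1"] PP.prob_space by (simp add: pull_dens_def)
        then have "?\<mu> - mean_dens x = (\<integral>\<omega>. pull_dens (params \<omega>) 0 l x - fibre_dens (params \<omega>) 0 x \<partial>PP)"
          unfolding mean_dens_def using ui fibre_dens_omega_integrable[OF x] by simp
        then have "\<bar>?\<mu> - mean_dens x\<bar> \<le> (\<integral>\<omega>. \<bar>pull_dens (params \<omega>) 0 l x - fibre_dens (params \<omega>) 0 x\<bar> \<partial>PP)" by (simp add: integral_abs_bound)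
        moreover have "(\<integral>\<omega>. \<bar>pull_dens (params \<omega>) 0 l x - fibre_dens (params \<omega>) 0 x\<bar> \<partial>PP) \<le> (\<integral>\<omega>. e / 4 \<partial>PP)"
          using ui fibre_dens_omega_integrable[OF x] l admissible_params by (intro integral_mono) auto
        ultimately show ?thesis using PP.prob_space by simp
      qed
      from LIMSEQ_D[OF L[rule_format, of l] \<open>0 < e / 4\<close>] obtain N where
        N: "\<And>n. N \<le> n \<Longrightarrow> \<bar>(\<Sum>k<n. pull_dens (params \<omega>) (int k) l x) / real n - ?\<mu>\<bar> < e / 4" by auto
      show "\<exists>N. \<forall>n\<ge>N. norm ((\<Sum>k<n. fibre_dens (params \<omega>) (int k) x) / real n - mean_dens x) < e"
      proof (intro exI allI impI)
        fix n assume n: "max 1 N \<le> n"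
        have "\<bar>(\<Sum>k<n. pull_dens (params \<omega>) (int k) l x) - (\<Sum>k<n. fibre_dens (params \<omega>) (int k) x)\<bar> \<le> (\<Sum>k<n. e / 4)"
          unfolding sum_subtractf[symmetric]
          by (rule order_trans[OF sum_abs]) (intro sum_mono l admissible_params w)
        then have "\<bar>(\<Sum>k<n. pull_dens (params \<omega>) (int k) l x) - (\<Sum>k<n. fibre_dens (params \<omega>) (int k) x)\<bar> / real n \<le> e / 4"
          using n by (simp add: divide_le_eq mult.commute)
        then have "\<bar>(\<Sum>k<n. pull_dens (params \<omega>) (int k) l x) / real n - (\<Sum>k<n. fibre_dens (params \<omega>) (int k) x) / real n\<bar> \<le> e / 4"
          by (simp add: diff_divide_distrib[symmetric] abs_divide)
        moreover have "\<bar>(\<Sum>k<n. pull_dens (params \<omega>) (int k) l x) / real n - ?\<mu>\<bar> < e / 4" using N n by auto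
        ultimately show "norm ((\<Sum>k<n. fibre_dens (params \<omega>) (int k) x) / real n - mean_dens x) < e"
          using \<mu> e unfolding real_norm_def by linarith
      qed
    qed
  qed
qed

section \<open>Almost sure smallness of the short returns, and the points where everything
  converges\<close>

lemma joint_measurable:
  fixes \<Psi> :: "(real \<Rightarrow> real) \<Rightarrow> real \<Rightarrow> ennreal"
  assumes \<Psi>: "\<And>f. f \<in> borel_measurable borel \<Longrightarrow> \<Psi> f \<in> borel_measurable U"
    and g: "g \<in> borel_measurable borel"
  shows "(\<lambda>z. \<Psi> (\<lambda>x. Tn (params (fst z)) n k (g x)) (snd z)) \<in> borel_measurable (PP \<Otimes>\<^sub>M U)"
  using g
proof (induction n arbitrary: k g)
  case 0
  then show ?case using measurable_compose[OF measurable_snd \<Psi>[OF 0]] by simp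
next
  case (Suc n)
  have set: "{z \<in> space (PP \<Otimes>\<^sub>M U). fst z k = i} \<in> sets (PP \<Otimes>\<^sub>M U)" for i
  proof -
    have "fst -` {\<omega> \<in> space PP. \<omega> k = i} \<inter> space (PP \<Otimes>\<^sub>M U) \<in> sets (PP \<Otimes>\<^sub>M U)"
      by (rule measurable_sets[OF measurable_fst coord_set])
    moreover have "fst -` {\<omega> \<in> space PP. \<omega> k = i} \<inter> space (PP \<Otimes>\<^sub>M U) = {z \<in> space (PP \<Otimes>\<^sub>M U). fst z k = i}"
      by (auto simp: space_pair_measure)
    ultimately show ?thesis by simp
  qed
  \<comment> \<open>Fixing the symbol at \<open>k\<close> turns the first random map into a
    deterministic one, which is absorbed into \<open>g\<close>; after \<open>n\<close> steps a
    function of the point alone remains.\<close>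
  have "(\<lambda>z. \<Sum>i\<in>{1..q}. if fst z k = i then \<Psi> (\<lambda>x. Tn (params (fst z)) n (k + 1) (lsv_map (\<gamma> i) (g x))) (snd z) else 0)
      \<in> borel_measurable (PP \<Otimes>\<^sub>M U)"
    using measurable_compose[OF Suc.prems lsv_map_measurable]
    by (intro borel_measurable_sum measurable_If Suc.IH) (auto simp: set)
  moreover have "\<Psi> (\<lambda>x. Tn (params (fst z)) (Suc n) k (g x)) (snd z)
     = (\<Sum>i\<in>{1..q}. if fst z k = i then \<Psi> (\<lambda>x. Tn (params (fst z)) n (k + 1) (lsv_map (\<gamma> i) (g x))) (snd z) else 0)"
    if "z \<in> space (PP \<Otimes>\<^sub>M U)" for z
  proof -
    have "fst z \<in> space PP" using that by (auto simp: space_pair_measure)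
    from split_coord[OF this, of "\<lambda>i. \<Psi> (\<lambda>x. Tn (params (fst z)) n (k + 1) (lsv_map (\<gamma> i) (g x))) (snd z)" k]
    show ?thesis by (simp add: params_def)
  qed
  ultimately show ?case by (subst measurable_cong) auto
qed

lemma ball_return_joint: "(\<lambda>z. ball_return (params (fst z)) j k r (snd z)) \<in> borel_measurable (PP \<Otimes>\<^sub>M U)"
proof -
  define \<Psi> :: "(real \<Rightarrow> real) \<Rightarrow> real \<Rightarrow> ennreal" where
    "\<Psi> = (\<lambda>f x0. \<integral>\<^sup>+x. indicator {x. \<bar>x - x0\<bar> < r \<and> \<bar>f x - x0\<bar> < r} x \<partial>U)"
  have m: "\<Psi> f \<in> borel_measurable U" if [measurable]: "f \<in> borel_measurable borel" for f
    unfolding \<Psi>_def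
  proof (rule U.borel_measurable_nn_integral)
    have U_id: "(\<lambda>x. x) \<in> borel_measurable U" by (rule measurable_U) simp
    have [measurable]: "fst \<in> borel_measurable (U \<Otimes>\<^sub>M U)" "snd \<in> borel_measurable (U \<Otimes>\<^sub>M U)"
      by (rule measurable_compose[OF measurable_fst U_id], rule measurable_compose[OF measurable_snd U_id])
    have [measurable]: "(\<lambda>z. f (snd z)) \<in> borel_measurable (U \<Otimes>\<^sub>M U)" by measurable
    have "(\<lambda>z. if \<bar>snd z - fst z\<bar> < r then (if \<bar>f (snd z) - fst z\<bar> < r then 1 else 0) else 0 :: ennreal) \<in> borel_measurable (U \<Otimes>\<^sub>M U)"
      by measurable
    also have "(\<lambda>z. if \<bar>snd z - fst z\<bar> < r then (if \<bar>f (snd z) - fst z\<bar> < r then 1 else 0) else 0 :: ennreal)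
        = (\<lambda>(x0, x). indicator {x. \<bar>x - x0\<bar> < r \<and> \<bar>f x - x0\<bar> < r} x)"
      by (auto simp: fun_eq_iff split: split_indicator)
    finally show "(\<lambda>(x0, x). indicator {x. \<bar>x - x0\<bar> < r \<and> \<bar>f x - x0\<bar> < r} x :: ennreal) \<in> borel_measurable (U \<Otimes>\<^sub>M U)" .
  qed
  have "(\<lambda>z. \<Psi> (\<lambda>x. Tn (params (fst z)) j k x) (snd z)) \<in> borel_measurable (PP \<Otimes>\<^sub>M U)"
    by (rule joint_measurable[of \<Psi> "\<lambda>x. x"]) (erule m, simp)
  then show ?thesis unfolding \<Psi>_def ball_return_def .
qed

lemma return_sum_joint: "(\<lambda>z. return_sum M i (params (fst z)) (snd z)) \<in> borel_measurable (PP \<Otimes>\<^sub>M U)"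
  unfolding return_sum_def by (intro borel_measurable_sum ball_return_joint)

lemma ball_return_measurable:
  assumes "\<omega> \<in> space PP"
  shows "ball_return (params \<omega>) j k r \<in> borel_measurable U"
proof -
  have "(\<lambda>x0. ball_return (params (fst (\<omega>, x0))) j k r (snd (\<omega>, x0))) \<in> borel_measurable U"
    by (rule measurable_compose[OF measurable_Pair1'[OF assms] ball_return_joint])
  then show ?thesis by simp
qed

lemma return_const_nonneg: "0 < d \<Longrightarrow> \<theta> < 1 \<Longrightarrow> 0 \<le> return_const d \<theta>"
  by (auto simp: return_const_def intro!: mult_nonneg_nonneg divide_nonneg_pos)

text \<open>About \<open>M * i ^ 4\<close> fibres, \<open>M * i ^ 2\<close> times and the square of
  the radius \<open>M / i ^ 4\<close> give a total of order \<open>1 / i ^ 2\<close>.\<close>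

lemma return_sum_average:
  assumes w: "\<omega> \<in> space PP" and d: "0 < d" "d \<le> 1/2" and M: "1 \<le> M" and i: "1 \<le> i" "real M / real (i ^ 4) \<le> d / 4"
  shows "(\<integral>\<^sup>+x0. indicator {2 * d..} x0 * return_sum M i (params \<omega>) x0 \<partial>U)
    \<le> ennreal (4 * real M ^ 4 * return_const d (1 / (1 + 2 * d)) * inverse (real i ^ 2))"
proof -
  let ?r = "real M / real (i ^ 4)" and ?C = "return_const d (1 / (1 + 2 * d))" and ?a = "params \<omega>"
  have r: "0 < ?r" using M i by auto
  have C: "0 \<le> ?C" using d by (intro return_const_nonneg) (auto simp: field_simps)
  note [measurable] = ball_return_measurable[OF w]
  have [measurable]: "(\<lambda>x0. indicator {2 * d..} x0 :: ennreal) \<in> borel_measurable U" by (rule measurable_U) measurable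
  have m: "(\<lambda>x0. indicator {2 * d..} x0 * ball_return ?a j k ?r x0) \<in> borel_measurable U" for j k by measurable
  have "(\<integral>\<^sup>+x0. indicator {2 * d..} x0 * return_sum M i ?a x0 \<partial>U)
     = (\<integral>\<^sup>+x0. (\<Sum>k\<le>M * i ^ 4. \<Sum>j\<in>{1..M * i ^ 2}. indicator {2 * d..} x0 * ball_return ?a j (int k) ?r x0) \<partial>U)"
    by (simp add: return_sum_def sum_distrib_left)
  also have "\<dots> = (\<Sum>k\<le>M * i ^ 4. (\<integral>\<^sup>+x0. (\<Sum>j\<in>{1..M * i ^ 2}. indicator {2 * d..} x0 * ball_return ?a j (int k) ?r x0) \<partial>U))"
    by (rule nn_integral_sum) (intro borel_measurable_sum m)
  also have "\<dots> = (\<Sum>k\<le>M * i ^ 4. \<Sum>j\<in>{1..M * i ^ 2}. (\<integral>\<^sup>+x0. indicator {2 * d..} x0 * ball_return ?a j (int k) ?r x0 \<partial>U))"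
    by (intro sum.cong refl nn_integral_sum m)
  also have "\<dots> \<le> (\<Sum>k\<le>M * i ^ 4. \<Sum>j\<in>{1..M * i ^ 2}. ennreal (2 * ?r * (?C * ?r)))"
    by (intro sum_mono ball_return_average admissible_params w d r i) auto
  also have "\<dots> = ennreal (real (M * i ^ 4 + 1) * (real (M * i ^ 2) * (2 * ?r * (?C * ?r))))"
    using r C by (simp add: ennreal_of_nat_eq_real_of_nat ennreal_mult[symmetric] del: of_nat_mult of_nat_add of_nat_Suc of_nat_power)
  also have "\<dots> \<le> ennreal (4 * real M ^ 4 * ?C * inverse (real i ^ 2))"
  proof (rule ennreal_leI)
    have "real (M * i ^ 4 + 1) \<le> 2 * (real M * real i ^ 4)"
    proof -
      have "1 \<le> M * i ^ 4" using M i by simp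
      then have "real (M * i ^ 4 + 1) \<le> real (2 * (M * i ^ 4))" by (simp only: of_nat_le_iff)
      then show ?thesis by simp
    qed
    then have "real (M * i ^ 4 + 1) * (real (M * i ^ 2) * (2 * ?r * (?C * ?r)))
       \<le> 2 * (real M * real i ^ 4) * (real (M * i ^ 2) * (2 * ?r * (?C * ?r)))"
      using r C by (intro mult_right_mono) auto
    also have "\<dots> = 4 * real M ^ 4 * ?C * inverse (real i ^ 2)"
    proof -
      have "2 * (m * y ^ 4) * ((m * y ^ 2) * (2 * (m / y ^ 4) * (c * (m / y ^ 4)))) = 4 * m ^ 4 * c * inverse (y ^ 2)"
        if "y \<noteq> 0" for m y c :: real
        using that by (simp add: field_simps power_numeral_reduce)
      from this[of "real i" "real M" ?C] show ?thesis using i by simp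
    qed
    finally show "real (M * i ^ 4 + 1) * (real (M * i ^ 2) * (2 * ?r * (?C * ?r))) \<le> 4 * real M ^ 4 * ?C * inverse (real i ^ 2)" .
  qed
  finally show ?thesis .
qed

text \<open>Borel-Cantelli in integrated form: the whole series has finite integral over fibres and
  centres, so by Fubini it converges for almost every centre and then almost every fibre, and its
  terms tend to 0.\<close>

lemma return_sum_tendsto:
  assumes d: "0 < d" "d \<le> 1/2" and M: "1 \<le> M"
  shows "AE x0 in U. 2 * d \<le> x0 \<longrightarrow> (AE \<omega> in PP. (\<lambda>i. return_sum M i (params \<omega>) x0) \<longlonglongrightarrow> 0)"
proof -
  interpret PU: pair_sigma_finite PP U ..
  have "(\<lambda>i. real M / real (i ^ 4)) \<longlonglongrightarrow> 0" by real_asymp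
  then have "\<forall>\<^sub>F i in sequentially. real M / real (i ^ 4) < d / 4"
    by (rule order_tendstoD(2)) (use d in simp)
  then obtain i1 where i1: "\<And>i. i1 \<le> i \<Longrightarrow> real M / real (i ^ 4) < d / 4"
    unfolding eventually_sequentially by blast
  \<comment> \<open>The shift provides an index at least 1 and a radius at most
    \<open>d / 4\<close>, as \<open>return_sum_average\<close> requires.\<close>
  define i0 where "i0 = Suc i1"
  let ?C = "4 * real M ^ 4 * return_const d (1 / (1 + 2 * d))"
  have C: "0 \<le> ?C" using d return_const_nonneg[of d "1 / (1 + 2 * d)"] by (auto simp: field_simps)
  define F :: "nat \<Rightarrow> (int \<Rightarrow> nat) \<Rightarrow> real \<Rightarrow> ennreal" where
    "F = (\<lambda>i \<omega> x0. indicator {2 * d..} x0 * return_sum M (i + i0) (params \<omega>) x0)"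
  have indU: "(\<lambda>x0. indicator {2 * d..} x0 :: ennreal) \<in> borel_measurable U" by (rule measurable_U) measurable
  have Fm: "(\<lambda>z. F i (fst z) (snd z)) \<in> borel_measurable (PP \<Otimes>\<^sub>M U)" for i
  proof -
    note [measurable] = return_sum_joint[of M "i + i0"] measurable_compose[OF measurable_snd indU, of PP]
    show ?thesis unfolding F_def by measurable
  qed
  have Sm: "(\<lambda>z. \<Sum>i. F i (fst z) (snd z)) \<in> borel_measurable (PP \<Otimes>\<^sub>M U)"
    using Fm by measurable
  then have Sm': "(\<lambda>(\<omega>, x0). \<Sum>i. F i \<omega> x0) \<in> borel_measurable (PP \<Otimes>\<^sub>M U)" by (simp add: split_beta')
  have FU: "F i \<omega> \<in> borel_measurable U" if "\<omega> \<in> space PP" for i \<omega>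
  proof -
    have "(\<lambda>x0. F i (fst (\<omega>, x0)) (snd (\<omega>, x0))) \<in> borel_measurable U"
      by (rule measurable_compose[OF measurable_Pair1'[OF that] Fm])
    then show ?thesis by simp
  qed
  have FP: "(\<lambda>\<omega>. \<Sum>i. F i \<omega> x0) \<in> borel_measurable PP" if "x0 \<in> space U" for x0
  proof -
    have "(\<lambda>\<omega>. \<Sum>i. F i (fst (\<omega>, x0)) (snd (\<omega>, x0))) \<in> borel_measurable PP"
      by (rule measurable_compose[OF measurable_Pair2'[OF that] Sm])
    then show ?thesis by simp
  qed
  have inner: "(\<integral>\<^sup>+x0. (\<Sum>i. F i \<omega> x0) \<partial>U) \<le> (\<Sum>i. ennreal (?C * inverse (real (i + i0) ^ 2)))" if w: "\<omega> \<in> space PP" for \<omega>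
  proof -
    have "(\<integral>\<^sup>+x0. (\<Sum>i. F i \<omega> x0) \<partial>U) = (\<Sum>i. \<integral>\<^sup>+x0. F i \<omega> x0 \<partial>U)"
      by (rule nn_integral_suminf) (rule FU[OF w])
    also have "\<dots> \<le> (\<Sum>i. ennreal (?C * inverse (real (i + i0) ^ 2)))"
    proof (intro suminf_le)
      fix i
      have "real M / real ((i + i0) ^ 4) \<le> d / 4" using i1[of "i + i0"] by (simp add: i0_def)
      then show "(\<integral>\<^sup>+x0. F i \<omega> x0 \<partial>U) \<le> ennreal (?C * inverse (real (i + i0) ^ 2))"
        unfolding F_def by (intro return_sum_average w d M) (auto simp: i0_def)
    qed auto
    finally show ?thesis .
  qed
  have summ: "summable (\<lambda>i. ?C * inverse (real (i + i0) ^ 2))"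
  proof (rule summable_mult)
    have "summable (\<lambda>i. inverse (real i ^ 2))" by (rule inverse_power_summable) simp
    then show "summable (\<lambda>i. inverse (real (i + i0) ^ 2))" by (rule summable_ignore_initial_segment)
  qed
  have "(\<integral>\<^sup>+x0. (\<integral>\<^sup>+\<omega>. (\<Sum>i. F i \<omega> x0) \<partial>PP) \<partial>U) = (\<integral>\<^sup>+\<omega>. (\<integral>\<^sup>+x0. (\<Sum>i. F i \<omega> x0) \<partial>U) \<partial>PP)"
    by (rule PU.Fubini'[OF Sm'])
  also have "\<dots> \<le> (\<integral>\<^sup>+\<omega>. (\<Sum>i. ennreal (?C * inverse (real (i + i0) ^ 2))) \<partial>PP)"
    by (intro nn_integral_mono inner)
  also have "\<dots> = (\<Sum>i. ennreal (?C * inverse (real (i + i0) ^ 2)))" by (simp add: PP.emeasure_space_1)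
  also have "\<dots> < \<infinity>" using summ C by (subst suminf_ennreal2) auto
  finally have fin: "(\<integral>\<^sup>+x0. (\<integral>\<^sup>+\<omega>. (\<Sum>i. F i \<omega> x0) \<partial>PP) \<partial>U) \<noteq> \<infinity>" by simp
  have "(\<lambda>x0. \<integral>\<^sup>+\<omega>. (\<Sum>i. F i \<omega> x0) \<partial>PP) \<in> borel_measurable U"
  proof (rule PP.borel_measurable_nn_integral)
    have "(\<lambda>z. (snd z, fst z)) \<in> measurable (U \<Otimes>\<^sub>M PP) (PP \<Otimes>\<^sub>M U)"
      by (intro measurable_Pair measurable_fst measurable_snd)
    from measurable_compose[OF this Sm] show "(\<lambda>(x0, \<omega>). \<Sum>i. F i \<omega> x0) \<in> borel_measurable (U \<Otimes>\<^sub>M PP)"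
      by (simp add: split_beta')
  qed
  then have ae: "AE x0 in U. (\<integral>\<^sup>+\<omega>. (\<Sum>i. F i \<omega> x0) \<partial>PP) \<noteq> \<infinity>"
    using fin by (rule nn_integral_PInf_AE)
  show ?thesis
  proof (rule AE_mp[OF ae], rule AE_I2, intro impI)
    fix x0 assume x0: "x0 \<in> space U" "2 * d \<le> x0" and f: "(\<integral>\<^sup>+\<omega>. (\<Sum>i. F i \<omega> x0) \<partial>PP) \<noteq> \<infinity>"
    have "AE \<omega> in PP. (\<Sum>i. F i \<omega> x0) \<noteq> \<infinity>"
      by (rule nn_integral_PInf_AE[OF FP[OF x0(1)] f])
    then show "AE \<omega> in PP. (\<lambda>i. return_sum M i (params \<omega>) x0) \<longlonglongrightarrow> 0"
    proof eventually_elim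
      fix \<omega> assume h: "(\<Sum>i. F i \<omega> x0) \<noteq> \<infinity>"
      define s where "s = (\<lambda>i. enn2real (return_sum M (i + i0) (params \<omega>) x0))"
      have s: "ennreal (s i) = return_sum M (i + i0) (params \<omega>) x0" for i
        unfolding s_def using return_sum_finite[of M "i + i0" "params \<omega>" x0] by simp
      have "F i \<omega> x0 = ennreal (s i)" for i using x0(2) by (simp add: F_def s)
      then have "(\<Sum>i. ennreal (s i)) \<noteq> \<infinity>" using h by simp
      then have "summable s" by (intro summable_suminf_not_top) (auto simp: s_def)
      then have "s \<longlonglongrightarrow> 0" by (rule summable_LIMSEQ_zero)
      then have "(\<lambda>i. ennreal (s i)) \<longlonglongrightarrow> ennreal 0" by (rule tendsto_ennrealI)
      then have "(\<lambda>i. return_sum M (i + i0) (params \<omega>) x0) \<longlonglongrightarrow> 0" by (simp add: s)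
      then show "(\<lambda>i. return_sum M i (params \<omega>) x0) \<longlonglongrightarrow> 0" by (rule LIMSEQ_offset)
    qed
  qed
qed

text \<open>The cut-offs \<open>d = 1 / (m + 2)\<close> exhaust the interval and the constants
  \<open>M\<close> are integers, so countably many null sets suffice. Neither \<open>b\<close>,
  \<open>J\<close>, \<open>s\<close> nor \<open>t\<close> occurs, so the exceptional sets do not
  depend on them.\<close>

lemma generic_points:
  "AE x0 in U. 0 < x0 \<and> x0 < 1 \<and>
    (AE \<omega> in PP. (\<lambda>n. (\<Sum>k<n. fibre_dens (params \<omega>) (int k) x0) / real n) \<longlonglongrightarrow> mean_dens x0 \<and>
       (\<forall>M\<ge>1. (\<lambda>i. return_sum M i (params \<omega>) x0) \<longlonglongrightarrow> 0))"
proof -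
  have "AE x0 in U. \<forall>m M. 2 * (1 / real (m + 2)) \<le> x0 \<longrightarrow> (AE \<omega> in PP. (\<lambda>i. return_sum (Suc M) i (params \<omega>) x0) \<longlonglongrightarrow> 0)"
    unfolding AE_all_countable by (intro allI return_sum_tendsto) (auto simp: field_simps)
  moreover have "AE x0 in U. 0 < x0 \<and> x0 < 1" by (rule AE_U_I) auto
  ultimately show ?thesis
  proof eventually_elim
    fix x0 :: real
    assume h: "\<forall>m M. 2 * (1 / real (m + 2)) \<le> x0 \<longrightarrow> (AE \<omega> in PP. (\<lambda>i. return_sum (Suc M) i (params \<omega>) x0) \<longlonglongrightarrow> 0)"
      and x0: "0 < x0 \<and> x0 < 1"
    obtain m where "2 / x0 < real m" using reals_Archimedean2 by blast
    then have "2 * (1 / real (m + 2)) \<le> x0" using x0 by (simp add: field_simps)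
    then have "AE \<omega> in PP. \<forall>M. (\<lambda>i. return_sum (Suc M) i (params \<omega>) x0) \<longlonglongrightarrow> 0"
      unfolding AE_all_countable using h by blast
    moreover have "AE \<omega> in PP. (\<lambda>n. (\<Sum>k<n. fibre_dens (params \<omega>) (int k) x0) / real n) \<longlonglongrightarrow> mean_dens x0"
      using x0 by (intro fibre_dens_slln) auto
    ultimately have "AE \<omega> in PP. (\<lambda>n. (\<Sum>k<n. fibre_dens (params \<omega>) (int k) x0) / real n) \<longlonglongrightarrow> mean_dens x0 \<and>
       (\<forall>M\<ge>1. (\<lambda>i. return_sum M i (params \<omega>) x0) \<longlonglongrightarrow> 0)"
    proof eventually_elim
      case (elim \<omega>)
      have "(\<lambda>i. return_sum M i (params \<omega>) x0) \<longlonglongrightarrow> 0" if "1 \<le> M" for M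
        using elim(1)[rule_format, of "M - 1"] that by simp
      with elim(2) show ?case by blast
    qed
    with x0 show "0 < x0 \<and> x0 < 1 \<and> (AE \<omega> in PP. (\<lambda>n. (\<Sum>k<n. fibre_dens (params \<omega>) (int k) x0) / real n) \<longlonglongrightarrow> mean_dens x0 \<and>
       (\<forall>M\<ge>1. (\<lambda>i. return_sum M i (params \<omega>) x0) \<longlonglongrightarrow> 0))" by blast
  qed
qed

end

subsection \<open>The exponential limit law\<close>

text \<open>For factors uniformly close to 1 the product is squeezed by
  \<open>exp (- w / (1 - D)) \<le> 1 - w \<le> exp (- w)\<close>; the lower estimate is
  \<open>1 + y \<le> exp y\<close> at \<open>y = w / (1 - w)\<close>.\<close>

lemma prod_exp_limit:
  fixes w :: "nat \<Rightarrow> nat \<Rightarrow> real" and N :: "nat \<Rightarrow> nat"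
  assumes w0: "\<And>n i. 0 \<le> w n i" and wD: "\<forall>\<^sub>F n in sequentially. \<forall>i. w n i \<le> D n" and D: "D \<longlonglongrightarrow> 0"
    and S: "(\<lambda>n. \<Sum>i<N n. w n i) \<longlonglongrightarrow> \<sigma>"
  shows "(\<lambda>n. \<Prod>i<N n. 1 - w n i) \<longlonglongrightarrow> exp (- \<sigma>)"
proof (rule tendsto_sandwich)
  have D1: "\<forall>\<^sub>F n in sequentially. D n < 1" by (rule order_tendstoD(2)[OF D]) simp
  show "\<forall>\<^sub>F n in sequentially. exp (- ((\<Sum>i<N n. w n i) / (1 - D n))) \<le> (\<Prod>i<N n. 1 - w n i)"
    using wD D1
  proof eventually_elim
    fix n assume wd: "\<forall>i. w n i \<le> D n" and d: "D n < 1"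
    have "exp (- (w n i / (1 - D n))) \<le> 1 - w n i" for i
    proof -
      let ?w = "w n i"
      have w: "0 \<le> ?w" "?w \<le> D n" "?w < 1" using w0 wd d by (auto intro: le_less_trans)
      have "1 / (1 - ?w) = 1 + ?w / (1 - ?w)" using w by (simp add: field_simps)
      also have "\<dots> \<le> exp (?w / (1 - ?w))" by (rule exp_ge_add_one_self)
      also have "\<dots> \<le> exp (?w / (1 - D n))" using w d by (simp add: divide_left_mono)
      finally have "inverse (exp (?w / (1 - D n))) \<le> inverse (1 / (1 - ?w))"
        using w by (intro le_imp_inverse_le) auto
      then show ?thesis by (simp add: exp_minus)
    qed
    then have "(\<Prod>i<N n. exp (- (w n i / (1 - D n)))) \<le> (\<Prod>i<N n. 1 - w n i)"
      by (intro prod_mono) auto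
    then show "exp (- ((\<Sum>i<N n. w n i) / (1 - D n))) \<le> (\<Prod>i<N n. 1 - w n i)"
      by (simp add: exp_sum[symmetric] sum_negf sum_divide_distrib)
  qed
  show "\<forall>\<^sub>F n in sequentially. (\<Prod>i<N n. 1 - w n i) \<le> exp (- (\<Sum>i<N n. w n i))"
    using wD D1
  proof eventually_elim
    fix n assume wd: "\<forall>i. w n i \<le> D n" and d: "D n < 1"
    have "(\<Prod>i<N n. 1 - w n i) \<le> (\<Prod>i<N n. exp (- w n i))"
    proof (rule prod_mono)
      fix i
      have "w n i < 1" using wd d by (auto intro: le_less_trans)
      then show "0 \<le> 1 - w n i \<and> 1 - w n i \<le> exp (- w n i)" using exp_ge_add_one_self[of "- w n i"] by simp
    qed
    then show "(\<Prod>i<N n. 1 - w n i) \<le> exp (- (\<Sum>i<N n. w n i))"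
      by (simp add: exp_sum[symmetric] sum_negf)
  qed
  have "(\<lambda>n. exp (- ((\<Sum>i<N n. w n i) / (1 - D n)))) \<longlonglongrightarrow> exp (- (\<sigma> / (1 - 0)))"
    by (intro tendsto_intros S D) auto
  then show "(\<lambda>n. exp (- ((\<Sum>i<N n. w n i) / (1 - D n)))) \<longlonglongrightarrow> exp (- \<sigma>)" by simp
  show "(\<lambda>n. exp (- (\<Sum>i<N n. w n i))) \<longlonglongrightarrow> exp (- \<sigma>)" by (intro tendsto_intros S)
qed

text \<open>The indices \<open>m n\<close> may stay bounded, as happens for \<open>s = 0\<close>.
  The constant \<open>C\<close> absorbs the finitely many indices at which the average is not yet
  close to its limit.\<close>

lemma average_subsequence:
  fixes S :: "nat \<Rightarrow> real" and m :: "nat \<Rightarrow> nat"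
  assumes S: "(\<lambda>n. S n / real n) \<longlonglongrightarrow> H" and m: "(\<lambda>n. real (m n) / real n) \<longlonglongrightarrow> u"
  shows "(\<lambda>n. S (m n) / real n) \<longlonglongrightarrow> u * H"
proof -
  have "(\<lambda>n. (S (m n) - real (m n) * H) / real n) \<longlonglongrightarrow> 0"
  proof (rule LIMSEQ_I)
    fix e :: real assume e: "0 < e"
    define e1 where "e1 = e / (2 * (\<bar>u\<bar> + 1))"
    have e1: "0 < e1" using e by (auto simp: e1_def intro!: divide_pos_pos add_nonneg_pos)
    from LIMSEQ_D[OF S e1] obtain N where N: "\<And>k. N \<le> k \<Longrightarrow> \<bar>S k / real k - H\<bar> < e1" by auto
    define C where "C = (\<Sum>k\<le>N. \<bar>S k - real k * H\<bar>)"
    have C0: "0 \<le> C" unfolding C_def by (intro sum_nonneg) auto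
    have b: "\<bar>S k - real k * H\<bar> \<le> e1 * real k + C" for k
    proof (cases "k \<le> N")
      case True
      then have "\<bar>S k - real k * H\<bar> \<le> C" unfolding C_def by (intro member_le_sum) auto
      then show ?thesis using e1 by (simp add: add_increasing)
    next
      case False
      then have k: "0 < real k" by auto
      have "S k - real k * H = real k * (S k / real k - H)" using k by (simp add: right_diff_distrib)
      then have "\<bar>S k - real k * H\<bar> = real k * \<bar>S k / real k - H\<bar>" using k by (simp add: abs_mult)
      also have "\<dots> \<le> real k * e1" using N[of k] False k by (intro mult_left_mono) auto
      finally show ?thesis using C0 by (simp add: mult.commute)
    qed
    have lim: "(\<lambda>n. e1 * (real (m n) / real n) + C / real n) \<longlonglongrightarrow> e1 * u + 0"
      by (intro tendsto_intros m lim_const_over_n)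
    have lt: "e1 * u + 0 < e"
    proof -
      have "e1 * u \<le> e1 * (\<bar>u\<bar> + 1)" using e1 by (intro mult_left_mono) auto
      also have "\<dots> = e / 2"
      proof -
        have "e / (2 * y) * y = e / 2" if "y \<noteq> 0" for y :: real using that by simp
        moreover have "\<bar>u\<bar> + 1 \<noteq> 0" by linarith
        ultimately show ?thesis unfolding e1_def by blast
      qed
      finally show ?thesis using e by simp
    qed
    from order_tendstoD(2)[OF lim lt] obtain M where M: "\<And>n. M \<le> n \<Longrightarrow> e1 * (real (m n) / real n) + C / real n < e"
      unfolding eventually_sequentially by blast
    show "\<exists>no. \<forall>n\<ge>no. norm ((S (m n) - real (m n) * H) / real n - 0) < e"
    proof (intro exI allI impI)
      fix n assume n: "M \<le> n"
      have "norm ((S (m n) - real (m n) * H) / real n - 0) = \<bar>S (m n) - real (m n) * H\<bar> / real n" by simp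
      also have "\<dots> \<le> (e1 * real (m n) + C) / real n" by (intro divide_right_mono b) auto
      also have "\<dots> < e" using M[OF n] by (simp add: add_divide_distrib)
      finally show "norm ((S (m n) - real (m n) * H) / real n - 0) < e" .
    qed
  qed
  then have "(\<lambda>n. (S (m n) - real (m n) * H) / real n + real (m n) / real n * H) \<longlonglongrightarrow> 0 + u * H"
    by (intro tendsto_intros m)
  then show ?thesis by (simp add: diff_divide_distrib)
qed

definition fourth_root :: "nat \<Rightarrow> nat" where
  "fourth_root n = nat \<lfloor>sqrt (sqrt (real n))\<rfloor>"

text \<open>The constants 4 and 16 are powers of 2 and come from
  \<open>x \<le> i + 1 \<le> 2 * i\<close> for the real fourth root \<open>x\<close> and its integer
  part \<open>i\<close>.\<close>

lemma fourth_root: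
  assumes "1 \<le> n"
  shows "1 \<le> fourth_root n" "fourth_root n ^ 4 \<le> n" "sqrt (real n) \<le> 4 * real (fourth_root n) ^ 2" "real n \<le> 16 * real (fourth_root n) ^ 4"
proof -
  let ?x = "sqrt (sqrt (real n))"
  have x: "1 \<le> ?x" using assms by simp
  have i: "real (fourth_root n) = real_of_int \<lfloor>?x\<rfloor>" using x by (simp add: fourth_root_def)
  then have il: "real (fourth_root n) \<le> ?x" and iu: "?x \<le> real (fourth_root n) + 1" by linarith+
  have "1 \<le> \<lfloor>?x\<rfloor>" using x by (simp add: le_floor_iff)
  then have i1: "1 \<le> real (fourth_root n)" unfolding i by simp
  then show "1 \<le> fourth_root n" by simp
  have s: "?x ^ 2 = sqrt (real n)" by simp
  have f: "?x ^ 4 = real n"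
  proof -
    have "?x ^ 4 = (?x ^ 2) ^ 2" by (simp only: power_mult[symmetric]) simp
    then show ?thesis unfolding s by simp
  qed
  have "real (fourth_root n) ^ 4 \<le> ?x ^ 4" using il by (intro power_mono) auto
  then have "real (fourth_root n ^ 4) \<le> real n" unfolding f by simp
  then show "fourth_root n ^ 4 \<le> n" by (simp only: of_nat_le_iff)
  have x2: "?x \<le> 2 * real (fourth_root n)" using iu i1 by linarith
  have "?x ^ 2 \<le> (2 * real (fourth_root n)) ^ 2" using x2 x by (intro power_mono) auto
  then show "sqrt (real n) \<le> 4 * real (fourth_root n) ^ 2" unfolding s by (simp add: power_mult_distrib)
  have "?x ^ 4 \<le> (2 * real (fourth_root n)) ^ 4" using x2 x by (intro power_mono) auto
  then show "real n \<le> 16 * real (fourth_root n) ^ 4" unfolding f by (simp add: power_mult_distrib)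
qed

lemma fourth_root_lim: "filterlim fourth_root at_top sequentially"
  unfolding fourth_root_def
  by (intro filterlim_compose[OF filterlim_nat_sequentially] filterlim_compose[OF filterlim_floor_sequentially]
      filterlim_compose[OF sqrt_at_top filterlim_compose[OF sqrt_at_top filterlim_real_sequentially]])

context lsv
begin

lemma ball_return_mono: "r \<le> r' \<Longrightarrow> ball_return a j k r x0 \<le> ball_return a j k r' x0"
  unfolding ball_return_def by (intro nn_integral_mono) (auto split: split_indicator)

lemma fibre_dens_le_near:
  assumes "admissible a" "0 < \<delta>" "\<delta> \<le> x" "x \<le> 1"
  shows "fibre_dens a k x \<le> a0 / \<delta>"
  using cone_pole_bound_le[OF cone_fibre_dens(2)[OF assms(1)] _ assms(2-4)] a0_gt by simp

text \<open>Away from 0 the density is at most \<open>a0 / \<delta>\<close>. This step replaces the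
  target, which depends on \<open>b\<close> and \<open>J\<close>, by a ball, for which the
  exceptional sets have already been fixed.\<close>

lemma return_mass_le_ball_return:
  assumes a: "admissible a" and A: "A \<in> sets borel" "A \<subseteq> {x. \<bar>x - x0\<bar> < r}" and \<delta>: "0 < \<delta>" "\<delta> \<le> x0 - r" "x0 + r \<le> 1"
  shows "ennreal (return_mass a j k A) \<le> ennreal (a0 / \<delta>) * ball_return a j k r x0"
proof -
  note D = cone_densD[OF cone_dens_fibre_dens[OF a], of k]
  let ?f = "\<lambda>x. fibre_dens a k x * indicator A x * indicator A (Tn a j k x)"
  let ?S = "{x. \<bar>x - x0\<bar> < r \<and> \<bar>Tn a j k x - x0\<bar> < r}"
  have Sb [measurable]: "?S \<in> sets borel" by measurable
  note [measurable] = A(1) D(5)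
  have fi: "integrable U ?f"
    by (rule integrable_mult_bounded[OF fibre_dens_ind_integrable[OF a A(1)] _ _ ind_le_1]) measurable
  have inA: "\<delta> \<le> x \<and> x \<le> 1 \<and> \<bar>x - x0\<bar> < r" if "x \<in> A" for x
    using that A(2) \<delta> by (force simp: abs_less_iff)
  have f0: "0 \<le> ?f x" for x
    using inA[of x] \<delta>(1) reg_nonneg[OF D(1), of x] by (auto split: split_indicator)
  have "ennreal (return_mass a j k A) = (\<integral>\<^sup>+x. ennreal (?f x) \<partial>U)"
    unfolding return_mass_def by (rule nn_integral_eq_integral[symmetric, OF fi]) (use f0 in auto)
  also have "\<dots> \<le> (\<integral>\<^sup>+x. ennreal (a0 / \<delta>) * indicator ?S x \<partial>U)"
  proof (rule nn_integral_mono)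
    fix x
    show "ennreal (?f x) \<le> ennreal (a0 / \<delta>) * indicator ?S x"
    proof (cases "x \<in> A \<and> Tn a j k x \<in> A")
      case True
      then have "x \<in> ?S" using inA by auto
      moreover have "fibre_dens a k x \<le> a0 / \<delta>" using True inA[of x] by (intro fibre_dens_le_near a \<delta>) auto
      ultimately show ?thesis using True by (auto intro: ennreal_leI)
    next
      case False
      then have z: "?f x = 0" by (auto split: split_indicator)
      show ?thesis unfolding z by simp
    qed
  qed
  also have "\<dots> = ennreal (a0 / \<delta>) * ball_return a j k r x0"
    unfolding ball_return_def by (rule nn_integral_cmult) (rule measurable_U, measurable)
  finally show ?thesis .
qed

lemma return_mass_nonneg:
  assumes a: "admissible a" and A: "A \<in> sets borel"
  shows "0 \<le> return_mass a j k A"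
  unfolding return_mass_def using reg_nonneg[OF cone_fibre_dens(1)[OF a]] by (intro integral_nonneg_AE AE_U_I) auto

lemma mix_error_nonneg: "0 \<le> mix_error a g k A"
  by (simp add: mix_error_def)

lemma fibre_mass_le_measure:
  assumes a: "admissible a" and A: "A \<in> sets borel" "A \<subseteq> {\<delta>..1}" and \<delta>: "0 < \<delta>"
  shows "fibre_mass a k A \<le> a0 / \<delta> * measure lborel A"
proof -
  have "fibre_mass a k A \<le> (\<integral>x. indicator A x * (a0 / \<delta>) \<partial>U)"
    unfolding fibre_mass_def
  proof (rule integral_mono_AE)
    show "integrable U (\<lambda>x. indicator A x * fibre_dens a k x)" using fibre_dens_ind_integrable[OF a A(1)] by (simp add: mult.commute)
    show "integrable U (\<lambda>x. indicator A x * (a0 / \<delta>))"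
      by (intro integrable_mult_left U.integrable_const_bound[where B = 1]) (use A(1) in \<open>auto intro: measurable_U split: split_indicator\<close>)
    show "AE x in U. indicator A x * fibre_dens a k x \<le> indicator A x * (a0 / \<delta>)"
      by (rule AE_I2) (use A(2) fibre_dens_le_near[OF a \<delta>] in \<open>auto split: split_indicator\<close>)
  qed
  also have "\<dots> = measure lborel A * (a0 / \<delta>)"
  proof -
    have "A \<subseteq> {0..1}" using A(2) \<delta> by auto
    then show ?thesis using integral_U_ind[OF A(1)] by simp
  qed
  finally show ?thesis by (simp add: mult.commute)
qed

text \<open>The deterministic half of the argument, for one fibre and one centre: the random input
  is confined to \<open>H\<close> and \<open>SSl\<close>. About \<open>n * (t - s)\<close> factors
  \<open>1 - w\<close> occur, and the law of large numbers identifies the limit of the sum of the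
  \<open>w\<close>.\<close>

lemma hitting_limit:
  assumes a: "admissible a" and x0: "0 < x0" "x0 < 1"
    and H: "(\<lambda>n. (\<Sum>k<n. fibre_dens a (int k) x0) / real n) \<longlonglongrightarrow> H"
    and SSl: "\<And>M. 1 \<le> M \<Longrightarrow> (\<lambda>i. return_sum M i a x0) \<longlonglongrightarrow> 0"
    and A: "\<And>n. A n \<in> sets borel" "\<And>n. A n \<subseteq> {0..1}"
    and near: "\<forall>\<^sub>F n in sequentially. A n \<subseteq> {x. \<bar>x - x0\<bar> < real M1 / real n}"
    and mA: "(\<lambda>n. real n * measure lborel (A n)) \<longlonglongrightarrow> c"
    and mixA: "\<And>e. 0 < e \<Longrightarrow> \<exists>N. \<forall>n\<ge>N. \<forall>k. real n * mix_error a (3 * root_up n) k (A n) \<le> e"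
    and st: "0 \<le> s" "s < t"
  shows "(\<lambda>n. surv_mass a (nat \<lfloor>real n * (t - s)\<rfloor>) \<lfloor>real n * s\<rfloor> (A n)) \<longlonglongrightarrow> exp (- ((t - s) * (c * H)))"
proof -
  define \<delta> where "\<delta> = min x0 (1 - x0) / 2"
  have \<delta>: "0 < \<delta>" using x0 by (simp add: \<delta>_def)
  define Kh where "Kh = a0 / \<delta>"
  have Kh: "0 < Kh" using a0_gt \<delta> by (simp add: Kh_def)
  define N where "N = (\<lambda>n. nat \<lfloor>real n * (t - s)\<rfloor>)"
  define K where "K = (\<lambda>n. nat \<lfloor>real n * s\<rfloor>)"
  define g where "g = (\<lambda>n. 3 * root_up n)"
  define mu where "mu = (\<lambda>n. measure lborel (A n))"
  \<comment> \<open>Hitting times start at 1, so the first fibre that counts is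
    \<open>K n + 1\<close> and not \<open>K n\<close>.\<close>
  define w where "w = (\<lambda>n i. fibre_mass a (int (K n) + 1 + int i) (A n))"
  have intK: "int (K n) = \<lfloor>real n * s\<rfloor>" for n using st by (simp add: K_def)
  have Nle: "real (N n) \<le> real n * (t - s)" for n using st by (simp add: N_def)
  have Kle: "real (K n) \<le> real n * s" for n using st by (simp add: K_def)
  have mu0: "0 \<le> mu n" for n by (simp add: mu_def)
  have nmu: "(\<lambda>n. real n * mu n) \<longlonglongrightarrow> c" using mA by (simp add: mu_def)
  have inv0: "(\<lambda>n. C / real n) \<longlonglongrightarrow> 0" for C by (rule lim_const_over_n)
  have "\<forall>\<^sub>F n in sequentially. real M1 / real n < \<delta>" by (rule order_tendstoD(2)[OF inv0 \<delta>])
  then have good: "\<forall>\<^sub>F n in sequentially. 1 \<le> n \<and> A n \<subseteq> {x. \<bar>x - x0\<bar> < real M1 / real n} \<and> real M1 / real n < \<delta>"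
    using near eventually_ge_at_top[of "1::nat"] by eventually_elim auto
  have geo: "\<delta> \<le> x0 - r \<and> x0 + r \<le> 1" if "r < \<delta>" for r
    using that x0 by (auto simp: \<delta>_def min_def split: if_splits)
  have wle: "fibre_mass a k (A n) \<le> Kh * mu n" if n: "A n \<subseteq> {x. \<bar>x - x0\<bar> < real M1 / real n}" "real M1 / real n < \<delta>" for k n
    unfolding Kh_def mu_def
  proof (rule fibre_mass_le_measure[OF a A(1) _ \<delta>])
    show "A n \<subseteq> {\<delta>..1}" using n(1) geo[OF n(2)] by (force simp: abs_less_iff)
  qed
  have mulim: "mu \<longlonglongrightarrow> 0"
  proof -
    have "(\<lambda>n. (real n * mu n) * (1 / real n)) \<longlonglongrightarrow> c * 0" by (intro tendsto_mult nmu inv0)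
    moreover have "\<forall>\<^sub>F n in sequentially. (real n * mu n) * (1 / real n) = mu n"
      using eventually_ge_at_top[of "1::nat"] by eventually_elim auto
    ultimately show ?thesis by (simp add: filterlim_cong)
  qed
  have Nlim: "(\<lambda>n. real (N n) / real n) \<longlonglongrightarrow> t - s"
    unfolding N_def using st by real_asymp
  have Klim: "(\<lambda>n. real (K n + 1) / real n) \<longlonglongrightarrow> s"
  proof (cases "s = 0")
    case True
    then show ?thesis using inv0[of 1] by (simp add: K_def)
  next
    case False
    then have "0 < s" using st by simp
    then show ?thesis unfolding K_def by real_asymp
  qed
  have KNlim: "(\<lambda>n. real (K n + 1 + N n) / real n) \<longlonglongrightarrow> s + (t - s)"
    using tendsto_add[OF Klim Nlim] by (simp add: add_divide_distrib ac_simps)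
  define Sm where "Sm = (\<lambda>n. \<Sum>k<n. fibre_dens a (int k) x0)"
  have avg: "(\<lambda>n. (\<Sum>i<N n. fibre_dens a (int (K n) + 1 + int i) x0) / real n) \<longlonglongrightarrow> (t - s) * H"
  proof -
    have Sl: "(\<lambda>n. Sm n / real n) \<longlonglongrightarrow> H" using H by (simp add: Sm_def)
    have "(\<lambda>n. Sm (K n + 1 + N n) / real n - Sm (K n + 1) / real n) \<longlonglongrightarrow> (s + (t - s)) * H - s * H"
      by (intro tendsto_diff average_subsequence[OF Sl] KNlim Klim)
    moreover have "Sm (K n + 1 + N n) - Sm (K n + 1) = (\<Sum>i<N n. fibre_dens a (int (K n) + 1 + int i) x0)" for n
    proof -
      have "Sm (m + l) - Sm m = (\<Sum>i<l. fibre_dens a (int m + int i) x0)" for m l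
        by (induction l) (auto simp: Sm_def)
      from this[of "K n + 1" "N n"] show ?thesis by (simp add: algebra_simps)
    qed
    ultimately show ?thesis by (simp add: diff_divide_distrib[symmetric] algebra_simps)
  qed
  \<comment> \<open>Each target mass is replaced by \<open>mu n\<close> times the density at
    \<open>x0\<close>. By the Lipschitz bound the error is \<open>mu n\<close> times a quantity of
    order \<open>1/n\<close>, negligible after summing \<open>N n\<close> terms.\<close>
  have wsum: "(\<lambda>n. \<Sum>i<N n. w n i) \<longlonglongrightarrow> (t - s) * (c * H)"
  proof -
    let ?L = "2 * a0 / \<delta>\<^sup>2"
    have main: "(\<lambda>n. (real n * mu n) * ((\<Sum>i<N n. fibre_dens a (int (K n) + 1 + int i) x0) / real n)) \<longlonglongrightarrow> c * ((t - s) * H)"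
      by (intro tendsto_mult nmu avg)
    have up: "(\<lambda>n. ((real (N n) / real n) * (real n * mu n)) * (?L * (real M1 / real n))) \<longlonglongrightarrow> ((t - s) * c) * (?L * 0)"
      by (intro tendsto_intros Nlim nmu inv0)
    have "(\<lambda>n. (\<Sum>i<N n. w n i) - (real n * mu n) * ((\<Sum>i<N n. fibre_dens a (int (K n) + 1 + int i) x0) / real n)) \<longlonglongrightarrow> 0"
    proof (rule Lim_null_comparison)
      show "(\<lambda>n. ((real (N n) / real n) * (real n * mu n)) * (?L * (real M1 / real n))) \<longlonglongrightarrow> 0" using up by simp
      show "\<forall>\<^sub>F n in sequentially. norm ((\<Sum>i<N n. w n i) - (real n * mu n) * ((\<Sum>i<N n. fibre_dens a (int (K n) + 1 + int i) x0) / real n))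
         \<le> ((real (N n) / real n) * (real n * mu n)) * (?L * (real M1 / real n))"
        using good
      proof eventually_elim
        fix n assume n: "1 \<le> n \<and> A n \<subseteq> {x. \<bar>x - x0\<bar> < real M1 / real n} \<and> real M1 / real n < \<delta>"
        then have n0: "real n \<noteq> 0" by auto
        let ?r = "real M1 / real n"
        have sub: "A n \<subseteq> {x0 - ?r..x0 + ?r}" using n by (force simp: abs_less_iff)
        have "\<bar>w n i - mu n * fibre_dens a (int (K n) + 1 + int i) x0\<bar> \<le> ?L * ?r * mu n" for i
          unfolding w_def mu_def using n geo[of ?r] by (intro fibre_mass_approx a A(1) sub \<delta>) auto
        then have s1: "\<bar>\<Sum>i<N n. w n i - mu n * fibre_dens a (int (K n) + 1 + int i) x0\<bar> \<le> (\<Sum>i<N n. ?L * ?r * mu n)"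
          by (intro order_trans[OF sum_abs] sum_mono)
        have s2: "(\<Sum>i<N n. w n i) - (real n * mu n) * ((\<Sum>i<N n. fibre_dens a (int (K n) + 1 + int i) x0) / real n)
          = (\<Sum>i<N n. w n i - mu n * fibre_dens a (int (K n) + 1 + int i) x0)"
        proof -
          have "(real n * mu n) * (Z / real n) = mu n * Z" for Z using n0 by simp
          then show ?thesis unfolding sum_subtractf sum_distrib_left[symmetric] by simp
        qed
        have s3: "(\<Sum>i<N n. ?L * ?r * mu n) = ((real (N n) / real n) * (real n * mu n)) * (?L * ?r)"
          using n0 by simp
        show "norm ((\<Sum>i<N n. w n i) - (real n * mu n) * ((\<Sum>i<N n. fibre_dens a (int (K n) + 1 + int i) x0) / real n))
         \<le> ((real (N n) / real n) * (real n * mu n)) * (?L * ?r)"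
          unfolding real_norm_def s2 s3[symmetric] by (rule s1)
      qed
    qed
    from tendsto_add[OF this main] show ?thesis by (simp add: ac_simps)
  qed
  have prod: "(\<lambda>n. \<Prod>i<N n. 1 - w n i) \<longlonglongrightarrow> exp (- ((t - s) * (c * H)))"
  proof (rule prod_exp_limit[OF _ _ _ wsum])
    show "0 \<le> w n i" for n i unfolding w_def using fibre_mass_bounds[OF a A(1)] by simp
    show "\<forall>\<^sub>F n in sequentially. \<forall>i. w n i \<le> Kh * mu n"
      using good by eventually_elim (auto simp: w_def intro!: wle)
    show "(\<lambda>n. Kh * mu n) \<longlonglongrightarrow> 0" using tendsto_mult_left[OF mulim, of Kh] by simp
  qed
  \<comment> \<open>The three parts vanish after summation for different reasons: mixing errors are
    o(1/n) uniformly, short returns are small by the choice of the centre, and the products of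
    masses total n * sqrt n * (1/n)^2.\<close>
  define E where "E = (\<lambda>n k. mix_error a (g n) k (A n) + (\<Sum>j\<in>{1..g n}. return_mass a j k (A n)) + fibre_mass a k (A n) * (\<Sum>j\<in>{1..g n}. fibre_mass a (k + int j) (A n)))"
  have E1: "(\<lambda>n. \<Sum>i<N n. mix_error a (g n) (int (K n) + 1 + int i) (A n)) \<longlonglongrightarrow> 0"
  proof (rule LIMSEQ_I)
    fix e :: real assume e: "0 < e"
    define e1 where "e1 = e / (2 * (t - s))"
    have e1: "0 < e1" using e st by (simp add: e1_def)
    obtain M where M0: "\<forall>n\<ge>M. \<forall>k. real n * mix_error a (g n) k (A n) \<le> e1"
      unfolding g_def by (rule exE[OF mixA[OF e1]])
    then have M: "real n * mix_error a (g n) k (A n) \<le> e1" if "M \<le> n" for n k using that by simp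
    show "\<exists>no. \<forall>n\<ge>no. norm ((\<Sum>i<N n. mix_error a (g n) (int (K n) + 1 + int i) (A n)) - 0) < e"
    proof (intro exI allI impI)
      fix n assume n: "max 1 M \<le> n"
      then have n0: "0 < real n" by auto
      have "(\<Sum>i<N n. mix_error a (g n) (int (K n) + 1 + int i) (A n)) \<le> (\<Sum>i<N n. e1 / real n)"
        using M n n0 by (intro sum_mono) (auto simp: pos_le_divide_eq mult.commute)
      also have "\<dots> = real (N n) * (e1 / real n)" by simp
      also have "\<dots> \<le> (real n * (t - s)) * (e1 / real n)" using Nle e1 n0 by (intro mult_right_mono) auto
      also have "\<dots> = e / 2"
      proof -
        have "(z * y) * (e / (2 * y) / z) = e / 2" if "y \<noteq> 0" "z \<noteq> 0" for y z :: real using that by simp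
        moreover have "t - s \<noteq> 0" "real n \<noteq> 0" using n0 st by auto
        ultimately show ?thesis unfolding e1_def by blast
      qed
      finally have "(\<Sum>i<N n. mix_error a (g n) (int (K n) + 1 + int i) (A n)) < e" using e by simp
      moreover have "0 \<le> (\<Sum>i<N n. mix_error a (g n) (int (K n) + 1 + int i) (A n))" by (intro sum_nonneg mix_error_nonneg)
      ultimately show "norm ((\<Sum>i<N n. mix_error a (g n) (int (K n) + 1 + int i) (A n)) - 0) < e" by simp
    qed
  qed
  have E2: "(\<lambda>n. \<Sum>i<N n. \<Sum>j\<in>{1..g n}. return_mass a j (int (K n) + 1 + int i) (A n)) \<longlonglongrightarrow> 0"
  proof -
    \<comment> \<open>One integer dominates three constants: the radius constant \<open>M1\<close>,
      the gap through \<open>3 * (sqrt n + 1) \<le> 15 * i ^ 2\<close>, and the last fibre through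
      \<open>n * t \<le> 16 * t * i ^ 4\<close>, where \<open>i = fourth_root n\<close>.\<close>
    define M where "M = max M1 (max 15 (nat \<lceil>16 * t + 1\<rceil>))"
    have M: "1 \<le> M" "M1 \<le> M" "15 \<le> M" unfolding M_def by simp_all
    have M4: "16 * t + 1 \<le> real M"
    proof -
      have "16 * t + 1 \<le> real (nat \<lceil>16 * t + 1\<rceil>)" by (rule real_nat_ceiling_ge)
      moreover have "nat \<lceil>16 * t + 1\<rceil> \<le> M" unfolding M_def by simp
      ultimately show ?thesis by linarith
    qed
    let ?u = "\<lambda>n. \<Sum>i<N n. \<Sum>j\<in>{1..g n}. return_mass a j (int (K n) + 1 + int i) (A n)"
    have u0: "0 \<le> ?u n" for n by (intro sum_nonneg return_mass_nonneg a A)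
    have lim: "(\<lambda>n. ennreal Kh * return_sum M (fourth_root n) a x0) \<longlonglongrightarrow> ennreal Kh * 0"
      using filterlim_compose[OF SSl[OF M(1)] fourth_root_lim] by (intro ennreal_tendsto_cmult) auto
    have le: "\<forall>\<^sub>F n in sequentially. ennreal (?u n) \<le> ennreal Kh * return_sum M (fourth_root n) a x0"
      using good
    proof eventually_elim
      fix n assume n: "1 \<le> n \<and> A n \<subseteq> {x. \<bar>x - x0\<bar> < real M1 / real n} \<and> real M1 / real n < \<delta>"
      let ?r = "real M1 / real n" and ?R = "real M / real (fourth_root n ^ 4)"
      note i = fourth_root[of n]
      have i1: "1 \<le> fourth_root n ^ 4" using i(1) n by simp
      have rR: "?r \<le> ?R"
      proof (rule frac_le)
        show "real M1 \<le> real M" using M(2) by simp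
        show "0 < real (fourth_root n ^ 4)" using i1 by (simp only: of_nat_0_less_iff)
        show "real (fourth_root n ^ 4) \<le> real n" using i(2) n by (simp only: of_nat_le_iff)
      qed simp
      have gR: "g n \<le> M * fourth_root n ^ 2"
      proof -
        have "real (g n) \<le> 3 * (sqrt (real n) + 1)" using root_up_le[of n] by (simp add: g_def)
        also have "\<dots> \<le> 3 * (4 * real (fourth_root n) ^ 2 + real (fourth_root n) ^ 2)" using i n by (intro mult_left_mono add_mono) auto
        also have "\<dots> \<le> real M * real (fourth_root n) ^ 2" using M(3) by (simp add: mult_right_mono)
        finally have "real (g n) \<le> real (M * fourth_root n ^ 2)" by simp
        then show ?thesis by (simp only: of_nat_le_iff)
      qed
      have KR: "K n + N n \<le> M * fourth_root n ^ 4"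
      proof -
        have "real (K n + N n) \<le> real n * t" using Kle[of n] Nle[of n] by (simp add: algebra_simps)
        also have "\<dots> \<le> (16 * real (fourth_root n) ^ 4) * t" using i(4) n st by (intro mult_right_mono) auto
        also have "\<dots> = (16 * t) * real (fourth_root n) ^ 4" by simp
        also have "\<dots> \<le> real M * real (fourth_root n) ^ 4" using M4 by (intro mult_right_mono) auto
        finally have "real (K n + N n) \<le> real (M * fourth_root n ^ 4)" by simp
        then show ?thesis by (simp only: of_nat_le_iff)
      qed
      have SRle: "ennreal (return_mass a j k (A n)) \<le> ennreal Kh * ball_return a j k ?R x0" for j k
      proof -
        have "ennreal (return_mass a j k (A n)) \<le> ennreal Kh * ball_return a j k ?r x0"
          unfolding Kh_def using n geo[of ?r] by (intro return_mass_le_ball_return a A \<delta>) auto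
        also have "\<dots> \<le> ennreal Kh * ball_return a j k ?R x0" by (intro mult_left_mono ball_return_mono rR) auto
        finally show ?thesis .
      qed
      have "ennreal (?u n) = (\<Sum>i<N n. \<Sum>j\<in>{1..g n}. ennreal (return_mass a j (int (K n) + 1 + int i) (A n)))"
        by (simp add: sum_ennreal sum_nonneg return_mass_nonneg[OF a A(1)])
      also have "\<dots> \<le> (\<Sum>i<N n. \<Sum>j\<in>{1..g n}. ennreal Kh * ball_return a j (int (K n) + 1 + int i) ?R x0)"
        by (intro sum_mono SRle)
      also have "\<dots> \<le> (\<Sum>i<N n. \<Sum>j\<in>{1..M * fourth_root n ^ 2}. ennreal Kh * ball_return a j (int (K n) + 1 + int i) ?R x0)"
        using gR by (intro sum_mono sum_mono2) auto
      also have "\<dots> = (\<Sum>k\<in>(\<lambda>i. K n + 1 + i) ` {..<N n}. \<Sum>j\<in>{1..M * fourth_root n ^ 2}. ennreal Kh * ball_return a j (int k) ?R x0)"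
        by (subst sum.reindex) (auto simp: inj_on_def ac_simps)
      also have "\<dots> \<le> (\<Sum>k\<le>M * fourth_root n ^ 4. \<Sum>j\<in>{1..M * fourth_root n ^ 2}. ennreal Kh * ball_return a j (int k) ?R x0)"
        using KR by (intro sum_mono2) auto
      also have "\<dots> = ennreal Kh * return_sum M (fourth_root n) a x0" by (simp add: return_sum_def sum_distrib_left)
      finally show "ennreal (?u n) \<le> ennreal Kh * return_sum M (fourth_root n) a x0" .
    qed
    have "(\<lambda>n. ennreal (?u n)) \<longlonglongrightarrow> ennreal 0"
      by (rule tendsto_sandwich[OF _ le tendsto_const]) (use lim in auto)
    then show ?thesis by (rule tendsto_ennrealD) (use u0 in auto)
  qed
  have E3: "(\<lambda>n. \<Sum>i<N n. fibre_mass a (int (K n) + 1 + int i) (A n) * (\<Sum>j\<in>{1..g n}. fibre_mass a (int (K n) + 1 + int i + int j) (A n))) \<longlonglongrightarrow> 0"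
  proof (rule Lim_null_comparison)
    have gl: "(\<lambda>n. real (g n) / real n) \<longlonglongrightarrow> 0"
    proof (rule Lim_null_comparison)
      show "(\<lambda>n. 3 * (sqrt (real n) + 1) / real n) \<longlonglongrightarrow> 0" by real_asymp
      show "\<forall>\<^sub>F n in sequentially. norm (real (g n) / real n) \<le> 3 * (sqrt (real n) + 1) / real n"
      proof (intro always_eventually allI)
        fix n
        have "real (g n) \<le> 3 * (sqrt (real n) + 1)" using root_up_le[of n] by (simp add: g_def)
        then have "real (g n) / real n \<le> 3 * (sqrt (real n) + 1) / real n" by (intro divide_right_mono) auto
        then show "norm (real (g n) / real n) \<le> 3 * (sqrt (real n) + 1) / real n" by simp
      qed
    qed
    have "(\<lambda>n. (t - s) * (Kh * (real n * mu n)) * (Kh * (real n * mu n)) * (real (g n) / real n)) \<longlonglongrightarrow> (t - s) * (Kh * c) * (Kh * c) * 0"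
      by (intro tendsto_intros nmu gl)
    then show "(\<lambda>n. (t - s) * (Kh * (real n * mu n)) * (Kh * (real n * mu n)) * (real (g n) / real n)) \<longlonglongrightarrow> 0" by simp
    show "\<forall>\<^sub>F n in sequentially. norm (\<Sum>i<N n. fibre_mass a (int (K n) + 1 + int i) (A n) * (\<Sum>j\<in>{1..g n}. fibre_mass a (int (K n) + 1 + int i + int j) (A n)))
      \<le> (t - s) * (Kh * (real n * mu n)) * (Kh * (real n * mu n)) * (real (g n) / real n)"
      using good
    proof eventually_elim
      fix n assume n: "1 \<le> n \<and> A n \<subseteq> {x. \<bar>x - x0\<bar> < real M1 / real n} \<and> real M1 / real n < \<delta>"
      then have n0: "0 < real n" by auto
      have wb: "0 \<le> fibre_mass a k (A n)" "fibre_mass a k (A n) \<le> Kh * mu n" for k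
        using fibre_mass_bounds[OF a A(1)] wle[of n k] n by auto
      let ?T = "\<Sum>i<N n. fibre_mass a (int (K n) + 1 + int i) (A n) * (\<Sum>j\<in>{1..g n}. fibre_mass a (int (K n) + 1 + int i + int j) (A n))"
      have "0 \<le> ?T" by (intro sum_nonneg mult_nonneg_nonneg wb)
      moreover have "?T \<le> (\<Sum>i<N n. (Kh * mu n) * (\<Sum>j\<in>{1..g n}. Kh * mu n))"
        using Kh mu0 by (intro sum_mono mult_mono wb sum_nonneg) auto
      moreover have "(\<Sum>i<N n. (Kh * mu n) * (\<Sum>j\<in>{1..g n}. Kh * mu n)) = real (N n) * ((Kh * mu n) * (real (g n) * (Kh * mu n)))" by simp
      moreover have "\<dots> \<le> (real n * (t - s)) * ((Kh * mu n) * (real (g n) * (Kh * mu n)))"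
        using Nle Kh mu0 by (intro mult_right_mono) auto
      moreover have "\<dots> = (t - s) * (Kh * (real n * mu n)) * (Kh * (real n * mu n)) * (real (g n) / real n)"
        using n0 by (simp add: field_simps)
      ultimately show "norm ?T \<le> (t - s) * (Kh * (real n * mu n)) * (Kh * (real n * mu n)) * (real (g n) / real n)"
        by simp
    qed
  qed
  have Esum: "(\<lambda>n. \<Sum>i<N n. E n (int (K n) + 1 + int i)) \<longlonglongrightarrow> 0"
    using tendsto_add[OF tendsto_add[OF E1 E2] E3] by (simp add: E_def sum.distrib)
  have "(\<lambda>n. surv_mass a (N n) (int (K n)) (A n) - (\<Prod>i<N n. 1 - w n i)) \<longlonglongrightarrow> 0"
  proof (rule Lim_null_comparison[OF _ Esum], intro always_eventually allI)
    fix n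
    have "\<bar>surv_mass a (N n) (int (K n)) (A n) - (\<Prod>i<N n. 1 - fibre_mass a (int (K n) + 1 + int i) (A n))\<bar> \<le> (\<Sum>i<N n. E n (int (K n) + 1 + int i))"
      by (rule surv_mass_prod[OF a A(1)]) (unfold E_def, rule hit_error[OF a A(1)])
    then show "norm (surv_mass a (N n) (int (K n)) (A n) - (\<Prod>i<N n. 1 - w n i)) \<le> (\<Sum>i<N n. E n (int (K n) + 1 + int i))"
      by (simp add: w_def)
  qed
  from tendsto_add[OF this prod] show ?thesis by (simp add: N_def intK)
qed

end

subsection \<open>Shrinking targets\<close>

definition level_set :: "real \<Rightarrow> real \<Rightarrow> real \<Rightarrow> real set \<Rightarrow> real set" where
  "level_set \<alpha> x0 \<beta> J = {x \<in> {0..1}. observable \<alpha> x0 x \<in> (\<lambda>z. \<beta> * z) ` J}"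

lemma mem_level_set:
  "0 < \<beta> \<Longrightarrow> x \<in> level_set \<alpha> x0 \<beta> J \<longleftrightarrow> x \<in> {0..1} \<and> observable \<alpha> x0 x / \<beta> \<in> J"
  by (force simp: level_set_def field_simps)

lemma observable_measurable [measurable]: "observable \<alpha> x0 \<in> borel_measurable borel"
  unfolding observable_def[abs_def] by measurable

lemma level_set_borel:
  assumes "0 < \<beta>" and [measurable]: "J \<in> sets borel"
  shows "level_set \<alpha> x0 \<beta> J \<in> sets borel"
proof -
  have "level_set \<alpha> x0 \<beta> J = {0..1} \<inter> (\<lambda>x. observable \<alpha> x0 x / \<beta>) -` J"
    using mem_level_set[OF assms(1)] by auto
  moreover have "(\<lambda>x. observable \<alpha> x0 x / \<beta>) -` J \<in> sets borel"
    using measurable_sets[of "\<lambda>x. observable \<alpha> x0 x / \<beta>" borel borel J] by simp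
  ultimately show ?thesis by simp
qed

lemma less_observable_iff:
  fixes \<alpha> y d :: real
  assumes "0 < \<alpha>" "0 < y" "0 < d"
  shows "y < d powr (- (1 / \<alpha>)) \<longleftrightarrow> d < y powr (- \<alpha>)"
proof -
  have e: "(d powr (- (1 / \<alpha>))) powr (- \<alpha>) = d" using assms by (simp add: powr_powr)
  have dp: "0 < d powr (- (1 / \<alpha>))" using assms by simp
  show ?thesis
  proof
    assume "y < d powr (- (1 / \<alpha>))"
    then have "(d powr (- (1 / \<alpha>))) powr (- \<alpha>) < y powr (- \<alpha>)"
      using assms by (intro powr_less_mono2_neg) auto
    then show "d < y powr (- \<alpha>)" by (simp only: e)
  next
    assume h: "d < y powr (- \<alpha>)"
    show "y < d powr (- (1 / \<alpha>))"
    proof (rule ccontr)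
      assume "\<not> y < d powr (- (1 / \<alpha>))"
      then have "y powr (- \<alpha>) \<le> (d powr (- (1 / \<alpha>))) powr (- \<alpha>)"
        using assms dp by (intro powr_mono2') auto
      then show False using h by (simp only: e)
    qed
  qed
qed

lemma less_observable:
  assumes "0 < \<alpha>" "0 < \<beta>" "0 < y" "x \<noteq> x0"
  shows "y < observable \<alpha> x0 x / \<beta> \<longleftrightarrow> \<bar>x - x0\<bar> < \<beta> powr (- \<alpha>) * y powr (- \<alpha>)"
proof -
  have "y < observable \<alpha> x0 x / \<beta> \<longleftrightarrow> \<beta> * y < \<bar>x - x0\<bar> powr (- (1 / \<alpha>))"
    using assms by (simp add: observable_def field_simps)
  also have "\<dots> \<longleftrightarrow> \<bar>x - x0\<bar> < (\<beta> * y) powr (- \<alpha>)"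
    using assms by (intro less_observable_iff) auto
  finally show ?thesis by (simp add: powr_mult)
qed

text \<open>Inclusion-exclusion for two sets requires the property of their intersection as well.
  The intersection of a union with one more member is a union of equally many members of
  \<open>C\<close>, so the induction runs on their number with the sets themselves varying.\<close>

lemma finite_union_induct:
  fixes P :: "'a set \<Rightarrow> bool"
  assumes C: "\<And>A B. A \<in> C \<Longrightarrow> B \<in> C \<Longrightarrow> A \<inter> B \<in> C" and P0: "P {}" and P1: "\<And>A. A \<in> C \<Longrightarrow> P A"
    and PU: "\<And>A B. P A \<Longrightarrow> P B \<Longrightarrow> P (A \<inter> B) \<Longrightarrow> P (A \<union> B)"
    and F: "finite F" "F \<subseteq> C"
  shows "P (\<Union>F)"
proof -
  have "P (\<Union>(f ` {..<n}))" if "f ` {..<n} \<subseteq> C" for n and f :: "nat \<Rightarrow> 'a set"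
    using that
  proof (induction n arbitrary: f)
    case 0
    then show ?case using P0 by simp
  next
    case (Suc n)
    have sub: "f ` {..<n} \<subseteq> C" "f n \<in> C" using Suc.prems by auto
    have "P (\<Union>((\<lambda>i. f i \<inter> f n) ` {..<n}))" using sub C by (intro Suc.IH) auto
    moreover have "\<Union>((\<lambda>i. f i \<inter> f n) ` {..<n}) = \<Union>(f ` {..<n}) \<inter> f n" by auto
    ultimately have "P (\<Union>(f ` {..<n}) \<union> f n)" using Suc.IH[OF sub(1)] P1[OF sub(2)] by (intro PU) auto
    moreover have "\<Union>(f ` {..<n}) \<union> f n = \<Union>(f ` {..<Suc n})" by (auto simp: lessThan_Suc)
    ultimately show ?case by simp
  qed
  moreover obtain f n where "F = f ` {i::nat. i < n}" using F(1) finite_imp_nat_seg_image_inj_on by metis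
  ultimately show ?thesis using F(2) by (metis lessThan_def)
qed

text \<open>The intervals allowed in \<open>interval_unions\<close>, together with the degenerate
  ones, so that the class is closed under intersection.\<close>

definition ioc_class :: "real set set" where
  "ioc_class = {ereal_Ioc u v | u v. 0 \<notin> {u..v}}"

lemma ioc_class_Int:
  assumes "A \<in> ioc_class" "B \<in> ioc_class"
  shows "A \<inter> B \<in> ioc_class"
proof -
  obtain u v u' v' where A: "A = ereal_Ioc u v" "0 \<notin> {u..v}" and B: "B = ereal_Ioc u' v'"
    using assms by (auto simp: ioc_class_def)
  have "A \<inter> B = ereal_Ioc (max u u') (min v v')" unfolding A B ereal_Ioc_def by auto
  moreover have "0 \<notin> {max u u'..min v v'}" using A(2) by auto
  ultimately show ?thesis unfolding ioc_class_def by blast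
qed

text \<open>An interval avoiding 0 lies on one side of it; the case \<open>neg\<close> also takes
  the empty intervals.\<close>

lemma ioc_class_cases:
  assumes "A \<in> ioc_class"
  obtains (neg) "A \<in> sets borel" "\<And>z. z \<in> A \<Longrightarrow> z < 0"
    | (bounded) \<eta> v where "0 < \<eta>" "\<eta> \<le> v" "A = {\<eta><..v}"
    | (unbounded) \<eta> where "0 < \<eta>" "A = {\<eta><..}"
proof -
  obtain u v where A: "A = ereal_Ioc u v" "0 \<notin> {u..v}" using assms by (auto simp: ioc_class_def)
  have Ab: "A \<in> sets borel"
  proof -
    have "A = ereal -` {u<..v}" by (auto simp: A ereal_Ioc_def)
    moreover have "ereal -` {u<..v} \<in> sets borel"
      using measurable_sets[of ereal borel borel "{u<..v}"] by simp
    ultimately show ?thesis by simp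
  qed
  show thesis
  proof (cases "0 < u \<and> u < v")
    case True
    then obtain \<eta> where u: "u = ereal \<eta>" "0 < \<eta>" by (cases u) auto
    consider (real) w where "v = ereal w" | (inf) "v = \<infinity>" using True by (cases v) auto
    then show thesis
    proof cases
      case (real w)
      have "A = {\<eta><..w}" by (auto simp: A(1) ereal_Ioc_def u real)
      moreover have "\<eta> \<le> w" using True by (simp add: u real)
      ultimately show thesis using u(2) bounded by blast
    next
      case inf
      have "A = {\<eta><..}" by (auto simp: A(1) ereal_Ioc_def u inf)
      then show thesis using u(2) unbounded by blast
    qed
  next
    case False
    have "z < 0" if "z \<in> A" for z
    proof -
      have z: "u < ereal z" "ereal z \<le> v" using that by (auto simp: A ereal_Ioc_def)
      then have "u < v" by order
      then have "\<not> 0 < u" using False by auto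
      then have "v < 0" using A(2) by auto
      then have "ereal z < 0" using z(2) by order
      then show ?thesis by simp
    qed
    then show thesis using Ab neg by blast
  qed
qed

lemma levy_Ioc:
  assumes \<alpha>: "0 < \<alpha>" and \<eta>: "0 < \<eta>" "\<eta> \<le> v"
  shows "emeasure (levy_measure \<alpha>) {\<eta><..v} = ennreal (\<eta> powr (- \<alpha>) - v powr (- \<alpha>))"
proof -
  let ?f = "\<lambda>x. \<alpha> * x powr (- \<alpha> - 1)"
  have "emeasure (levy_measure \<alpha>) {\<eta><..v}
     = (\<integral>\<^sup>+x. ennreal (if 0 < x then ?f x else 0) * indicator {\<eta><..v} x \<partial>lborel)"
    unfolding levy_measure_def by (rule emeasure_density) auto
  also have "\<dots> = (\<integral>\<^sup>+x. ennreal (?f x) * indicator {\<eta>..v} x \<partial>lborel)"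
  proof (rule nn_integral_cong_AE)
    show "AE x in lborel. ennreal (if 0 < x then ?f x else 0) * indicator {\<eta><..v} x = ennreal (?f x) * indicator {\<eta>..v} x"
      using AE_lborel_singleton[of \<eta>] by eventually_elim (use \<eta> in \<open>auto split: split_indicator\<close>)
  qed
  also have "\<dots> = ennreal (- (v powr (- \<alpha>)) - (- (\<eta> powr (- \<alpha>))))"
  proof (rule nn_integral_FTC_Icc[OF _ _ _ \<eta>(2)])
    fix x assume "x \<in> {\<eta>..v}"
    then have x: "0 < x" using \<eta> by simp
    then have "((\<lambda>x. - (x powr (- \<alpha>))) has_real_derivative - (- \<alpha> * x powr (- \<alpha> - 1))) (at x)"
      by (intro DERIV_minus has_real_derivative_powr)
    then have "((\<lambda>x. - (x powr (- \<alpha>))) has_real_derivative ?f x) (at x)" by simp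
    then show "((\<lambda>x. - (x powr (- \<alpha>))) has_real_derivative ?f x) (at x)" .
    show "0 \<le> ?f x" using \<alpha> by simp
  qed simp
  finally show ?thesis by simp
qed

lemma levy_Ioi:
  assumes \<alpha>: "0 < \<alpha>" and \<eta>: "0 < \<eta>"
  shows "emeasure (levy_measure \<alpha>) {\<eta><..} = ennreal (\<eta> powr (- \<alpha>))"
proof -
  let ?f = "\<lambda>x. \<alpha> * x powr (- \<alpha> - 1)"
  have "emeasure (levy_measure \<alpha>) {\<eta><..}
     = (\<integral>\<^sup>+x. ennreal (if 0 < x then ?f x else 0) * indicator {\<eta><..} x \<partial>lborel)"
    unfolding levy_measure_def by (rule emeasure_density) auto
  also have "\<dots> = (\<integral>\<^sup>+x. ennreal (?f x) * indicator {\<eta>..} x \<partial>lborel)"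
  proof (rule nn_integral_cong_AE)
    show "AE x in lborel. ennreal (if 0 < x then ?f x else 0) * indicator {\<eta><..} x = ennreal (?f x) * indicator {\<eta>..} x"
      using AE_lborel_singleton[of \<eta>] by eventually_elim (use \<eta> in \<open>auto split: split_indicator\<close>)
  qed
  also have "\<dots> = ennreal (0 - (- (\<eta> powr (- \<alpha>))))"
  proof (rule nn_integral_FTC_atLeast)
    fix x assume "\<eta> \<le> x"
    then have x: "0 < x" using \<eta> by simp
    then have "((\<lambda>x. - (x powr (- \<alpha>))) has_real_derivative - (- \<alpha> * x powr (- \<alpha> - 1))) (at x)"
      by (intro DERIV_minus has_real_derivative_powr)
    then show "((\<lambda>x. - (x powr (- \<alpha>))) has_real_derivative ?f x) (at x)" by simp
    show "0 \<le> ?f x" using \<alpha> by simp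
  next
    show "((\<lambda>x. - (x powr (- \<alpha>))) \<longlongrightarrow> 0) at_top" using \<alpha> by real_asymp
  qed simp
  finally show ?thesis by simp
qed

lemma levy_neg:
  assumes A: "A \<in> sets borel" "\<And>z. z \<in> A \<Longrightarrow> z < 0"
  shows "emeasure (levy_measure \<alpha>) A = 0"
proof -
  have "emeasure (levy_measure \<alpha>) A
     = (\<integral>\<^sup>+x. ennreal (if 0 < x then \<alpha> * x powr (- \<alpha> - 1) else 0) * indicator A x \<partial>lborel)"
    unfolding levy_measure_def by (rule emeasure_density) (use A in auto)
  also have "\<dots> = (\<integral>\<^sup>+x. 0 \<partial>(lborel :: real measure))"
  proof (rule nn_integral_cong)
    fix x :: real
    show "ennreal (if 0 < x then \<alpha> * x powr (- \<alpha> - 1) else 0) * indicator A x = 0"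
      using A(2)[of x] by (cases "x \<in> A") auto
  qed
  finally show ?thesis by simp
qed

lemma sets_levy [simp]: "sets (levy_measure \<alpha>) = sets borel"
  by (simp add: levy_measure_def)

context lsv
begin

lemma mix_error_empty: "mix_error a g k {} = 0"
  by (simp add: mix_error_def fibre_mass_def Pn_0)

text \<open>The function inside the norm is linear in the indicator, and indicators obey
  inclusion-exclusion.\<close>

lemma mix_error_Un:
  assumes a: "admissible a" and A: "A \<in> sets borel" and B: "B \<in> sets borel"
  shows "mix_error a g k (A \<union> B) \<le> mix_error a g k A + mix_error a g k B + mix_error a g k (A \<inter> B)"
proof -
  note D = cone_densD[OF cone_dens_fibre_dens[OF a]]
  note pos = admissibleD(2)[OF a]
  define f where "f = (\<lambda>S x. indicator S x * fibre_dens a k x)"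
  define Z where "Z = (\<lambda>S x. Pn a g k (f S) x - fibre_mass a k S * fibre_dens a (k + int g) x)"
  have fi: "integrable U (f S)" "f S \<in> borel_measurable borel" if "S \<in> sets borel" for S
    using fibre_dens_ind_integrable[OF a that, of k] D(5)[of k] that by (auto simp: f_def mult.commute)
  have Zi: "integrable U (Z S)" if "S \<in> sets borel" for S
    unfolding Z_def using Pn_integrable[of a, OF pos fi(2)[OF that] fi(1)[OF that]] D(4) by auto
  have AB: "A \<inter> B \<in> sets borel" using A B by auto
  have fU: "f (A \<union> B) = (\<lambda>x. (f A x + f B x) - f (A \<inter> B) x)"
    by (auto simp: f_def fun_eq_iff split: split_indicator)
  have wU: "fibre_mass a k (A \<union> B) = fibre_mass a k A + fibre_mass a k B - fibre_mass a k (A \<inter> B)"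
  proof -
    have "fibre_mass a k (A \<union> B) = (\<integral>x. (f A x + f B x) - f (A \<inter> B) x \<partial>U)" unfolding fibre_mass_def using fU by (simp add: f_def)
    then show ?thesis using fi(1)[OF A] fi(1)[OF B] fi(1)[OF AB] by (simp add: fibre_mass_def f_def)
  qed
  have ZU: "Z (A \<union> B) = (\<lambda>x. (Z A x + Z B x) - Z (A \<inter> B) x)"
    unfolding Z_def fU wU Pn_minus Pn_plus by (auto simp: fun_eq_iff algebra_simps)
  have m: "mix_error a g k S = nrm (Z S)" for S by (simp add: mix_error_def Z_def f_def)
  have t1: "nrm (\<lambda>x. (Z A x + Z B x) - Z (A \<inter> B) x) \<le> nrm (\<lambda>x. Z A x + Z B x) + nrm (Z (A \<inter> B))"
    using Zi[OF A] Zi[OF B] Zi[OF AB] by (intro nrm_minus_triangle) auto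
  have t2: "nrm (\<lambda>x. Z A x + Z B x) \<le> nrm (Z A) + nrm (Z B)"
    using Zi[OF A] Zi[OF B] by (intro nrm_triangle)
  show ?thesis unfolding m ZU using t1 t2 by linarith
qed

lemma fibre_mass_lower:
  assumes a: "admissible a" and B: "B \<in> sets borel" "B \<subseteq> {0..1}"
  shows "16 * couple_const a0 * measure lborel B \<le> fibre_mass a k B"
proof -
  have "16 * couple_const a0 * measure lborel B = (\<integral>x. indicator B x * (16 * couple_const a0) \<partial>U)"
    using integral_U_ind[OF B] by simp
  also have "\<dots> \<le> fibre_mass a k B"
    unfolding fibre_mass_def
  proof (rule integral_mono_AE)
    show "integrable U (\<lambda>x. indicator B x * (16 * couple_const a0))"
      by (intro integrable_mult_left U.integrable_const_bound[where B = 1]) (use B(1) in \<open>auto intro: measurable_U split: split_indicator\<close>)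
    show "integrable U (\<lambda>x. indicator B x * fibre_dens a k x)" using fibre_dens_ind_integrable[OF a B(1)] by (simp add: mult.commute)
    show "AE x in U. indicator B x * (16 * couple_const a0) \<le> indicator B x * fibre_dens a k x"
      by (rule AE_U_I) (use fibre_dens_lower[OF a] in \<open>auto split: split_indicator\<close>)
  qed
  finally show ?thesis .
qed

end

lemma annulus_measure:
  fixes x0 :: real
  assumes S: "S \<in> sets borel" and c: "0 \<le> c" "c \<le> d"
    and iff: "\<And>x. x \<notin> {x0, x0 - c, x0 + c} \<Longrightarrow> x \<in> S \<longleftrightarrow> c < \<bar>x - x0\<bar> \<and> \<bar>x - x0\<bar> < d"
  shows "measure lborel S = 2 * (d - c)"
proof -
  let ?L = "{x0 - d<..<x0 - c}" and ?R = "{x0 + c<..<x0 + d}"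
  have "AE x in lborel. x \<notin> {x0, x0 - c, x0 + c}"
    by (intro AE_not_in countable_imp_null_set_lborel) auto
  then have "AE x in lborel. x \<in> S \<longleftrightarrow> x \<in> ?L \<union> ?R"
  proof eventually_elim
    fix x assume "x \<notin> {x0, x0 - c, x0 + c}"
    from iff[OF this] show "x \<in> S \<longleftrightarrow> x \<in> ?L \<union> ?R" using c by auto
  qed
  then have "measure lborel S = measure lborel (?L \<union> ?R)"
    by (rule measure_eq_AE) (use S in auto)
  also have "\<dots> = measure lborel ?L + measure lborel ?R"
    using c by (intro measure_Union) auto
  finally show ?thesis using c by simp
qed

context rand_lsv
begin

lemma stationary_lower:
  assumes B: "B \<in> sets borel" "B \<subseteq> {0..1}"
  shows "16 * couple_const a0 * measure lborel B \<le> stationary_measure q p \<gamma> B"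
proof -
  have wi: "integrable PP (\<lambda>\<omega>. fibre_mass (params \<omega>) 0 B)"
    by (rule PP.integrable_const_bound[where B = 1])
      (use fibre_mass_bounds[OF admissible_params B(1)] fibre_mass_omega_measurable[OF B(1)] in \<open>auto intro: AE_I2\<close>)
  have "16 * couple_const a0 * measure lborel B = (\<integral>\<omega>. 16 * couple_const a0 * measure lborel B \<partial>PP)" using PP.prob_space by simp
  also have "\<dots> \<le> stationary_measure q p \<gamma> B"
    unfolding stationary_eq[OF B] using wi fibre_mass_lower[OF admissible_params B] by (intro integral_mono) auto
  finally show ?thesis .
qed

end

section \<open>The targets around a fixed centre and the limit law for them\<close>

locale obs_point = rand_lsv G q p \<gamma> for G :: real and q :: nat and p \<gamma> :: "nat \<Rightarrow> real" +
  fixes \<alpha> x0 :: real and b :: "nat \<Rightarrow> real"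
  assumes \<alpha>0: "0 < \<alpha>" and x0: "0 < x0" "x0 < 1" and b0: "\<And>n. 0 < b n"
    and bl: "(\<lambda>n. real n * stationary_measure q p \<gamma> {x \<in> {0..1}. observable \<alpha> x0 x > b n}) \<longlonglongrightarrow> 1"
begin

text \<open>The observable exceeds \<open>b n\<close> exactly on the punctured ball of this radius,
  intersected with the unit interval; the centre is missing because \<open>observable\<close> is 0
  there.\<close>

definition r :: "nat \<Rightarrow> real" where "r n = b n powr (- \<alpha>)"
definition \<delta> :: real where "\<delta> = min x0 (1 - x0) / 2"
definition exceedance :: "nat \<Rightarrow> real set" where "exceedance n = {x \<in> {0..1}. observable \<alpha> x0 x > b n}"
abbreviation "AA n J \<equiv> level_set \<alpha> x0 (b n) J"

lemma r_pos: "0 < r n"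
  using b0[of n] by (simp add: r_def)

lemma \<delta>: "0 < \<delta>" "\<delta> < x0" "x0 + \<delta> < 1" "2 * \<delta> \<le> x0" "x0 + 2 * \<delta> \<le> 1"
  using x0 by (auto simp: \<delta>_def min_def field_simps)

lemma less_obs: "0 < y \<Longrightarrow> y < observable \<alpha> x0 x / b n \<longleftrightarrow> x \<noteq> x0 \<and> \<bar>x - x0\<bar> < r n * y powr (- \<alpha>)"
proof (cases "x = x0")
  case True
  then show "0 < y \<Longrightarrow> ?thesis" by (simp add: observable_def)
next
  case False
  assume "0 < y"
  then show ?thesis using less_observable[OF \<alpha>0 b0, of y x x0 n] False by (simp add: r_def)
qed

lemma exceedance_borel: "exceedance n \<in> sets borel" "exceedance n \<subseteq> {0..1}"
proof -
  have "exceedance n = {0..1} \<inter> {x. b n < observable \<alpha> x0 x}" by (auto simp: exceedance_def)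
  then show "exceedance n \<in> sets borel" by (simp add: borel_measurable_pred_less)
qed (auto simp: exceedance_def)

lemma exceedance_iff: "x \<in> exceedance n \<longleftrightarrow> x \<in> {0..1} \<and> x \<noteq> x0 \<and> \<bar>x - x0\<bar> < r n"
  using less_obs[of 1 x n] b0[of n] by (auto simp: exceedance_def field_simps)

lemma nBB: "(\<lambda>n. real n * stationary_measure q p \<gamma> (exceedance n)) \<longlonglongrightarrow> 1"
  using bl by (simp add: exceedance_def)

lemma inv_n: "(\<lambda>n. 1 / real n) \<longlonglongrightarrow> 0"
  by (rule lim_const_over_n)

lemma st_lim: "(\<lambda>n. stationary_measure q p \<gamma> (exceedance n)) \<longlonglongrightarrow> 0"
proof -
  have "(\<lambda>n. (real n * stationary_measure q p \<gamma> (exceedance n)) * (1 / real n)) \<longlonglongrightarrow> 1 * 0"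
    by (intro tendsto_mult nBB inv_n)
  moreover have "\<forall>\<^sub>F n in sequentially. (real n * stationary_measure q p \<gamma> (exceedance n)) * (1 / real n) = stationary_measure q p \<gamma> (exceedance n)"
    using eventually_ge_at_top[of "1::nat"] by eventually_elim auto
  ultimately show ?thesis by (simp add: filterlim_cong)
qed

text \<open>The stationary measure is bounded below by a multiple of Lebesgue measure, and the
  exceedance set contains an interval of length \<open>min (r n) \<delta>\<close>; its stationary
  measure tends to 0 by the normalisation of \<open>b\<close>.\<close>

lemma r_lim: "r \<longlonglongrightarrow> 0"
proof -
  have c: "0 < couple_const a0" using couple_const(1)[of a0] a0_gt by simp
  have le: "16 * couple_const a0 * min (r n) \<delta> \<le> stationary_measure q p \<gamma> (exceedance n)" for n
  proof -
    let ?I = "{x0<..<x0 + min (r n) \<delta>}"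
    have "?I \<subseteq> exceedance n" using \<delta> x0 by (auto simp: exceedance_iff)
    moreover have "emeasure lborel (exceedance n) \<noteq> \<infinity>"
      using emeasure_mono[OF exceedance_borel(2), of lborel n] by (auto simp: top_unique)
    ultimately have "measure lborel ?I \<le> measure lborel (exceedance n)"
      using exceedance_borel by (intro measure_mono_fmeasurable) (auto simp: fmeasurable_def less_top)
    then have "min (r n) \<delta> \<le> measure lborel (exceedance n)" using r_pos[of n] \<delta> by simp
    then have "16 * couple_const a0 * min (r n) \<delta> \<le> 16 * couple_const a0 * measure lborel (exceedance n)" using c by (intro mult_left_mono) auto
    also have "\<dots> \<le> stationary_measure q p \<gamma> (exceedance n)" by (rule stationary_lower[OF exceedance_borel])
    finally show ?thesis .
  qed
  have "(\<lambda>n. stationary_measure q p \<gamma> (exceedance n) / (16 * couple_const a0)) \<longlonglongrightarrow> 0 / (16 * couple_const a0)"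
    using c by (intro tendsto_intros st_lim) auto
  then have lim: "(\<lambda>n. stationary_measure q p \<gamma> (exceedance n) / (16 * couple_const a0)) \<longlonglongrightarrow> 0" by simp
  have m0: "(\<lambda>n. min (r n) \<delta>) \<longlonglongrightarrow> 0"
  proof (rule Lim_null_comparison[OF _ lim], intro always_eventually allI)
    fix n
    show "norm (min (r n) \<delta>) \<le> stationary_measure q p \<gamma> (exceedance n) / (16 * couple_const a0)"
      using le[of n] c r_pos[of n] \<delta> by (simp add: pos_le_divide_eq mult.commute)
  qed
  have "\<forall>\<^sub>F n in sequentially. min (r n) \<delta> < \<delta>" by (rule order_tendstoD(2)[OF m0 \<delta>(1)])
  then have "\<forall>\<^sub>F n in sequentially. min (r n) \<delta> = r n" by eventually_elim auto
  then show ?thesis using m0 by (simp add: filterlim_cong)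
qed

text \<open>For small radii the stationary measure of the ball is
  \<open>2 * r n * (mean_dens x0 + \<theta> n)\<close> with \<open>\<theta> n\<close> tending to 0,
  so the normalisation of \<open>b\<close> determines the limit of \<open>n * r n\<close>.\<close>

lemma nr_lim: "(\<lambda>n. real n * r n) \<longlonglongrightarrow> 1 / (2 * mean_dens x0)"
proof -
  have H: "0 < mean_dens x0" using mean_dens_pos x0 by simp
  define \<theta> where "\<theta> = (\<lambda>n. stationary_measure q p \<gamma> (exceedance n) / (2 * r n) - mean_dens x0)"
  have ev: "\<forall>\<^sub>F n in sequentially. r n < \<delta>" by (rule order_tendstoD(2)[OF r_lim \<delta>(1)])
  have up: "(\<lambda>n. 2 * a0 / \<delta>\<^sup>2 * r n) \<longlonglongrightarrow> 0" using tendsto_mult_left[OF r_lim, of "2 * a0 / \<delta>\<^sup>2"] by simp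
  have "\<theta> \<longlonglongrightarrow> 0"
  proof (rule Lim_null_comparison[OF _ up])
    show "\<forall>\<^sub>F n in sequentially. norm (\<theta> n) \<le> 2 * a0 / \<delta>\<^sup>2 * r n"
      using ev
    proof eventually_elim
      fix n assume n: "r n < \<delta>"
      have m: "measure lborel (exceedance n) = 2 * (r n - 0)"
        using n \<delta> r_pos[of n] exceedance_borel(1) by (intro annulus_measure[of _ _ _ x0]) (auto simp: exceedance_iff)
      have "\<bar>stationary_measure q p \<gamma> (exceedance n) - measure lborel (exceedance n) * mean_dens x0\<bar> \<le> (2 * a0 / \<delta>\<^sup>2 * r n) * measure lborel (exceedance n)"
        using n \<delta> r_pos[of n] by (intro stationary_approx exceedance_borel(1)) (auto simp: exceedance_iff abs_less_iff)
      then have "\<bar>stationary_measure q p \<gamma> (exceedance n) - 2 * r n * mean_dens x0\<bar> \<le> (2 * a0 / \<delta>\<^sup>2 * r n) * (2 * r n)"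
        unfolding m by simp
      moreover have "\<theta> n = (stationary_measure q p \<gamma> (exceedance n) - 2 * r n * mean_dens x0) / (2 * r n)"
        using r_pos[of n] by (simp add: \<theta>_def diff_divide_distrib)
      ultimately show "norm (\<theta> n) \<le> 2 * a0 / \<delta>\<^sup>2 * r n"
        using r_pos[of n] by (simp add: abs_divide pos_divide_le_eq)
    qed
  qed
  then have "(\<lambda>n. (real n * stationary_measure q p \<gamma> (exceedance n)) / (2 * (mean_dens x0 + \<theta> n))) \<longlonglongrightarrow> 1 / (2 * (mean_dens x0 + 0))"
    using H by (intro tendsto_intros nBB) auto
  moreover have "\<forall>\<^sub>F n in sequentially. (real n * stationary_measure q p \<gamma> (exceedance n)) / (2 * (mean_dens x0 + \<theta> n)) = real n * r n"
  proof -
    have "\<forall>\<^sub>F n in sequentially. - mean_dens x0 < \<theta> n" using \<open>\<theta> \<longlonglongrightarrow> 0\<close> H by (intro order_tendstoD(1)) auto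
    then show ?thesis
    proof eventually_elim
      fix n assume n: "- mean_dens x0 < \<theta> n"
      have e: "mean_dens x0 + \<theta> n = stationary_measure q p \<gamma> (exceedance n) / (2 * r n)" by (simp add: \<theta>_def)
      then have "stationary_measure q p \<gamma> (exceedance n) \<noteq> 0" using n by auto
      then show "(real n * stationary_measure q p \<gamma> (exceedance n)) / (2 * (mean_dens x0 + \<theta> n)) = real n * r n"
        unfolding e using r_pos[of n] by simp
    qed
  qed
  ultimately show ?thesis by (simp add: filterlim_cong)
qed

text \<open>The properties of the targets that enter \<open>hitting_limit\<close>, in a form that
  survives unions. The divisor \<open>mean_dens x0\<close> cancels later against the limit of the
  averaged fibre densities at \<open>x0\<close>. The mixing condition is uniform in the
  fibre.\<close>

definition good :: "real set \<Rightarrow> bool" where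
  "good J \<longleftrightarrow> J \<in> sets borel \<and> emeasure (levy_measure \<alpha>) J \<noteq> \<infinity> \<and>
    (\<lambda>n. real n * measure lborel (AA n J)) \<longlonglongrightarrow> measure (levy_measure \<alpha>) J / mean_dens x0 \<and>
    (\<exists>S. \<forall>n. AA n J \<subseteq> {x. \<bar>x - x0\<bar> \<le> S * r n}) \<and>
    (\<forall>e>0. \<exists>N. \<forall>n\<ge>N. \<forall>a k. admissible a \<longrightarrow> real n * mix_error a (3 * root_up n) k (AA n J) \<le> e)"

lemma AA_borel: "J \<in> sets borel \<Longrightarrow> AA n J \<in> sets borel" "AA n J \<subseteq> {0..1}"
  using level_set_borel[OF b0] by (auto simp: level_set_def)

lemma AA_finite: "J \<in> sets borel \<Longrightarrow> AA n J \<in> fmeasurable lborel"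
proof -
  assume J: "J \<in> sets borel"
  have "{0..1::real} \<in> fmeasurable lborel" by (auto simp: fmeasurable_def)
  then show ?thesis by (rule fmeasurableI2[OF _ AA_borel(2)]) (use AA_borel(1)[OF J] in simp)
qed

lemma good_empty:
  assumes "J \<in> sets borel" "\<And>z. z \<in> J \<Longrightarrow> z < 0"
  shows "good J"
proof -
  have "AA n J = {}" for n
  proof -
    have "observable \<alpha> x0 x / b n \<notin> J" for x
    proof
      assume "observable \<alpha> x0 x / b n \<in> J"
      from assms(2)[OF this] have "observable \<alpha> x0 x < 0" using b0[of n] by (simp add: divide_less_0_iff)
      then show False by (simp add: observable_def)
    qed
    then show ?thesis using mem_level_set[OF b0[of n], of _ \<alpha> x0 J] by blast
  qed
  moreover have "emeasure (levy_measure \<alpha>) J = 0" by (rule levy_neg[OF assms])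
  ultimately show ?thesis
    using assms(1) by (auto simp: good_def mix_error_empty measure_def)
qed

lemma good_Un:
  assumes A: "good A" and B: "good B" and AB: "good (A \<inter> B)"
  shows "good (A \<union> B)"
proof -
  have b: "A \<in> sets borel" "B \<in> sets borel" using A B by (auto simp: good_def)
  have lU: "AA n (A \<union> B) = AA n A \<union> AA n B" and lI: "AA n (A \<inter> B) = AA n A \<inter> AA n B" for n
    using b0[of n] by (auto simp: mem_level_set)
  have f: "A \<in> fmeasurable (levy_measure \<alpha>)" "B \<in> fmeasurable (levy_measure \<alpha>)"
    using A B by (auto simp: good_def fmeasurable_def less_top)
  have fU: "A \<union> B \<in> fmeasurable (levy_measure \<alpha>)" using f by (rule fmeasurable.Un)
  have m1: "measure (levy_measure \<alpha>) (A \<union> B) = measure (levy_measure \<alpha>) A + measure (levy_measure \<alpha>) B - measure (levy_measure \<alpha>) (A \<inter> B)"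
    by (rule measure_Un3[OF f])
  have m2: "measure lborel (AA n (A \<union> B)) = measure lborel (AA n A) + measure lborel (AA n B) - measure lborel (AA n (A \<inter> B))" for n
    unfolding lU lI by (rule measure_Un3[OF AA_finite AA_finite]) (use b in auto)
  have lim: "(\<lambda>n. real n * measure lborel (AA n (A \<union> B))) \<longlonglongrightarrow> measure (levy_measure \<alpha>) (A \<union> B) / mean_dens x0"
  proof -
    have "(\<lambda>n. real n * measure lborel (AA n A) + real n * measure lborel (AA n B) - real n * measure lborel (AA n (A \<inter> B)))
      \<longlonglongrightarrow> measure (levy_measure \<alpha>) A / mean_dens x0 + measure (levy_measure \<alpha>) B / mean_dens x0 - measure (levy_measure \<alpha>) (A \<inter> B) / mean_dens x0"
      using A B AB by (intro tendsto_intros) (auto simp: good_def)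
    then show ?thesis unfolding m1 m2 by (simp add: algebra_simps add_divide_distrib diff_divide_distrib)
  qed
  obtain S1 S2 where S: "\<And>n. AA n A \<subseteq> {x. \<bar>x - x0\<bar> \<le> S1 * r n}" "\<And>n. AA n B \<subseteq> {x. \<bar>x - x0\<bar> \<le> S2 * r n}"
    using A B unfolding good_def by blast
  have near: "AA n (A \<union> B) \<subseteq> {x. \<bar>x - x0\<bar> \<le> max S1 S2 * r n}" for n
  proof -
    have "S1 * r n \<le> max S1 S2 * r n" "S2 * r n \<le> max S1 S2 * r n" using r_pos[of n] by (auto intro: mult_right_mono)
    then show ?thesis unfolding lU using S[of n] by fastforce
  qed
  have mix: "\<exists>N. \<forall>n\<ge>N. \<forall>a k. admissible a \<longrightarrow> real n * mix_error a (3 * root_up n) k (AA n (A \<union> B)) \<le> e" if e: "0 < e" for e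
  proof -
    have e3: "0 < e / 3" using e by simp
    have get: "\<exists>N. \<forall>n\<ge>N. \<forall>a k. admissible a \<longrightarrow> real n * mix_error a (3 * root_up n) k (AA n J) \<le> e / 3" if "good J" for J
      using that e3 unfolding good_def by blast
    obtain N1 N2 N3 where N: "\<And>n a k. N1 \<le> n \<Longrightarrow> admissible a \<Longrightarrow> real n * mix_error a (3 * root_up n) k (AA n A) \<le> e / 3"
      "\<And>n a k. N2 \<le> n \<Longrightarrow> admissible a \<Longrightarrow> real n * mix_error a (3 * root_up n) k (AA n B) \<le> e / 3"
      "\<And>n a k. N3 \<le> n \<Longrightarrow> admissible a \<Longrightarrow> real n * mix_error a (3 * root_up n) k (AA n (A \<inter> B)) \<le> e / 3"
    proof -
      from get[OF A] obtain N1 where n1: "\<forall>n\<ge>N1. \<forall>a k. admissible a \<longrightarrow> real n * mix_error a (3 * root_up n) k (AA n A) \<le> e / 3" ..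
      from get[OF B] obtain N2 where n2: "\<forall>n\<ge>N2. \<forall>a k. admissible a \<longrightarrow> real n * mix_error a (3 * root_up n) k (AA n B) \<le> e / 3" ..
      from get[OF AB] obtain N3 where n3: "\<forall>n\<ge>N3. \<forall>a k. admissible a \<longrightarrow> real n * mix_error a (3 * root_up n) k (AA n (A \<inter> B)) \<le> e / 3" ..
      show thesis by (rule that[of N1 N2 N3]) (use n1 n2 n3 in simp_all)
    qed
    show ?thesis
    proof (rule exI[of _ "max N1 (max N2 N3)"], intro allI impI)
      fix n a k assume n: "max N1 (max N2 N3) \<le> n" and a: "admissible a"
      have "real n * mix_error a (3 * root_up n) k (AA n (A \<union> B))
        \<le> real n * (mix_error a (3 * root_up n) k (AA n A) + mix_error a (3 * root_up n) k (AA n B) + mix_error a (3 * root_up n) k (AA n (A \<inter> B)))"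
        unfolding lU lI using AA_borel(1) b by (intro mult_left_mono mix_error_Un a) auto
      also have "\<dots> \<le> e" using N(1)[of n a k] N(2)[of n a k] N(3)[of n a k] n a by (simp add: distrib_left)
      finally show "real n * mix_error a (3 * root_up n) k (AA n (A \<union> B)) \<le> e" .
    qed
  qed
  show ?thesis
    unfolding good_def using b fU lim near mix by (auto simp: fmeasurable_def)
qed

text \<open>Eventually the target is a full annulus around \<open>x0\<close> inside the unit
  interval, of measure \<open>2 * r n * (c1 - c2)\<close>. Its two halves are intervals, to which
  \<open>mixing\<close> applies separately.\<close>

lemma good_annulus:
  assumes J: "J \<in> sets borel" and c: "0 \<le> c2" "c2 \<le> c1"
    and levy: "emeasure (levy_measure \<alpha>) J = ennreal (c1 - c2)"
    and iff: "\<And>n x. x \<in> AA n J \<longleftrightarrow> x \<in> {0..1} \<and> x \<noteq> x0 \<and> r n * c2 \<le> \<bar>x - x0\<bar> \<and> \<bar>x - x0\<bar> < r n * c1"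
  shows "good J"
proof -
  have lm: "measure (levy_measure \<alpha>) J = c1 - c2" using levy c by (simp add: measure_def)
  have "(\<lambda>n. r n * c1) \<longlonglongrightarrow> 0" using tendsto_mult_right[OF r_lim, of c1] by simp
  then have ev: "\<forall>\<^sub>F n in sequentially. r n * c1 < \<delta>" by (rule order_tendstoD(2)) (rule \<delta>(1))
  have lim: "(\<lambda>n. real n * measure lborel (AA n J)) \<longlonglongrightarrow> measure (levy_measure \<alpha>) J / mean_dens x0"
  proof -
    have "(\<lambda>n. 2 * (c1 - c2) * (real n * r n)) \<longlonglongrightarrow> 2 * (c1 - c2) * (1 / (2 * mean_dens x0))"
      by (intro tendsto_mult_left nr_lim)
    moreover have "\<forall>\<^sub>F n in sequentially. 2 * (c1 - c2) * (real n * r n) = real n * measure lborel (AA n J)"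
      using ev
    proof eventually_elim
      fix n assume n: "r n * c1 < \<delta>"
      have cr: "0 \<le> r n * c2" "r n * c2 \<le> r n * c1" using r_pos[of n] c by (auto intro: mult_left_mono)
      have "measure lborel (AA n J) = 2 * (r n * c1 - r n * c2)"
      proof (rule annulus_measure[OF AA_borel(1)[OF J] cr])
        fix x assume x: "x \<notin> {x0, x0 - r n * c2, x0 + r n * c2}"
        show "x \<in> AA n J \<longleftrightarrow> r n * c2 < \<bar>x - x0\<bar> \<and> \<bar>x - x0\<bar> < r n * c1"
          unfolding iff using x n \<delta> by auto
      qed
      then show "2 * (c1 - c2) * (real n * r n) = real n * measure lborel (AA n J)" by (simp only:) (simp add: algebra_simps)
    qed
    ultimately have "(\<lambda>n. real n * measure lborel (AA n J)) \<longlonglongrightarrow> 2 * (c1 - c2) * (1 / (2 * mean_dens x0))"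
      by (rule Lim_transform_eventually)
    moreover have "2 * u * (1 / (2 * H)) = u / H" for u H :: real by simp
    ultimately show ?thesis unfolding lm by (simp only:)
  qed
  have near: "AA n J \<subseteq> {x. \<bar>x - x0\<bar> \<le> c1 * r n}" for n
  proof
    fix x assume "x \<in> AA n J"
    then have "\<bar>x - x0\<bar> < r n * c1" unfolding iff by blast
    then have "\<bar>x - x0\<bar> \<le> c1 * r n" by (subst mult.commute) simp
    then show "x \<in> {x. \<bar>x - x0\<bar> \<le> c1 * r n}" by simp
  qed
  have "Bseq (\<lambda>n. real n * measure lborel (AA n J))" by (rule convergent_imp_Bseq[OF convergentI[OF lim]])
  then obtain C where C: "0 < C" "\<And>n. \<bar>real n * measure lborel (AA n J)\<bar> \<le> C"
    unfolding Bseq_def real_norm_def by blast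
  have mix: "\<exists>N. \<forall>n\<ge>N. \<forall>a k. admissible a \<longrightarrow> real n * mix_error a (3 * root_up n) k (AA n J) \<le> e" if e: "0 < e" for e
  proof -
    \<comment> \<open>The 2 accounts for the two halves of the annulus;
      \<open>a0 / \<delta> * C\<close> bounds \<open>n\<close> times the fibre mass of either
      half.\<close>
    define \<epsilon> where "\<epsilon> = e / (2 * (1 + a0 / \<delta> * C))"
    have pos: "0 < 1 + a0 / \<delta> * C" using a0_gt \<delta> C by (intro add_pos_nonneg) auto
    then have \<epsilon>: "0 < \<epsilon>" using e by (simp add: \<epsilon>_def)
    from mixing[OF \<epsilon>] obtain N1 where N1: "\<And>n a k I. N1 \<le> n \<Longrightarrow> admissible a \<Longrightarrow> conv I \<Longrightarrow>
        real n * mix_error a (3 * root_up n) k I \<le> \<epsilon> * (1 + real n * fibre_mass a k I)"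
      unfolding mix_error_def fibre_mass_def by blast
    from ev obtain N2 where N2: "\<And>n. N2 \<le> n \<Longrightarrow> r n * c1 < \<delta>" unfolding eventually_sequentially by blast
    show ?thesis
    proof (rule exI[of _ "max N1 N2"], intro allI impI)
      fix n a k assume n: "max N1 N2 \<le> n" and a: "admissible a"
      let ?L = "AA n J \<inter> {..<x0}" and ?R = "AA n J \<inter> {x0<..}"
      have LR: "?L \<union> ?R = AA n J" "?L \<inter> ?R = {}" using iff[of x0 n] by (auto simp: not_less iff)
      have bor: "?L \<in> sets borel" "?R \<in> sets borel" using AA_borel(1)[OF J] by auto
      have sub: "AA n J \<subseteq> {\<delta>..1}" using N2[of n] n \<delta> by (auto simp: iff abs_less_iff)
      have one: "real n * mix_error a (3 * root_up n) k I \<le> e / 2" if I: "conv I" "I \<subseteq> AA n J" for I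
      proof -
        have Ib: "I \<in> sets borel" using I by (simp add: conv_def)
        have "fibre_mass a k I \<le> a0 / \<delta> * measure lborel I" using I sub \<delta> Ib by (intro fibre_mass_le_measure a) auto
        also have "\<dots> \<le> a0 / \<delta> * measure lborel (AA n J)"
          using a0_gt \<delta> I Ib AA_finite[OF J] by (intro mult_left_mono measure_mono_fmeasurable) auto
        finally have "real n * fibre_mass a k I \<le> real n * (a0 / \<delta> * measure lborel (AA n J))" by (intro mult_left_mono) auto
        also have "\<dots> = a0 / \<delta> * (real n * measure lborel (AA n J))" by simp
        also have "\<dots> \<le> a0 / \<delta> * C" using C(2)[of n] a0_gt \<delta> by (intro mult_left_mono) auto
        finally have "\<epsilon> * (1 + real n * fibre_mass a k I) \<le> \<epsilon> * (1 + a0 / \<delta> * C)" using \<epsilon> by (intro mult_left_mono) auto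
        also have "\<dots> = e / 2"
        proof -
          have y: "e / (2 * y) * y = e / 2" if "y \<noteq> 0" for y :: real using that by simp
          show ?thesis unfolding \<epsilon>_def by (rule y) (use pos in simp)
        qed
        finally show ?thesis using N1[of n a I k] n a I by auto
      qed
      have cL: "conv ?L" unfolding conv_def using bor(1) by (auto simp: iff)
      have cR: "conv ?R" unfolding conv_def using bor(2) by (auto simp: iff)
      have "mix_error a (3 * root_up n) k (AA n J) \<le> mix_error a (3 * root_up n) k ?L + mix_error a (3 * root_up n) k ?R"
        using mix_error_Un[OF a bor, of "3 * root_up n" k] unfolding LR mix_error_empty by simp
      then have "real n * mix_error a (3 * root_up n) k (AA n J) \<le> real n * (mix_error a (3 * root_up n) k ?L + mix_error a (3 * root_up n) k ?R)"
        by (intro mult_left_mono) auto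
      also have "\<dots> \<le> e" using one[OF cL] one[OF cR] by (simp add: distrib_left)
      finally show "real n * mix_error a (3 * root_up n) k (AA n J) \<le> e" .
    qed
  qed
  show ?thesis unfolding good_def using J levy lim near mix by auto
qed

text \<open>The power with exponent -\<alpha> reverses the order, so a bounded interval becomes an
  annulus that includes its inner boundary, and an unbounded one a punctured ball, which is the case
  of inner radius 0.\<close>

lemma good_ioc:
  assumes "J \<in> ioc_class"
  shows "good J"
  using assms
proof (cases rule: ioc_class_cases)
  case neg
  then show ?thesis by (rule good_empty)
next
  case (bounded \<eta> v)
  have v: "0 < v" using bounded by simp
  show ?thesis
  proof (rule good_annulus)
    show "J \<in> sets borel" using bounded by simp
    show "v powr (- \<alpha>) \<le> \<eta> powr (- \<alpha>)" using bounded \<alpha>0 by (intro powr_mono2') auto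
    show "emeasure (levy_measure \<alpha>) J = ennreal (\<eta> powr (- \<alpha>) - v powr (- \<alpha>))"
      unfolding bounded(3) by (rule levy_Ioc[OF \<alpha>0 bounded(1,2)])
    fix n x
    show "x \<in> AA n J \<longleftrightarrow> x \<in> {0..1} \<and> x \<noteq> x0 \<and> r n * v powr (- \<alpha>) \<le> \<bar>x - x0\<bar> \<and> \<bar>x - x0\<bar> < r n * \<eta> powr (- \<alpha>)"
      using less_obs[OF bounded(1), of x n] less_obs[OF v, of x n]
      by (auto simp: mem_level_set[OF b0] bounded(3) not_less[symmetric])
  qed simp
next
  case (unbounded \<eta>)
  show ?thesis
  proof (rule good_annulus)
    show "J \<in> sets borel" using unbounded by simp
    show "emeasure (levy_measure \<alpha>) J = ennreal (\<eta> powr (- \<alpha>) - 0)"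
      unfolding unbounded(2) using levy_Ioi[OF \<alpha>0 unbounded(1)] by simp
    fix n x
    show "x \<in> AA n J \<longleftrightarrow> x \<in> {0..1} \<and> x \<noteq> x0 \<and> r n * 0 \<le> \<bar>x - x0\<bar> \<and> \<bar>x - x0\<bar> < r n * \<eta> powr (- \<alpha>)"
      using less_obs[OF unbounded(1), of x n] by (auto simp: mem_level_set[OF b0] unbounded(2))
  qed simp_all
qed

lemma good_interval_unions:
  assumes "J \<in> interval_unions"
  shows "good J"
proof -
  obtain I where J: "J = \<Union>I" "finite I" "I \<subseteq> {ereal_Ioc x y | x y. x < y \<and> 0 \<notin> {x..y}}"
    using assms by (auto simp: interval_unions_def)
  have sub: "I \<subseteq> ioc_class" using J(3) unfolding ioc_class_def by blast
  show ?thesis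
    unfolding J(1)
    by (rule finite_union_induct[where C = ioc_class and P = good])
      (auto intro: ioc_class_Int good_ioc good_Un good_empty J(2) subsetD[OF sub])
qed

text \<open>Translation of \<open>hitting_limit\<close> back to the given notions: survival is
  expressed by \<open>hitting_time\<close>, and the measure limit
  \<open>measure (levy_measure \<alpha>) J / mean_dens x0\<close> meets the average
  \<open>mean_dens x0\<close>, which leaves the Levy measure alone in the exponent.\<close>

lemma hitting_law:
  assumes J: "J \<in> interval_unions" and w: "\<omega> \<in> space PP"
    and H: "(\<lambda>n. (\<Sum>k<n. fibre_dens (params \<omega>) (int k) x0) / real n) \<longlonglongrightarrow> mean_dens x0"
    and S: "\<And>M. 1 \<le> M \<Longrightarrow> (\<lambda>i. return_sum M i (params \<omega>) x0) \<longlonglongrightarrow> 0"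
    and st: "0 \<le> s" "s < t"
  shows "(\<lambda>n. measure (sample_measure \<gamma> (shift_by \<lfloor>real n * s\<rfloor> \<omega>))
      {x \<in> {0..1}. hitting_time \<gamma> (AA n J) (shift_by \<lfloor>real n * s\<rfloor> \<omega>) x > enat (nat \<lfloor>real n * (t - s)\<rfloor>)})
    \<longlonglongrightarrow> exp (- (t - s) * measure (levy_measure \<alpha>) J)"
proof -
  have g: "good J" by (rule good_interval_unions[OF J])
  then have Jb: "J \<in> sets borel" by (simp add: good_def)
  note a = admissible_params[OF w]
  have Hp: "0 < mean_dens x0" using mean_dens_pos x0 by simp
  let ?m = "measure (levy_measure \<alpha>) J"
  obtain S0 where S0: "\<And>n. AA n J \<subseteq> {x. \<bar>x - x0\<bar> \<le> S0 * r n}" using g unfolding good_def by blast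
  obtain M1 :: nat where M1: "S0 * (1 / (2 * mean_dens x0)) < real M1" using reals_Archimedean2 by blast
  have "(\<lambda>n. S0 * (real n * r n)) \<longlonglongrightarrow> S0 * (1 / (2 * mean_dens x0))" by (intro tendsto_mult_left nr_lim)
  then have "\<forall>\<^sub>F n in sequentially. S0 * (real n * r n) < real M1" by (rule order_tendstoD(2)) (rule M1)
  then have near: "\<forall>\<^sub>F n in sequentially. AA n J \<subseteq> {x. \<bar>x - x0\<bar> < real M1 / real n}"
    using eventually_ge_at_top[of "1::nat"]
  proof eventually_elim
    fix n :: nat assume n: "S0 * (real n * r n) < real M1" "1 \<le> n"
    then have "S0 * r n < real M1 / real n" by (simp add: pos_less_divide_eq ac_simps)
    then show "AA n J \<subseteq> {x. \<bar>x - x0\<bar> < real M1 / real n}" using S0[of n] by force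
  qed
  have "(\<lambda>n. surv_mass (params \<omega>) (nat \<lfloor>real n * (t - s)\<rfloor>) \<lfloor>real n * s\<rfloor> (AA n J)) \<longlonglongrightarrow> exp (- ((t - s) * (?m / mean_dens x0 * mean_dens x0)))"
  proof (rule hitting_limit[OF a x0 H S AA_borel(1)[OF Jb] AA_borel(2) near _ _ st])
    show "(\<lambda>n. real n * measure lborel (AA n J)) \<longlonglongrightarrow> ?m / mean_dens x0" using g by (simp add: good_def)
    show "\<exists>N. \<forall>n\<ge>N. \<forall>k. real n * mix_error (params \<omega>) (3 * root_up n) k (AA n J) \<le> e" if "0 < e" for e
      using g that a unfolding good_def by blast
  qed
  moreover have "measure (sample_measure \<gamma> (shift_by k \<omega>)) {x \<in> {0..1}. hitting_time \<gamma> (AA n J) (shift_by k \<omega>) x > enat N}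
     = surv_mass (params \<omega>) N k (AA n J)" for n N k
  proof -
    have sb: "survivors (params \<omega>) N k (AA n J) \<in> sets borel" by (rule survivors_borel[OF AA_borel(1)[OF Jb]])
    have "measure (sample_measure \<gamma> (shift_by k \<omega>)) (survivors (params \<omega>) N k (AA n J) \<inter> {0..1}) = fibre_mass (params \<omega>) k (survivors (params \<omega>) N k (AA n J) \<inter> {0..1})"
      using sample_measure_eq[of \<gamma> \<omega> "survivors (params \<omega>) N k (AA n J) \<inter> {0..1}" k] a sb by (simp add: params_def)
    also have "\<dots> = surv_mass (params \<omega>) N k (AA n J)"
      unfolding fibre_mass_def surv_mass_def by (intro Bochner_Integration.integral_cong) (auto split: split_indicator)
    finally show ?thesis unfolding hitting_set_eq by (simp add: params_def)
  qed
  moreover have "- ((t - s) * (?m / mean_dens x0 * mean_dens x0)) = - (t - s) * ?m"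
  proof -
    have y: "- (y * (m / H * H)) = - y * m" if "H \<noteq> 0" for y m H :: real using that by simp
    show ?thesis by (rule y) (use Hp in simp)
  qed
  ultimately show ?thesis by (simp only:)
qed

end

theorem theorem6p2:
  fixes q :: nat and \<gamma> p :: "nat \<Rightarrow> real" and \<alpha> :: real
  assumes "1 \<le> q"
    and "\<And>i. i \<in> {1..q} \<Longrightarrow> 0 < \<gamma> i \<and> \<gamma> i < 1"
    and "\<And>i. i \<in> {1..q} \<Longrightarrow> 0 \<le> p i"
    and "(\<Sum>i\<in>{1..q}. p i) = 1"
    and "Max (\<gamma> ` {1..q}) < 1 / 3"
    and "0 < \<alpha>" and "\<alpha> < 2"
  shows "AE x\<^sub>0 in unit_lebesgue.
    \<forall>b :: nat \<Rightarrow> real.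
      (\<forall>n. 0 < b n) \<and>
      (\<lambda>n. real n * stationary_measure q p \<gamma> {x \<in> {0..1}. observable \<alpha> x\<^sub>0 x > b n})
        \<longlonglongrightarrow> 1 \<longrightarrow>
      (\<forall>J \<in> interval_unions.
        let A = (\<lambda>n. {x \<in> {0..1}. observable \<alpha> x\<^sub>0 x \<in> (\<lambda>z. b n * z) ` J}) in
        AE \<omega> in bernoulli_measure q p.
          \<forall>s t :: real. 0 \<le> s \<and> s < t \<longrightarrow>
            (\<lambda>n. measure (sample_measure \<gamma> (shift_by \<lfloor>real n * s\<rfloor> \<omega>))
                   {x \<in> {0..1}.
                      hitting_time \<gamma> (A n) (shift_by \<lfloor>real n * s\<rfloor> \<omega>) x
                        > enat (nat \<lfloor>real n * (t - s)\<rfloor>)})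
              \<longlonglongrightarrow> exp (- (t - s) * measure (levy_measure \<alpha>) J))"
proof -
  define G where "G = Max (\<gamma> ` {1..q})"
  have G: "\<gamma> i \<le> G" if "i \<in> {1..q}" for i using that by (auto simp: G_def)
  have "0 < \<gamma> 1" using assms(1,2) by auto
  then have G0: "0 < G" using G[of 1] assms(1) by auto
  interpret L: lsv G using G0 assms(5) by unfold_locales (auto simp: G_def)
  interpret R: rand_lsv G q p \<gamma>
    by unfold_locales (use assms G L.param_def in auto)
  show ?thesis
    using R.generic_points
  proof eventually_elim
    fix x0 :: real
    assume x0: "0 < x0 \<and> x0 < 1 \<and>
      (AE \<omega> in bernoulli_measure q p. (\<lambda>n. (\<Sum>k<n. L.fibre_dens (R.params \<omega>) (int k) x0) / real n) \<longlonglongrightarrow> R.mean_dens x0 \<and>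
         (\<forall>M\<ge>1. (\<lambda>i. L.return_sum M i (R.params \<omega>) x0) \<longlonglongrightarrow> 0))"
    show "\<forall>b :: nat \<Rightarrow> real.
      (\<forall>n. 0 < b n) \<and>
      (\<lambda>n. real n * stationary_measure q p \<gamma> {x \<in> {0..1}. observable \<alpha> x0 x > b n})
        \<longlonglongrightarrow> 1 \<longrightarrow>
      (\<forall>J \<in> interval_unions.
        let A = (\<lambda>n. {x \<in> {0..1}. observable \<alpha> x0 x \<in> (\<lambda>z. b n * z) ` J}) in
        AE \<omega> in bernoulli_measure q p.
          \<forall>s t :: real. 0 \<le> s \<and> s < t \<longrightarrow>
            (\<lambda>n. measure (sample_measure \<gamma> (shift_by \<lfloor>real n * s\<rfloor> \<omega>))
                   {x \<in> {0..1}.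
                      hitting_time \<gamma> (A n) (shift_by \<lfloor>real n * s\<rfloor> \<omega>) x
                        > enat (nat \<lfloor>real n * (t - s)\<rfloor>)})
              \<longlonglongrightarrow> exp (- (t - s) * measure (levy_measure \<alpha>) J))"
    proof (intro allI impI ballI)
      fix b :: "nat \<Rightarrow> real" and J
      assume b: "(\<forall>n. 0 < b n) \<and>
        (\<lambda>n. real n * stationary_measure q p \<gamma> {x \<in> {0..1}. observable \<alpha> x0 x > b n}) \<longlonglongrightarrow> 1"
        and J: "J \<in> interval_unions"
      \<comment> \<open>The sequence \<open>b\<close> and the set \<open>J\<close> enter only now,
        after the exceptional centres and fibres have been fixed by
        \<open>generic_points\<close>.\<close>
      interpret O: obs_point G q p \<gamma> \<alpha> x0 b
        by unfold_locales (use assms(6) x0 b in auto)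
      have ae: "AE \<omega> in bernoulli_measure q p. (\<lambda>n. (\<Sum>k<n. L.fibre_dens (R.params \<omega>) (int k) x0) / real n) \<longlonglongrightarrow> R.mean_dens x0 \<and>
         (\<forall>M\<ge>1. (\<lambda>i. L.return_sum M i (R.params \<omega>) x0) \<longlonglongrightarrow> 0)"
        using x0 by blast
      show "let A = (\<lambda>n. {x \<in> {0..1}. observable \<alpha> x0 x \<in> (\<lambda>z. b n * z) ` J}) in
        AE \<omega> in bernoulli_measure q p.
          \<forall>s t :: real. 0 \<le> s \<and> s < t \<longrightarrow>
            (\<lambda>n. measure (sample_measure \<gamma> (shift_by \<lfloor>real n * s\<rfloor> \<omega>))
                   {x \<in> {0..1}.
                      hitting_time \<gamma> (A n) (shift_by \<lfloor>real n * s\<rfloor> \<omega>) x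
                        > enat (nat \<lfloor>real n * (t - s)\<rfloor>)})
              \<longlonglongrightarrow> exp (- (t - s) * measure (levy_measure \<alpha>) J)"
        unfolding Let_def level_set_def[symmetric]
      proof (rule AE_mp[OF ae], rule AE_I2, intro impI allI)
        fix \<omega> and s t :: real
        assume w: "\<omega> \<in> space (bernoulli_measure q p)"
          and h: "(\<lambda>n. (\<Sum>k<n. L.fibre_dens (R.params \<omega>) (int k) x0) / real n) \<longlonglongrightarrow> R.mean_dens x0 \<and>
            (\<forall>M\<ge>1. (\<lambda>i. L.return_sum M i (R.params \<omega>) x0) \<longlonglongrightarrow> 0)"
          and st: "0 \<le> s \<and> s < t"
        show "(\<lambda>n. measure (sample_measure \<gamma> (shift_by \<lfloor>real n * s\<rfloor> \<omega>))
            {x \<in> {0..1}. hitting_time \<gamma> (level_set \<alpha> x0 (b n) J) (shift_by \<lfloor>real n * s\<rfloor> \<omega>) x > enat (nat \<lfloor>real n * (t - s)\<rfloor>)})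
          \<longlonglongrightarrow> exp (- (t - s) * measure (levy_measure \<alpha>) J)"
          using h st by (intro O.hitting_law[OF J w]) auto
      qed
    qed
  qed
qed

end
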